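(* Let $K$ be a commutative ring, let $R$ be a symmetric monoidal partition functor taking values in $K$-modules, and let $M_*$ be the $\mathbb N$-graded $K$-module with $M_i=\bar R(i+1)=R(i+1)/I_{i+1}$. Then there is an isomorphism of commutative graded $K$-algebras $$TS(M_* )\cong\mathrm{PD}(R)[\Sigma].$$
   Context: Partitions. A partition $\Lambda=(X,\sim_\Lambda)$ is a finite set $X$ with an equivalence relation; its classes are called blocks. A morphism $f\colon\Lambda\to\Omega=(Y,\sim_\Omega)$ is a bijection $f\colon X\to Y$ with $x\sim_\Lambda x'\Rightarrow f(x)\sim_\Omega f(x')$. There is a (unique) 2-isomorphism $f\Rightarrow g$ between morphisms $f,g\colon\Lambda\to\Omega$ exactly when $f(x)\sim_\Omega g(x)$ for all $x$. This defines a $(2,1)$-category $\mathcal P$; functors from $\mathcal P$ to an ordinary category identify 2-isomorphic morphisms. Write $\Lambda\le\Omega$ if $X=Y$ and the identity is a morphism $\Lambda\to\Omega$; $\Lambda<\Omega$ if moreover $\Lambda\ne\Omega$. $\Lambda\cap\Gamma$ is the coarsest common refinement; $\Lambda\sqcup\Omega$ the disjoint union. $\underline m$ is $[m]=\{1,\dots,m\}$ with the indiscrete relation ($\underline 0$ empty). $\underline i\sqcup\underline j\le\underline{i+j}$ denotes the morphism sending $\underline i$ to the first $i$ and $\underline j$ to the last $j$ elements. $\Sigma_\Lambda$ is the group of bijections of $X$ preserving every block. For $f\colon\Lambda\to\Omega$ and $\Gamma\le\Lambda$, $f\Gamma$ is the transported partition and $f_\Gamma\colon\Gamma\to f\Gamma$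 the induced isomorphism. Partition functors. A partition functor $M$ consists of abelian groups $M(\Lambda)$, a contravariant functor $M^*$ (restrictions) and a covariant functor $M_*$ (transfers) from $\mathcal P$ to abelian groups with common values $M(\Lambda)$, with $M_*(f)=M^*(f^{-1})$ for isomorphisms $f$, and for $\Gamma,\Lambda\le\Omega$ $$M^*(\Gamma\le\Omega)M_*(\Lambda\le\Omega)=\sum_{[\sigma]\in\Sigma_\Gamma\backslash\Sigma_\Omega/\Sigma_\Lambda}M_*(\Gamma\cap\sigma\Lambda\le\Gamma)\,M_*(\sigma)\,M^*(\sigma^{-1}\Gamma\cap\Lambda\le\Lambda).$$ It is lax symmetric monoidal with values in $K$-modules if all values are $K$-modules, all structure maps are $K$-linear, and it is equipped with a unit $K\to M(\underline 0)$ and external products $M(\Lambda)\otimes_KM(\Omega)\to M(\Lambda\sqcup\Omega)$, $x\otimes y\mapsto x\boxtimes y$, natural in pairs of restrictions and pairs of transfers, associative, unital, symmetric. It is symmetric monoidal if the unit and all external products are isomorphisms. Write $M(m)=M(\underline m)$. $M[\Sigma]=\bigoplus_{m\ge0}M(m)$ is a commutative $\mathbb N$-graded $K$-algebra under $xy=M_*(\underline i\sqcup\underline j\le\underline{i+j})(x\boxtimes y)$, $x\in M(i)$, $y\in M(j)$. $\mathrm{PD}$. $I_\Gamma\subseteq R(\Gamma)$ is the sum of images of $R_*(\Omega<\Gamma)$ over $\Omega<\Gamma$; $I_m=I_{\underline m}$; $\bar R(\Gamma)=R(\Gamma)/I_\Gamma$; for isomorphisms $f$, $\bar R_*(f)$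 is induced by $R_*(f)$; external products descend to $\bar R$. $\mathrm{PD}(R)(\Lambda)=(\bigoplus_{\Gamma\le\Lambda}\bar R(\Gamma))^{\Sigma_\Lambda}$ with action $(\sigma x)_\Gamma=\bar R_*(\sigma)(x_{\sigma^{-1}\Gamma})$. It is a lax symmetric monoidal partition functor with values in $K$-modules, with restriction $(\mathrm{PD}(R)^*(f)x)_\Gamma=\bar R_*(f_\Gamma)^{-1}(x_{f\Gamma})$, transfer along $f\colon\Psi\to\Lambda$ given by $(\mathrm{PD}(R)_*(f)x)_\Gamma=\sum\bar R_*(\sigma f)(x_{(\sigma f)^{-1}\Gamma})$, the sum over $[\sigma]\in\Sigma_\Gamma\backslash\Sigma_\Lambda/\Sigma_{f\Psi}$ with $\Gamma\le\sigma f\Psi$, and external product $(x\boxtimes y)_{\Gamma\sqcup\Theta}=x_\Gamma\boxtimes y_\Theta$. Symmetric invariant tensors. For a $K$-module $M$, $TS(M)=\bigoplus_{r\ge0}(M^{\otimes r})^{\Sigma_r}\subseteq T(M)=\bigoplus_rM^{\otimes r}$ (tensor products over $K$), with the shuffle product $xy=\sum_{\sigma}\sigma(x\otimes y)$ for $x\in M^{\otimes i}$, $y\in M^{\otimes j}$, the sum over $(i,j)$-shuffles $\sigma$ (representatives of $\Sigma_{i+j}/(\Sigma_i\times\Sigma_j)$). For an $\mathbb N$-graded module $M_*$ (no signs), $M_i\subseteq M_*^{\otimes 1}$ is placed in degree $i+1$ of $TS(M_* )$, and generally $M_{i_1}\otimes\cdots\otimes M_{i_r}$ is placed in degree $\sum_j(i_j+1)$;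 e.g. the degree 1 part of $TS(M_* )$ is $M_0$ and the degree 2 part is $M_1\oplus(M_0^{\otimes2})^{\Sigma_2}$. *)

theory Defs
  imports
    "HOL-Algebra.Module"
    "HOL-Algebra.AbelCoset"
    "HOL-Algebra.QuotRing"
    "HOL-Combinatorics.Permutations"
    "HOL-Library.Nat_Bijection"
begin

section \<open>Modules over a commutative ring\<close>

text \<open>The record for modules extends that for rings; the two multiplicative fields play no role
  for a mere module and are left unspecified.\<close>

definition mk_module ::
    "'b set \<Rightarrow> ('b \<Rightarrow> 'b \<Rightarrow> 'b) \<Rightarrow> 'b \<Rightarrow> ('k \<Rightarrow> 'b \<Rightarrow> 'b) \<Rightarrow> ('k, 'b) module" where
  "mk_module C pl ze sm =
     \<lparr>carrier = C, monoid.mult = (\<lambda>_ _. undefined), one = undefined, zero = ze, add = pl, smult = sm\<rparr>"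

definition module_hom ::
    "('k, 'z) ring_scheme \<Rightarrow> ('k, 'b) module \<Rightarrow> ('k, 'c) module \<Rightarrow> ('b \<Rightarrow> 'c) set" where
  "module_hom K M N =
     {h \<in> hom (add_monoid M) (add_monoid N).
        \<forall>a \<in> carrier K. \<forall>x \<in> carrier M. h (a \<odot>\<^bsub>M\<^esub> x) = a \<odot>\<^bsub>N\<^esub> h x}"

definition submodule_span :: "('k, 'z) ring_scheme \<Rightarrow> ('k, 'b) module \<Rightarrow> 'b set \<Rightarrow> 'b set" where
  "submodule_span K M S = \<Inter>{H. submodule H K M \<and> S \<subseteq> H}"

definition quotient_module :: "('k, 'b) module \<Rightarrow> 'b set \<Rightarrow> ('k, 'b set) module" where
  "quotient_module M I =
     mk_module (a_rcosets\<^bsub>M\<^esub> I) (set_add M) I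
       (\<lambda>a C. I <+>\<^bsub>M\<^esub> ((\<lambda>x. a \<odot>\<^bsub>M\<^esub> x) ` C))"

definition self_module :: "('k, 'z) ring_scheme \<Rightarrow> ('k, 'k) module" where
  "self_module K = mk_module (carrier K) (add K) \<zero>\<^bsub>K\<^esub> (\<lambda>a x. a \<otimes>\<^bsub>K\<^esub> x)"

definition direct_sum :: "'i set \<Rightarrow> ('i \<Rightarrow> ('k, 'b) module) \<Rightarrow> ('k, 'i \<Rightarrow> 'b) module" where
  "direct_sum I N =
     mk_module {x \<in> (\<Pi>\<^sub>E i\<in>I. carrier (N i)). finite {i \<in> I. x i \<noteq> \<zero>\<^bsub>N i\<^esub>}}
       (\<lambda>x y. \<lambda>i\<in>I. x i \<oplus>\<^bsub>N i\<^esub> y i)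
       (\<lambda>i\<in>I. \<zero>\<^bsub>N i\<^esub>)
       (\<lambda>a x. \<lambda>i\<in>I. a \<odot>\<^bsub>N i\<^esub> x i)"

text \<open>The summand \<open>N n\<close> inside the graded module \<open>\<Oplus>\<^sub>i N i\<close>.\<close>

definition homogeneous :: "(nat \<Rightarrow> ('k, 'b) module) \<Rightarrow> nat \<Rightarrow> (nat \<Rightarrow> 'b) set" where
  "homogeneous N n = {x \<in> carrier (direct_sum UNIV N). \<forall>i. i \<noteq> n \<longrightarrow> x i = \<zero>\<^bsub>N i\<^esub>}"


section \<open>Tensor products\<close>

text \<open>The tensor product of a list of modules: the free module on the lists
  \<open>[x\<^sub>1, \<dots>, x\<^sub>r]\<close> with \<open>x\<^sub>j\<close> in the \<open>j\<close>-th module, modulo multilinearity. For the empty list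
  there are no relations and the result is free on the empty list.\<close>

definition tensor_index :: "('k, 'b) module list \<Rightarrow> 'b list set" where
  "tensor_index Ms = {xs. list_all2 (\<lambda>x M. x \<in> carrier M) xs Ms}"

definition free_module :: "('k, 'z) ring_scheme \<Rightarrow> 's set \<Rightarrow> ('k, 's \<Rightarrow> 'k) module" where
  "free_module K S = direct_sum S (\<lambda>_. self_module K)"

definition free_basis :: "('k, 'z) ring_scheme \<Rightarrow> 's set \<Rightarrow> 's \<Rightarrow> 's \<Rightarrow> 'k" where
  "free_basis K S s = (\<lambda>t\<in>S. if t = s then \<one>\<^bsub>K\<^esub> else \<zero>\<^bsub>K\<^esub>)"

definition tensor_relations ::
    "('k, 'z) ring_scheme \<Rightarrow> ('k, 'b) module list \<Rightarrow> ('b list \<Rightarrow> 'k) set" where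
  "tensor_relations K Ms =
    (let S = tensor_index Ms; F = free_module K S; e = free_basis K S in
     submodule_span K F
      ({(e (xs[i := x \<oplus>\<^bsub>Ms ! i\<^esub> y]) \<ominus>\<^bsub>F\<^esub> e (xs[i := x])) \<ominus>\<^bsub>F\<^esub> e (xs[i := y]) | xs i x y.
           xs \<in> S \<and> i < length Ms \<and> x \<in> carrier (Ms ! i) \<and> y \<in> carrier (Ms ! i)} \<union>
       {e (xs[i := a \<odot>\<^bsub>Ms ! i\<^esub> x]) \<ominus>\<^bsub>F\<^esub> (a \<odot>\<^bsub>F\<^esub> e (xs[i := x])) | xs i a x.
           xs \<in> S \<and> i < length Ms \<and> a \<in> carrier K \<and> x \<in> carrier (Ms ! i)}))"

definition tensor ::
    "('k, 'z) ring_scheme \<Rightarrow> ('k, 'b) module list \<Rightarrow> ('k, ('b list \<Rightarrow> 'k) set) module" where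
  "tensor K Ms = quotient_module (free_module K (tensor_index Ms)) (tensor_relations K Ms)"

definition pure_tensor ::
    "('k, 'z) ring_scheme \<Rightarrow> ('k, 'b) module list \<Rightarrow> 'b list \<Rightarrow> ('b list \<Rightarrow> 'k) set" where
  "pure_tensor K Ms xs =
     tensor_relations K Ms +>\<^bsub>free_module K (tensor_index Ms)\<^esub> free_basis K (tensor_index Ms) xs"

text \<open>The linear map \<open>x\<^sub>1 \<otimes> \<dots> \<otimes> x\<^sub>r \<mapsto> \<phi> [x\<^sub>1, \<dots>, x\<^sub>r]\<close> on the tensor product. It is only used for
  multilinear \<open>\<phi>\<close>, where the choice of a representative of the class \<open>t\<close> does not matter.\<close>

definition tensor_lift ::
    "('k, 'z) ring_scheme \<Rightarrow> ('k, 'b) module list \<Rightarrow> ('k, 'c) module \<Rightarrow> ('b list \<Rightarrow> 'c)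
       \<Rightarrow> ('b list \<Rightarrow> 'k) set \<Rightarrow> 'c" where
  "tensor_lift K Ms P \<phi> t =
    (let f = (SOME f. f \<in> t) in
     finsum P (\<lambda>xs. f xs \<odot>\<^bsub>P\<^esub> \<phi> xs) {xs \<in> tensor_index Ms. f xs \<noteq> \<zero>\<^bsub>K\<^esub>})"


section \<open>Symmetric invariant tensors\<close>

definition tensor_power ::
    "('k, 'z) ring_scheme \<Rightarrow> ('k, 'b) module \<Rightarrow> nat \<Rightarrow> ('k, ('b list \<Rightarrow> 'k) set) module" where
  "tensor_power K M r = tensor K (replicate r M)"

text \<open>A permutation \<open>\<sigma>\<close> moves the \<open>k\<close>-th tensor factor to position \<open>\<sigma> k\<close>. Positions are counted
  from \<open>0\<close>, so \<open>\<Sigma>\<^sub>r\<close> consists of the permutations of \<open>{..<r}\<close>.\<close>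

definition tensor_permute ::
    "('k, 'z) ring_scheme \<Rightarrow> ('k, 'b) module \<Rightarrow> nat \<Rightarrow> (nat \<Rightarrow> nat)
       \<Rightarrow> ('b list \<Rightarrow> 'k) set \<Rightarrow> ('b list \<Rightarrow> 'k) set" where
  "tensor_permute K M r \<sigma> =
     tensor_lift K (replicate r M) (tensor_power K M r)
       (\<lambda>xs. pure_tensor K (replicate r M) (permute_list (inv_into UNIV \<sigma>) xs))"

definition tensor_concat ::
    "('k, 'z) ring_scheme \<Rightarrow> ('k, 'b) module \<Rightarrow> nat \<Rightarrow> nat
       \<Rightarrow> ('b list \<Rightarrow> 'k) set \<Rightarrow> ('b list \<Rightarrow> 'k) set \<Rightarrow> ('b list \<Rightarrow> 'k) set" where
  "tensor_concat K M i j s t =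
     tensor_lift K (replicate i M) (tensor_power K M (i + j))
       (\<lambda>xs. tensor_lift K (replicate j M) (tensor_power K M (i + j))
          (\<lambda>ys. pure_tensor K (replicate (i + j) M) (xs @ ys)) t) s"

definition shuffle_perms :: "nat \<Rightarrow> nat \<Rightarrow> (nat \<Rightarrow> nat) set" where
  "shuffle_perms i j =
     {\<sigma>. \<sigma> permutes {..<i + j} \<and> strict_mono_on {..<i} \<sigma> \<and> strict_mono_on {i..<i + j} \<sigma>}"

definition TS ::
    "('k, 'z) ring_scheme \<Rightarrow> ('k, 'b) module \<Rightarrow> ('k, nat \<Rightarrow> ('b list \<Rightarrow> 'k) set) module" where
  "TS K M =
    (let T = direct_sum UNIV (tensor_power K M) in
     \<lparr>carrier = {x \<in> carrier T. \<forall>r \<sigma>. \<sigma> permutes {..<r} \<longrightarrow> tensor_permute K M r \<sigma> (x r) = x r},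
      monoid.mult = (\<lambda>x y n.
        finsum (tensor_power K M n)
          (\<lambda>i. finsum (tensor_power K M n)
             (\<lambda>\<sigma>. tensor_permute K M n \<sigma> (tensor_concat K M i (n - i) (x i) (y (n - i))))
             (shuffle_perms i (n - i)))
          {..n}),
      one = (\<lambda>r. if r = 0 then pure_tensor K [] [] else \<zero>\<^bsub>tensor_power K M r\<^esub>),
      zero = \<zero>\<^bsub>T\<^esub>,
      add = add T,
      smult = smult T\<rparr>)"

text \<open>For a graded module \<open>M\<^sub>* = \<Oplus>\<^sub>i N i\<close>, the degree \<open>n\<close> part of \<open>TS M\<^sub>*\<close>: in each \<open>M\<^sub>*\<^sup>\<otimes>\<^sup>r\<close> the
  submodule spanned by the \<open>N i\<^sub>1 \<otimes> \<dots> \<otimes> N i\<^sub>r\<close> with \<open>\<Sum>\<^sub>j (i\<^sub>j + 1) = n\<close>.\<close>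

definition TS_degree ::
    "('k, 'z) ring_scheme \<Rightarrow> (nat \<Rightarrow> ('k, 'b) module) \<Rightarrow> nat
       \<Rightarrow> (nat \<Rightarrow> ((nat \<Rightarrow> 'b) list \<Rightarrow> 'k) set) set" where
  "TS_degree K N n =
    (let M = direct_sum UNIV N in
     {x \<in> carrier (TS K M). \<forall>r.
        x r \<in> submodule_span K (tensor_power K M r)
          {pure_tensor K (replicate r M) xs | xs ds.
             length xs = r \<and> length ds = r \<and> (\<forall>j<r. xs ! j \<in> homogeneous N (ds ! j)) \<and>
             (\<Sum>j<r. ds ! j + 1) = n}})"


section \<open>Commutative graded algebras\<close>

definition graded_algebra ::
    "('k, 'z) ring_scheme \<Rightarrow> ('k, 'b) module \<Rightarrow> (nat \<Rightarrow> 'b set) \<Rightarrow> bool" where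
  "graded_algebra K A G \<longleftrightarrow>
     algebra K A \<and>
     (\<forall>n. submodule (G n) K A) \<and>
     (\<forall>x \<in> carrier A. \<exists>!c. (\<forall>n. c n \<in> G n) \<and> finite {n. c n \<noteq> \<zero>\<^bsub>A\<^esub>} \<and>
        x = finsum A c {n. c n \<noteq> \<zero>\<^bsub>A\<^esub>}) \<and>
     \<one>\<^bsub>A\<^esub> \<in> G 0 \<and>
     (\<forall>i j. \<forall>x \<in> G i. \<forall>y \<in> G j. x \<otimes>\<^bsub>A\<^esub> y \<in> G (i + j))"

definition graded_algebra_iso ::
    "('k, 'z) ring_scheme \<Rightarrow> ('k, 'b) module \<Rightarrow> (nat \<Rightarrow> 'b set) \<Rightarrow>
      ('k, 'c) module \<Rightarrow> (nat \<Rightarrow> 'c set) \<Rightarrow> ('b \<Rightarrow> 'c) set" where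
  "graded_algebra_iso K A G B H =
     {\<phi> \<in> ring_iso A B \<inter> module_hom K A B.
        graded_algebra K A G \<and> graded_algebra K B H \<and> (\<forall>n. \<phi> ` G n = H n)}"


section \<open>Partitions\<close>

text \<open>The finite sets are taken to be the finite sets of natural numbers. This is a full
  subcategory equivalent to that of all finite sets; it contains the sets \<open>{1..m}\<close> and is made
  closed under disjoint unions by the bijection \<^const>\<open>sum_encode\<close>.\<close>

type_synonym ptn = "nat set \<times> nat rel"

definition is_ptn :: "ptn \<Rightarrow> bool" where
  "is_ptn \<Lambda> \<longleftrightarrow> finite (fst \<Lambda>) \<and> equiv (fst \<Lambda>) (snd \<Lambda>)"

text \<open>Morphisms are functions on all of \<^typ>\<open>nat\<close> whose values outside the source are
  irrelevant: functions that agree on the source are in particular 2-isomorphic.\<close>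

definition ptn_mor :: "ptn \<Rightarrow> ptn \<Rightarrow> (nat \<Rightarrow> nat) set" where
  "ptn_mor \<Lambda> \<Omega> =
     {f. bij_betw f (fst \<Lambda>) (fst \<Omega>) \<and> (\<forall>(x, x') \<in> snd \<Lambda>. (f x, f x') \<in> snd \<Omega>)}"

definition two_iso :: "ptn \<Rightarrow> ptn \<Rightarrow> (nat \<Rightarrow> nat) \<Rightarrow> (nat \<Rightarrow> nat) \<Rightarrow> bool" where
  "two_iso \<Lambda> \<Omega> f g \<longleftrightarrow> (\<forall>x \<in> fst \<Lambda>. (f x, g x) \<in> snd \<Omega>)"

definition ptn_iso :: "ptn \<Rightarrow> ptn \<Rightarrow> (nat \<Rightarrow> nat) set" where
  "ptn_iso \<Lambda> \<Omega> = {f \<in> ptn_mor \<Lambda> \<Omega>. inv_into (fst \<Lambda>) f \<in> ptn_mor \<Omega> \<Lambda>}"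

definition ptn_le :: "ptn \<Rightarrow> ptn \<Rightarrow> bool" where
  "ptn_le \<Lambda> \<Omega> \<longleftrightarrow> fst \<Lambda> = fst \<Omega> \<and> id \<in> ptn_mor \<Lambda> \<Omega>"

definition refinements :: "ptn \<Rightarrow> ptn set" where
  "refinements \<Lambda> = {\<Gamma>. is_ptn \<Gamma> \<and> ptn_le \<Gamma> \<Lambda>}"

text \<open>The coarsest common refinement, for partitions of the same set.\<close>

definition ptn_inter :: "ptn \<Rightarrow> ptn \<Rightarrow> ptn" where
  "ptn_inter \<Lambda> \<Gamma> = (fst \<Lambda>, snd \<Lambda> \<inter> snd \<Gamma>)"

definition ptn_image :: "(nat \<Rightarrow> nat) \<Rightarrow> ptn \<Rightarrow> ptn" where
  "ptn_image f \<Gamma> = (f ` fst \<Gamma>, map_prod f f ` snd \<Gamma>)"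

definition underline :: "nat \<Rightarrow> ptn" where
  "underline m = ({1..m}, {1..m} \<times> {1..m})"

definition block_perms :: "ptn \<Rightarrow> (nat \<Rightarrow> nat) set" where
  "block_perms \<Lambda> = {\<sigma>. \<sigma> permutes fst \<Lambda> \<and> (\<forall>B \<in> fst \<Lambda> // snd \<Lambda>. \<sigma> ` B = B)}"

definition rep :: "'a set \<Rightarrow> 'a" where
  "rep D = (SOME \<sigma>. \<sigma> \<in> D)"

text \<open>\<open>\<Sigma>\<^sub>\<Gamma> \<setminus> \<Sigma>\<^sub>\<Omega> / \<Sigma>\<^sub>\<Lambda>\<close>. Sums over it below use an arbitrary representative \<^term>\<open>rep D\<close> of
  each double coset \<open>D\<close>, on which the summands do not depend.\<close>

definition double_cosets :: "ptn \<Rightarrow> ptn \<Rightarrow> ptn \<Rightarrow> (nat \<Rightarrow> nat) set set" where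
  "double_cosets \<Gamma> \<Omega> \<Lambda> =
     (\<lambda>\<sigma>. {\<gamma> \<circ> \<sigma> \<circ> \<delta> | \<gamma> \<delta>. \<gamma> \<in> block_perms \<Gamma> \<and> \<delta> \<in> block_perms \<Lambda>}) ` block_perms \<Omega>"

definition ptn_sum :: "ptn \<Rightarrow> ptn \<Rightarrow> ptn" where
  "ptn_sum \<Lambda> \<Omega> =
     (sum_encode ` (Inl ` fst \<Lambda> \<union> Inr ` fst \<Omega>),
      {(sum_encode (Inl x), sum_encode (Inl x')) | x x'. (x, x') \<in> snd \<Lambda>} \<union>
      {(sum_encode (Inr y), sum_encode (Inr y')) | y y'. (y, y') \<in> snd \<Omega>})"

definition mor_sum :: "(nat \<Rightarrow> nat) \<Rightarrow> (nat \<Rightarrow> nat) \<Rightarrow> nat \<Rightarrow> nat" where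
  "mor_sum f g = sum_encode \<circ> map_sum f g \<circ> sum_decode"

text \<open>\<open>(\<Lambda> \<squnion> \<Omega>) \<squnion> \<Psi> \<rightarrow> \<Lambda> \<squnion> (\<Omega> \<squnion> \<Psi>)\<close>\<close>

definition sum_assoc :: "nat \<Rightarrow> nat" where
  "sum_assoc n =
     (case sum_decode n of
        Inl m \<Rightarrow>
          (case sum_decode m of
             Inl x \<Rightarrow> sum_encode (Inl x)
           | Inr y \<Rightarrow> sum_encode (Inr (sum_encode (Inl y))))
      | Inr z \<Rightarrow> sum_encode (Inr (sum_encode (Inr z))))"

text \<open>\<open>\<Lambda> \<squnion> \<Omega> \<rightarrow> \<Omega> \<squnion> \<Lambda>\<close>\<close>

definition sum_swap :: "nat \<Rightarrow> nat" where
  "sum_swap n = (case sum_decode n of Inl x \<Rightarrow> sum_encode (Inr x) | Inr y \<Rightarrow> sum_encode (Inl y))"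

text \<open>Both unit isomorphisms \<open>\<Lambda> \<squnion> \<emptyset> \<rightarrow> \<Lambda>\<close> and \<open>\<emptyset> \<squnion> \<Lambda> \<rightarrow> \<Lambda>\<close>.\<close>

definition sum_fold :: "nat \<Rightarrow> nat" where
  "sum_fold n = (case sum_decode n of Inl x \<Rightarrow> x | Inr y \<Rightarrow> y)"

text \<open>The morphism from \<^term>\<open>ptn_sum (underline i) (underline j)\<close> to \<^term>\<open>underline (i + j)\<close>.\<close>

definition append_mor :: "nat \<Rightarrow> nat \<Rightarrow> nat" where
  "append_mor i n = (case sum_decode n of Inl x \<Rightarrow> x | Inr y \<Rightarrow> i + y)"


section \<open>Partition functors\<close>

text \<open>For \<open>f : \<Lambda> \<rightarrow> \<Omega>\<close>, \<open>pf_res M \<Lambda> \<Omega> f : M(\<Omega>) \<rightarrow> M(\<Lambda>)\<close> is the restriction \<open>M\<^sup>*(f)\<close> and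
  \<open>pf_tr M \<Lambda> \<Omega> f : M(\<Lambda>) \<rightarrow> M(\<Omega>)\<close> the transfer \<open>M\<^sub>*(f)\<close>. The values at different partitions
  are modules with carriers in one common type.\<close>

record ('k, 'b) pf =
  pf_val :: "ptn \<Rightarrow> ('k, 'b) module"
  pf_res :: "ptn \<Rightarrow> ptn \<Rightarrow> (nat \<Rightarrow> nat) \<Rightarrow> 'b \<Rightarrow> 'b"
  pf_tr :: "ptn \<Rightarrow> ptn \<Rightarrow> (nat \<Rightarrow> nat) \<Rightarrow> 'b \<Rightarrow> 'b"

record ('k, 'b) monoidal_pf = "('k, 'b) pf" +
  pf_unit :: "'k \<Rightarrow> 'b"
  pf_prod :: "ptn \<Rightarrow> ptn \<Rightarrow> 'b \<Rightarrow> 'b \<Rightarrow> 'b"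

locale partition_functor =
  fixes M :: "('k, 'b, 'y) pf_scheme"
  assumes val: "is_ptn \<Lambda> \<Longrightarrow> abelian_group (pf_val M \<Lambda>)"
    and res_hom: "\<lbrakk>is_ptn \<Lambda>; is_ptn \<Omega>; f \<in> ptn_mor \<Lambda> \<Omega>\<rbrakk>
      \<Longrightarrow> pf_res M \<Lambda> \<Omega> f \<in> hom (add_monoid (pf_val M \<Omega>)) (add_monoid (pf_val M \<Lambda>))"
    and tr_hom: "\<lbrakk>is_ptn \<Lambda>; is_ptn \<Omega>; f \<in> ptn_mor \<Lambda> \<Omega>\<rbrakk>
      \<Longrightarrow> pf_tr M \<Lambda> \<Omega> f \<in> hom (add_monoid (pf_val M \<Lambda>)) (add_monoid (pf_val M \<Omega>))"
    and res_id: "\<lbrakk>is_ptn \<Lambda>; x \<in> carrier (pf_val M \<Lambda>)\<rbrakk> \<Longrightarrow> pf_res M \<Lambda> \<Lambda> id x = x"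
    and tr_id: "\<lbrakk>is_ptn \<Lambda>; x \<in> carrier (pf_val M \<Lambda>)\<rbrakk> \<Longrightarrow> pf_tr M \<Lambda> \<Lambda> id x = x"
    and res_comp: "\<lbrakk>is_ptn \<Lambda>; is_ptn \<Omega>; is_ptn \<Psi>; f \<in> ptn_mor \<Lambda> \<Omega>; g \<in> ptn_mor \<Omega> \<Psi>;
        x \<in> carrier (pf_val M \<Psi>)\<rbrakk>
      \<Longrightarrow> pf_res M \<Lambda> \<Psi> (g \<circ> f) x = pf_res M \<Lambda> \<Omega> f (pf_res M \<Omega> \<Psi> g x)"
    and tr_comp: "\<lbrakk>is_ptn \<Lambda>; is_ptn \<Omega>; is_ptn \<Psi>; f \<in> ptn_mor \<Lambda> \<Omega>; g \<in> ptn_mor \<Omega> \<Psi>;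
        x \<in> carrier (pf_val M \<Lambda>)\<rbrakk>
      \<Longrightarrow> pf_tr M \<Lambda> \<Psi> (g \<circ> f) x = pf_tr M \<Omega> \<Psi> g (pf_tr M \<Lambda> \<Omega> f x)"
    and res_two_iso: "\<lbrakk>is_ptn \<Lambda>; is_ptn \<Omega>; f \<in> ptn_mor \<Lambda> \<Omega>; g \<in> ptn_mor \<Lambda> \<Omega>;
        two_iso \<Lambda> \<Omega> f g; x \<in> carrier (pf_val M \<Omega>)\<rbrakk>
      \<Longrightarrow> pf_res M \<Lambda> \<Omega> f x = pf_res M \<Lambda> \<Omega> g x"
    and tr_two_iso: "\<lbrakk>is_ptn \<Lambda>; is_ptn \<Omega>; f \<in> ptn_mor \<Lambda> \<Omega>; g \<in> ptn_mor \<Lambda> \<Omega>;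
        two_iso \<Lambda> \<Omega> f g; x \<in> carrier (pf_val M \<Lambda>)\<rbrakk>
      \<Longrightarrow> pf_tr M \<Lambda> \<Omega> f x = pf_tr M \<Lambda> \<Omega> g x"
    and tr_iso: "\<lbrakk>is_ptn \<Lambda>; is_ptn \<Omega>; f \<in> ptn_iso \<Lambda> \<Omega>; x \<in> carrier (pf_val M \<Lambda>)\<rbrakk>
      \<Longrightarrow> pf_tr M \<Lambda> \<Omega> f x = pf_res M \<Omega> \<Lambda> (inv_into (fst \<Lambda>) f) x"
    and double_coset: "\<lbrakk>is_ptn \<Omega>; \<Gamma> \<in> refinements \<Omega>; \<Lambda> \<in> refinements \<Omega>;
        x \<in> carrier (pf_val M \<Lambda>)\<rbrakk>
      \<Longrightarrow> pf_res M \<Gamma> \<Omega> id (pf_tr M \<Lambda> \<Omega> id x) =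
        finsum (pf_val M \<Gamma>)
          (\<lambda>D. let \<sigma> = rep D;
                    \<Psi> = ptn_inter \<Gamma> (ptn_image \<sigma> \<Lambda>);
                    \<Phi> = ptn_inter (ptn_image (inv_into UNIV \<sigma>) \<Gamma>) \<Lambda>
                in pf_tr M \<Psi> \<Gamma> id (pf_tr M \<Phi> \<Psi> \<sigma> (pf_res M \<Phi> \<Lambda> id x)))
          (double_cosets \<Gamma> \<Omega> \<Lambda>)"

text \<open>Linear maps out of a tensor product of two modules are given as bilinear maps.\<close>

locale lax_symmetric_monoidal_pf = partition_functor M
  for K :: "('k, 'z) ring_scheme" and M :: "('k, 'b, 'y) monoidal_pf_scheme" +
  assumes val_module: "is_ptn \<Lambda> \<Longrightarrow> module K (pf_val M \<Lambda>)"
    and res_linear: "\<lbrakk>is_ptn \<Lambda>; is_ptn \<Omega>; f \<in> ptn_mor \<Lambda> \<Omega>\<rbrakk>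
      \<Longrightarrow> pf_res M \<Lambda> \<Omega> f \<in> module_hom K (pf_val M \<Omega>) (pf_val M \<Lambda>)"
    and tr_linear: "\<lbrakk>is_ptn \<Lambda>; is_ptn \<Omega>; f \<in> ptn_mor \<Lambda> \<Omega>\<rbrakk>
      \<Longrightarrow> pf_tr M \<Lambda> \<Omega> f \<in> module_hom K (pf_val M \<Lambda>) (pf_val M \<Omega>)"
    and unit_linear: "pf_unit M \<in> module_hom K (self_module K) (pf_val M (underline 0))"
    and prod_linear1: "\<lbrakk>is_ptn \<Lambda>; is_ptn \<Omega>; y \<in> carrier (pf_val M \<Omega>)\<rbrakk>
      \<Longrightarrow> (\<lambda>x. pf_prod M \<Lambda> \<Omega> x y) \<in> module_hom K (pf_val M \<Lambda>) (pf_val M (ptn_sum \<Lambda> \<Omega>))"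
    and prod_linear2: "\<lbrakk>is_ptn \<Lambda>; is_ptn \<Omega>; x \<in> carrier (pf_val M \<Lambda>)\<rbrakk>
      \<Longrightarrow> (\<lambda>y. pf_prod M \<Lambda> \<Omega> x y) \<in> module_hom K (pf_val M \<Omega>) (pf_val M (ptn_sum \<Lambda> \<Omega>))"
    and prod_res: "\<lbrakk>is_ptn \<Lambda>; is_ptn \<Lambda>'; is_ptn \<Omega>; is_ptn \<Omega>'; f \<in> ptn_mor \<Lambda> \<Lambda>'; g \<in> ptn_mor \<Omega> \<Omega>';
        x \<in> carrier (pf_val M \<Lambda>'); y \<in> carrier (pf_val M \<Omega>')\<rbrakk>
      \<Longrightarrow> pf_res M (ptn_sum \<Lambda> \<Omega>) (ptn_sum \<Lambda>' \<Omega>') (mor_sum f g) (pf_prod M \<Lambda>' \<Omega>' x y) =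
          pf_prod M \<Lambda> \<Omega> (pf_res M \<Lambda> \<Lambda>' f x) (pf_res M \<Omega> \<Omega>' g y)"
    and prod_tr: "\<lbrakk>is_ptn \<Lambda>; is_ptn \<Lambda>'; is_ptn \<Omega>; is_ptn \<Omega>'; f \<in> ptn_mor \<Lambda> \<Lambda>'; g \<in> ptn_mor \<Omega> \<Omega>';
        x \<in> carrier (pf_val M \<Lambda>); y \<in> carrier (pf_val M \<Omega>)\<rbrakk>
      \<Longrightarrow> pf_tr M (ptn_sum \<Lambda> \<Omega>) (ptn_sum \<Lambda>' \<Omega>') (mor_sum f g) (pf_prod M \<Lambda> \<Omega> x y) =
          pf_prod M \<Lambda>' \<Omega>' (pf_tr M \<Lambda> \<Lambda>' f x) (pf_tr M \<Omega> \<Omega>' g y)"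
    and prod_assoc: "\<lbrakk>is_ptn \<Lambda>; is_ptn \<Omega>; is_ptn \<Psi>;
        x \<in> carrier (pf_val M \<Lambda>); y \<in> carrier (pf_val M \<Omega>); z \<in> carrier (pf_val M \<Psi>)\<rbrakk>
      \<Longrightarrow> pf_tr M (ptn_sum (ptn_sum \<Lambda> \<Omega>) \<Psi>) (ptn_sum \<Lambda> (ptn_sum \<Omega> \<Psi>)) sum_assoc
            (pf_prod M (ptn_sum \<Lambda> \<Omega>) \<Psi> (pf_prod M \<Lambda> \<Omega> x y) z) =
          pf_prod M \<Lambda> (ptn_sum \<Omega> \<Psi>) x (pf_prod M \<Omega> \<Psi> y z)"
    and prod_unit_right: "\<lbrakk>is_ptn \<Lambda>; x \<in> carrier (pf_val M \<Lambda>)\<rbrakk>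
      \<Longrightarrow> pf_tr M (ptn_sum \<Lambda> (underline 0)) \<Lambda> sum_fold
            (pf_prod M \<Lambda> (underline 0) x (pf_unit M \<one>\<^bsub>K\<^esub>)) = x"
    and prod_unit_left: "\<lbrakk>is_ptn \<Lambda>; x \<in> carrier (pf_val M \<Lambda>)\<rbrakk>
      \<Longrightarrow> pf_tr M (ptn_sum (underline 0) \<Lambda>) \<Lambda> sum_fold
            (pf_prod M (underline 0) \<Lambda> (pf_unit M \<one>\<^bsub>K\<^esub>) x) = x"
    and prod_sym: "\<lbrakk>is_ptn \<Lambda>; is_ptn \<Omega>; x \<in> carrier (pf_val M \<Lambda>); y \<in> carrier (pf_val M \<Omega>)\<rbrakk>
      \<Longrightarrow> pf_tr M (ptn_sum \<Lambda> \<Omega>) (ptn_sum \<Omega> \<Lambda>) sum_swap (pf_prod M \<Lambda> \<Omega> x y) =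
          pf_prod M \<Omega> \<Lambda> y x"

locale symmetric_monoidal_pf = lax_symmetric_monoidal_pf +
  assumes unit_bij: "bij_betw (pf_unit M) (carrier K) (carrier (pf_val M (underline 0)))"
    and prod_bij: "\<lbrakk>is_ptn \<Lambda>; is_ptn \<Omega>\<rbrakk> \<Longrightarrow>
      bij_betw
        (tensor_lift K [pf_val M \<Lambda>, pf_val M \<Omega>] (pf_val M (ptn_sum \<Lambda> \<Omega>))
          (\<lambda>xs. pf_prod M \<Lambda> \<Omega> (xs ! 0) (xs ! 1)))
        (carrier (tensor K [pf_val M \<Lambda>, pf_val M \<Omega>]))
        (carrier (pf_val M (ptn_sum \<Lambda> \<Omega>)))"


section \<open>The algebra of a lax symmetric monoidal partition functor\<close>

definition Sigma_algebra ::
    "('k, 'z) ring_scheme \<Rightarrow> ('k, 'b, 'y) monoidal_pf_scheme \<Rightarrow> ('k, nat \<Rightarrow> 'b) module" where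
  "Sigma_algebra K M =
    (let A = direct_sum UNIV (\<lambda>m. pf_val M (underline m)) in
     \<lparr>carrier = carrier A,
      monoid.mult = (\<lambda>x y n.
        finsum (pf_val M (underline n))
          (\<lambda>i. pf_tr M (ptn_sum (underline i) (underline (n - i))) (underline n) (append_mor i)
                 (pf_prod M (underline i) (underline (n - i)) (x i) (y (n - i))))
          {..n}),
      one = (\<lambda>m. if m = 0 then pf_unit M \<one>\<^bsub>K\<^esub> else \<zero>\<^bsub>pf_val M (underline m)\<^esub>),
      zero = \<zero>\<^bsub>A\<^esub>,
      add = add A,
      smult = smult A\<rparr>)"

definition Sigma_degree :: "('k, 'b, 'y) monoidal_pf_scheme \<Rightarrow> nat \<Rightarrow> (nat \<Rightarrow> 'b) set" where
  "Sigma_degree M n = homogeneous (\<lambda>m. pf_val M (underline m)) n"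


section \<open>The partition functor PD(R)\<close>

definition tr_ideal ::
    "('k, 'z) ring_scheme \<Rightarrow> ('k, 'b, 'y) pf_scheme \<Rightarrow> ptn \<Rightarrow> 'b set" where
  "tr_ideal K R \<Gamma> =
     submodule_span K (pf_val R \<Gamma>)
       (\<Union>\<Omega> \<in> refinements \<Gamma> - {\<Gamma>}. pf_tr R \<Omega> \<Gamma> id ` carrier (pf_val R \<Omega>))"

definition Rbar ::
    "('k, 'z) ring_scheme \<Rightarrow> ('k, 'b, 'y) pf_scheme \<Rightarrow> ptn \<Rightarrow> ('k, 'b set) module" where
  "Rbar K R \<Gamma> = quotient_module (pf_val R \<Gamma>) (tr_ideal K R \<Gamma>)"

text \<open>The maps induced on quotients send cosets to cosets; adding the submodule to the image of
  a coset makes this a definition without choice of representatives.\<close>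

definition Rbar_tr ::
    "('k, 'z) ring_scheme \<Rightarrow> ('k, 'b, 'y) pf_scheme \<Rightarrow> ptn \<Rightarrow> ptn \<Rightarrow> (nat \<Rightarrow> nat)
       \<Rightarrow> 'b set \<Rightarrow> 'b set" where
  "Rbar_tr K R \<Gamma> \<Omega> f C = tr_ideal K R \<Omega> <+>\<^bsub>pf_val R \<Omega>\<^esub> (pf_tr R \<Gamma> \<Omega> f ` C)"

definition Rbar_prod ::
    "('k, 'z) ring_scheme \<Rightarrow> ('k, 'b, 'y) monoidal_pf_scheme \<Rightarrow> ptn \<Rightarrow> ptn
       \<Rightarrow> 'b set \<Rightarrow> 'b set \<Rightarrow> 'b set" where
  "Rbar_prod K R \<Gamma> \<Theta> C D =
     tr_ideal K R (ptn_sum \<Gamma> \<Theta>) <+>\<^bsub>pf_val R (ptn_sum \<Gamma> \<Theta>)\<^esub>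
       {pf_prod R \<Gamma> \<Theta> x y | x y. x \<in> C \<and> y \<in> D}"

definition PD_val ::
    "('k, 'z) ring_scheme \<Rightarrow> ('k, 'b, 'y) monoidal_pf_scheme \<Rightarrow> ptn
       \<Rightarrow> ('k, ptn \<Rightarrow> 'b set) module" where
  "PD_val K R \<Lambda> =
    (let S = direct_sum (refinements \<Lambda>) (Rbar K R) in
     S\<lparr>carrier :=
        {x \<in> carrier S. \<forall>\<sigma> \<in> block_perms \<Lambda>. \<forall>\<Gamma> \<in> refinements \<Lambda>.
           Rbar_tr K R (ptn_image (inv_into UNIV \<sigma>) \<Gamma>) \<Gamma> \<sigma> (x (ptn_image (inv_into UNIV \<sigma>) \<Gamma>)) = x \<Gamma>}\<rparr>)"

definition PD_res ::
    "('k, 'z) ring_scheme \<Rightarrow> ('k, 'b, 'y) monoidal_pf_scheme \<Rightarrow> ptn \<Rightarrow> ptn \<Rightarrow> (nat \<Rightarrow> nat)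
       \<Rightarrow> (ptn \<Rightarrow> 'b set) \<Rightarrow> (ptn \<Rightarrow> 'b set)" where
  "PD_res K R \<Lambda> \<Omega> f x =
     (\<lambda>\<Gamma> \<in> refinements \<Lambda>.
        inv_into (carrier (Rbar K R \<Gamma>)) (Rbar_tr K R \<Gamma> (ptn_image f \<Gamma>) f) (x (ptn_image f \<Gamma>)))"

definition PD_tr ::
    "('k, 'z) ring_scheme \<Rightarrow> ('k, 'b, 'y) monoidal_pf_scheme \<Rightarrow> ptn \<Rightarrow> ptn \<Rightarrow> (nat \<Rightarrow> nat)
       \<Rightarrow> (ptn \<Rightarrow> 'b set) \<Rightarrow> (ptn \<Rightarrow> 'b set)" where
  "PD_tr K R \<Psi> \<Lambda> f x =
     (\<lambda>\<Gamma> \<in> refinements \<Lambda>.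
        finsum (Rbar K R \<Gamma>)
          (\<lambda>D. let h = rep D \<circ> f; \<Gamma>' = ptn_image (inv_into (fst \<Psi>) h) \<Gamma>
                in Rbar_tr K R \<Gamma>' \<Gamma> h (x \<Gamma>'))
          {D \<in> double_cosets \<Gamma> \<Lambda> (ptn_image f \<Psi>). ptn_le \<Gamma> (ptn_image (rep D \<circ> f) \<Psi>)})"

definition PD_unit ::
    "('k, 'z) ring_scheme \<Rightarrow> ('k, 'b, 'y) monoidal_pf_scheme \<Rightarrow> 'k \<Rightarrow> (ptn \<Rightarrow> 'b set)" where
  "PD_unit K R a =
     (\<lambda>\<Gamma> \<in> refinements (underline 0). tr_ideal K R \<Gamma> +>\<^bsub>pf_val R \<Gamma>\<^esub> pf_unit R a)"

text \<open>Every refinement \<open>\<Delta>\<close> of \<open>\<Lambda> \<squnion> \<Omega>\<close> is \<open>\<Gamma> \<squnion> \<Theta>\<close> for unique \<open>\<Gamma> \<le> \<Lambda>\<close> and \<open>\<Theta> \<le> \<Omega>\<close>.\<close>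

definition PD_prod ::
    "('k, 'z) ring_scheme \<Rightarrow> ('k, 'b, 'y) monoidal_pf_scheme \<Rightarrow> ptn \<Rightarrow> ptn
       \<Rightarrow> (ptn \<Rightarrow> 'b set) \<Rightarrow> (ptn \<Rightarrow> 'b set) \<Rightarrow> (ptn \<Rightarrow> 'b set)" where
  "PD_prod K R \<Lambda> \<Omega> x y =
     (\<lambda>\<Delta> \<in> refinements (ptn_sum \<Lambda> \<Omega>).
        THE v. \<exists>\<Gamma> \<in> refinements \<Lambda>. \<exists>\<Theta> \<in> refinements \<Omega>.
          \<Delta> = ptn_sum \<Gamma> \<Theta> \<and> v = Rbar_prod K R \<Gamma> \<Theta> (x \<Gamma>) (y \<Theta>))"

definition PD ::
    "('k, 'z) ring_scheme \<Rightarrow> ('k, 'b, 'y) monoidal_pf_scheme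
       \<Rightarrow> ('k, ptn \<Rightarrow> 'b set) monoidal_pf" where
  "PD K R =
     \<lparr>pf_val = PD_val K R, pf_res = PD_res K R, pf_tr = PD_tr K R,
      pf_unit = PD_unit K R, pf_prod = PD_prod K R\<rparr>"

end

theory Submission
  imports Defs "HOL-Library.Disjoint_Sets"
begin

text \<open>
  A partition is determined by its set \<open>A\<close> of blocks, and \<open>R\<close> modulo \<open>I\<close> is a species \<open>V\<close> on finite
  sets of disjoint blocks. For disjoint \<open>A\<close> and \<open>B\<close>, folding the disjoint union onto \<open>A \<union> B\<close> turns
  the external product into an internal one \<open>\<star> : V A \<otimes> V B \<rightarrow> V (A \<union> B)\<close>. It is an isomorphism:
  \<open>R\<close> is monoidal, and a proper refinement of \<open>A \<union> B\<close> properly refines \<open>A\<close> or \<open>B\<close>.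

  Both sides of the claim are the algebra of families \<open>u A \<in> V A\<close> that are natural in bijections
  and vanish for large \<open>A\<close>, with \<open>(u v) A = \<Sum>\<^bsub>S \<subseteq> A\<^esub> u S \<star> v (A - S)\<close>. For \<open>TS\<close>, an \<open>r\<close>-tensor is
  evaluated on an ordered list of \<open>r\<close> blocks by reading off the homogeneous component that fits the
  block sizes; these evaluations determine the tensor, its invariance makes the value independent
  of the order, and \<open>(i, j)\<close>-shuffles are the subsets \<open>S\<close> with \<open>i\<close> of the \<open>i + j\<close> blocks. For \<open>PD\<close>,
  a family is restricted to the partitions of the sets \<open>{1..n}\<close>; in degrees \<open>i\<close> and \<open>j\<close> the double
  cosets in the transfer formula are the sets \<open>S\<close> of blocks whose union has \<open>i\<close> elements.
\<close>

section \<open>Linear maps, spans and quotients\<close>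

text \<open>A direct map between the two algebras would depend on an order of the blocks, on
  numberings of the blocks and on coset representatives, and multiplicativity would have to compare
  all these choices. Natural families carry a value on every block family, so each side is compared
  with one sum over subsets that involves no choice. The price is to show that evaluation on ordered
  blocks loses nothing. Here the external products must be injective as well as surjective: their
  universal property yields, for each block list, a section \<open>theta\<close> of the evaluation
  \<open>nuhat\<close> that sends a product of fitting homogeneous vectors back to the pure tensor.
  The composites of \<open>theta\<close> and \<open>nuhat\<close>, one for each sequence of block
  sizes, are the projections of a tensor power onto its multihomogeneous parts; injectivity,
  surjectivity and the grading all follow from this decomposition. The shift by one in the grading
  of \<open>TS\<close> is the size of a block: degree \<open>i\<close> of the graded module lives on
  one block with \<open>i + 1\<close> points, and the total degree is the number of points. As
  blocks are nonempty, a bound on the number of points also bounds the number of tensor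
  factors.\<close>

lemma (in abelian_monoid) finsum_Sigma:
  assumes "finite A" "\<And>x. x \<in> A \<Longrightarrow> finite (B x)"
    and "\<And>x y. x \<in> A \<Longrightarrow> y \<in> B x \<Longrightarrow> f x y \<in> carrier G"
  shows "finsum G (\<lambda>x. finsum G (f x) (B x)) A = finsum G (\<lambda>(x, y). f x y) (Sigma A B)"
  using assms
proof (induction A)
  case empty
  then show ?case by simp
next
  case (insert a A)
  have split: "Sigma (insert a A) B = Pair a ` B a \<union> Sigma A B"
    by auto
  have 1: "finsum G (\<lambda>(x, y). f x y) (Pair a ` B a) = finsum G (f a) (B a)"
    using insert.prems by (subst finsum_reindex) (auto simp: inj_on_def)
  have "finsum G (\<lambda>(x, y). f x y) (Sigma (insert a A) B) =
      finsum G (\<lambda>(x, y). f x y) (Pair a ` B a) \<oplus> finsum G (\<lambda>(x, y). f x y) (Sigma A B)"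
    unfolding split using insert by (intro finsum_Un_disjoint) (auto intro!: finite_SigmaI)
  moreover have "finsum G (\<lambda>x. finsum G (f x) (B x)) (insert a A) =
      finsum G (f a) (B a) \<oplus> finsum G (\<lambda>x. finsum G (f x) (B x)) A"
    using insert by (intro finsum_insert) (auto intro!: finsum_closed)
  ultimately show ?case
    using insert 1 by simp
qed

lemma moduleD_abelian_group: "module K M \<Longrightarrow> abelian_group M"
  by (simp add: module_def)

lemma module_homI:
  assumes "\<And>x. x \<in> carrier M \<Longrightarrow> h x \<in> carrier N"
    and "\<And>x y. \<lbrakk>x \<in> carrier M; y \<in> carrier M\<rbrakk> \<Longrightarrow> h (x \<oplus>\<^bsub>M\<^esub> y) = h x \<oplus>\<^bsub>N\<^esub> h y"
    and "\<And>a x. \<lbrakk>a \<in> carrier K; x \<in> carrier M\<rbrakk> \<Longrightarrow> h (a \<odot>\<^bsub>M\<^esub> x) = a \<odot>\<^bsub>N\<^esub> h x"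
  shows "h \<in> module_hom K M N"
  using assms by (auto simp: module_hom_def hom_def)

lemma
  assumes "h \<in> module_hom K M N"
  shows module_hom_closed: "x \<in> carrier M \<Longrightarrow> h x \<in> carrier N"
    and module_hom_add:
      "\<lbrakk>x \<in> carrier M; y \<in> carrier M\<rbrakk> \<Longrightarrow> h (x \<oplus>\<^bsub>M\<^esub> y) = h x \<oplus>\<^bsub>N\<^esub> h y"
    and module_hom_smult:
      "\<lbrakk>a \<in> carrier K; x \<in> carrier M\<rbrakk> \<Longrightarrow> h (a \<odot>\<^bsub>M\<^esub> x) = a \<odot>\<^bsub>N\<^esub> h x"
  using assms by (auto simp: module_hom_def hom_def)

lemma module_hom_cong:
  assumes "h \<in> module_hom K M N" "module K M" "\<And>x. x \<in> carrier M \<Longrightarrow> h x = g x"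
  shows "g \<in> module_hom K M N"
proof -
  interpret M: module K M by fact
  show ?thesis
    using assms(1,3)
    by (intro module_homI)
      (auto simp: module_hom_closed module_hom_add module_hom_smult simp flip: assms(3))
qed

lemma module_hom_zero:
  assumes "h \<in> module_hom K M N" "module K M" "module K N"
  shows "h \<zero>\<^bsub>M\<^esub> = \<zero>\<^bsub>N\<^esub>"
proof -
  interpret M: module K M by fact
  interpret N: module K N by fact
  have "h \<zero>\<^bsub>M\<^esub> = h (\<zero>\<^bsub>K\<^esub> \<odot>\<^bsub>M\<^esub> \<zero>\<^bsub>M\<^esub>)" by simp
  also have "\<dots> = \<zero>\<^bsub>K\<^esub> \<odot>\<^bsub>N\<^esub> h \<zero>\<^bsub>M\<^esub>"
    by (rule module_hom_smult[OF assms(1)]) simp_all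
  also have "\<dots> = \<zero>\<^bsub>N\<^esub>"
    using module_hom_closed[OF assms(1)] by simp
  finally show ?thesis .
qed

text \<open>Expressing negatives as scalar multiples makes compatibility with addition and scalars
  the only thing to check for linear maps and submodules.\<close>

lemma module_minus_eq:
  assumes "module K M" "x \<in> carrier M"
  shows "\<ominus>\<^bsub>M\<^esub> x = (\<ominus>\<^bsub>K\<^esub> \<one>\<^bsub>K\<^esub>) \<odot>\<^bsub>M\<^esub> x"
proof -
  interpret M: module K M by fact
  show ?thesis using assms by (simp add: M.smult_l_minus)
qed

lemma module_hom_a_inv:
  assumes "h \<in> module_hom K M N" "module K M" "module K N" "x \<in> carrier M"
  shows "h (\<ominus>\<^bsub>M\<^esub> x) = \<ominus>\<^bsub>N\<^esub> h x"
proof -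
  interpret M: module K M by fact
  interpret N: module K N by fact
  show ?thesis
    using assms module_hom_closed[OF assms(1)] module_hom_smult[OF assms(1), of "\<ominus>\<^bsub>K\<^esub> \<one>\<^bsub>K\<^esub>" x]
    by (simp add: module_minus_eq[of K])
qed

lemma module_hom_a_minus:
  assumes "h \<in> module_hom K M N" "module K M" "module K N" "x \<in> carrier M" "y \<in> carrier M"
  shows "h (x \<ominus>\<^bsub>M\<^esub> y) = h x \<ominus>\<^bsub>N\<^esub> h y"
proof -
  interpret M: module K M by fact
  interpret N: module K N by fact
  show ?thesis
    using assms by (simp add: a_minus_def module_hom_add[OF assms(1)] module_hom_a_inv[OF assms(1)])
qed

text \<open>Over an infinite index set both sums are zero by convention, and \<open>h\<close>
  preserves zero, so the rule applies to every \<open>A\<close>.\<close>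

lemma module_hom_finsum:
  assumes h: "h \<in> module_hom K M N" and M: "module K M" and N: "module K N"
    and f: "\<And>x. x \<in> A \<Longrightarrow> f x \<in> carrier M"
  shows "h (finsum M f A) = finsum N (\<lambda>x. h (f x)) A"
proof -
  interpret M: module K M by fact
  interpret N: module K N by fact
  show ?thesis
  proof (cases "finite A")
    case True
    then show ?thesis using f
    proof (induction A)
      case empty
      then show ?case using module_hom_zero[OF h M N] by simp
    next
      case (insert a A)
      then show ?case
        by (simp add: M.M.finsum_insert N.M.finsum_insert Pi_iff module_hom_closed[OF h]
            module_hom_add[OF h] M.M.finsum_closed)
    qed
  next
    case False
    then show ?thesis using module_hom_zero[OF h M N] by (simp add: M.M.finsum_infinite N.M.finsum_infinite)
  qed
qed

lemma module_hom_compose: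
  assumes "h \<in> module_hom K M N" "g \<in> module_hom K N P"
  shows "(\<lambda>x. g (h x)) \<in> module_hom K M P"
  using assms by (auto intro!: module_homI simp: module_hom_closed module_hom_add module_hom_smult)

lemma module_hom_id: "(\<lambda>x. x) \<in> module_hom K M M"
  by (auto intro!: module_homI)

lemma module_hom_const_zero:
  assumes "module K N"
  shows "(\<lambda>x. \<zero>\<^bsub>N\<^esub>) \<in> module_hom K M N"
proof -
  interpret N: module K N by fact
  show ?thesis by (intro module_homI) auto
qed

lemma module_hom_add_fun:
  assumes "f \<in> module_hom K M N" "g \<in> module_hom K M N" "module K N"
  shows "(\<lambda>x. f x \<oplus>\<^bsub>N\<^esub> g x) \<in> module_hom K M N"
proof -
  interpret N: module K N by fact
  show ?thesis
    using assms(1,2)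
    by (intro module_homI)
      (auto simp: module_hom_closed module_hom_add module_hom_smult N.smult_r_distr N.M.a_ac)
qed

lemma module_hom_smult_fun:
  assumes "f \<in> module_hom K M N" "module K N" "a \<in> carrier K"
  shows "(\<lambda>x. a \<odot>\<^bsub>N\<^esub> f x) \<in> module_hom K M N"
proof -
  interpret N: module K N by fact
  show ?thesis
    using assms(1,3)
    by (intro module_homI)
      (auto simp: module_hom_closed module_hom_add module_hom_smult N.smult_r_distr N.R.m_comm
        simp flip: N.smult_assoc1)
qed

section \<open>Submodules and spans\<close>

lemma submoduleI':
  assumes "module K M" "H \<subseteq> carrier M" "\<zero>\<^bsub>M\<^esub> \<in> H"
    and add: "\<And>x y. \<lbrakk>x \<in> H; y \<in> H\<rbrakk> \<Longrightarrow> x \<oplus>\<^bsub>M\<^esub> y \<in> H"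
    and smult: "\<And>a x. \<lbrakk>a \<in> carrier K; x \<in> H\<rbrakk> \<Longrightarrow> a \<odot>\<^bsub>M\<^esub> x \<in> H"
  shows "submodule H K M"
proof -
  interpret M: module K M by fact
  have "\<ominus>\<^bsub>M\<^esub> x \<in> H" if "x \<in> H" for x
    using smult[of "\<ominus>\<^bsub>K\<^esub> \<one>\<^bsub>K\<^esub>" x] that assms(2) by (auto simp: module_minus_eq[OF assms(1)])
  then show ?thesis
    using assms by (intro M.submoduleI) auto
qed

lemma
  assumes "submodule H K M"
  shows submodule_subset: "H \<subseteq> carrier M"
    and submodule_zero: "\<zero>\<^bsub>M\<^esub> \<in> H"
    and submodule_add: "\<lbrakk>x \<in> H; y \<in> H\<rbrakk> \<Longrightarrow> x \<oplus>\<^bsub>M\<^esub> y \<in> H"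
    and submodule_smult: "\<lbrakk>a \<in> carrier K; x \<in> H\<rbrakk> \<Longrightarrow> a \<odot>\<^bsub>M\<^esub> x \<in> H"
proof -
  interpret submodule H K M by fact
  show "H \<subseteq> carrier M" "\<zero>\<^bsub>M\<^esub> \<in> H" "\<lbrakk>x \<in> H; y \<in> H\<rbrakk> \<Longrightarrow> x \<oplus>\<^bsub>M\<^esub> y \<in> H"
    using subset one_closed m_closed by auto
  show "\<lbrakk>a \<in> carrier K; x \<in> H\<rbrakk> \<Longrightarrow> a \<odot>\<^bsub>M\<^esub> x \<in> H" by simp
qed

lemma submodule_finsum:
  assumes H: "submodule H K M" and M: "module K M" and f: "\<And>x. x \<in> A \<Longrightarrow> f x \<in> H"
  shows "finsum M f A \<in> H"
proof -
  interpret M: module K M by fact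
  have sub: "H \<subseteq> carrier M" by (rule submodule_subset[OF H])
  show ?thesis
  proof (cases "finite A")
    case True
    then show ?thesis using f
    proof (induction A)
      case empty
      then show ?case using submodule_zero[OF H] by simp
    next
      case (insert a A)
      then have "finsum M f (insert a A) = f a \<oplus>\<^bsub>M\<^esub> finsum M f A"
        using sub by (intro M.M.finsum_insert) auto
      then show ?case using insert submodule_add[OF H] by simp
    qed
  next
    case False
    then show ?thesis using submodule_zero[OF H] by (simp add: M.M.finsum_infinite)
  qed
qed

lemma submodule_a_minus:
  assumes H: "submodule H K M" and M: "module K M" and "x \<in> H" "y \<in> H"
  shows "x \<ominus>\<^bsub>M\<^esub> y \<in> H"
proof -
  interpret M: module K M by fact
  have "\<ominus>\<^bsub>M\<^esub> y = (\<ominus>\<^bsub>K\<^esub> \<one>\<^bsub>K\<^esub>) \<odot>\<^bsub>M\<^esub> y"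
    using submodule_subset[OF H] assms by (intro module_minus_eq[OF M]) auto
  then show ?thesis
    using submodule_smult[OF H, of "\<ominus>\<^bsub>K\<^esub> \<one>\<^bsub>K\<^esub>" y] submodule_add[OF H] assms
    by (simp add: a_minus_def)
qed

lemma submodule_vimage:
  assumes h: "h \<in> module_hom K M N" and M: "module K M" and N: "module K N"
    and H: "submodule H K N"
  shows "submodule {x \<in> carrier M. h x \<in> H} K M"
proof -
  interpret M: module K M by fact
  show ?thesis
    using submodule_zero[OF H] submodule_add[OF H] submodule_smult[OF H]
    by (intro submoduleI'[OF M])
      (auto simp: module_hom_zero[OF h M N] module_hom_add[OF h] module_hom_smult[OF h])
qed

text \<open>Behind every argument by generators: the locus where two linear maps agree is a
  submodule, so agreement on generators spreads to their span.\<close>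

lemma submodule_equalizer:
  assumes h: "h \<in> module_hom K M N" and g: "g \<in> module_hom K M N"
    and M: "module K M" and N: "module K N"
  shows "submodule {x \<in> carrier M. h x = g x} K M"
proof -
  interpret M: module K M by fact
  show ?thesis
    by (intro submoduleI'[OF M])
      (auto simp: module_hom_zero[OF h M N] module_hom_add[OF h] module_hom_smult[OF h]
        module_hom_zero[OF g M N] module_hom_add[OF g] module_hom_smult[OF g])
qed

lemma submodule_image:
  assumes h: "h \<in> module_hom K M N" and M: "module K M" and N: "module K N"
    and H: "submodule H K M"
  shows "submodule (h ` H) K N"
proof (rule submoduleI'[OF N])
  show "h ` H \<subseteq> carrier N"
    using submodule_subset[OF H] module_hom_closed[OF h] by auto
  show "\<zero>\<^bsub>N\<^esub> \<in> h ` H"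
    using submodule_zero[OF H] module_hom_zero[OF h M N] by (metis image_eqI)
  show "x \<oplus>\<^bsub>N\<^esub> y \<in> h ` H" if xy: "x \<in> h ` H" "y \<in> h ` H" for x y
  proof -
    from xy obtain x' y' where "x' \<in> H" "y' \<in> H" "x = h x'" "y = h y'" by auto
    then show ?thesis
      using submodule_subset[OF H] submodule_add[OF H] module_hom_add[OF h, of x' y']
      by (auto intro!: image_eqI[of _ h "x' \<oplus>\<^bsub>M\<^esub> y'"] simp: subset_iff)
  qed
  show "a \<odot>\<^bsub>N\<^esub> x \<in> h ` H" if ax: "a \<in> carrier K" "x \<in> h ` H" for a x
  proof -
    from ax obtain x' where "x' \<in> H" "x = h x'" by auto
    then show ?thesis
      using ax submodule_subset[OF H] submodule_smult[OF H] module_hom_smult[OF h, of a x']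
      by (auto intro!: image_eqI[of _ h "a \<odot>\<^bsub>M\<^esub> x'"] simp: subset_iff)
  qed
qed

lemma submodule_spanI:
  assumes "module K M" "S \<subseteq> carrier M"
  shows "submodule (submodule_span K M S) K M"
proof (rule submoduleI'[OF assms(1)])
  interpret M: module K M by fact
  show "submodule_span K M S \<subseteq> carrier M"
    using M.carrier_is_submodule assms(2) by (auto simp: submodule_span_def)
  show "\<zero>\<^bsub>M\<^esub> \<in> submodule_span K M S"
    unfolding submodule_span_def by (auto intro: submodule_zero)
  show "x \<oplus>\<^bsub>M\<^esub> y \<in> submodule_span K M S"
    if "x \<in> submodule_span K M S" "y \<in> submodule_span K M S" for x y
    using that unfolding submodule_span_def by (auto intro: submodule_add)
  show "a \<odot>\<^bsub>M\<^esub> x \<in> submodule_span K M S" if "a \<in> carrier K" "x \<in> submodule_span K M S" for a x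
    using that unfolding submodule_span_def by (auto intro: submodule_smult)
qed

lemma span_superset: "S \<subseteq> submodule_span K M S"
  by (auto simp: submodule_span_def)

lemma span_least: "submodule H K M \<Longrightarrow> S \<subseteq> H \<Longrightarrow> submodule_span K M S \<subseteq> H"
  by (auto simp: submodule_span_def)

text \<open>Negatives are multiples by \<open>-1\<close>, so closure under multiples suffices.\<close>

lemma pointwise_module:
  assumes K: "cring K" and N: "\<And>i. i \<in> I \<Longrightarrow> module K (N i)"
    and sub: "carrier Q \<subseteq> (\<Pi>\<^sub>E i\<in>I. carrier (N i))"
    and zero: "\<zero>\<^bsub>Q\<^esub> = (\<lambda>i\<in>I. \<zero>\<^bsub>N i\<^esub>)" "\<zero>\<^bsub>Q\<^esub> \<in> carrier Q"
    and add: "\<And>x y. \<lbrakk>x \<in> carrier Q; y \<in> carrier Q\<rbrakk> \<Longrightarrow> x \<oplus>\<^bsub>Q\<^esub> y = (\<lambda>i\<in>I. x i \<oplus>\<^bsub>N i\<^esub> y i)"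
      "\<And>x y. \<lbrakk>x \<in> carrier Q; y \<in> carrier Q\<rbrakk> \<Longrightarrow> x \<oplus>\<^bsub>Q\<^esub> y \<in> carrier Q"
    and smult: "\<And>a x. \<lbrakk>a \<in> carrier K; x \<in> carrier Q\<rbrakk> \<Longrightarrow> a \<odot>\<^bsub>Q\<^esub> x = (\<lambda>i\<in>I. a \<odot>\<^bsub>N i\<^esub> x i)"
      "\<And>a x. \<lbrakk>a \<in> carrier K; x \<in> carrier Q\<rbrakk> \<Longrightarrow> a \<odot>\<^bsub>Q\<^esub> x \<in> carrier Q"
  shows "module K Q"
proof -
  interpret K: cring K by fact
  have ag: "abelian_group (N i)" if "i \<in> I" for i
    using N that by (simp add: module_def)
  have mem: "x i \<in> carrier (N i)" if "x \<in> carrier Q" "i \<in> I" for x i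
    using sub that by auto
  have eqI: "x = y" if "x \<in> carrier Q" "y \<in> carrier Q" "\<And>i. i \<in> I \<Longrightarrow> x i = y i" for x y
    using that sub by (meson PiE_ext subsetD)
  have ev: "(x \<oplus>\<^bsub>Q\<^esub> y) i = x i \<oplus>\<^bsub>N i\<^esub> y i" if "x \<in> carrier Q" "y \<in> carrier Q" "i \<in> I" for x y i
    using add(1) that by simp
  have ez: "\<zero>\<^bsub>Q\<^esub> i = \<zero>\<^bsub>N i\<^esub>" if "i \<in> I" for i
    using zero that by simp
  have es: "(a \<odot>\<^bsub>Q\<^esub> x) i = a \<odot>\<^bsub>N i\<^esub> x i" if "a \<in> carrier K" "x \<in> carrier Q" "i \<in> I" for a x i
    using smult(1) that by simp
  have comm: "x \<oplus>\<^bsub>Q\<^esub> y = y \<oplus>\<^bsub>Q\<^esub> x" if "x \<in> carrier Q" "y \<in> carrier Q" for x y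
    using that by (intro eqI add(2)) (auto simp: ev abelian_monoid.a_comm[OF abelian_group.axioms(1)[OF ag]] mem)
  have inv: "\<exists>y \<in> carrier Q. y \<oplus>\<^bsub>Q\<^esub> x = \<zero>\<^bsub>Q\<^esub>" if x: "x \<in> carrier Q" for x
  proof (intro bexI[of _ "(\<ominus>\<^bsub>K\<^esub> \<one>\<^bsub>K\<^esub>) \<odot>\<^bsub>Q\<^esub> x"] eqI add(2) smult(2) zero(2) x)
    fix i assume i: "i \<in> I"
    have "\<ominus>\<^bsub>K\<^esub> \<one>\<^bsub>K\<^esub> \<odot>\<^bsub>N i\<^esub> x i \<oplus>\<^bsub>N i\<^esub> x i = \<zero>\<^bsub>N i\<^esub>"
      using module_minus_eq[OF N[OF i] mem[OF x i]] abelian_group.l_neg[OF ag[OF i] mem[OF x i]] by simp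
    then show "(\<ominus>\<^bsub>K\<^esub> \<one>\<^bsub>K\<^esub> \<odot>\<^bsub>Q\<^esub> x \<oplus>\<^bsub>Q\<^esub> x) i = \<zero>\<^bsub>Q\<^esub> i"
      using x i smult(2)[of "\<ominus>\<^bsub>K\<^esub> \<one>\<^bsub>K\<^esub>" x] by (simp add: ev es ez)
  qed auto
  have "abelian_group Q"
  proof (rule abelian_groupI)
    show "x \<oplus>\<^bsub>Q\<^esub> y \<oplus>\<^bsub>Q\<^esub> z = x \<oplus>\<^bsub>Q\<^esub> (y \<oplus>\<^bsub>Q\<^esub> z)"
      if "x \<in> carrier Q" "y \<in> carrier Q" "z \<in> carrier Q" for x y z
      using that by (intro eqI add(2))
        (auto simp: ev add(2) abelian_monoid.a_assoc[OF abelian_group.axioms(1)[OF ag]] mem)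
    show "\<zero>\<^bsub>Q\<^esub> \<oplus>\<^bsub>Q\<^esub> x = x" if "x \<in> carrier Q" for x
      using that by (intro eqI add(2) zero(2))
        (auto simp: ev ez zero(2) abelian_monoid.l_zero[OF abelian_group.axioms(1)[OF ag]] mem)
  qed (use zero add(2) comm inv in auto)
  then show ?thesis
  proof (rule moduleI[OF K])
    show "(a \<oplus>\<^bsub>K\<^esub> b) \<odot>\<^bsub>Q\<^esub> x = a \<odot>\<^bsub>Q\<^esub> x \<oplus>\<^bsub>Q\<^esub> b \<odot>\<^bsub>Q\<^esub> x"
      if "a \<in> carrier K" "b \<in> carrier K" "x \<in> carrier Q" for a b x
      using that by (intro eqI add(2) smult(2))
        (auto simp: ev es mem smult(2) module.smult_l_distr[OF N])
    show "a \<odot>\<^bsub>Q\<^esub> (x \<oplus>\<^bsub>Q\<^esub> y) = a \<odot>\<^bsub>Q\<^esub> x \<oplus>\<^bsub>Q\<^esub> a \<odot>\<^bsub>Q\<^esub> y"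
      if "a \<in> carrier K" "x \<in> carrier Q" "y \<in> carrier Q" for a x y
      using that by (intro eqI add(2) smult(2))
        (auto simp: ev es mem smult(2) add(2) module.smult_r_distr[OF N])
    show "a \<otimes>\<^bsub>K\<^esub> b \<odot>\<^bsub>Q\<^esub> x = a \<odot>\<^bsub>Q\<^esub> (b \<odot>\<^bsub>Q\<^esub> x)"
      if "a \<in> carrier K" "b \<in> carrier K" "x \<in> carrier Q" for a b x
      using that by (intro eqI smult(2))
        (auto simp: ev es mem smult(2) module.smult_assoc1[OF N])
    show "\<one>\<^bsub>K\<^esub> \<odot>\<^bsub>Q\<^esub> x = x" if "x \<in> carrier Q" for x
      using that by (intro eqI smult(2)) (auto simp: es mem smult(2) module.smult_one[OF N])
  qed (use smult(2) in auto)
qed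

section \<open>Direct sums and images of modules\<close>

lemma mk_module_simps [simp]:
  "carrier (mk_module C pl ze sm) = C"
  "add (mk_module C pl ze sm) = pl"
  "zero (mk_module C pl ze sm) = ze"
  "smult (mk_module C pl ze sm) = sm"
  by (simp_all add: mk_module_def)

lemma direct_sum_simps:
  "carrier (direct_sum I N) = {x \<in> (\<Pi>\<^sub>E i\<in>I. carrier (N i)). finite {i \<in> I. x i \<noteq> \<zero>\<^bsub>N i\<^esub>}}"
  "x \<oplus>\<^bsub>direct_sum I N\<^esub> y = (\<lambda>i\<in>I. x i \<oplus>\<^bsub>N i\<^esub> y i)"
  "\<zero>\<^bsub>direct_sum I N\<^esub> = (\<lambda>i\<in>I. \<zero>\<^bsub>N i\<^esub>)"
  "a \<odot>\<^bsub>direct_sum I N\<^esub> x = (\<lambda>i\<in>I. a \<odot>\<^bsub>N i\<^esub> x i)"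
  by (simp_all add: direct_sum_def)

lemma module_direct_sum:
  assumes K: "cring K" and N: "\<And>i. i \<in> I \<Longrightarrow> module K (N i)"
  shows "module K (direct_sum I N)"
proof (rule pointwise_module[OF K N])
  have mg: "abelian_group (N i)" if "i \<in> I" for i
    using N that by (simp add: module_def)
  note zz = abelian_monoid.zero_closed[OF abelian_group.axioms(1)[OF mg]]
  have z: "\<zero>\<^bsub>N i\<^esub> \<oplus>\<^bsub>N i\<^esub> \<zero>\<^bsub>N i\<^esub> = \<zero>\<^bsub>N i\<^esub>" if "i \<in> I" for i
    using abelian_monoid.l_zero[OF abelian_group.axioms(1)[OF mg]] zz that by auto
  show "\<zero>\<^bsub>direct_sum I N\<^esub> \<in> carrier (direct_sum I N)"
    using zz by (auto simp: direct_sum_simps)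
  show "x \<oplus>\<^bsub>direct_sum I N\<^esub> y \<in> carrier (direct_sum I N)"
    if xy: "x \<in> carrier (direct_sum I N)" "y \<in> carrier (direct_sum I N)" for x y
  proof -
    have "{i \<in> I. x i \<oplus>\<^bsub>N i\<^esub> y i \<noteq> \<zero>\<^bsub>N i\<^esub>}
        \<subseteq> {i \<in> I. x i \<noteq> \<zero>\<^bsub>N i\<^esub>} \<union> {i \<in> I. y i \<noteq> \<zero>\<^bsub>N i\<^esub>}"
      using z by auto
    then have "finite {i \<in> I. x i \<oplus>\<^bsub>N i\<^esub> y i \<noteq> \<zero>\<^bsub>N i\<^esub>}"
      using xy by (auto simp: direct_sum_simps intro: finite_subset)
    then show ?thesis
      using xy abelian_monoid.a_closed[OF abelian_group.axioms(1)[OF mg]]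
      by (simp add: direct_sum_simps PiE_iff cong: conj_cong)
  qed
  show "a \<odot>\<^bsub>direct_sum I N\<^esub> x \<in> carrier (direct_sum I N)"
    if ax: "a \<in> carrier K" "x \<in> carrier (direct_sum I N)" for a x
  proof -
    have "{i \<in> I. a \<odot>\<^bsub>N i\<^esub> x i \<noteq> \<zero>\<^bsub>N i\<^esub>} \<subseteq> {i \<in> I. x i \<noteq> \<zero>\<^bsub>N i\<^esub>}"
      using module.smult_r_null[OF N] ax by auto
    then have "finite {i \<in> I. a \<odot>\<^bsub>N i\<^esub> x i \<noteq> \<zero>\<^bsub>N i\<^esub>}"
      using ax by (auto simp: direct_sum_simps intro: finite_subset)
    then show ?thesis
      using ax module.smult_closed[OF N] by (simp add: direct_sum_simps PiE_iff cong: conj_cong)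
  qed
qed (auto simp: direct_sum_simps)

lemma pointwise_eval:
  assumes "carrier Q \<subseteq> (\<Pi>\<^sub>E i\<in>I. carrier (N i))" "i \<in> I"
    and "\<And>x y. \<lbrakk>x \<in> carrier Q; y \<in> carrier Q\<rbrakk> \<Longrightarrow> x \<oplus>\<^bsub>Q\<^esub> y = (\<lambda>i\<in>I. x i \<oplus>\<^bsub>N i\<^esub> y i)"
    and "\<And>a x. \<lbrakk>a \<in> carrier K; x \<in> carrier Q\<rbrakk> \<Longrightarrow> a \<odot>\<^bsub>Q\<^esub> x = (\<lambda>i\<in>I. a \<odot>\<^bsub>N i\<^esub> x i)"
  shows "(\<lambda>x. x i) \<in> module_hom K Q (N i)"
  using assms by (intro module_homI) auto

lemma direct_sum_eval:
  "i \<in> I \<Longrightarrow> (\<lambda>x. x i) \<in> module_hom K (direct_sum I N) (N i)"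
  by (rule pointwise_eval) (auto simp: direct_sum_simps)

text \<open>The module axioms are equations and existence statements, so they pass along a
  surjection that respects the operations. Nothing about \<open>Q\<close> is presupposed, which
  suits quotients as well as records whose axioms have not been checked yet.\<close>

lemma module_surj_image:
  assumes M: "module K M" and q: "q ` carrier M = carrier Q"
    and add: "\<And>x y. \<lbrakk>x \<in> carrier M; y \<in> carrier M\<rbrakk> \<Longrightarrow> q (x \<oplus>\<^bsub>M\<^esub> y) = q x \<oplus>\<^bsub>Q\<^esub> q y"
    and smult: "\<And>a x. \<lbrakk>a \<in> carrier K; x \<in> carrier M\<rbrakk> \<Longrightarrow> q (a \<odot>\<^bsub>M\<^esub> x) = a \<odot>\<^bsub>Q\<^esub> q x"
    and zero: "q \<zero>\<^bsub>M\<^esub> = \<zero>\<^bsub>Q\<^esub>"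
  shows "module K Q"
proof -
  interpret M: module K M by fact
  have ex: "\<exists>x' \<in> carrier M. x = q x'" if "x \<in> carrier Q" for x
    using q that by auto
  have qc: "q x \<in> carrier Q" if "x \<in> carrier M" for x
    using q that by auto
  have "abelian_group Q"
  proof (rule abelian_groupI)
    fix x assume "x \<in> carrier Q"
    then obtain x' where [simp]: "x' \<in> carrier M" "x = q x'"
      by (metis ex)
    show "\<zero>\<^bsub>Q\<^esub> \<oplus>\<^bsub>Q\<^esub> x = x"
      by (simp flip: add zero)
    have "q (\<ominus>\<^bsub>M\<^esub> x') \<oplus>\<^bsub>Q\<^esub> q x' = \<zero>\<^bsub>Q\<^esub>"
      by (simp flip: add zero add: M.M.l_neg)
    then show "\<exists>y\<in>carrier Q. y \<oplus>\<^bsub>Q\<^esub> x = \<zero>\<^bsub>Q\<^esub>"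
      by (auto intro!: bexI[of _ "q (\<ominus>\<^bsub>M\<^esub> x')"] qc)
    fix y assume "y \<in> carrier Q"
    then obtain y' where [simp]: "y' \<in> carrier M" "y = q y'"
      by (metis ex)
    show "x \<oplus>\<^bsub>Q\<^esub> y \<in> carrier Q"
      by (simp flip: add add: qc)
    show "x \<oplus>\<^bsub>Q\<^esub> y = y \<oplus>\<^bsub>Q\<^esub> x"
      by (simp flip: add) (simp add: M.M.a_comm)
    fix z assume "z \<in> carrier Q"
    then obtain z' where [simp]: "z' \<in> carrier M" "z = q z'"
      by (metis ex)
    show "x \<oplus>\<^bsub>Q\<^esub> y \<oplus>\<^bsub>Q\<^esub> z = x \<oplus>\<^bsub>Q\<^esub> (y \<oplus>\<^bsub>Q\<^esub> z)"
      by (simp flip: add add: M.M.a_assoc)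
  qed (use zero qc[of "\<zero>\<^bsub>M\<^esub>"] in auto)
  then show ?thesis
  proof (rule moduleI[OF M.R.is_cring])
    fix a x assume [simp]: "a \<in> carrier K" and "x \<in> carrier Q"
    then obtain x' where [simp]: "x' \<in> carrier M" "x = q x'"
      by (metis ex)
    show "a \<odot>\<^bsub>Q\<^esub> x \<in> carrier Q"
      by (simp flip: smult add: qc)
    show "(a \<oplus>\<^bsub>K\<^esub> b) \<odot>\<^bsub>Q\<^esub> x = a \<odot>\<^bsub>Q\<^esub> x \<oplus>\<^bsub>Q\<^esub> b \<odot>\<^bsub>Q\<^esub> x" if "b \<in> carrier K" for b
      using that by (simp flip: smult add add: M.smult_l_distr)
    show "a \<otimes>\<^bsub>K\<^esub> b \<odot>\<^bsub>Q\<^esub> x = a \<odot>\<^bsub>Q\<^esub> (b \<odot>\<^bsub>Q\<^esub> x)" if "b \<in> carrier K" for b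
      using that by (simp flip: smult add add: M.smult_assoc1)
    fix y assume "y \<in> carrier Q"
    then obtain y' where [simp]: "y' \<in> carrier M" "y = q y'"
      by (metis ex)
    show "a \<odot>\<^bsub>Q\<^esub> (x \<oplus>\<^bsub>Q\<^esub> y) = a \<odot>\<^bsub>Q\<^esub> x \<oplus>\<^bsub>Q\<^esub> a \<odot>\<^bsub>Q\<^esub> y"
      by (simp flip: smult add add: M.smult_r_distr)
  next
    fix x assume "x \<in> carrier Q"
    then obtain x' where [simp]: "x' \<in> carrier M" "x = q x'"
      by (metis ex)
    show "\<one>\<^bsub>K\<^esub> \<odot>\<^bsub>Q\<^esub> x = x"
      by (simp flip: smult)
  qed
qed

section \<open>Cosets and quotient modules\<close>

lemma submodule_abelian_subgroup:
  assumes "module K M" "submodule I K M"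
  shows "abelian_subgroup I M"
proof -
  interpret M: module K M by fact
  interpret submodule I K M by fact
  show ?thesis
    using subgroup_axioms M.M.abelian_group_axioms
    by (auto intro!: abelian_subgroupI3 additive_subgroup.intro)
qed

lemma coset_self:
  assumes "module K M" "submodule I K M" "x \<in> carrier M"
  shows "x \<in> I +>\<^bsub>M\<^esub> x"
proof -
  interpret abelian_subgroup I M
    by (rule submodule_abelian_subgroup) fact+
  show ?thesis using a_rcos_self assms by auto
qed

lemma coset_eq_iff:
  assumes M: "module K M" and I: "submodule I K M" and x: "x \<in> carrier M" and y: "y \<in> carrier M"
  shows "I +>\<^bsub>M\<^esub> x = I +>\<^bsub>M\<^esub> y \<longleftrightarrow> x \<ominus>\<^bsub>M\<^esub> y \<in> I"
proof -
  interpret M: module K M by fact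
  interpret I: abelian_subgroup I M
    by (rule submodule_abelian_subgroup) fact+
  have "x \<ominus>\<^bsub>M\<^esub> y \<in> I" if "I +>\<^bsub>M\<^esub> x = I +>\<^bsub>M\<^esub> y"
  proof -
    from that coset_self[OF M I x] obtain h where "h \<in> I" "x = h \<oplus>\<^bsub>M\<^esub> y"
      by (auto simp: a_r_coset_def')
    then show ?thesis
      using x y submodule_subset[OF I]
      by (auto simp: a_minus_def M.M.a_assoc M.M.r_neg subset_iff)
  qed
  moreover have "I +>\<^bsub>M\<^esub> x = I +>\<^bsub>M\<^esub> y" if h: "x \<ominus>\<^bsub>M\<^esub> y \<in> I"
  proof -
    have "x = (x \<ominus>\<^bsub>M\<^esub> y) \<oplus>\<^bsub>M\<^esub> y"
      using x y by (simp add: a_minus_def M.M.a_assoc M.M.l_neg)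
    then have "x \<in> I +>\<^bsub>M\<^esub> y"
      using h by (auto simp: a_r_coset_def')
    then show ?thesis
      using I.a_repr_independence' y by blast
  qed
  ultimately show ?thesis by blast
qed

lemma coset_eqI:
  assumes M: "module K M" and I: "submodule I K M" and y: "y \<in> carrier M" "x \<in> I +>\<^bsub>M\<^esub> y"
  shows "I +>\<^bsub>M\<^esub> x = I +>\<^bsub>M\<^esub> y"
proof -
  interpret I: abelian_subgroup I M
    by (rule submodule_abelian_subgroup) fact+
  show ?thesis using I.a_repr_independence' y by blast
qed

lemma coset_zero:
  assumes M: "module K M" and I: "submodule I K M"
  shows "I +>\<^bsub>M\<^esub> \<zero>\<^bsub>M\<^esub> = I"
proof -
  interpret M: module K M by fact
  show ?thesis using submodule_subset[OF I] by simp
qed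

lemma coset_add:
  assumes M: "module K M" and I: "submodule I K M" and x: "x \<in> carrier M" and y: "y \<in> carrier M"
  shows "(I +>\<^bsub>M\<^esub> x) <+>\<^bsub>M\<^esub> (I +>\<^bsub>M\<^esub> y) = I +>\<^bsub>M\<^esub> (x \<oplus>\<^bsub>M\<^esub> y)"
proof -
  interpret I: abelian_subgroup I M
    by (rule submodule_abelian_subgroup) fact+
  show ?thesis using x y by (rule I.a_rcos_sum)
qed

text \<open>Operations on quotients are defined by applying a map to a whole coset and adding the
  submodule. Once the images are known to lie in a single coset, the result is that coset; this is
  how well-definedness is used for scalars, transfers and products.\<close>

lemma set_add_representatives:
  assumes M: "module K M" and I: "submodule I K M" and y: "y \<in> carrier M"
    and S: "S \<subseteq> I +>\<^bsub>M\<^esub> y" "S \<noteq> {}"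
  shows "I <+>\<^bsub>M\<^esub> S = I +>\<^bsub>M\<^esub> y"
proof -
  interpret M: module K M by fact
  have "I +>\<^bsub>M\<^esub> s = I +>\<^bsub>M\<^esub> y" if "s \<in> S" for s
    using that S y by (intro coset_eqI[OF M I]) auto
  moreover have "I <+>\<^bsub>M\<^esub> S = (\<Union>s\<in>S. I +>\<^bsub>M\<^esub> s)"
    by (auto simp: set_add_def' a_r_coset_def')
  ultimately show ?thesis using S by auto
qed

lemma quotient_module_simps:
  "carrier (quotient_module M I) = (\<lambda>x. I +>\<^bsub>M\<^esub> x) ` carrier M"
  "C \<oplus>\<^bsub>quotient_module M I\<^esub> D = C <+>\<^bsub>M\<^esub> D"
  "\<zero>\<^bsub>quotient_module M I\<^esub> = I"
  "a \<odot>\<^bsub>quotient_module M I\<^esub> C = I <+>\<^bsub>M\<^esub> ((\<lambda>x. a \<odot>\<^bsub>M\<^esub> x) ` C)"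
  by (auto simp: quotient_module_def A_RCOSETS_def')

lemma coset_smult:
  assumes M: "module K M" and I: "submodule I K M" and a: "a \<in> carrier K" and x: "x \<in> carrier M"
  shows "I <+>\<^bsub>M\<^esub> ((\<lambda>x. a \<odot>\<^bsub>M\<^esub> x) ` (I +>\<^bsub>M\<^esub> x)) = I +>\<^bsub>M\<^esub> (a \<odot>\<^bsub>M\<^esub> x)"
proof (rule set_add_representatives[OF M I])
  interpret M: module K M by fact
  show "a \<odot>\<^bsub>M\<^esub> x \<in> carrier M" using a x by simp
  show "(\<lambda>x. a \<odot>\<^bsub>M\<^esub> x) ` (I +>\<^bsub>M\<^esub> x) \<subseteq> I +>\<^bsub>M\<^esub> (a \<odot>\<^bsub>M\<^esub> x)"
    using a x submodule_subset[OF I] submodule_smult[OF I a]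
    by (auto simp: a_r_coset_def' M.smult_r_distr subset_iff)
  show "(\<lambda>x. a \<odot>\<^bsub>M\<^esub> x) ` (I +>\<^bsub>M\<^esub> x) \<noteq> {}"
    using coset_self[OF M I x] by auto
qed

lemma module_quotient:
  assumes M: "module K M" and I: "submodule I K M"
  shows "module K (quotient_module M I)"
  by (rule module_surj_image[OF M, of "\<lambda>x. I +>\<^bsub>M\<^esub> x"])
    (simp_all add: quotient_module_simps coset_add[OF M I] coset_smult[OF M I] coset_zero[OF M I])

lemma coset_hom:
  assumes M: "module K M" and I: "submodule I K M"
  shows "(\<lambda>x. I +>\<^bsub>M\<^esub> x) \<in> module_hom K M (quotient_module M I)"
  by (rule module_homI) (simp_all add: quotient_module_simps coset_add[OF M I] coset_smult[OF M I])

text \<open>The induced map takes the value of \<open>h\<close> at a chosen element of the coset.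
  Two elements of a coset differ by an element of \<open>I\<close>, where \<open>h\<close>
  vanishes.\<close>

lemma quotient_hom_ex:
  assumes M: "module K M" and I: "submodule I K M" and N: "module K N"
    and h: "h \<in> module_hom K M N" and I0: "\<And>x. x \<in> I \<Longrightarrow> h x = \<zero>\<^bsub>N\<^esub>"
  shows "\<exists>g \<in> module_hom K (quotient_module M I) N. \<forall>x \<in> carrier M. g (I +>\<^bsub>M\<^esub> x) = h x"
proof -
  interpret M: module K M by fact
  interpret N: module K N by fact
  define g where "g C = h (SOME x. x \<in> C)" for C
  have rep: "h y = h x" if x: "x \<in> carrier M" and y: "y \<in> I +>\<^bsub>M\<^esub> x" for x y
  proof -
    from y obtain i where "i \<in> I" "y = i \<oplus>\<^bsub>M\<^esub> x" by (auto simp: a_r_coset_def')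
    then show ?thesis
      using x submodule_subset[OF I] by (auto simp: module_hom_add[OF h] I0 subset_iff module_hom_closed[OF h])
  qed
  have g: "g (I +>\<^bsub>M\<^esub> x) = h x" if "x \<in> carrier M" for x
    unfolding g_def using coset_self[OF M I that] rep[OF that] by (metis someI_ex)
  have "g \<in> module_hom K (quotient_module M I) N"
    by (rule module_homI)
      (auto simp: quotient_module_simps g coset_add[OF M I] coset_smult[OF M I] module_hom_closed[OF h]
        module_hom_add[OF h] module_hom_smult[OF h])
  then show ?thesis using g by blast
qed

section \<open>Tensor products\<close>

lemma self_module_simps [simp]:
  "carrier (self_module K) = carrier K"
  "x \<oplus>\<^bsub>self_module K\<^esub> y = x \<oplus>\<^bsub>K\<^esub> y"
  "\<zero>\<^bsub>self_module K\<^esub> = \<zero>\<^bsub>K\<^esub>"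
  "a \<odot>\<^bsub>self_module K\<^esub> x = a \<otimes>\<^bsub>K\<^esub> x"
  by (simp_all add: self_module_def)

lemma module_self:
  assumes "cring K"
  shows "module K (self_module K)"
proof -
  interpret K: cring K by fact
  have "abelian_group (self_module K)"
    by (rule abelian_groupI) (auto simp: K.a_ac intro: bexI[of _ "\<ominus>\<^bsub>K\<^esub> _"] K.l_neg)
  then show ?thesis
    by (rule moduleI[OF K.is_cring]) (auto simp: K.l_distr K.r_distr K.m_assoc)
qed

lemma module_free:
  "cring K \<Longrightarrow> module K (free_module K S)"
  unfolding free_module_def by (intro module_direct_sum module_self)

lemma free_module_carrier:
  "carrier (free_module K S) = {f \<in> S \<rightarrow>\<^sub>E carrier K. finite {s \<in> S. f s \<noteq> \<zero>\<^bsub>K\<^esub>}}"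
  by (simp add: free_module_def direct_sum_simps)

lemma free_module_ops:
  "f \<oplus>\<^bsub>free_module K S\<^esub> g = (\<lambda>s\<in>S. f s \<oplus>\<^bsub>K\<^esub> g s)"
  "a \<odot>\<^bsub>free_module K S\<^esub> f = (\<lambda>s\<in>S. a \<otimes>\<^bsub>K\<^esub> f s)"
  by (simp_all add: free_module_def direct_sum_simps)

lemma free_basis_closed:
  assumes "cring K"
  shows "free_basis K S s \<in> carrier (free_module K S)"
proof -
  interpret K: cring K by fact
  have "{t \<in> S. free_basis K S s t \<noteq> \<zero>\<^bsub>K\<^esub>} \<subseteq> {s}"
    by (auto simp: free_basis_def)
  then have "finite {t \<in> S. free_basis K S s t \<noteq> \<zero>\<^bsub>K\<^esub>}"
    using finite_subset by blast
  then show ?thesis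
    by (auto simp: free_module_carrier free_basis_def)
qed

text \<open>The sum inside \<open>tensor_lift\<close>, isolated so that its linearity can be proved
  on the free module before passing to the quotient.\<close>

definition free_lift ::
    "('k, 'z) ring_scheme \<Rightarrow> ('k, 'c) module \<Rightarrow> ('s \<Rightarrow> 'c) \<Rightarrow> 's set \<Rightarrow> ('s \<Rightarrow> 'k) \<Rightarrow> 'c" where
  "free_lift K P \<phi> S f = finsum P (\<lambda>s. f s \<odot>\<^bsub>P\<^esub> \<phi> s) {s \<in> S. f s \<noteq> \<zero>\<^bsub>K\<^esub>}"

text \<open>The support of a sum may be smaller than the union of the supports. Enlarging the index
  set to a common finite set makes the two sides of additivity comparable term by term.\<close>

lemma free_lift_superset:
  assumes P: "module K P" and f: "f \<in> carrier (free_module K S)" and \<phi>: "\<And>s. s \<in> S \<Longrightarrow> \<phi> s \<in> carrier P"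
    and T: "finite T" "{s \<in> S. f s \<noteq> \<zero>\<^bsub>K\<^esub>} \<subseteq> T" "T \<subseteq> S"
  shows "free_lift K P \<phi> S f = finsum P (\<lambda>s. f s \<odot>\<^bsub>P\<^esub> \<phi> s) T"
proof -
  interpret P: module K P by fact
  have "f s \<in> carrier K" if "s \<in> S" for s
    using f that by (auto simp: free_module_carrier)
  then show ?thesis
    unfolding free_lift_def using T \<phi>
    by (intro P.M.add.finprod_mono_neutral_cong_left) (auto simp: subset_iff)
qed

lemma free_lift_hom:
  assumes P: "module K P" and \<phi>: "\<And>s. s \<in> S \<Longrightarrow> \<phi> s \<in> carrier P"
  shows "free_lift K P \<phi> S \<in> module_hom K (free_module K S) P"
proof (rule module_homI)
  interpret P: module K P by fact
  interpret F: module K "free_module K S" by (rule module_free) (rule P.R.is_cring)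
  have mem: "f s \<in> carrier K" if "f \<in> carrier (free_module K S)" "s \<in> S" for f s
    using that by (auto simp: free_module_carrier)
  have fin: "finite {s \<in> S. f s \<noteq> \<zero>\<^bsub>K\<^esub>}" if "f \<in> carrier (free_module K S)" for f
    using that by (auto simp: free_module_carrier)
  show "free_lift K P \<phi> S f \<in> carrier P" if "f \<in> carrier (free_module K S)" for f
    unfolding free_lift_def using mem[OF that] \<phi> by (intro P.M.finsum_closed) auto
  show "free_lift K P \<phi> S (f \<oplus>\<^bsub>free_module K S\<^esub> g) = free_lift K P \<phi> S f \<oplus>\<^bsub>P\<^esub> free_lift K P \<phi> S g"
    if f: "f \<in> carrier (free_module K S)" and g: "g \<in> carrier (free_module K S)" for f g
  proof -
    let ?T = "{s \<in> S. f s \<noteq> \<zero>\<^bsub>K\<^esub>} \<union> {s \<in> S. g s \<noteq> \<zero>\<^bsub>K\<^esub>}"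
    have T: "finite ?T" "?T \<subseteq> S" using fin f g by auto
    have "f \<oplus>\<^bsub>free_module K S\<^esub> g \<in> carrier (free_module K S)"
      using f g by simp
    then have "free_lift K P \<phi> S (f \<oplus>\<^bsub>free_module K S\<^esub> g) =
        finsum P (\<lambda>s. (f \<oplus>\<^bsub>free_module K S\<^esub> g) s \<odot>\<^bsub>P\<^esub> \<phi> s) ?T"
      using T f g by (intro free_lift_superset[OF P _ \<phi>]) (auto simp: free_module_ops)
    also have "\<dots> = finsum P (\<lambda>s. f s \<odot>\<^bsub>P\<^esub> \<phi> s \<oplus>\<^bsub>P\<^esub> g s \<odot>\<^bsub>P\<^esub> \<phi> s) ?T"
      using mem f g \<phi> by (intro P.M.finsum_cong') (auto simp: free_module_ops P.smult_l_distr)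
    also have "\<dots> = finsum P (\<lambda>s. f s \<odot>\<^bsub>P\<^esub> \<phi> s) ?T \<oplus>\<^bsub>P\<^esub> finsum P (\<lambda>s. g s \<odot>\<^bsub>P\<^esub> \<phi> s) ?T"
      using mem f g \<phi> by (intro P.M.finsum_addf) auto
    also have "finsum P (\<lambda>s. f s \<odot>\<^bsub>P\<^esub> \<phi> s) ?T = free_lift K P \<phi> S f"
      using T f by (intro free_lift_superset[OF P _ \<phi>, symmetric]) auto
    also have "finsum P (\<lambda>s. g s \<odot>\<^bsub>P\<^esub> \<phi> s) ?T = free_lift K P \<phi> S g"
      using T g by (intro free_lift_superset[OF P _ \<phi>, symmetric]) auto
    finally show ?thesis .
  qed
  show "free_lift K P \<phi> S (a \<odot>\<^bsub>free_module K S\<^esub> f) = a \<odot>\<^bsub>P\<^esub> free_lift K P \<phi> S f"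
    if a: "a \<in> carrier K" and f: "f \<in> carrier (free_module K S)" for a f
  proof -
    let ?T = "{s \<in> S. f s \<noteq> \<zero>\<^bsub>K\<^esub>}"
    have "a \<odot>\<^bsub>free_module K S\<^esub> f \<in> carrier (free_module K S)"
      using a f by simp
    then have "free_lift K P \<phi> S (a \<odot>\<^bsub>free_module K S\<^esub> f) =
        finsum P (\<lambda>s. (a \<odot>\<^bsub>free_module K S\<^esub> f) s \<odot>\<^bsub>P\<^esub> \<phi> s) ?T"
      using a f fin[OF f] by (intro free_lift_superset[OF P _ \<phi>]) (auto simp: free_module_ops)
    also have "\<dots> = finsum P (\<lambda>s. a \<odot>\<^bsub>P\<^esub> (f s \<odot>\<^bsub>P\<^esub> \<phi> s)) ?T"
      using mem[OF f] a \<phi> by (intro P.M.finsum_cong') (auto simp: free_module_ops P.smult_assoc1)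
    also have "\<dots> = a \<odot>\<^bsub>P\<^esub> free_lift K P \<phi> S f"
      unfolding free_lift_def using mem[OF f] a \<phi> fin[OF f]
      by (intro P.finsum_smult_ldistr[symmetric]) auto
    finally show ?thesis .
  qed
qed

lemma free_lift_basis:
  assumes P: "module K P" and \<phi>: "\<And>s. s \<in> S \<Longrightarrow> \<phi> s \<in> carrier P" and s: "s \<in> S"
  shows "free_lift K P \<phi> S (free_basis K S s) = \<phi> s"
proof -
  interpret P: module K P by fact
  have "free_lift K P \<phi> S (free_basis K S s) = finsum P (\<lambda>t. free_basis K S s t \<odot>\<^bsub>P\<^esub> \<phi> t) {s}"
    using s \<phi> free_basis_closed[OF P.R.is_cring]
    by (intro free_lift_superset[OF P]) (auto simp: free_basis_def)
  also have "\<dots> = \<phi> s"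
    using s \<phi> by (simp add: P.M.finsum_insert free_basis_def)
  finally show ?thesis .
qed

lemma free_module_expand:
  assumes K: "cring K" and f: "f \<in> carrier (free_module K S)"
  shows "f = finsum (free_module K S) (\<lambda>s. f s \<odot>\<^bsub>free_module K S\<^esub> free_basis K S s) {s \<in> S. f s \<noteq> \<zero>\<^bsub>K\<^esub>}"
    (is "_ = ?g")
proof -
  interpret K: cring K by fact
  interpret F: module K "free_module K S" by (rule module_free[OF K])
  interpret L: module K "self_module K" by (rule module_self[OF K])
  have fs: "f s \<in> carrier K" if "s \<in> S" for s
    using f that by (auto simp: free_module_carrier)
  have cl: "f s \<odot>\<^bsub>free_module K S\<^esub> free_basis K S s \<in> carrier (free_module K S)" if "s \<in> S" for s
    using that fs free_basis_closed[OF K, of S] by simp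
  have "?g \<in> carrier (free_module K S)"
    using cl by (intro F.M.finsum_closed) auto
  moreover have "f t = ?g t" if t: "t \<in> S" for t
  proof -
    let ?A = "{s \<in> S. f s \<noteq> \<zero>\<^bsub>K\<^esub>}"
    have fin: "finite ?A" using f by (auto simp: free_module_carrier)
    have "?g t = finsum (self_module K) (\<lambda>s. (f s \<odot>\<^bsub>free_module K S\<^esub> free_basis K S s) t) ?A"
      unfolding free_module_def using t cl
      by (intro module_hom_finsum[where K = K, OF direct_sum_eval] module_direct_sum module_self K)
        (auto simp: free_module_def)
    also have "\<dots> = finsum (self_module K) (\<lambda>s. if t = s then f s else \<zero>\<^bsub>K\<^esub>) ?A"
      using t fs by (intro L.M.finsum_cong') (auto simp: free_module_ops free_basis_def)
    also have "\<dots> = f t"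
    proof (cases "t \<in> ?A")
      case True
      then show ?thesis
        using L.M.finsum_singleton[of t ?A f, unfolded self_module_simps] fin fs by (auto simp: Pi_iff)
    next
      case False
      then have "finsum (self_module K) (\<lambda>s. if t = s then f s else \<zero>\<^bsub>K\<^esub>) ?A =
          finsum (self_module K) (\<lambda>s. \<zero>\<^bsub>self_module K\<^esub>) ?A"
        by (intro L.M.finsum_cong') auto
      then show ?thesis using False t by (simp add: L.M.finsum_zero[unfolded self_module_simps])
    qed
    finally show ?thesis by simp
  qed
  ultimately show ?thesis
    using f by (auto simp: free_module_carrier intro!: PiE_ext[of f S "\<lambda>_. carrier K"])
qed

lemma free_basis_span:
  assumes K: "cring K" and H: "submodule H K (free_module K S)"
    and b: "\<And>s. s \<in> S \<Longrightarrow> free_basis K S s \<in> H"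
  shows "carrier (free_module K S) \<subseteq> H"
proof
  fix f assume f: "f \<in> carrier (free_module K S)"
  have "finsum (free_module K S) (\<lambda>s. f s \<odot>\<^bsub>free_module K S\<^esub> free_basis K S s) {s \<in> S. f s \<noteq> \<zero>\<^bsub>K\<^esub>} \<in> H"
    using f b by (intro submodule_finsum[OF H module_free[OF K]] submodule_smult[OF H])
      (auto simp: free_module_carrier)
  then show "f \<in> H"
    using free_module_expand[OF K f] by simp
qed

text \<open>The first clause is not implied by the second: for the empty list there are no slots,
  and it is the only condition left.\<close>

definition multilinear ::
    "('k, 'z) ring_scheme \<Rightarrow> ('k, 'b) module list \<Rightarrow> ('k, 'c) module \<Rightarrow> ('b list \<Rightarrow> 'c) \<Rightarrow> bool" where
  "multilinear K Ms P \<phi> \<longleftrightarrow>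
     (\<forall>xs \<in> tensor_index Ms. \<phi> xs \<in> carrier P) \<and>
     (\<forall>xs \<in> tensor_index Ms. \<forall>i < length Ms. (\<lambda>x. \<phi> (xs[i := x])) \<in> module_hom K (Ms ! i) P)"

lemma tensor_index_update:
  "xs \<in> tensor_index Ms \<Longrightarrow> i < length Ms \<Longrightarrow> x \<in> carrier (Ms ! i) \<Longrightarrow> xs[i := x] \<in> tensor_index Ms"
  by (auto simp: tensor_index_def list_all2_conv_all_nth nth_list_update)

lemma tensor_index_replicate:
  "xs \<in> tensor_index (replicate r M) \<longleftrightarrow> length xs = r \<and> set xs \<subseteq> carrier M"
  by (auto simp: tensor_index_def list_all2_conv_all_nth set_conv_nth)

section \<open>The universal property of the tensor product\<close>

locale tensor_setup =
  fixes K :: "('k, 'z) ring_scheme" and Ms :: "('k, 'b) module list"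
  assumes K: "cring K" and Ms: "\<And>M. M \<in> set Ms \<Longrightarrow> module K M"
begin

abbreviation "S \<equiv> tensor_index Ms"
abbreviation "F \<equiv> free_module K S"
abbreviation "e \<equiv> free_basis K S"

lemma module_F: "module K F"
  by (rule module_free[OF K])

lemma module_nth: "i < length Ms \<Longrightarrow> module K (Ms ! i)"
  by (simp add: Ms)

lemma tensor_relations_eq:
  "tensor_relations K Ms = submodule_span K F
      ({(e (xs[i := x \<oplus>\<^bsub>Ms ! i\<^esub> y]) \<ominus>\<^bsub>F\<^esub> e (xs[i := x])) \<ominus>\<^bsub>F\<^esub> e (xs[i := y]) | xs i x y.
           xs \<in> S \<and> i < length Ms \<and> x \<in> carrier (Ms ! i) \<and> y \<in> carrier (Ms ! i)} \<union>
       {e (xs[i := a \<odot>\<^bsub>Ms ! i\<^esub> x]) \<ominus>\<^bsub>F\<^esub> (a \<odot>\<^bsub>F\<^esub> e (xs[i := x])) | xs i a x.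
           xs \<in> S \<and> i < length Ms \<and> a \<in> carrier K \<and> x \<in> carrier (Ms ! i)})"
  (is "_ = submodule_span K F (?A \<union> ?B)")
  by (simp add: tensor_relations_def Let_def)

lemma submodule_relations: "submodule (tensor_relations K Ms) K F"
proof -
  interpret F: module K F by (rule module_F)
  show ?thesis
    unfolding tensor_relations_eq
    by (rule submodule_spanI[OF module_F]) (auto intro!: F.M.minus_closed free_basis_closed[OF K] F.smult_closed)
qed

lemma module_tensor: "module K (tensor K Ms)"
  unfolding tensor_def by (rule module_quotient[OF module_F submodule_relations])

lemma pure_tensor_closed: "pure_tensor K Ms xs \<in> carrier (tensor K Ms)"
  by (simp add: tensor_def pure_tensor_def quotient_module_simps free_basis_closed[OF K])

lemma coset_tensor_hom:
  "(\<lambda>f. tensor_relations K Ms +>\<^bsub>F\<^esub> f) \<in> module_hom K F (tensor K Ms)"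
  unfolding tensor_def by (rule coset_hom[OF module_F submodule_relations])

lemma pure_tensor_multilinear: "multilinear K Ms (tensor K Ms) (pure_tensor K Ms)"
  unfolding multilinear_def
proof (intro conjI ballI allI impI module_homI)
  interpret F: module K F by (rule module_F)
  note c = free_basis_closed[OF K, of S]
  fix xs i x assume xs: "xs \<in> S" and i: "i < length Ms" and x: "x \<in> carrier (Ms ! i)"
  show "pure_tensor K Ms (xs[i := x \<oplus>\<^bsub>Ms ! i\<^esub> y]) =
      pure_tensor K Ms (xs[i := x]) \<oplus>\<^bsub>tensor K Ms\<^esub> pure_tensor K Ms (xs[i := y])"
    if y: "y \<in> carrier (Ms ! i)" for y
  proof -
    have "(e (xs[i := x \<oplus>\<^bsub>Ms ! i\<^esub> y]) \<ominus>\<^bsub>F\<^esub> e (xs[i := x])) \<ominus>\<^bsub>F\<^esub> e (xs[i := y]) \<in> tensor_relations K Ms"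
      unfolding tensor_relations_eq using xs i x y by (intro subsetD[OF span_superset]) blast
    moreover have "(e (xs[i := x \<oplus>\<^bsub>Ms ! i\<^esub> y]) \<ominus>\<^bsub>F\<^esub> e (xs[i := x])) \<ominus>\<^bsub>F\<^esub> e (xs[i := y]) =
        e (xs[i := x \<oplus>\<^bsub>Ms ! i\<^esub> y]) \<ominus>\<^bsub>F\<^esub> (e (xs[i := x]) \<oplus>\<^bsub>F\<^esub> e (xs[i := y]))"
      using c by (simp add: a_minus_def F.M.minus_add F.M.a_assoc)
    ultimately have "tensor_relations K Ms +>\<^bsub>F\<^esub> e (xs[i := x \<oplus>\<^bsub>Ms ! i\<^esub> y]) =
        tensor_relations K Ms +>\<^bsub>F\<^esub> (e (xs[i := x]) \<oplus>\<^bsub>F\<^esub> e (xs[i := y]))"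
      using c by (subst coset_eq_iff[OF module_F submodule_relations]) simp_all
    then show ?thesis
      using module_hom_add[OF coset_tensor_hom] c by (simp add: pure_tensor_def)
  qed
  show "pure_tensor K Ms (xs[i := a \<odot>\<^bsub>Ms ! i\<^esub> x]) = a \<odot>\<^bsub>tensor K Ms\<^esub> pure_tensor K Ms (xs[i := x])"
    if a: "a \<in> carrier K" for a
  proof -
    have "e (xs[i := a \<odot>\<^bsub>Ms ! i\<^esub> x]) \<ominus>\<^bsub>F\<^esub> (a \<odot>\<^bsub>F\<^esub> e (xs[i := x])) \<in> tensor_relations K Ms"
      unfolding tensor_relations_eq using xs i x a by (intro subsetD[OF span_superset]) blast
    then have "tensor_relations K Ms +>\<^bsub>F\<^esub> e (xs[i := a \<odot>\<^bsub>Ms ! i\<^esub> x]) =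
        tensor_relations K Ms +>\<^bsub>F\<^esub> (a \<odot>\<^bsub>F\<^esub> e (xs[i := x]))"
      using a c by (subst coset_eq_iff[OF module_F submodule_relations]) simp_all
    then show ?thesis
      using module_hom_smult[OF coset_tensor_hom] a c by (simp add: pure_tensor_def)
  qed
qed (simp_all add: pure_tensor_closed)

text \<open>Pure tensors are the classes of the free basis, and the preimage of \<open>H\<close> in
  the free module is a submodule that contains this basis.\<close>

lemma tensor_span:
  assumes H: "submodule H K (tensor K Ms)" and pure: "\<And>xs. xs \<in> S \<Longrightarrow> pure_tensor K Ms xs \<in> H"
  shows "carrier (tensor K Ms) \<subseteq> H"
proof -
  let ?H = "{f \<in> carrier F. tensor_relations K Ms +>\<^bsub>F\<^esub> f \<in> H}"
  have "carrier F \<subseteq> ?H"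
    using pure free_basis_closed[OF K]
    by (intro free_basis_span[OF K submodule_vimage[OF coset_tensor_hom module_F module_tensor H]])
      (auto simp: pure_tensor_def)
  then show ?thesis
    by (auto simp: tensor_def quotient_module_simps)
qed

lemma tensor_hom_eqI:
  assumes h: "h \<in> module_hom K (tensor K Ms) P" and g: "g \<in> module_hom K (tensor K Ms) P"
    and P: "module K P" and eq: "\<And>xs. xs \<in> S \<Longrightarrow> h (pure_tensor K Ms xs) = g (pure_tensor K Ms xs)"
    and t: "t \<in> carrier (tensor K Ms)"
  shows "h t = g t"
  using tensor_span[OF submodule_equalizer[OF h g module_tensor P]] pure_tensor_closed eq t by auto

text \<open>The generating relations measure the failure of additivity and homogeneity in one slot,
  so the lift of a multilinear map kills each of them. Its kernel is a submodule and therefore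
  contains their span.\<close>

lemma free_lift_relations:
  assumes P: "module K P" and \<phi>: "multilinear K Ms P \<phi>" and f: "f \<in> tensor_relations K Ms"
  shows "free_lift K P \<phi> S f = \<zero>\<^bsub>P\<^esub>"
proof -
  interpret F: module K F by (rule module_F)
  interpret P: module K P by (rule P)
  note c = free_basis_closed[OF K, of S]
  have \<phi>c: "\<phi> xs \<in> carrier P" if "xs \<in> S" for xs
    using \<phi> that by (auto simp: multilinear_def)
  have \<phi>h: "(\<lambda>x. \<phi> (xs[i := x])) \<in> module_hom K (Ms ! i) P" if "xs \<in> S" "i < length Ms" for xs i
    using \<phi> that by (auto simp: multilinear_def)
  note L = free_lift_hom[of K P S \<phi>, OF P \<phi>c]
  have sub: "submodule {f \<in> carrier F. free_lift K P \<phi> S f = \<zero>\<^bsub>P\<^esub>} K F"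
    by (rule submodule_equalizer[OF L module_hom_const_zero[OF P] module_F P])
  have Lm: "free_lift K P \<phi> S (f \<ominus>\<^bsub>F\<^esub> g) = free_lift K P \<phi> S f \<ominus>\<^bsub>P\<^esub> free_lift K P \<phi> S g"
    if "f \<in> carrier F" "g \<in> carrier F" for f g
    using that by (intro module_hom_a_minus[OF L module_F P]) auto
  have Lb: "free_lift K P \<phi> S (e xs) = \<phi> xs" if "xs \<in> S" for xs
    using free_lift_basis[OF P \<phi>c that] .
  have 1: "free_lift K P \<phi> S ((e (xs[i := x \<oplus>\<^bsub>Ms ! i\<^esub> y]) \<ominus>\<^bsub>F\<^esub> e (xs[i := x])) \<ominus>\<^bsub>F\<^esub> e (xs[i := y])) = \<zero>\<^bsub>P\<^esub>"
    if "xs \<in> S" "i < length Ms" "x \<in> carrier (Ms ! i)" "y \<in> carrier (Ms ! i)" for xs i x y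
  proof -
    interpret N: module K "Ms ! i" using that by (simp add: module_nth)
    have [simp]: "\<phi> (xs[i := x]) \<in> carrier P" "\<phi> (xs[i := y]) \<in> carrier P"
      using that by (auto intro: \<phi>c tensor_index_update)
    show ?thesis
      using that c by (simp add: Lm F.M.minus_closed Lb tensor_index_update module_hom_add[OF \<phi>h])
        (simp add: a_minus_def P.M.a_assoc P.M.r_neg
          P.M.a_lcomm[of "\<phi> (xs[i := y])" "\<ominus>\<^bsub>P\<^esub> \<phi> (xs[i := x])"])
  qed
  have 2: "free_lift K P \<phi> S (e (xs[i := a \<odot>\<^bsub>Ms ! i\<^esub> x]) \<ominus>\<^bsub>F\<^esub> (a \<odot>\<^bsub>F\<^esub> e (xs[i := x]))) = \<zero>\<^bsub>P\<^esub>"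
    if "xs \<in> S" "i < length Ms" "x \<in> carrier (Ms ! i)" "a \<in> carrier K" for xs i x a
  proof -
    interpret N: module K "Ms ! i" using that by (simp add: module_nth)
    have [simp]: "\<phi> (xs[i := x]) \<in> carrier P"
      using that by (auto intro: \<phi>c tensor_index_update)
    show ?thesis
      using that c by (simp add: Lm F.M.minus_closed Lb tensor_index_update module_hom_smult[OF \<phi>h]
          module_hom_smult[OF L]) (simp add: a_minus_def P.M.r_neg)
  qed
  have "tensor_relations K Ms \<subseteq> {f \<in> carrier F. free_lift K P \<phi> S f = \<zero>\<^bsub>P\<^esub>}"
    unfolding tensor_relations_eq
    by (rule span_least[OF sub]) (use 1 2 c in \<open>auto intro!: F.M.minus_closed\<close>)
  then show ?thesis using f by auto
qed

text \<open>Two representatives of a tensor differ by a relation, so the one that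
  \<open>tensor_lift\<close> selects by \<open>SOME\<close> may be replaced by any
  \<open>f\<close>.\<close>

lemma tensor_lift_coset:
  assumes P: "module K P" and \<phi>: "multilinear K Ms P \<phi>" and f: "f \<in> carrier F"
  shows "tensor_lift K Ms P \<phi> (tensor_relations K Ms +>\<^bsub>F\<^esub> f) = free_lift K P \<phi> S f"
proof -
  interpret F: module K F by (rule module_F)
  interpret P: module K P by (rule P)
  have \<phi>c: "\<phi> xs \<in> carrier P" if "xs \<in> S" for xs
    using \<phi> that by (auto simp: multilinear_def)
  note L = free_lift_hom[of K P S \<phi>, OF P \<phi>c]
  let ?t = "tensor_relations K Ms +>\<^bsub>F\<^esub> f"
  have "(SOME g. g \<in> ?t) \<in> ?t"
    using coset_self[OF module_F submodule_relations f] by (metis someI_ex)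
  then obtain i where "i \<in> tensor_relations K Ms" "(SOME g. g \<in> ?t) = i \<oplus>\<^bsub>F\<^esub> f"
    by (auto simp: a_r_coset_def')
  then have "free_lift K P \<phi> S (SOME g. g \<in> ?t) = free_lift K P \<phi> S f"
    using submodule_subset[OF submodule_relations] f module_hom_closed[OF L f]
    by (auto simp: module_hom_add[OF L] free_lift_relations[OF P \<phi>] subset_iff)
  then show ?thesis
    by (simp add: tensor_lift_def free_lift_def Let_def)
qed

lemma tensor_lift_hom:
  assumes P: "module K P" and \<phi>: "multilinear K Ms P \<phi>"
  shows "tensor_lift K Ms P \<phi> \<in> module_hom K (tensor K Ms) P"
proof (rule module_homI)
  interpret F: module K F by (rule module_F)
  have \<phi>c: "\<phi> xs \<in> carrier P" if "xs \<in> S" for xs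
    using \<phi> that by (auto simp: multilinear_def)
  note L = free_lift_hom[of K P S \<phi>, OF P \<phi>c]
  note q = coset_tensor_hom
  have ex: "\<exists>f \<in> carrier F. t = tensor_relations K Ms +>\<^bsub>F\<^esub> f" if "t \<in> carrier (tensor K Ms)" for t
    using that by (auto simp: tensor_def quotient_module_simps)
  fix s assume "s \<in> carrier (tensor K Ms)"
  then obtain f where f: "f \<in> carrier F" "s = tensor_relations K Ms +>\<^bsub>F\<^esub> f"
    using ex by blast
  show "tensor_lift K Ms P \<phi> s \<in> carrier P"
    using f by (simp add: tensor_lift_coset[OF P \<phi>] module_hom_closed[OF L])
  show "tensor_lift K Ms P \<phi> (a \<odot>\<^bsub>tensor K Ms\<^esub> s) = a \<odot>\<^bsub>P\<^esub> tensor_lift K Ms P \<phi> s" if "a \<in> carrier K" for a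
    using f that by (simp flip: module_hom_smult[OF q] add: tensor_lift_coset[OF P \<phi>] module_hom_smult[OF L])
  fix t assume "t \<in> carrier (tensor K Ms)"
  then obtain g where g: "g \<in> carrier F" "t = tensor_relations K Ms +>\<^bsub>F\<^esub> g"
    using ex by blast
  show "tensor_lift K Ms P \<phi> (s \<oplus>\<^bsub>tensor K Ms\<^esub> t) = tensor_lift K Ms P \<phi> s \<oplus>\<^bsub>P\<^esub> tensor_lift K Ms P \<phi> t"
    using f g by (simp flip: module_hom_add[OF q] add: tensor_lift_coset[OF P \<phi>] module_hom_add[OF L])
qed

lemma tensor_lift_pure:
  assumes P: "module K P" and \<phi>: "multilinear K Ms P \<phi>" and xs: "xs \<in> S"
  shows "tensor_lift K Ms P \<phi> (pure_tensor K Ms xs) = \<phi> xs"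
proof -
  have \<phi>c: "\<phi> xs \<in> carrier P" if "xs \<in> S" for xs
    using \<phi> that by (auto simp: multilinear_def)
  show ?thesis
    unfolding pure_tensor_def
    using tensor_lift_coset[OF P \<phi> free_basis_closed[OF K]] free_lift_basis[OF P \<phi>c xs] by simp
qed

end

text \<open>Linearity in the parameter is an identity between maps that are linear in
  \<open>t\<close>, so it is enough to have it for pure tensors, where it is the assumption
  \<open>lin\<close>. It is needed for iterated lifts, whose inner lift depends on the outer
  list.\<close>

lemma (in tensor_setup) tensor_lift_param:
  assumes P: "module K P" and Q: "module K Q"
    and \<Phi>: "\<And>x. x \<in> carrier Q \<Longrightarrow> multilinear K Ms P (\<Phi> x)"
    and lin: "\<And>ys. ys \<in> S \<Longrightarrow> (\<lambda>x. \<Phi> x ys) \<in> module_hom K Q P"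
    and t: "t \<in> carrier (tensor K Ms)"
  shows "(\<lambda>x. tensor_lift K Ms P (\<Phi> x) t) \<in> module_hom K Q P"
proof (rule module_homI)
  interpret Q: module K Q by (rule Q)
  note L = tensor_lift_hom[OF P \<Phi>]
  fix x assume x: "x \<in> carrier Q"
  show "tensor_lift K Ms P (\<Phi> x) t \<in> carrier P"
    by (rule module_hom_closed[OF L[OF x] t])
  show "tensor_lift K Ms P (\<Phi> (x \<oplus>\<^bsub>Q\<^esub> y)) t = tensor_lift K Ms P (\<Phi> x) t \<oplus>\<^bsub>P\<^esub> tensor_lift K Ms P (\<Phi> y) t"
    if y: "y \<in> carrier Q" for y
    using x y
    by (intro tensor_hom_eqI[OF L module_hom_add_fun[OF L L P] P _ t])
      (simp_all add: tensor_lift_pure[OF P \<Phi>] module_hom_add[OF lin])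
  show "tensor_lift K Ms P (\<Phi> (a \<odot>\<^bsub>Q\<^esub> x)) t = a \<odot>\<^bsub>P\<^esub> tensor_lift K Ms P (\<Phi> x) t"
    if a: "a \<in> carrier K" for a
    using x a
    by (intro tensor_hom_eqI[OF L module_hom_smult_fun[OF L P a] P _ t])
      (simp_all add: tensor_lift_pure[OF P \<Phi>] module_hom_smult[OF lin])
qed

definition incl :: "(nat \<Rightarrow> ('k, 'b) module) \<Rightarrow> nat \<Rightarrow> 'b \<Rightarrow> nat \<Rightarrow> 'b" where
  "incl N d x = (\<lambda>i. if i = d then x else \<zero>\<^bsub>N i\<^esub>)"

section \<open>Homogeneous elements of a direct sum\<close>

context
  fixes K :: "('k, 'z) ring_scheme" and N :: "nat \<Rightarrow> ('k, 'b) module"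
  assumes K: "cring K" and N: "\<And>i. module K (N i)"
begin

lemma homogeneous_subset: "homogeneous N n \<subseteq> carrier (direct_sum UNIV N)"
  by (auto simp: homogeneous_def)

lemma incl_homogeneous: "x \<in> carrier (N d) \<Longrightarrow> incl N d x \<in> homogeneous N d"
proof -
  assume x: "x \<in> carrier (N d)"
  have "abelian_group (N i)" for i using N by (rule moduleD_abelian_group)
  then have z: "\<zero>\<^bsub>N i\<^esub> \<in> carrier (N i)" for i
    by (simp add: abelian_group_def abelian_monoid.zero_closed)
  have "{i. incl N d x i \<noteq> \<zero>\<^bsub>N i\<^esub>} \<subseteq> {d}"
    by (auto simp: incl_def)
  then have "finite {i. incl N d x i \<noteq> \<zero>\<^bsub>N i\<^esub>}"
    using finite_subset by blast
  then show ?thesis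
    using x z by (auto simp: homogeneous_def direct_sum_simps incl_def)
qed

lemma incl_hom: "incl N d \<in> module_hom K (N d) (direct_sum UNIV N)"
proof (rule module_homI)
  show "incl N d x \<in> carrier (direct_sum UNIV N)" if "x \<in> carrier (N d)" for x
    using incl_homogeneous[OF that] homogeneous_subset by auto
  have z: "\<zero>\<^bsub>N i\<^esub> \<oplus>\<^bsub>N i\<^esub> \<zero>\<^bsub>N i\<^esub> = \<zero>\<^bsub>N i\<^esub>" for i
  proof -
    interpret module K "N i" by (rule N)
    show ?thesis by simp
  qed
  show "incl N d (x \<oplus>\<^bsub>N d\<^esub> y) = incl N d x \<oplus>\<^bsub>direct_sum UNIV N\<^esub> incl N d y" for x y
    by (auto simp: incl_def direct_sum_simps z)
  show "incl N d (a \<odot>\<^bsub>N d\<^esub> x) = a \<odot>\<^bsub>direct_sum UNIV N\<^esub> incl N d x" if "a \<in> carrier K" for a x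
    using that by (auto simp: incl_def direct_sum_simps module.smult_r_null[OF N])
qed

lemma incl_homogeneous_self: "z \<in> homogeneous N d \<Longrightarrow> incl N d (z d) = z"
  by (auto simp: homogeneous_def incl_def)

lemma direct_sum_expand:
  assumes x: "x \<in> carrier (direct_sum UNIV N)"
  shows "x = finsum (direct_sum UNIV N) (\<lambda>i. incl N i (x i)) {i. x i \<noteq> \<zero>\<^bsub>N i\<^esub>}"
proof
  fix j
  interpret D: module K "direct_sum UNIV N" by (rule module_direct_sum[OF K N])
  interpret Nj: module K "N j" by (rule N)
  let ?A = "{i. x i \<noteq> \<zero>\<^bsub>N i\<^esub>}"
  have fin: "finite ?A" and xi: "x i \<in> carrier (N i)" for i
    using x by (auto simp: direct_sum_simps)
  have "finsum (direct_sum UNIV N) (\<lambda>i. incl N i (x i)) ?A j = finsum (N j) (\<lambda>i. incl N i (x i) j) ?A"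
    using xi
    by (intro module_hom_finsum[where h = "\<lambda>x. x j" and N = "N j" and K = K]
        direct_sum_eval module_direct_sum[OF K] N) (auto intro: module_hom_closed[OF incl_hom])
  also have "\<dots> = finsum (N j) (\<lambda>i. if j = i then x j else \<zero>\<^bsub>N j\<^esub>) ?A"
    using xi by (intro Nj.M.finsum_cong') (auto simp: incl_def)
  also have "\<dots> = x j"
  proof (cases "j \<in> ?A")
    case True
    then show ?thesis
      using Nj.M.finsum_singleton[of j ?A "\<lambda>_. x j"] fin xi by simp
  next
    case False
    then have "finsum (N j) (\<lambda>i. if j = i then x j else \<zero>\<^bsub>N j\<^esub>) ?A = finsum (N j) (\<lambda>i. \<zero>\<^bsub>N j\<^esub>) ?A"
      by (intro Nj.M.finsum_cong') auto
    then show ?thesis using False by (simp add: Nj.M.finsum_zero)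
  qed
  finally show "x j = finsum (direct_sum UNIV N) (\<lambda>i. incl N i (x i)) ?A j" by simp
qed

lemma direct_sum_span:
  assumes H: "submodule H K (direct_sum UNIV N)" and hom: "\<And>d. homogeneous N d \<subseteq> H"
  shows "carrier (direct_sum UNIV N) \<subseteq> H"
proof
  fix x assume x: "x \<in> carrier (direct_sum UNIV N)"
  have "finsum (direct_sum UNIV N) (\<lambda>i. incl N i (x i)) {i. x i \<noteq> \<zero>\<^bsub>N i\<^esub>} \<in> H"
  proof (rule submodule_finsum[OF H module_direct_sum[OF K N]])
    fix i
    have "incl N i (x i) \<in> homogeneous N i"
      using x by (intro incl_homogeneous) (auto simp: direct_sum_simps)
    then show "incl N i (x i) \<in> H" using hom by blast
  qed
  then show "x \<in> H" using direct_sum_expand[OF x] by simp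
qed

end

section \<open>Block families and species\<close>

text \<open>A partition of the finite set \<open>\<Union>A\<close>, given by its blocks alone. The
  underlying set need not be carried along, and parts and disjoint unions of partitions become
  subsets and unions of sets of blocks.\<close>

definition block_family :: "nat set set \<Rightarrow> bool" where
  "block_family A \<longleftrightarrow> finite (\<Union>A) \<and> disjoint A \<and> {} \<notin> A"

abbreviation im :: "(nat \<Rightarrow> nat) \<Rightarrow> nat set set \<Rightarrow> nat set set" where
  "im f A \<equiv> (\<lambda>B. f ` B) ` A"

text \<open>For block families this is stronger than having no common block: no point is shared, so
  the union is again a block family.\<close>

abbreviation sep :: "nat set set \<Rightarrow> nat set set \<Rightarrow> bool" where
  "sep A B \<equiv> \<Union>A \<inter> \<Union>B = {}"

lemma block_family_empty [simp]: "block_family {}"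
  by (simp add: block_family_def)

lemma block_family_finite: "block_family A \<Longrightarrow> finite A"
  by (auto simp: block_family_def intro: finite_UnionD)

lemma block_family_single [simp]: "block_family {B} \<longleftrightarrow> finite B \<and> B \<noteq> {}"
  by (auto simp: block_family_def)

lemma block_family_subset: "block_family A \<Longrightarrow> S \<subseteq> A \<Longrightarrow> block_family S"
  using finite_subset[of "\<Union>S" "\<Union>A"] by (auto simp: block_family_def disjoint_def)

lemma block_family_Un:
  assumes "block_family A" "block_family B" "sep A B"
  shows "block_family (A \<union> B)"
  using assms disjoint_union[of A B] by (auto simp: block_family_def)

lemma block_family_im:
  assumes "block_family A" "inj_on f (\<Union>A)"
  shows "block_family (im f A)"
proof -
  have "f ` B \<inter> f ` C = {}" if "B \<in> A" "C \<in> A" "f ` B \<noteq> f ` C" for B C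
  proof -
    have "B \<inter> C = {}" using assms that by (auto simp: block_family_def disjoint_def)
    then show ?thesis
      using inj_on_image_Int[OF assms(2), of B C] that by auto
  qed
  moreover have "\<Union>(im f A) = f ` \<Union>A" by auto
  ultimately show ?thesis
    using assms(1) unfolding block_family_def disjoint_def by auto
qed

lemma block_family_sep:
  assumes "block_family A" "S \<subseteq> A" "T \<subseteq> A" "S \<inter> T = {}"
  shows "sep S T"
proof -
  have "B \<inter> C = {}" if "B \<in> S" "C \<in> T" for B C
  proof -
    have "B \<in> A" "C \<in> A" "B \<noteq> C" using assms that by auto
    then show ?thesis using assms(1) by (simp add: block_family_def disjoint_def)
  qed
  then show ?thesis by (auto simp: disjoint_iff)
qed

lemma sep_disjoint:
  assumes "block_family A" "sep A B"
  shows "A \<inter> B = {}"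
proof -
  have "C = {}" if "C \<in> A" "C \<in> B" for C
    using assms(2) that by auto
  then show ?thesis using assms(1) by (auto simp: block_family_def)
qed

lemma Union_im: "\<Union>(im f A) = f ` \<Union>A"
  by auto

lemma sep_im: "inj_on f (\<Union>(A \<union> B)) \<Longrightarrow> sep A B \<Longrightarrow> sep (im f A) (im f B)"
  unfolding Union_im by (subst inj_on_image_Int[symmetric]) auto

definition block_list :: "nat set list \<Rightarrow> bool" where
  "block_list Bs \<longleftrightarrow> distinct Bs \<and> block_family (set Bs)"

lemma block_list_Nil [simp]: "block_list []"
  by (simp add: block_list_def)

lemma block_list_Cons:
  "block_list (B # Bs) \<longleftrightarrow> finite B \<and> B \<noteq> {} \<and> sep {B} (set Bs) \<and> block_list Bs"
proof
  assume h: "block_list (B # Bs)"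
  then have "block_family (set (B # Bs))" by (simp add: block_list_def)
  moreover have "sep {B} (set Bs)"
    using h by (intro block_family_sep[of "set (B # Bs)"]) (auto simp: block_list_def)
  ultimately show "finite B \<and> B \<noteq> {} \<and> sep {B} (set Bs) \<and> block_list Bs"
    using h block_family_subset[of "set (B # Bs)" "set Bs"]
    by (auto simp: block_list_def block_family_def)
next
  assume h: "finite B \<and> B \<noteq> {} \<and> sep {B} (set Bs) \<and> block_list Bs"
  then have "block_family ({B} \<union> set Bs)"
    by (intro block_family_Un) (auto simp: block_list_def)
  moreover have "{B} \<inter> set Bs = {}"
    using h by (intro sep_disjoint) auto
  ultimately show "block_list (B # Bs)"
    using h by (auto simp: block_list_def)
qed

lemma block_list_append:
  "block_list (Bs @ Cs) \<longleftrightarrow> block_list Bs \<and> block_list Cs \<and> sep (set Bs) (set Cs)"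
proof (induction Bs)
  case (Cons B Bs)
  then show ?case by (auto simp: block_list_Cons)
qed simp

lemma block_list_mset: "mset Bs = mset Cs \<Longrightarrow> block_list Bs \<Longrightarrow> block_list Cs"
  unfolding block_list_def by (metis mset_eq_imp_distinct_iff set_mset_mset)

lemma block_list_map:
  assumes "block_list Bs" "inj_on f (\<Union>(set Bs))"
  shows "block_list (map (image f) Bs)"
proof -
  have "inj_on (image f) (set Bs)"
    using assms(2) by (intro inj_onI) (metis Sup_upper inj_on_image_eq_iff)
  then show ?thesis
    using assms block_family_im[of "set Bs" f] by (simp add: block_list_def distinct_map)
qed

text \<open>The expressions \<open>{1..n}\<close> and \<open>card B - 1\<close> occur throughout;
  this keeps the simplifier from turning their \<open>1\<close> into \<open>Suc 0\<close>.\<close>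

declare One_nat_def [simp del]

text \<open>A commutative monoid in species on finite sets of disjoint blocks. Disjoint families are joined
  by their union and not by a formal disjoint union, which makes the product strictly commutative
  and associative.\<close>

locale block_species =
  fixes K :: "('k, 'z) ring_scheme" and V :: "nat set set \<Rightarrow> ('k, 'v) module"
    and act :: "(nat \<Rightarrow> nat) \<Rightarrow> nat set set \<Rightarrow> 'v \<Rightarrow> 'v"
    and star :: "nat set set \<Rightarrow> nat set set \<Rightarrow> 'v \<Rightarrow> 'v \<Rightarrow> 'v"
    and e :: 'v
  assumes K: "cring K"
    and V: "block_family A \<Longrightarrow> module K (V A)"
    and act_hom: "\<lbrakk>block_family A; inj_on f (\<Union>A)\<rbrakk> \<Longrightarrow> act f A \<in> module_hom K (V A) (V (im f A))"
    and act_cong: "\<lbrakk>block_family A; inj_on f (\<Union>A); inj_on g (\<Union>A); \<forall>B \<in> A. f ` B = g ` B;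
        x \<in> carrier (V A)\<rbrakk> \<Longrightarrow> act f A x = act g A x"
    and act_id: "\<lbrakk>block_family A; x \<in> carrier (V A)\<rbrakk> \<Longrightarrow> act id A x = x"
    and act_comp: "\<lbrakk>block_family A; inj_on f (\<Union>A); inj_on g (f ` \<Union>A); x \<in> carrier (V A)\<rbrakk>
      \<Longrightarrow> act g (im f A) (act f A x) = act (g \<circ> f) A x"
    and star_hom1: "\<lbrakk>block_family A; block_family B; sep A B; y \<in> carrier (V B)\<rbrakk>
      \<Longrightarrow> (\<lambda>x. star A B x y) \<in> module_hom K (V A) (V (A \<union> B))"
    and star_hom2: "\<lbrakk>block_family A; block_family B; sep A B; x \<in> carrier (V A)\<rbrakk>
      \<Longrightarrow> (\<lambda>y. star A B x y) \<in> module_hom K (V B) (V (A \<union> B))"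
    and star_comm: "\<lbrakk>block_family A; block_family B; sep A B; x \<in> carrier (V A); y \<in> carrier (V B)\<rbrakk>
      \<Longrightarrow> star A B x y = star B A y x"
    and star_assoc: "\<lbrakk>block_family A; block_family B; block_family C; sep A B; sep A C; sep B C;
        x \<in> carrier (V A); y \<in> carrier (V B); z \<in> carrier (V C)\<rbrakk>
      \<Longrightarrow> star (A \<union> B) C (star A B x y) z = star A (B \<union> C) x (star B C y z)"
    and star_act: "\<lbrakk>block_family A; block_family B; sep A B; inj_on f (\<Union>(A \<union> B));
        x \<in> carrier (V A); y \<in> carrier (V B)\<rbrakk>
      \<Longrightarrow> act f (A \<union> B) (star A B x y) = star (im f A) (im f B) (act f A x) (act f B y)"
    and e_closed: "e \<in> carrier (V {})"
    and star_e: "\<lbrakk>block_family A; x \<in> carrier (V A)\<rbrakk> \<Longrightarrow> star {} A e x = x"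
    and e_span: "x \<in> carrier (V {}) \<Longrightarrow> \<exists>a \<in> carrier K. x = a \<odot>\<^bsub>V {}\<^esub> e"
    and e_coord: "\<exists>\<epsilon> \<in> module_hom K (V {}) (self_module K). \<epsilon> e = \<one>\<^bsub>K\<^esub>"
    and star_span: "\<lbrakk>block_family A; block_family B; sep A B; submodule H K (V (A \<union> B));
        \<And>x y. \<lbrakk>x \<in> carrier (V A); y \<in> carrier (V B)\<rbrakk> \<Longrightarrow> star A B x y \<in> H\<rbrakk>
      \<Longrightarrow> carrier (V (A \<union> B)) \<subseteq> H"
    and star_univ: "\<And>(P :: ('k, ((nat \<Rightarrow> 'v) list \<Rightarrow> 'k) set) module) b.
      \<lbrakk>block_family A; block_family B; sep A B; module K P;
        \<And>y. y \<in> carrier (V B) \<Longrightarrow> (\<lambda>x. b x y) \<in> module_hom K (V A) P;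
        \<And>x. x \<in> carrier (V A) \<Longrightarrow> (\<lambda>y. b x y) \<in> module_hom K (V B) P\<rbrakk>
      \<Longrightarrow> \<exists>h \<in> module_hom K (V (A \<union> B)) P. \<forall>x \<in> carrier (V A). \<forall>y \<in> carrier (V B). h (star A B x y) = b x y"
begin

lemma act_closed:
  "\<lbrakk>block_family A; inj_on f (\<Union>A); x \<in> carrier (V A)\<rbrakk> \<Longrightarrow> act f A x \<in> carrier (V (im f A))"
  by (rule module_hom_closed[OF act_hom])

lemma star_closed:
  "\<lbrakk>block_family A; block_family B; sep A B; x \<in> carrier (V A); y \<in> carrier (V B)\<rbrakk>
    \<Longrightarrow> star A B x y \<in> carrier (V (A \<union> B))"
  by (rule module_hom_closed[OF star_hom1])

lemma act_ident:
  assumes A: "block_family A" and f: "inj_on f (\<Union>A)" and "\<forall>B \<in> A. f ` B = B" and x: "x \<in> carrier (V A)"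
  shows "act f A x = x"
  using act_cong[OF A f _ _ x, of id] act_id[OF A x] assms by simp

lemma act_inverse:
  assumes A: "block_family A" and f: "inj_on f (\<Union>A)" and gf: "\<And>i. i \<in> \<Union>A \<Longrightarrow> g (f i) = i"
    and x: "x \<in> carrier (V A)"
  shows "act g (im f A) (act f A x) = x"
proof -
  have "inj_on g (f ` \<Union>A)"
    by (rule inj_onI) (metis (no_types, lifting) gf imageE)
  then have "act g (im f A) (act f A x) = act (g \<circ> f) A x"
    by (rule act_comp[OF A f _ x])
  also have "\<dots> = x"
  proof (rule act_ident[OF A _ _ x])
    show "inj_on (g \<circ> f) (\<Union>A)"
      by (rule inj_onI) (metis (no_types, lifting) gf comp_apply)
    show "\<forall>B\<in>A. (g \<circ> f) ` B = B"
      using gf by (auto simp: image_comp[symmetric] image_iff) (metis UnionI)+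
  qed
  finally show ?thesis .
qed

text \<open>A vector of degree \<open>d\<close> lives on one block with \<open>d + 1\<close> points;
  this is the origin of the shift in the grading of \<open>TS\<close>.\<close>

definition M :: "nat \<Rightarrow> ('k, 'v) module" where
  "M d = V {{1..d + 1}}"

abbreviation D :: "('k, nat \<Rightarrow> 'v) module" where
  "D \<equiv> direct_sum UNIV M"

abbreviation T :: "nat \<Rightarrow> ('k, ((nat \<Rightarrow> 'v) list \<Rightarrow> 'k) set) module" where
  "T r \<equiv> tensor_power K D r"

abbreviation pure :: "nat \<Rightarrow> (nat \<Rightarrow> 'v) list \<Rightarrow> ((nat \<Rightarrow> 'v) list \<Rightarrow> 'k) set" where
  "pure r \<equiv> pure_tensor K (replicate r D)"

lemma module_M: "module K (M d)"
  unfolding M_def by (rule V) simp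

lemma module_D: "module K D"
  by (rule module_direct_sum[OF K module_M])

lemma tensor_setup_D: "tensor_setup K (replicate r D)"
  by (rule tensor_setup.intro) (use K module_D in auto)

lemma module_T: "module K (T r)"
  unfolding tensor_power_def by (rule tensor_setup.module_tensor[OF tensor_setup_D])

lemmas homogeneous_subset_D = homogeneous_subset[of K M, OF K module_M]

text \<open>The numbering of \<open>B\<close> is chosen, but it does not matter:
  \<open>act_cong\<close> sees only the images of blocks, and here there is a single block with
  image \<open>B\<close>.\<close>

definition canon :: "nat set \<Rightarrow> 'v \<Rightarrow> 'v" where
  "canon B = act (SOME g. bij_betw g {1..card B} B) {{1..card B}}"

lemma canon_eq:
  assumes B: "finite B" "B \<noteq> {}" and g: "bij_betw g {1..card B} B" and x: "x \<in> carrier (M (card B - 1))"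
  shows "canon B x = act g {{1..card B}} x"
proof -
  let ?h = "SOME g. bij_betw g {1..card B} B"
  have h: "bij_betw ?h {1..card B} B" using someI[where P = "\<lambda>g. bij_betw g {1..card B} B"] g .
  have c: "card B > 0" using B by (simp add: card_gt_0_iff)
  then show ?thesis
    unfolding canon_def using x h g
    by (intro act_cong) (auto simp: M_def bij_betw_def)
qed

lemma canon_ex:
  assumes "finite B"
  obtains g where "bij_betw g {1..card B} B"
  using finite_same_card_bij[of "{1..card B}" B] assms by auto

lemma M_card: "finite B \<Longrightarrow> B \<noteq> {} \<Longrightarrow> M (card B - 1) = V {{1..card B}}"
  using card_gt_0_iff[of B] by (simp add: M_def)

lemma canon_hom:
  assumes B: "finite B" "B \<noteq> {}"
  shows "canon B \<in> module_hom K (M (card B - 1)) (V {B})"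
proof -
  obtain g where g: "bij_betw g {1..card B} B" using canon_ex[OF B(1)] .
  have c: "card B > 0" using B by (simp add: card_gt_0_iff)
  have "act g {{1..card B}} \<in> module_hom K (V {{1..card B}}) (V {B})"
    using act_hom[of "{{1..card B}}" g] g c by (simp add: bij_betw_def)
  then show ?thesis
    unfolding M_card[OF B, symmetric]
    by (rule module_hom_cong[OF _ module_M]) (simp add: canon_eq[OF B g])
qed

lemma canon_act:
  assumes B: "finite B" "B \<noteq> {}" and f: "inj_on f B" and x: "x \<in> carrier (M (card B - 1))"
  shows "act f {B} (canon B x) = canon (f ` B) x"
proof -
  obtain g where g: "bij_betw g {1..card B} B" using canon_ex[OF B(1)] .
  have c: "card B > 0" using B by (simp add: card_gt_0_iff)
  have cf: "card (f ` B) = card B" by (rule card_image[OF f])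
  have "act f {B} (canon B x) = act f (im g {{1..card B}}) (act g {{1..card B}} x)"
    using g x by (simp add: canon_eq[OF B g] bij_betw_def)
  also have "\<dots> = act (f \<circ> g) {{1..card B}} x"
    using g c f x by (intro act_comp) (auto simp: bij_betw_def M_card[OF B])
  also have "\<dots> = canon (f ` B) x"
    using canon_eq[of "f ` B" "f \<circ> g" x] B x f g bij_betw_trans[OF g, of f "f ` B"]
    by (simp add: cf bij_betw_def)
  finally show ?thesis .
qed

lemma canon_inverse:
  assumes B: "finite B" "B \<noteq> {}"
  obtains c where "c \<in> module_hom K (V {B}) (M (card B - 1))"
    "\<And>x. x \<in> carrier (M (card B - 1)) \<Longrightarrow> c (canon B x) = x"
    "\<And>y. y \<in> carrier (V {B}) \<Longrightarrow> canon B (c y) = y"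
proof -
  obtain g where g: "bij_betw g {1..card B} B" using canon_ex[OF B(1)] .
  have c0: "card B > 0" using B by (simp add: card_gt_0_iff)
  define g' where "g' = inv_into {1..card B} g"
  have g': "bij_betw g' B {1..card B}" unfolding g'_def by (rule bij_betw_inv_into[OF g])
  have gg: "g' (g i) = i" if "i \<in> {1..card B}" for i
    using g that by (simp add: g'_def bij_betw_def inv_into_f_f)
  have gg': "g (g' i) = i" if "i \<in> B" for i
    using g that by (simp add: g'_def bij_betw_def f_inv_into_f)
  have 1: "act g' {B} \<in> module_hom K (V {B}) (M (card B - 1))"
    using act_hom[of "{B}" g'] g' B by (simp add: bij_betw_def M_card[OF B])
  show ?thesis
  proof (rule that[OF 1])
    show "act g' {B} (canon B x) = x" if "x \<in> carrier (M (card B - 1))" for x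
      using act_inverse[of "{{1..card B}}" g g' x] g gg that c0
      by (simp add: canon_eq[OF B g] bij_betw_def M_card[OF B])
    show "canon B (act g' {B} y) = y" if "y \<in> carrier (V {B})" for y
      using act_inverse[of "{B}" g' g y] g' gg' that B module_hom_closed[OF 1 that]
      by (simp add: canon_eq[OF B g] bij_betw_def M_card[OF B])
  qed
qed

text \<open>Each block is paired with a vector, of which only the component in degree
  \<open>card B - 1\<close> is used: it is the one defined on a block with as many points as
  \<open>B\<close>. \<open>canon\<close> carries it to \<open>B\<close>, and \<open>star\<close>
  multiplies the results.\<close>

primrec nu :: "(nat set \<times> (nat \<Rightarrow> 'v)) list \<Rightarrow> 'v" where
  "nu [] = e"
| "nu (p # ps) =
     star {fst p} (set (map fst ps)) (canon (fst p) (snd p (card (fst p) - 1))) (nu ps)"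

abbreviation admissible :: "(nat set \<times> (nat \<Rightarrow> 'v)) list \<Rightarrow> bool" where
  "admissible ps \<equiv> block_list (map fst ps) \<and> snd ` set ps \<subseteq> carrier D"

lemma D_component: "z \<in> carrier D \<Longrightarrow> z i \<in> carrier (M i)"
  by (auto simp: direct_sum_simps)

lemma canon_closed:
  "\<lbrakk>finite B; B \<noteq> {}; z \<in> carrier D\<rbrakk> \<Longrightarrow> canon B (z (card B - 1)) \<in> carrier (V {B})"
  by (rule module_hom_closed[OF canon_hom]) (auto intro: D_component)

lemma nu_closed: "admissible ps \<Longrightarrow> nu ps \<in> carrier (V (set (map fst ps)))"
proof (induction ps)
  case Nil
  then show ?case by (simp add: e_closed)
next
  case (Cons p ps)
  have "star {fst p} (set (map fst ps)) (canon (fst p) (snd p (card (fst p) - 1))) (nu ps)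
      \<in> carrier (V ({fst p} \<union> set (map fst ps)))"
    using Cons by (intro star_closed canon_closed) (auto simp: block_list_Cons block_list_def[of "map fst ps"])
  then show ?case by simp
qed

lemma nu_append:
  "admissible (ps @ qs) \<Longrightarrow>
    nu (ps @ qs) = star (set (map fst ps)) (set (map fst qs)) (nu ps) (nu qs)"
proof (induction ps)
  case Nil
  then show ?case
    using star_e[of "set (map fst qs)" "nu qs"] nu_closed[of qs] by (simp add: block_list_def)
next
  case (Cons p ps)
  let ?c = "canon (fst p) (snd p (card (fst p) - 1))"
  have bl: "block_list (map fst ps)" "block_list (map fst qs)" "finite (fst p)" "fst p \<noteq> {}"
    and sep: "sep (set (map fst ps)) (set (map fst qs))" "sep {fst p} (set (map fst ps))"
      "sep {fst p} (set (map fst qs))"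
    and D: "snd p \<in> carrier D"
    using Cons.prems by (auto simp: block_list_Cons block_list_append)
  have "nu ((p # ps) @ qs) = star {fst p} (set (map fst ps) \<union> set (map fst qs)) ?c
      (star (set (map fst ps)) (set (map fst qs)) (nu ps) (nu qs))"
    using Cons by (simp add: block_list_Cons image_Un)
  also have "\<dots> = star ({fst p} \<union> set (map fst ps)) (set (map fst qs))
      (star {fst p} (set (map fst ps)) ?c (nu ps)) (nu qs)"
    using bl sep D Cons.prems
    by (intro star_assoc[symmetric] canon_closed nu_closed) (auto simp: block_list_def)
  finally show ?case by simp
qed

text \<open>Commutativity allows one to move any factor to the front.\<close>

lemma nu_mset: "admissible ps \<Longrightarrow> mset ps = mset qs \<Longrightarrow> nu ps = nu qs"
proof (induction ps arbitrary: qs)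
  case Nil
  then show ?case by simp
next
  case (Cons p ps)
  obtain q1 q2 where q: "qs = q1 @ p # q2"
    using Cons.prems(2) by (metis list.set_intros(1) set_mset_mset split_list)
  then have ms: "mset ps = mset (q1 @ q2)" using Cons.prems(2) by simp
  have adq: "admissible qs"
    using Cons.prems block_list_mset[of "map fst (p # ps)" "map fst qs"]
    by (metis (no_types, opaque_lifting) mset_map set_mset_mset)
  then have ad: "admissible q1" "admissible (p # q2)" "admissible q2" "admissible [p]" "admissible (p # q1)"
      "admissible (q1 @ q2)"
    and sep: "sep (set (map fst q1)) {fst p}" "sep (set (map fst q1)) (set (map fst q2))"
      "sep {fst p} (set (map fst q2))"
    unfolding q by (auto simp: block_list_append block_list_Cons)
  have bf: "block_family (set (map fst q1))" "block_family (set (map fst q2))" "block_family {fst p}"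
    using ad by (auto simp: block_list_def)
  define c where "c = canon (fst p) (snd p (card (fst p) - 1))"
  have c: "c \<in> carrier (V {fst p})"
    unfolding c_def using ad(2) by (intro canon_closed) (auto simp: block_list_Cons)
  have "nu qs = star (set (map fst q1)) ({fst p} \<union> set (map fst q2)) (nu q1)
      (star {fst p} (set (map fst q2)) c (nu q2))"
    using nu_append[of q1 "p # q2"] adq unfolding q c_def by simp
  also have "\<dots> = star (set (map fst q1) \<union> {fst p}) (set (map fst q2))
      (star (set (map fst q1)) {fst p} (nu q1) c) (nu q2)"
    using bf sep c ad by (intro star_assoc[symmetric] nu_closed) auto
  also have "star (set (map fst q1)) {fst p} (nu q1) c = star {fst p} (set (map fst q1)) c (nu q1)"
    using bf sep c ad by (intro star_comm nu_closed) auto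
  also have "set (map fst q1) \<union> {fst p} = {fst p} \<union> set (map fst q1)" by simp
  also have "star ({fst p} \<union> set (map fst q1)) (set (map fst q2)) (star {fst p} (set (map fst q1)) c (nu q1)) (nu q2)
      = star {fst p} (set (map fst q1) \<union> set (map fst q2)) c (star (set (map fst q1)) (set (map fst q2)) (nu q1) (nu q2))"
    using bf sep c ad by (intro star_assoc nu_closed) auto
  also have "\<dots> = nu (p # q1 @ q2)"
    using ad(6) by (simp add: nu_append c_def image_Un)
  also have "\<dots> = nu (p # ps)"
  proof -
    have "nu ps = nu (q1 @ q2)"
      using Cons.prems by (intro Cons.IH ms) (auto simp: block_list_Cons)
    moreover have "set (map fst ps) = set (map fst (q1 @ q2))"
      using ms by (metis mset_map set_mset_mset)
    ultimately show ?thesis by simp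
  qed
  finally show ?case by simp
qed

text \<open>An injection preserves the sizes of blocks, so the same components of the vectors are
  read off before and after.\<close>

lemma nu_act:
  "admissible ps \<Longrightarrow> inj_on f (\<Union>(set (map fst ps))) \<Longrightarrow>
    act f (set (map fst ps)) (nu ps) = nu (map (\<lambda>p. (f ` fst p, snd p)) ps)"
proof (induction ps)
  case Nil
  then show ?case using act_ident[of "{}" f e] e_closed by simp
next
  case (Cons p ps)
  obtain B z where p: "p = (B, z)" by (cases p)
  let ?S = "set (map fst ps)"
  have B: "finite B" "B \<noteq> {}" "block_list (map fst ps)" "sep {B} ?S" and z: "z \<in> carrier D"
    using Cons.prems by (auto simp: p block_list_Cons)
  have inj: "inj_on f B" "inj_on f (\<Union>?S)"
    using Cons.prems(2) by (auto simp: p inj_on_Un)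
  have "act f ({B} \<union> ?S) (star {B} ?S (canon B (z (card B - 1))) (nu ps)) =
      star (im f {B}) (im f ?S) (act f {B} (canon B (z (card B - 1)))) (act f ?S (nu ps))"
    using B z Cons.prems by (intro star_act canon_closed nu_closed) (auto simp: p block_list_def)
  also have "act f {B} (canon B (z (card B - 1))) = canon (f ` B) (z (card B - 1))"
    using B z inj by (intro canon_act) (auto intro: D_component)
  also have "act f ?S (nu ps) = nu (map (\<lambda>p. (f ` fst p, snd p)) ps)"
    using Cons.prems inj by (intro Cons.IH) (auto simp: block_list_Cons)
  finally show ?case
    using card_image[OF inj(1)] by (simp add: p image_image case_prod_beta)
qed

lemma zip_admissible:
  assumes "block_list Bs" "length zs = length Bs" "set zs \<subseteq> carrier D"
  shows "admissible (zip Bs zs)"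
proof -
  have "snd ` set (zip Bs zs) \<subseteq> set zs" by (auto dest: set_zip_rightD)
  then show ?thesis using assms by simp
qed

text \<open>In the first slot linearity comes from \<open>canon\<close> and the left argument of
  \<open>star\<close>; in the others it comes from the induction and the right argument.\<close>

lemma nu_multilinear:
  assumes "block_list Bs"
  shows "multilinear K (replicate (length Bs) D) (V (set Bs)) (\<lambda>zs. nu (zip Bs zs))"
proof -
  have hom: "(\<lambda>z. nu (zip Bs (zs[i := z]))) \<in> module_hom K D (V (set Bs))"
    if "block_list Bs" "length zs = length Bs" "set zs \<subseteq> carrier D" "i < length Bs" for zs i Bs
    using that
  proof (induction Bs arbitrary: zs i)
    case Nil
    then show ?case by simp
  next
    case (Cons B Bs)
    obtain w ws where zs: "zs = w # ws" using Cons.prems(2) by (cases zs) auto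
    have B: "finite B" "B \<noteq> {}" "block_list Bs" "block_family (set Bs)" "sep {B} (set Bs)"
      using Cons.prems(1) by (auto simp: block_list_Cons block_list_def[of Bs])
    have len: "map fst (zip Bs ws) = Bs" using Cons.prems zs by simp
    have nc: "nu (zip Bs ws) \<in> carrier (V (set Bs))"
      using nu_closed[of "zip Bs ws"] zip_admissible[of Bs ws] B Cons.prems zs len by auto
    show ?case
    proof (cases i)
      case 0
      have "(\<lambda>z. z (card B - 1)) \<in> module_hom K D (M (card B - 1))"
        by (rule direct_sum_eval) simp
      then have "(\<lambda>z. star {B} (set Bs) (canon B (z (card B - 1))) (nu (zip Bs ws))) \<in>
          module_hom K D (V ({B} \<union> set Bs))"
        using B nc
        by (intro module_hom_compose[OF module_hom_compose[OF _ canon_hom] star_hom1]) auto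
      then show ?thesis using len by (simp add: zs 0)
    next
      case (Suc k)
      have "(\<lambda>z. star {B} (set Bs) (canon B (w (card B - 1))) (nu (zip Bs (ws[k := z])))) \<in>
          module_hom K D (V ({B} \<union> set Bs))"
        using B Cons.prems
        by (intro module_hom_compose[OF Cons.IH star_hom2] canon_closed) (auto simp: zs Suc)
      moreover have "map fst (zip Bs (ws[k := z])) = Bs" for z using Cons.prems zs by simp
      ultimately show ?thesis by (simp add: zs Suc)
    qed
  qed
  have "nu (zip Bs zs) \<in> carrier (V (set Bs))" if "length zs = length Bs" "set zs \<subseteq> carrier D" for zs
    using nu_closed[of "zip Bs zs"] zip_admissible[OF assms that] that by simp
  then show ?thesis
    using hom[OF assms] by (auto simp: multilinear_def tensor_index_replicate)
qed

end

section \<open>The evaluation of tensors on lists of blocks\<close>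

context block_species
begin

section \<open>Evaluation against permutation and concatenation of tensors\<close>

abbreviation idx :: "nat \<Rightarrow> (nat \<Rightarrow> 'v) list set" where
  "idx r \<equiv> tensor_index (replicate r D)"

lemmas T_lift_hom = tensor_setup.tensor_lift_hom[OF tensor_setup_D, folded tensor_power_def]
lemmas T_lift_pure = tensor_setup.tensor_lift_pure[OF tensor_setup_D]
lemmas T_lift_param = tensor_setup.tensor_lift_param[OF tensor_setup_D, folded tensor_power_def]
lemmas T_hom_eqI = tensor_setup.tensor_hom_eqI[OF tensor_setup_D, folded tensor_power_def]
lemmas T_span = tensor_setup.tensor_span[OF tensor_setup_D, folded tensor_power_def]
lemmas pure_closed = tensor_setup.pure_tensor_closed[OF tensor_setup_D, folded tensor_power_def]
lemmas pure_multilinear = tensor_setup.pure_tensor_multilinear[OF tensor_setup_D, folded tensor_power_def]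

lemma idx_iff: "zs \<in> idx r \<longleftrightarrow> length zs = r \<and> set zs \<subseteq> carrier D"
  by (rule tensor_index_replicate)

lemma D_zero_closed: "\<zero>\<^bsub>D\<^esub> \<in> carrier D"
proof -
  interpret module K D by (rule module_D)
  show ?thesis by simp
qed

lemma pure_update_hom:
  "\<lbrakk>zs \<in> idx r; i < r\<rbrakk> \<Longrightarrow> (\<lambda>z. pure r (zs[i := z])) \<in> module_hom K D (T r)"
  using pure_multilinear[of r] by (auto simp: multilinear_def)

lemma T_multilinearI:
  assumes "\<And>zs. zs \<in> idx r \<Longrightarrow> \<phi> zs \<in> carrier P"
    and "\<And>zs i. \<lbrakk>zs \<in> idx r; i < r\<rbrakk> \<Longrightarrow> (\<lambda>z. \<phi> (zs[i := z])) \<in> module_hom K D P"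
  shows "multilinear K (replicate r D) P \<phi>"
  using assms by (simp add: multilinear_def)

definition nuhat :: "nat set list \<Rightarrow> ((nat \<Rightarrow> 'v) list \<Rightarrow> 'k) set \<Rightarrow> 'v" where
  "nuhat Bs = tensor_lift K (replicate (length Bs) D) (V (set Bs)) (\<lambda>zs. nu (zip Bs zs))"

lemma V_blocks: "block_list Bs \<Longrightarrow> module K (V (set Bs))"
  by (rule V) (simp add: block_list_def)

lemma nuhat_hom: "block_list Bs \<Longrightarrow> nuhat Bs \<in> module_hom K (T (length Bs)) (V (set Bs))"
  unfolding nuhat_def by (intro T_lift_hom V_blocks nu_multilinear)

lemma nuhat_closed: "block_list Bs \<Longrightarrow> t \<in> carrier (T (length Bs)) \<Longrightarrow> nuhat Bs t \<in> carrier (V (set Bs))"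
  by (rule module_hom_closed[OF nuhat_hom])

lemma nuhat_pure:
  "block_list Bs \<Longrightarrow> zs \<in> idx (length Bs) \<Longrightarrow> nuhat Bs (pure (length Bs) zs) = nu (zip Bs zs)"
  unfolding nuhat_def by (intro T_lift_pure V_blocks nu_multilinear)

lemma nuhat_act:
  assumes Bs: "block_list Bs" and f: "inj_on f (\<Union>(set Bs))" and t: "t \<in> carrier (T (length Bs))"
  shows "act f (set Bs) (nuhat Bs t) = nuhat (map (image f) Bs) t"
proof (rule T_hom_eqI[OF _ _ _ _ t])
  have Bs': "block_list (map (image f) Bs)" by (rule block_list_map[OF Bs f])
  show "(\<lambda>t. act f (set Bs) (nuhat Bs t)) \<in> module_hom K (T (length Bs)) (V (im f (set Bs)))"
    using Bs f by (intro module_hom_compose[OF nuhat_hom act_hom]) (auto simp: block_list_def)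
  show "nuhat (map (image f) Bs) \<in> module_hom K (T (length Bs)) (V (im f (set Bs)))"
    using nuhat_hom[OF Bs'] by simp
  show "module K (V (im f (set Bs)))"
    using V_blocks[OF Bs'] by simp
  fix zs assume zs: "zs \<in> idx (length Bs)"
  have "act f (set Bs) (nu (zip Bs zs)) = nu (map (\<lambda>p. (f ` fst p, snd p)) (zip Bs zs))"
    using nu_act[of "zip Bs zs" f] Bs f zs zip_admissible[of Bs zs] by (simp add: idx_iff del: set_map)
  also have "map (\<lambda>p. (f ` fst p, snd p)) (zip Bs zs) = zip (map (image f) Bs) zs"
    by (simp add: zip_map1 case_prod_unfold)
  finally show "act f (set Bs) (nuhat Bs (pure (length Bs) zs)) = nuhat (map (image f) Bs) (pure (length Bs) zs)"
    using nuhat_pure[OF Bs zs] nuhat_pure[OF Bs', of zs] zs by simp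
qed

lemma permute_list_update:
  assumes p: "p permutes {..<length xs}" and i: "i < length xs"
  shows "permute_list (inv_into UNIV p) (xs[i := x]) = (permute_list (inv_into UNIV p) xs)[p i := x]"
proof (rule nth_equalityI)
  have ip: "inv_into UNIV p permutes {..<length xs}" by (rule permutes_inv[OF p])
  fix k assume "k < length (permute_list (inv_into UNIV p) (xs[i := x]))"
  then have k: "k < length xs" by simp
  have ik: "inv_into UNIV p k < length xs" using permutes_in_image[OF ip, of k] k by simp
  have pi: "p i < length xs" using permutes_in_image[OF p, of i] i by simp
  have "inv_into UNIV p k = i \<longleftrightarrow> k = p i" using permutes_inverses[OF p] by metis
  then show "permute_list (inv_into UNIV p) (xs[i := x]) ! k = (permute_list (inv_into UNIV p) xs)[p i := x] ! k"
    using k ik i pi ip by (auto simp: permute_list_nth nth_list_update)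
qed simp

lemma permute_multilinear:
  assumes \<sigma>: "\<sigma> permutes {..<r}"
  shows "multilinear K (replicate r D) (T r) (\<lambda>zs. pure r (permute_list (inv_into UNIV \<sigma>) zs))"
proof (rule T_multilinearI)
  fix zs i assume zs: "zs \<in> idx r" and i: "i < r"
  have "permute_list (inv_into UNIV \<sigma>) zs \<in> idx r"
    using zs \<sigma> by (simp add: idx_iff permutes_inv)
  moreover have "\<sigma> i < r" using permutes_in_image[OF \<sigma>, of i] i by simp
  ultimately have "(\<lambda>z. pure r ((permute_list (inv_into UNIV \<sigma>) zs)[\<sigma> i := z])) \<in> module_hom K D (T r)"
    by (rule pure_update_hom)
  then show "(\<lambda>z. pure r (permute_list (inv_into UNIV \<sigma>) (zs[i := z]))) \<in> module_hom K D (T r)"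
    using zs i \<sigma> by (simp add: permute_list_update idx_iff)
qed (rule pure_closed)

lemma permute_hom: "\<sigma> permutes {..<r} \<Longrightarrow> tensor_permute K D r \<sigma> \<in> module_hom K (T r) (T r)"
  unfolding tensor_permute_def by (rule T_lift_hom[OF module_T permute_multilinear])

lemma permute_pure:
  "\<sigma> permutes {..<r} \<Longrightarrow> zs \<in> idx r \<Longrightarrow>
    tensor_permute K D r \<sigma> (pure r zs) = pure r (permute_list (inv_into UNIV \<sigma>) zs)"
  unfolding tensor_permute_def by (rule T_lift_pure[OF module_T permute_multilinear])

lemma block_list_permute:
  "block_list Bs \<Longrightarrow> \<sigma> permutes {..<length Bs} \<Longrightarrow> block_list (permute_list \<sigma> Bs)"
  by (rule block_list_mset[of Bs]) simp_all

text \<open>Moving the tensor factors or moving the blocks produces the same pairs of a block and a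
  vector up to order, and \<open>nu\<close> does not see the order.\<close>

lemma nuhat_permute:
  assumes Bs: "block_list Bs" and \<sigma>: "\<sigma> permutes {..<length Bs}" and t: "t \<in> carrier (T (length Bs))"
  shows "nuhat Bs (tensor_permute K D (length Bs) \<sigma> t) = nuhat (permute_list \<sigma> Bs) t"
proof (rule T_hom_eqI[OF _ _ V_blocks[OF Bs] _ t])
  let ?r = "length Bs"
  have Bs': "block_list (permute_list \<sigma> Bs)" by (rule block_list_permute[OF Bs \<sigma>])
  show "(\<lambda>t. nuhat Bs (tensor_permute K D ?r \<sigma> t)) \<in> module_hom K (T ?r) (V (set Bs))"
    by (rule module_hom_compose[OF permute_hom[OF \<sigma>] nuhat_hom[OF Bs]])
  show "nuhat (permute_list \<sigma> Bs) \<in> module_hom K (T ?r) (V (set Bs))"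
    using nuhat_hom[OF Bs'] \<sigma> by simp
  fix zs assume zs: "zs \<in> idx ?r"
  have i\<sigma>: "inv_into UNIV \<sigma> permutes {..<?r}" by (rule permutes_inv[OF \<sigma>])
  have zs': "permute_list (inv_into UNIV \<sigma>) zs \<in> idx ?r" using zs i\<sigma> by (simp add: idx_iff)
  \<comment> \<open>Permuting the zipped list by the inverse of \<open>\<sigma>\<close> restores the
    order of the blocks and moves the vectors as \<open>tensor_permute\<close> does.\<close>
  have "permute_list (inv_into UNIV \<sigma>) (permute_list \<sigma> Bs) = permute_list (\<sigma> \<circ> inv_into UNIV \<sigma>) Bs"
    using i\<sigma> by (rule permute_list_compose[symmetric])
  also have "\<dots> = Bs"
    using \<sigma> by (simp add: permutes_inv_o)
  finally have "permute_list (inv_into UNIV \<sigma>) (zip (permute_list \<sigma> Bs) zs) = zip Bs (permute_list (inv_into UNIV \<sigma>) zs)"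
    using zs i\<sigma> by (subst permute_list_zip[of _ "{..<?r}"]) (simp_all add: idx_iff)
  then have "mset (zip Bs (permute_list (inv_into UNIV \<sigma>) zs)) = mset (zip (permute_list \<sigma> Bs) zs)"
    using zs i\<sigma> by (metis idx_iff length_permute_list length_zip min.idem mset_permute_list)
  then have "nu (zip Bs (permute_list (inv_into UNIV \<sigma>) zs)) = nu (zip (permute_list \<sigma> Bs) zs)"
    using zip_admissible[OF Bs, of "permute_list (inv_into UNIV \<sigma>) zs"] zs' by (intro nu_mset) (auto simp: idx_iff)
  then show "nuhat Bs (tensor_permute K D ?r \<sigma> (pure ?r zs)) = nuhat (permute_list \<sigma> Bs) (pure ?r zs)"
    using nuhat_pure[OF Bs zs'] nuhat_pure[OF Bs', of zs] zs \<sigma> by (simp add: permute_pure)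
qed

lemma append_multilinear_right:
  assumes xs: "xs \<in> idx i"
  shows "multilinear K (replicate j D) (T (i + j)) (\<lambda>ys. pure (i + j) (xs @ ys))"
proof (rule T_multilinearI)
  fix ys k assume ys: "ys \<in> idx j" and k: "k < j"
  have "(\<lambda>z. pure (i + j) ((xs @ ys)[i + k := z])) \<in> module_hom K D (T (i + j))"
    using xs ys k by (intro pure_update_hom) (auto simp: idx_iff)
  then show "(\<lambda>z. pure (i + j) (xs @ ys[k := z])) \<in> module_hom K D (T (i + j))"
    using xs by (simp add: idx_iff list_update_append)
qed (rule pure_closed)

text \<open>The outer lift in \<open>tensor_concat\<close> requires its inner lift to be multilinear
  in the first list. The second tensor is arbitrary here, so linearity in a parameter is what is
  needed.\<close>

lemma append_inner_multilinear:
  assumes t: "t \<in> carrier (T j)"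
  shows "multilinear K (replicate i D) (T (i + j))
    (\<lambda>xs. tensor_lift K (replicate j D) (T (i + j)) (\<lambda>ys. pure (i + j) (xs @ ys)) t)"
proof (rule T_multilinearI)
  fix xs assume xs: "xs \<in> idx i"
  show "tensor_lift K (replicate j D) (T (i + j)) (\<lambda>ys. pure (i + j) (xs @ ys)) t \<in> carrier (T (i + j))"
    by (rule module_hom_closed[OF T_lift_hom[OF module_T append_multilinear_right[OF xs]] t])
  fix k assume k: "k < i"
  show "(\<lambda>z. tensor_lift K (replicate j D) (T (i + j)) (\<lambda>ys. pure (i + j) (xs[k := z] @ ys)) t)
      \<in> module_hom K D (T (i + j))"
  proof (rule T_lift_param[OF module_T module_D _ _ t])
    show "multilinear K (replicate j D) (T (i + j)) (\<lambda>ys. pure (i + j) (xs[k := z] @ ys))"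
      if "z \<in> carrier D" for z
      using xs k that set_update_subset_insert[of xs k z]
      by (intro append_multilinear_right) (auto simp: idx_iff)
    fix ys assume ys: "ys \<in> idx j"
    have "(\<lambda>z. pure (i + j) ((xs @ ys)[k := z])) \<in> module_hom K D (T (i + j))"
      using xs ys k by (intro pure_update_hom) (auto simp: idx_iff)
    then show "(\<lambda>z. pure (i + j) (xs[k := z] @ ys)) \<in> module_hom K D (T (i + j))"
      using xs k by (simp add: idx_iff list_update_append1)
  qed
qed

lemma concat_hom1:
  "t \<in> carrier (T j) \<Longrightarrow> (\<lambda>s. tensor_concat K D i j s t) \<in> module_hom K (T i) (T (i + j))"
  unfolding tensor_concat_def by (rule T_lift_hom[OF module_T append_inner_multilinear])

lemma concat_hom2:
  assumes s: "s \<in> carrier (T i)"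
  shows "(\<lambda>t. tensor_concat K D i j s t) \<in> module_hom K (T j) (T (i + j))"
  unfolding tensor_concat_def
  by (rule T_lift_param[OF module_T module_T append_inner_multilinear
        T_lift_hom[OF module_T append_multilinear_right] s])

lemma concat_closed:
  "s \<in> carrier (T i) \<Longrightarrow> t \<in> carrier (T j) \<Longrightarrow> tensor_concat K D i j s t \<in> carrier (T (i + j))"
  by (rule module_hom_closed[OF concat_hom1])

lemma concat_pure:
  "xs \<in> idx i \<Longrightarrow> ys \<in> idx j \<Longrightarrow>
    tensor_concat K D i j (pure i xs) (pure j ys) = pure (i + j) (xs @ ys)"
  unfolding tensor_concat_def
  by (simp add: T_lift_pure[OF module_T append_inner_multilinear[OF pure_closed]]
      T_lift_pure[OF module_T append_multilinear_right])

text \<open>For pure tensors this is \<open>nu_append\<close>. Both sides are linear in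
  \<open>s\<close> and in \<open>t\<close>, so the identity is extended in one argument after the
  other.\<close>

lemma nuhat_concat:
  assumes bl: "block_list (Bs @ Cs)" and s: "s \<in> carrier (T (length Bs))" and t: "t \<in> carrier (T (length Cs))"
  shows "nuhat (Bs @ Cs) (tensor_concat K D (length Bs) (length Cs) s t) =
    star (set Bs) (set Cs) (nuhat Bs s) (nuhat Cs t)"
proof -
  let ?i = "length Bs" and ?j = "length Cs"
  have b: "block_list Bs" "block_list Cs" "sep (set Bs) (set Cs)" "block_family (set Bs)" "block_family (set Cs)"
    using bl by (auto simp: block_list_append block_list_def[of Bs] block_list_def[of Cs])
  have P: "module K (V (set Bs \<union> set Cs))"
    using V_blocks[OF bl] by simp
  have n: "nuhat (Bs @ Cs) \<in> module_hom K (T (?i + ?j)) (V (set Bs \<union> set Cs))"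
    using nuhat_hom[OF bl] by simp
  have pp: "nuhat (Bs @ Cs) (tensor_concat K D ?i ?j (pure ?i xs) (pure ?j ys)) =
      star (set Bs) (set Cs) (nuhat Bs (pure ?i xs)) (nuhat Cs (pure ?j ys))"
    if xs: "xs \<in> idx ?i" and ys: "ys \<in> idx ?j" for xs ys
  proof -
    have xy: "xs @ ys \<in> idx (length (Bs @ Cs))" using xs ys by (simp add: idx_iff)
    have z: "zip (Bs @ Cs) (xs @ ys) = zip Bs xs @ zip Cs ys"
      using xs by (simp add: idx_iff)
    have "nu (zip Bs xs @ zip Cs ys) =
        star (set (map fst (zip Bs xs))) (set (map fst (zip Cs ys))) (nu (zip Bs xs)) (nu (zip Cs ys))"
      using zip_admissible[OF bl, of "xs @ ys"] xy unfolding z idx_iff by (intro nu_append) simp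
    then show ?thesis
      using nuhat_pure[OF bl xy] nuhat_pure[OF b(1) xs] nuhat_pure[OF b(2) ys] xs ys z
      by (simp add: concat_pure idx_iff del: set_map)
  qed
  have ps: "nuhat (Bs @ Cs) (tensor_concat K D ?i ?j s (pure ?j ys)) =
      star (set Bs) (set Cs) (nuhat Bs s) (nuhat Cs (pure ?j ys))" if ys: "ys \<in> idx ?j" for ys
    using b pp[OF _ ys]
    by (intro T_hom_eqI[OF module_hom_compose[OF concat_hom1 n]
          module_hom_compose[OF nuhat_hom star_hom1] P _ s] nuhat_closed pure_closed) auto
  show ?thesis
    using b s ps
    by (intro T_hom_eqI[OF module_hom_compose[OF concat_hom2 n]
          module_hom_compose[OF nuhat_hom star_hom2] P _ t] nuhat_closed pure_closed) auto
qed

text \<open>Tensoring with \<open>z\<close> on the left. It supplies the inductive step in the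
  construction of the section \<open>theta\<close>, one block at a time.\<close>

definition kappa :: "nat \<Rightarrow> (nat \<Rightarrow> 'v) \<Rightarrow> ((nat \<Rightarrow> 'v) list \<Rightarrow> 'k) set \<Rightarrow> ((nat \<Rightarrow> 'v) list \<Rightarrow> 'k) set" where
  "kappa r z = tensor_lift K (replicate r D) (T (Suc r)) (\<lambda>zs. pure (Suc r) (z # zs))"

lemma kappa_multilinear:
  assumes z: "z \<in> carrier D"
  shows "multilinear K (replicate r D) (T (Suc r)) (\<lambda>zs. pure (Suc r) (z # zs))"
proof (rule T_multilinearI)
  fix zs i assume zs: "zs \<in> idx r" and i: "i < r"
  have "(\<lambda>y. pure (Suc r) ((z # zs)[Suc i := y])) \<in> module_hom K D (T (Suc r))"
    using zs z i by (intro pure_update_hom) (auto simp: idx_iff simp del: replicate_Suc)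
  then show "(\<lambda>y. pure (Suc r) (z # zs[i := y])) \<in> module_hom K D (T (Suc r))" by simp
qed (rule pure_closed)

lemma kappa_hom2: "z \<in> carrier D \<Longrightarrow> kappa r z \<in> module_hom K (T r) (T (Suc r))"
  unfolding kappa_def by (rule T_lift_hom[OF module_T kappa_multilinear])

lemma kappa_pure: "z \<in> carrier D \<Longrightarrow> zs \<in> idx r \<Longrightarrow> kappa r z (pure r zs) = pure (Suc r) (z # zs)"
  unfolding kappa_def by (rule T_lift_pure[OF module_T kappa_multilinear])

lemma kappa_hom1:
  assumes t: "t \<in> carrier (T r)"
  shows "(\<lambda>z. kappa r z t) \<in> module_hom K D (T (Suc r))"
  unfolding kappa_def
proof (rule T_lift_param[OF module_T module_D kappa_multilinear _ t])
  fix zs assume zs: "zs \<in> idx r"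
  \<comment> \<open>The zero vector only holds the place of the first entry, which the update
    overwrites.\<close>
  have "(\<lambda>y. pure (Suc r) ((\<zero>\<^bsub>D\<^esub> # zs)[0 := y])) \<in> module_hom K D (T (Suc r))"
    using zs D_zero_closed by (intro pure_update_hom) (auto simp: idx_iff simp del: replicate_Suc)
  then show "(\<lambda>z. pure (Suc r) (z # zs)) \<in> module_hom K D (T (Suc r))" by simp
qed

text \<open>Vectors that are homogeneous in exactly the degrees that the blocks read off, so that
  \<open>nu\<close> discards no component.\<close>

abbreviation homlist :: "nat set list \<Rightarrow> (nat \<Rightarrow> 'v) list \<Rightarrow> bool" where
  "homlist \<equiv> list_all2 (\<lambda>B z. z \<in> homogeneous M (card B - 1))"

lemma homlist_idx: "homlist Bs zs \<Longrightarrow> zs \<in> idx (length Bs)"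
  using homogeneous_subset_D by (fastforce simp: idx_iff list_all2_conv_all_nth set_conv_nth)

section \<open>The section of the evaluation\<close>

lemmas incl_homogeneous_D = incl_homogeneous[of K M, OF K module_M]
lemmas incl_hom_D = incl_hom[of K M, OF K module_M]

lemma nu_zip_closed:
  assumes "block_list Bs" "zs \<in> idx (length Bs)"
  shows "nu (zip Bs zs) \<in> carrier (V (set Bs))"
  using nu_closed[of "zip Bs zs"] zip_admissible[of Bs zs] assms by (simp add: idx_iff del: set_map)

text \<open>By \<open>star_span\<close> it suffices to reach products of an element on the first
  block with one on the rest. As \<open>canon\<close> is onto, the former comes from a homogeneous
  vector; the latter is handled by the induction.\<close>

lemma nu_span:
  assumes "block_list Bs" "submodule H K (V (set Bs))"
    and "\<And>zs. homlist Bs zs \<Longrightarrow> nu (zip Bs zs) \<in> H"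
  shows "carrier (V (set Bs)) \<subseteq> H"
  using assms
proof (induction Bs arbitrary: H)
  case Nil
  have "e \<in> H" using Nil.prems(3)[of "[]"] by simp
  then show ?case using e_span submodule_smult[of H K "V {}"] Nil.prems(2) by auto
next
  case (Cons B Bs)
  have B: "finite B" "B \<noteq> {}" "block_list Bs" "block_family (set Bs)" "sep {B} (set Bs)"
    using Cons.prems(1) by (auto simp: block_list_Cons block_list_def[of Bs])
  obtain c where c: "c \<in> module_hom K (V {B}) (M (card B - 1))"
    "\<And>y. y \<in> carrier (V {B}) \<Longrightarrow> canon B (c y) = y"
    using canon_inverse[OF B(1,2)] by metis
  have "carrier (V ({B} \<union> set Bs)) \<subseteq> H"
  proof (rule star_span)
    show "submodule H K (V ({B} \<union> set Bs))" using Cons.prems(2) by simp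
    fix x y assume x: "x \<in> carrier (V {B})" and y: "y \<in> carrier (V (set Bs))"
    have "carrier (V (set Bs)) \<subseteq> {y \<in> carrier (V (set Bs)). star {B} (set Bs) x y \<in> H}"
    proof (rule Cons.IH[OF B(3)])
      show "submodule {y \<in> carrier (V (set Bs)). star {B} (set Bs) x y \<in> H} K (V (set Bs))"
        using B x Cons.prems V_blocks[OF Cons.prems(1)]
        by (intro submodule_vimage[where N = "V ({B} \<union> set Bs)"] star_hom2 V_blocks) auto
      fix zs assume zs: "homlist Bs zs"
      let ?z = "incl M (card B - 1) (c x)"
      have z: "?z \<in> homogeneous M (card B - 1)"
        by (rule incl_homogeneous_D[OF module_hom_closed[OF c(1) x]])
      have len: "map fst (zip Bs zs) = Bs" using zs by (simp add: list_all2_lengthD)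
      have "nu (zip Bs zs) \<in> carrier (V (set Bs))"
        by (rule nu_zip_closed[OF B(3) homlist_idx[OF zs]])
      moreover have "nu (zip (B # Bs) (?z # zs)) \<in> H"
        using zs z by (intro Cons.prems(3)) simp
      ultimately show "nu (zip Bs zs) \<in> {y \<in> carrier (V (set Bs)). star {B} (set Bs) x y \<in> H}"
        using len c(2)[OF x] by (simp add: incl_def)
    qed
    then show "star {B} (set Bs) x y \<in> H" using y by auto
  qed (use B in auto)
  then show ?case by simp
qed

text \<open>The universal property of \<open>star\<close>, iterated over the list: split off the
  first block, undo \<open>canon\<close>, view the result as a homogeneous vector and prepend it to
  the tensor obtained for the remaining blocks.\<close>

lemma theta_ex:
  assumes "block_list Bs"
  shows "\<exists>h \<in> module_hom K (V (set Bs)) (T (length Bs)).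
    \<forall>zs. homlist Bs zs \<longrightarrow> h (nu (zip Bs zs)) = pure (length Bs) zs"
  using assms
proof (induction Bs)
  case Nil
  interpret T0: module K "T 0" by (rule module_T)
  \<comment> \<open>The coordinate \<open>\<epsilon>\<close> with respect to \<open>e\<close>
    provides a linear map with the prescribed value, the empty pure tensor, at
    \<open>e\<close>.\<close>
  obtain \<epsilon> where \<epsilon>: "\<epsilon> \<in> module_hom K (V {}) (self_module K)" "\<epsilon> e = \<one>\<^bsub>K\<^esub>" using e_coord by blast
  have "(\<lambda>a. a \<odot>\<^bsub>T 0\<^esub> pure 0 []) \<in> module_hom K (self_module K) (T 0)"
    using pure_closed[of 0 "[]"] by (intro module_homI) (simp_all add: T0.smult_l_distr T0.smult_assoc1)
  from module_hom_compose[OF \<epsilon>(1) this] show ?case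
    using \<epsilon>(2) pure_closed[of 0 "[]"] by (intro bexI[where x = "\<lambda>x. \<epsilon> x \<odot>\<^bsub>T 0\<^esub> pure 0 []"]) auto
next
  case (Cons B Bs)
  let ?r = "length Bs"
  have B: "finite B" "B \<noteq> {}" "block_list Bs" "block_family (set Bs)" "sep {B} (set Bs)"
    using Cons.prems(1) by (auto simp: block_list_Cons block_list_def[of Bs])
  obtain h where h: "h \<in> module_hom K (V (set Bs)) (T ?r)"
    "\<And>zs. homlist Bs zs \<Longrightarrow> h (nu (zip Bs zs)) = pure ?r zs"
    using Cons.IH[OF B(3)] by auto
  obtain c where c: "c \<in> module_hom K (V {B}) (M (card B - 1))"
    "\<And>x. x \<in> carrier (M (card B - 1)) \<Longrightarrow> c (canon B x) = x"
    using canon_inverse[OF B(1,2)] by metis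
  let ?i = "incl M (card B - 1)"
  have ih: "(\<lambda>x. ?i (c x)) \<in> module_hom K (V {B}) D"
    by (rule module_hom_compose[OF c(1) incl_hom_D])
  \<comment> \<open>\<open>kappa\<close> is linear in the prepended vector and in the remaining
    tensor, which is the bilinearity that \<open>star_univ\<close> asks for.\<close>
  have "\<exists>g \<in> module_hom K (V ({B} \<union> set Bs)) (T (Suc ?r)). \<forall>x \<in> carrier (V {B}). \<forall>y \<in> carrier (V (set Bs)).
      g (star {B} (set Bs) x y) = kappa ?r (?i (c x)) (h y)"
    using B
    by (intro star_univ module_T module_hom_compose[OF ih kappa_hom1] module_hom_compose[OF h(1) kappa_hom2]
        module_hom_closed[OF h(1)] module_hom_closed[OF ih]) auto
  then obtain g where g: "g \<in> module_hom K (V (set (B # Bs))) (T (Suc ?r))"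
    "\<And>x y. \<lbrakk>x \<in> carrier (V {B}); y \<in> carrier (V (set Bs))\<rbrakk> \<Longrightarrow>
      g (star {B} (set Bs) x y) = kappa ?r (?i (c x)) (h y)"
    by auto
  have "g (nu (zip (B # Bs) ws)) = pure (Suc ?r) ws" if ws: "homlist (B # Bs) ws" for ws
  proof -
    obtain z zs where w: "ws = z # zs" and z: "z \<in> homogeneous M (card B - 1)" and zs: "homlist Bs zs"
      using ws by (auto simp: list_all2_Cons1)
    have zD: "z \<in> carrier D" using z homogeneous_subset_D by auto
    have len: "map fst (zip Bs zs) = Bs" using zs by (simp add: list_all2_lengthD)
    have "nu (zip Bs zs) \<in> carrier (V (set Bs))"
      by (rule nu_zip_closed[OF B(3) homlist_idx[OF zs]])
    then have "g (star {B} (set Bs) (canon B (z (card B - 1))) (nu (zip Bs zs))) =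
        kappa ?r (?i (c (canon B (z (card B - 1))))) (h (nu (zip Bs zs)))"
      using B zD by (intro g(2) canon_closed)
    also have "\<dots> = kappa ?r z (pure ?r zs)"
      using c(2) h(2)[OF zs] D_component[OF zD] incl_homogeneous_self[of K M, OF K module_M z] by simp
    also have "\<dots> = pure (Suc ?r) ws"
      using zD homlist_idx[OF zs] by (simp add: kappa_pure w)
    finally show ?thesis using len by (simp add: w)
  qed
  then show ?case using g(1) by auto
qed

text \<open>The choice is harmless on the carrier: by \<open>nu_span\<close> a linear map is
  determined there by its values on the elements \<open>nu (zip Bs zs)\<close>.\<close>

definition theta :: "nat set list \<Rightarrow> 'v \<Rightarrow> ((nat \<Rightarrow> 'v) list \<Rightarrow> 'k) set" where
  "theta Bs = (SOME h. h \<in> module_hom K (V (set Bs)) (T (length Bs)) \<and>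
    (\<forall>zs. homlist Bs zs \<longrightarrow> h (nu (zip Bs zs)) = pure (length Bs) zs))"

lemma
  assumes "block_list Bs"
  shows theta_hom: "theta Bs \<in> module_hom K (V (set Bs)) (T (length Bs))"
    and theta_nu: "homlist Bs zs \<Longrightarrow> theta Bs (nu (zip Bs zs)) = pure (length Bs) zs"
proof -
  have "\<exists>h. h \<in> module_hom K (V (set Bs)) (T (length Bs)) \<and>
      (\<forall>zs. homlist Bs zs \<longrightarrow> h (nu (zip Bs zs)) = pure (length Bs) zs)"
    using theta_ex[OF assms] by blast
  from someI_ex[OF this, folded theta_def]
  show "theta Bs \<in> module_hom K (V (set Bs)) (T (length Bs))"
    "homlist Bs zs \<Longrightarrow> theta Bs (nu (zip Bs zs)) = pure (length Bs) zs"
    by auto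
qed

lemma theta_closed: "block_list Bs \<Longrightarrow> y \<in> carrier (V (set Bs)) \<Longrightarrow> theta Bs y \<in> carrier (T (length Bs))"
  by (rule module_hom_closed[OF theta_hom])

lemma V_hom_eqI:
  assumes Bs: "block_list Bs" and P: "module K P"
    and h: "h \<in> module_hom K (V (set Bs)) P" and g: "g \<in> module_hom K (V (set Bs)) P"
    and eq: "\<And>zs. homlist Bs zs \<Longrightarrow> h (nu (zip Bs zs)) = g (nu (zip Bs zs))"
    and y: "y \<in> carrier (V (set Bs))"
  shows "h y = g y"
proof -
  have "carrier (V (set Bs)) \<subseteq> {y \<in> carrier (V (set Bs)). h y = g y}"
  proof (rule nu_span[OF Bs submodule_equalizer[OF h g V_blocks[OF Bs] P]])
    fix zs assume zs: "homlist Bs zs"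
    then have "nu (zip Bs zs) \<in> carrier (V (set Bs))"
      by (intro nu_zip_closed[OF Bs homlist_idx])
    then show "nu (zip Bs zs) \<in> {y \<in> carrier (V (set Bs)). h y = g y}" using eq[OF zs] by simp
  qed
  then show ?thesis using y by auto
qed

text \<open>On a generator \<open>theta\<close> returns the pure tensor of the vectors, and
  evaluating this recovers the generator. Hence \<open>nuhat Bs\<close> is onto.\<close>

lemma nuhat_theta:
  assumes Bs: "block_list Bs" and y: "y \<in> carrier (V (set Bs))"
  shows "nuhat Bs (theta Bs y) = y"
  by (rule V_hom_eqI[OF Bs V_blocks[OF Bs] module_hom_compose[OF theta_hom[OF Bs] nuhat_hom[OF Bs]]
        module_hom_id _ y]) (simp add: theta_nu[OF Bs] nuhat_pure[OF Bs] homlist_idx)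

section \<open>The multihomogeneous decomposition of tensor powers\<close>

lemma nu_eq_zero:
  assumes Bs: "block_list Bs" and zs: "zs \<in> idx (length Bs)" and i: "i < length Bs"
    and z: "(zs ! i) (card (Bs ! i) - 1) = \<zero>\<^bsub>M (card (Bs ! i) - 1)\<^esub>"
  shows "nu (zip Bs zs) = \<zero>\<^bsub>V (set Bs)\<^esub>"
  using assms
proof (induction Bs arbitrary: zs i)
  case Nil
  then show ?case by simp
next
  case (Cons B Bs)
  obtain w ws where w: "zs = w # ws" using Cons.prems(2) by (cases zs) (auto simp: idx_iff simp del: replicate_Suc)
  have B: "finite B" "B \<noteq> {}" "block_list Bs" "block_family (set Bs)" "sep {B} (set Bs)"
    using Cons.prems(1) by (auto simp: block_list_Cons block_list_def[of Bs])
  have ws: "ws \<in> idx (length Bs)" and wD: "w \<in> carrier D" using Cons.prems(2) by (auto simp: w idx_iff simp del: replicate_Suc)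
  have len: "map fst (zip Bs ws) = Bs" using ws by (simp add: idx_iff)
  have n: "nu (zip Bs ws) \<in> carrier (V (set Bs))"
    by (rule nu_zip_closed[OF B(3) ws])
  have P: "module K (V ({B} \<union> set Bs))" using V_blocks[OF Cons.prems(1)] by simp
  have VB: "module K (V {B})" using B by (intro V) simp
  have "star {B} (set Bs) (canon B (w (card B - 1))) (nu (zip Bs ws)) = \<zero>\<^bsub>V ({B} \<union> set Bs)\<^esub>"
  proof (cases i)
    case 0
    then have "canon B (w (card B - 1)) = \<zero>\<^bsub>V {B}\<^esub>"
      using Cons.prems(4) module_hom_zero[OF canon_hom[OF B(1,2)] module_M VB] by (simp add: w)
    then show ?thesis
      using module_hom_zero[OF star_hom1[OF _ B(4,5) n] VB P] B by simp
  next
    case (Suc k)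
    then have "nu (zip Bs ws) = \<zero>\<^bsub>V (set Bs)\<^esub>"
      using Cons.prems by (intro Cons.IH[OF B(3) ws, of k]) (auto simp: w)
    then show ?thesis
      using module_hom_zero[OF star_hom2[OF _ B(4,5) canon_closed] V_blocks P] B wD by simp
  qed
  then show ?case using len by (simp add: w)
qed

text \<open>At a position where the sizes differ, the vector is homogeneous in a degree other than
  the one read off. This factor vanishes, and with it the product.\<close>

lemma nu_homlist_degree:
  assumes Bs: "block_list Bs" and zs: "homlist Cs zs" and len: "length Cs = length Bs"
    and card: "\<And>C. C \<in> set Cs \<Longrightarrow> C \<noteq> {} \<and> finite C" and ne: "map card Bs \<noteq> map card Cs"
  shows "nu (zip Bs zs) = \<zero>\<^bsub>V (set Bs)\<^esub>"
proof -
  obtain i where i: "i < length Bs" "card (Bs ! i) \<noteq> card (Cs ! i)"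
    using ne len by (metis length_map nth_equalityI nth_map)
  have "Bs ! i \<in> set Bs" "Cs ! i \<in> set Cs" using i len by auto
  then have "card (Bs ! i) > 0" "card (Cs ! i) > 0"
    using Bs card by (auto simp: block_list_def block_family_def card_gt_0_iff intro: finite_subset[OF Union_upper])
  \<comment> \<open>Nonemptiness of the blocks is essential: truncated subtraction would identify
    the sizes \<open>0\<close> and \<open>1\<close>.\<close>
  then have "card (Bs ! i) - 1 \<noteq> card (Cs ! i) - 1" using i by simp
  moreover have "zs ! i \<in> homogeneous M (card (Cs ! i) - 1)"
    using zs i len by (simp add: list_all2_conv_all_nth)
  ultimately show ?thesis
    using homlist_idx[OF zs] len i by (intro nu_eq_zero[OF Bs, of zs i]) (auto simp: homogeneous_def)
qed

lemma block_list_mem: "block_list Bs \<Longrightarrow> B \<in> set Bs \<Longrightarrow> B \<noteq> {} \<and> finite B"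
  by (auto simp: block_list_def block_family_def intro: finite_subset[OF Union_upper])

text \<open>Together with \<open>nuhat_theta\<close> this makes the composites of
  \<open>theta\<close> and \<open>nuhat\<close> for different size sequences orthogonal
  idempotents.\<close>

lemma nuhat_theta_other:
  assumes Bs: "block_list Bs" and Cs: "block_list Cs" and len: "length Cs = length Bs"
    and ne: "map card Bs \<noteq> map card Cs" and y: "y \<in> carrier (V (set Cs))"
  shows "nuhat Bs (theta Cs y) = \<zero>\<^bsub>V (set Bs)\<^esub>"
proof (rule V_hom_eqI[OF Cs V_blocks[OF Bs] _ module_hom_const_zero[OF V_blocks[OF Bs]] _ y])
  show "(\<lambda>y. nuhat Bs (theta Cs y)) \<in> module_hom K (V (set Cs)) (V (set Bs))"
    using nuhat_hom[OF Bs] len by (intro module_hom_compose[OF theta_hom[OF Cs]]) simp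
  fix zs assume zs: "homlist Cs zs"
  then have "theta Cs (nu (zip Cs zs)) = pure (length Bs) zs"
    using theta_nu[OF Cs] len by simp
  then show "nuhat Bs (theta Cs (nu (zip Cs zs))) = \<zero>\<^bsub>V (set Bs)\<^esub>"
    using nuhat_pure[OF Bs, of zs] homlist_idx[OF zs] len
      nu_homlist_degree[OF Bs zs len block_list_mem[OF Cs] ne] by simp
qed

text \<open>A pure tensor is linear in each entry, and homogeneous vectors span the direct sum; so
  the entries can be replaced by homogeneous ones one at a time.\<close>

lemma pure_homogeneous_span:
  assumes H: "submodule H K (T r)"
    and pure: "\<And>zs. \<lbrakk>length zs = r; \<And>i. i < r \<Longrightarrow> \<exists>d. zs ! i \<in> homogeneous M d\<rbrakk> \<Longrightarrow> pure r zs \<in> H"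
  shows "carrier (T r) \<subseteq> H"
proof (rule T_span[OF H])
  \<comment> \<open>The entries before position \<open>k\<close> are arbitrary, the others
    homogeneous. The case \<open>k = 0\<close> is the assumption, the case \<open>k = r\<close> the
    goal.\<close>
  have "\<forall>zs \<in> idx r. (\<forall>i. k \<le> i \<and> i < r \<longrightarrow> (\<exists>d. zs ! i \<in> homogeneous M d)) \<longrightarrow> pure r zs \<in> H" for k
  proof (induction k)
    case 0
    then show ?case using pure by (auto simp: idx_iff)
  next
    case (Suc k)
    show ?case
    proof (intro ballI impI)
      fix zs assume zs: "zs \<in> idx r" and hom: "\<forall>i. Suc k \<le> i \<and> i < r \<longrightarrow> (\<exists>d. zs ! i \<in> homogeneous M d)"
      show "pure r zs \<in> H"
      proof (cases "k < r")
        case True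
        have "carrier D \<subseteq> {z \<in> carrier D. pure r (zs[k := z]) \<in> H}"
        proof (rule direct_sum_span[OF K module_M])
          show "submodule {z \<in> carrier D. pure r (zs[k := z]) \<in> H} K D"
            by (rule submodule_vimage[OF pure_update_hom[OF zs True] module_D module_T H])
          show "homogeneous M d \<subseteq> {z \<in> carrier D. pure r (zs[k := z]) \<in> H}" for d
          proof
            fix z assume z: "z \<in> homogeneous M d"
            then have zD: "z \<in> carrier D" using homogeneous_subset_D by auto
            have "pure r (zs[k := z]) \<in> H"
            proof (rule Suc.IH[rule_format])
              show "zs[k := z] \<in> idx r"
                using zs zD set_update_subset_insert[of zs k z] by (auto simp: idx_iff)
              show "\<exists>d. zs[k := z] ! i \<in> homogeneous M d" if "k \<le> i \<and> i < r" for i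
                using that z hom zs by (cases "i = k") (auto simp: idx_iff)
            qed
            then show "z \<in> {z \<in> carrier D. pure r (zs[k := z]) \<in> H}" using zD by simp
          qed
        qed
        moreover have "zs ! k \<in> carrier D" using zs True by (auto simp: idx_iff)
        ultimately show ?thesis by auto
      next
        case False
        then show ?thesis using Suc.IH zs by auto
      qed
    qed
  qed
  from this[of r] show "pure r zs \<in> H" if "zs \<in> idx r" for zs using that by auto
qed

text \<open>A model block list for each degree sequence, with a block of \<open>ds ! j + 1\<close>
  points in position \<open>j\<close>. The first component of the encoded pairs keeps the blocks
  disjoint.\<close>

definition std :: "nat list \<Rightarrow> nat set list" where
  "std ds = map (\<lambda>j. (\<lambda>k. prod_encode (j, k)) ` {..ds ! j}) [0..<length ds]"

lemma std_length [simp]: "length (std ds) = length ds"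
  by (simp add: std_def)

lemma std_card: "map card (std ds) = map Suc ds"
proof (rule nth_equalityI)
  show "map card (std ds) ! i = map Suc ds ! i" if "i < length (map card (std ds))" for i
    using that by (simp add: std_def card_image inj_on_def)
qed simp

lemma block_list_std: "block_list (std ds)"
proof -
  have "distinct (std ds)"
  proof -
    have "j = j'" if "(\<lambda>k. prod_encode (j, k)) ` {..ds ! j} = (\<lambda>k. prod_encode (j', k)) ` {..ds ! j'}" for j j'
    proof -
      have "prod_encode (j, 0) \<in> (\<lambda>k. prod_encode (j', k)) ` {..ds ! j'}"
        unfolding that[symmetric] by auto
      then show ?thesis by auto
    qed
    then show ?thesis
      unfolding std_def by (auto simp: distinct_map inj_on_def)
  qed
  moreover have "disjoint (set (std ds))"
    unfolding std_def by (auto simp: disjoint_def)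
  ultimately show ?thesis
    by (auto simp: block_list_def block_family_def std_def)
qed

text \<open>Bijections between corresponding blocks glue because the blocks are disjoint. Hence the
  lists \<open>std ds\<close> represent all block lists up to an injection.\<close>

lemma block_list_transport:
  assumes "block_list Bs" "block_list Cs" "map card Bs = map card Cs"
  shows "\<exists>f. inj_on f (\<Union>(set Bs)) \<and> map (image f) Bs = Cs"
  using assms
proof (induction Bs arbitrary: Cs)
  case Nil
  then show ?case by simp
next
  case (Cons B Bs)
  obtain C Cs' where C: "Cs = C # Cs'" using Cons.prems(3) by (cases Cs) auto
  have "block_list Bs" "block_list Cs'" "map card Bs = map card Cs'"
    using Cons.prems by (auto simp: C block_list_Cons)
  from Cons.IH[OF this] obtain f where f: "inj_on f (\<Union>(set Bs))" "map (image f) Bs = Cs'"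
    by (elim exE conjE)
  have fin: "finite B" "finite C" "card B = card C" "B \<inter> \<Union>(set Bs) = {}" "C \<inter> \<Union>(set Cs') = {}"
    using Cons.prems by (auto simp: C block_list_Cons)
  from finite_same_card_bij[OF fin(1,2,3)] obtain g where g: "bij_betw g B C" ..
  define h where "h x = (if x \<in> B then g x else f x)" for x
  have hB: "h ` B = C" using g by (auto simp: bij_betw_def h_def)
  have hx: "h x = f x" if "x \<in> X" "X \<in> set Bs" for x X using that fin(4) by (auto simp: h_def)
  have hBs: "map (image h) Bs = Cs'"
    unfolding f(2)[symmetric] by (intro map_cong refl image_cong hx)
  have "inj_on h B" using g by (auto simp: bij_betw_def inj_on_def h_def)
  moreover have "inj_on h (\<Union>(set Bs))" using f(1) hx by (auto simp: inj_on_def)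
  moreover have "h ` \<Union>(set Bs) = \<Union>(set Cs')"
    unfolding hBs[symmetric] by auto
  moreover have "B - \<Union>(set Bs) = B" "\<Union>(set Bs) - B = \<Union>(set Bs)"
    using fin(4) by auto
  ultimately have "inj_on h (B \<union> \<Union>(set Bs))"
    using fin(5) hB by (simp add: inj_on_Un)
  then show ?case using hB hBs by (intro exI[of _ h]) (simp add: C)
qed

text \<open>\<open>theta\<close> is linear, and it sends the generators of \<open>nu_span\<close> to
  homogeneous pure tensors; so these control its whole image.\<close>

lemma theta_span:
  assumes Bs: "block_list Bs" and y: "y \<in> carrier (V (set Bs))" and H: "submodule H K (T (length Bs))"
    and pure: "\<And>zs. homlist Bs zs \<Longrightarrow> pure (length Bs) zs \<in> H"
  shows "theta Bs y \<in> H"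
proof -
  have "carrier (V (set Bs)) \<subseteq> {y \<in> carrier (V (set Bs)). theta Bs y \<in> H}"
  proof (rule nu_span[OF Bs submodule_vimage[OF theta_hom[OF Bs] V_blocks[OF Bs] module_T H]])
    fix zs assume zs: "homlist Bs zs"
    then have "nu (zip Bs zs) \<in> carrier (V (set Bs))"
      by (intro nu_zip_closed[OF Bs homlist_idx])
    then show "nu (zip Bs zs) \<in> {y \<in> carrier (V (set Bs)). theta Bs y \<in> H}"
      using theta_nu[OF Bs zs] pure[OF zs] by simp
  qed
  then show ?thesis using y by auto
qed

text \<open>A tensor is the sum of its multihomogeneous parts, only finitely many of which matter.
  The claim is made for all finite index sets above some \<open>F0\<close>, so that two tensors can
  be expanded over a common set; this is what makes it additive.\<close>

lemma T_expand:
  assumes t: "t \<in> carrier (T r)"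
  shows "\<exists>F0 \<subseteq> {ds. length ds = r}. finite F0 \<and>
    (\<forall>F. finite F \<and> F0 \<subseteq> F \<and> F \<subseteq> {ds. length ds = r} \<longrightarrow>
      t = finsum (T r) (\<lambda>ds. theta (std ds) (nuhat (std ds) t)) F)"
proof -
  interpret T: module K "T r" by (rule module_T)
  \<comment> \<open>The projection onto the part with degree sequence \<open>ds\<close>.\<close>
  define p where "p ds t = theta (std ds) (nuhat (std ds) t)" for ds t
  have p_hom: "p ds \<in> module_hom K (T r) (T r)" if "length ds = r" for ds
    using module_hom_compose[OF nuhat_hom[OF block_list_std] theta_hom[OF block_list_std], of ds] that
    by (simp add: p_def[abs_def])
  define good where "good t F0 \<longleftrightarrow> F0 \<subseteq> {ds. length ds = r} \<and> finite F0 \<and>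
    (\<forall>F. finite F \<and> F0 \<subseteq> F \<and> F \<subseteq> {ds. length ds = r} \<longrightarrow> t = finsum (T r) (\<lambda>ds. p ds t) F)" for t F0
  let ?H = "{t \<in> carrier (T r). \<exists>F0. good t F0}"
  have "carrier (T r) \<subseteq> ?H"
  proof (rule pure_homogeneous_span)
    show "submodule ?H K (T r)"
    proof (rule submoduleI'[OF module_T])
      have "good \<zero>\<^bsub>T r\<^esub> {}"
        unfolding good_def
      proof (intro conjI allI impI)
        fix F :: "nat list set" assume F: "finite F \<and> {} \<subseteq> F \<and> F \<subseteq> {ds. length ds = r}"
        have "finsum (T r) (\<lambda>ds. p ds \<zero>\<^bsub>T r\<^esub>) F = finsum (T r) (\<lambda>ds. \<zero>\<^bsub>T r\<^esub>) F"
          using F module_hom_zero[OF p_hom module_T module_T] by (intro T.M.finsum_cong') auto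
        then show "\<zero>\<^bsub>T r\<^esub> = finsum (T r) (\<lambda>ds. p ds \<zero>\<^bsub>T r\<^esub>) F" by (simp add: T.M.finsum_zero)
      qed auto
      then show "\<zero>\<^bsub>T r\<^esub> \<in> ?H" by auto
      show "s \<oplus>\<^bsub>T r\<^esub> t \<in> ?H" if st: "s \<in> ?H" "t \<in> ?H" for s t
      proof -
        from st obtain F G where FG: "good s F" "good t G" and c: "s \<in> carrier (T r)" "t \<in> carrier (T r)"
          by auto
        have "good (s \<oplus>\<^bsub>T r\<^esub> t) (F \<union> G)"
          unfolding good_def
        proof (intro conjI allI impI)
          fix E :: "nat list set" assume E: "finite E \<and> F \<union> G \<subseteq> E \<and> E \<subseteq> {ds. length ds = r}"
          have "finsum (T r) (\<lambda>ds. p ds (s \<oplus>\<^bsub>T r\<^esub> t)) E = finsum (T r) (\<lambda>ds. p ds s \<oplus>\<^bsub>T r\<^esub> p ds t) E"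
            using E c module_hom_add[OF p_hom]
            by (intro T.M.finsum_cong') (auto intro!: module_hom_closed[OF p_hom] simp: subset_iff)
          also have "\<dots> = finsum (T r) (\<lambda>ds. p ds s) E \<oplus>\<^bsub>T r\<^esub> finsum (T r) (\<lambda>ds. p ds t) E"
            using E c by (intro T.M.finsum_addf) (auto intro!: module_hom_closed[OF p_hom])
          also have "\<dots> = s \<oplus>\<^bsub>T r\<^esub> t"
            using FG E by (auto simp: good_def)
          finally show "s \<oplus>\<^bsub>T r\<^esub> t = finsum (T r) (\<lambda>ds. p ds (s \<oplus>\<^bsub>T r\<^esub> t)) E" ..
        qed (use FG in \<open>auto simp: good_def\<close>)
        then show ?thesis using c by auto
      qed
      show "a \<odot>\<^bsub>T r\<^esub> t \<in> ?H" if at: "a \<in> carrier K" "t \<in> ?H" for a t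
      proof -
        from at obtain F where F: "good t F" and c: "t \<in> carrier (T r)" by auto
        have "good (a \<odot>\<^bsub>T r\<^esub> t) F"
          unfolding good_def
        proof (intro conjI allI impI)
          fix E :: "nat list set" assume E: "finite E \<and> F \<subseteq> E \<and> E \<subseteq> {ds. length ds = r}"
          have "finsum (T r) (\<lambda>ds. p ds (a \<odot>\<^bsub>T r\<^esub> t)) E = finsum (T r) (\<lambda>ds. a \<odot>\<^bsub>T r\<^esub> p ds t) E"
            using E c at module_hom_smult[OF p_hom]
            by (intro T.M.finsum_cong') (auto intro!: module_hom_closed[OF p_hom] simp: subset_iff)
          also have "\<dots> = a \<odot>\<^bsub>T r\<^esub> finsum (T r) (\<lambda>ds. p ds t) E"
            using E c at
            by (intro T.finsum_smult_ldistr[symmetric]) (auto intro!: module_hom_closed[OF p_hom])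
          also have "finsum (T r) (\<lambda>ds. p ds t) E = t"
            using F E by (auto simp: good_def)
          finally show "a \<odot>\<^bsub>T r\<^esub> t = finsum (T r) (\<lambda>ds. p ds (a \<odot>\<^bsub>T r\<^esub> t)) E" ..
        qed (use F in \<open>auto simp: good_def\<close>)
        then show ?thesis using c at by auto
      qed
    qed auto
    fix zs assume len: "length zs = r" and hom: "\<And>i. i < r \<Longrightarrow> \<exists>d. zs ! i \<in> homogeneous M d"
    obtain d where d: "\<And>i. i < r \<Longrightarrow> zs ! i \<in> homogeneous M (d i)" using hom by metis
    define ds where "ds = map d [0..<r]"
    have lds: "length ds = r" by (simp add: ds_def)
    have cstd: "card (std ds' ! i) - 1 = ds' ! i" if "i < length ds'" for ds' i
      using arg_cong[OF std_card[of ds'], of "\<lambda>l. l ! i"] that by simp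
    have hl: "homlist (std ds) zs"
      using d len cstd[of _ ds] by (simp add: list_all2_conv_all_nth lds) (simp add: ds_def)
    have zs: "zs \<in> idx r" using homlist_idx[OF hl] lds by simp
    have pds: "p ds (pure r zs) = pure r zs"
      using theta_nu[OF block_list_std hl] nuhat_pure[OF block_list_std, of zs ds] zs lds by (simp add: p_def)
    \<comment> \<open>A homogeneous pure tensor has a single multihomogeneous part, so the
      one-element set \<open>{ds}\<close> serves as \<open>F0\<close> for it.\<close>
    have other: "p ds' (pure r zs) = \<zero>\<^bsub>T r\<^esub>" if l: "length ds' = r" and ne: "ds' \<noteq> ds" for ds'
    proof -
      have "map card (std ds') \<noteq> map card (std ds)"
        unfolding std_card using ne by (metis inj_Suc inj_map_eq_map)
      then have "nu (zip (std ds') zs) = \<zero>\<^bsub>V (set (std ds'))\<^esub>"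
        using l lds by (intro nu_homlist_degree[OF block_list_std hl _ block_list_mem[OF block_list_std]]) auto
      then show ?thesis
        using nuhat_pure[OF block_list_std, of zs ds'] zs l
          module_hom_zero[OF theta_hom[OF block_list_std] V_blocks[OF block_list_std] module_T, of ds']
        by (simp add: p_def)
    qed
    have "good (pure r zs) {ds}"
      unfolding good_def
    proof (intro conjI allI impI)
      fix F assume F: "finite F \<and> {ds} \<subseteq> F \<and> F \<subseteq> {ds. length ds = r}"
      have "finsum (T r) (\<lambda>ds. p ds (pure r zs)) F = finsum (T r) (\<lambda>c. if ds = c then pure r zs else \<zero>\<^bsub>T r\<^esub>) F"
        using F pds other pure_closed by (intro T.M.finsum_cong') auto
      also have "\<dots> = pure r zs"
        using F T.M.finsum_singleton[of ds F "\<lambda>_. pure r zs"] pure_closed by auto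
      finally show "pure r zs = finsum (T r) (\<lambda>ds. p ds (pure r zs)) F" ..
    qed (use lds in auto)
    then show "pure r zs \<in> ?H" using pure_closed by auto
  qed
  then have "t \<in> ?H" using t by auto
  then show ?thesis unfolding good_def p_def by blast
qed

text \<open>The multihomogeneous parts of a tensor are computed from its evaluations, and it is the
  sum of these parts.\<close>

lemma nuhat_inject:
  assumes s: "s \<in> carrier (T r)" and t: "t \<in> carrier (T r)"
    and eq: "\<And>Bs. \<lbrakk>block_list Bs; length Bs = r\<rbrakk> \<Longrightarrow> nuhat Bs s = nuhat Bs t"
  shows "s = t"
proof -
  interpret T: module K "T r" by (rule module_T)
  from T_expand[OF s] obtain F where F: "F \<subseteq> {ds. length ds = r}" "finite F"
    "\<forall>E. finite E \<and> F \<subseteq> E \<and> E \<subseteq> {ds. length ds = r} \<longrightarrow>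
      s = finsum (T r) (\<lambda>ds. theta (std ds) (nuhat (std ds) s)) E"
    by (elim exE conjE) (rule that; assumption)
  from T_expand[OF t] obtain G where G: "G \<subseteq> {ds. length ds = r}" "finite G"
    "\<forall>E. finite E \<and> G \<subseteq> E \<and> E \<subseteq> {ds. length ds = r} \<longrightarrow>
      t = finsum (T r) (\<lambda>ds. theta (std ds) (nuhat (std ds) t)) E"
    by (elim exE conjE) (rule that; assumption)
  \<comment> \<open>The index set is the union of those of \<open>s\<close> and \<open>t\<close>;
    both expansions are valid over it.\<close>
  have "s = finsum (T r) (\<lambda>ds. theta (std ds) (nuhat (std ds) s)) (F \<union> G)"
    using F G by (intro F(3)[rule_format]) auto
  also have "\<dots> = finsum (T r) (\<lambda>ds. theta (std ds) (nuhat (std ds) t)) (F \<union> G)"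
  proof (rule T.M.finsum_cong'[OF refl])
    show "theta (std ds) (nuhat (std ds) s) = theta (std ds) (nuhat (std ds) t)" if "ds \<in> F \<union> G" for ds
      using that F(1) G(1) eq[OF block_list_std] by auto
    show "(\<lambda>ds. theta (std ds) (nuhat (std ds) t)) \<in> F \<union> G \<rightarrow> carrier (T r)"
    proof (rule Pi_I)
      fix ds assume "ds \<in> F \<union> G"
      then have l: "length ds = r" using F(1) G(1) by auto
      show "theta (std ds) (nuhat (std ds) t) \<in> carrier (T r)"
        using theta_closed[OF block_list_std nuhat_closed[OF block_list_std], of t ds] t l by simp
    qed
  qed
  also have "\<dots> = t"
    using F G by (intro G(3)[rule_format, symmetric]) auto
  finally show ?thesis .
qed

end

text \<open>Transport of structure along a bijection. The target enters as a bare record, so the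
  axioms need checking only for the algebra of families and are inherited by both sides of the
  theorem.\<close>

lemma graded_algebra_image:
  assumes A: "graded_algebra K A G" and bij: "bij_betw \<phi> (carrier A) (carrier B)"
    and add: "\<And>x y. \<lbrakk>x \<in> carrier A; y \<in> carrier A\<rbrakk> \<Longrightarrow> \<phi> (x \<oplus>\<^bsub>A\<^esub> y) = \<phi> x \<oplus>\<^bsub>B\<^esub> \<phi> y"
    and mult: "\<And>x y. \<lbrakk>x \<in> carrier A; y \<in> carrier A\<rbrakk> \<Longrightarrow> \<phi> (x \<otimes>\<^bsub>A\<^esub> y) = \<phi> x \<otimes>\<^bsub>B\<^esub> \<phi> y"
    and smult: "\<And>a x. \<lbrakk>a \<in> carrier K; x \<in> carrier A\<rbrakk> \<Longrightarrow> \<phi> (a \<odot>\<^bsub>A\<^esub> x) = a \<odot>\<^bsub>B\<^esub> \<phi> x"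
    and one: "\<phi> \<one>\<^bsub>A\<^esub> = \<one>\<^bsub>B\<^esub>" and zero: "\<phi> \<zero>\<^bsub>A\<^esub> = \<zero>\<^bsub>B\<^esub>"
    and H: "\<And>n. H n = \<phi> ` G n"
  shows "graded_algebra K B H"
proof -
  interpret A: algebra K A using A by (simp add: graded_algebra_def)
  have mA: "module K A" by (rule A.module)
  have img: "\<phi> ` carrier A = carrier B" and inj: "inj_on \<phi> (carrier A)"
    using bij by (auto simp: bij_betw_def)
  have \<phi>c: "\<phi> x \<in> carrier B" if "x \<in> carrier A" for x using img that by auto
  have mB: "module K B" by (rule module_surj_image[OF mA img add smult zero])
  have hom: "\<phi> \<in> module_hom K A B" using \<phi>c add smult by (intro module_homI)
  have "\<phi> \<in> ring_iso A B"
    using bij by (auto simp: ring_iso_def ring_hom_def \<phi>c add mult one)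
  \<comment> \<open>A \<open>ring_iso\<close> does not speak of the zero field, so the transported
    ring carries the image of zero there; by assumption this is the zero of
    \<open>B\<close>.\<close>
  then have "cring (B\<lparr>zero := \<phi> \<zero>\<^bsub>A\<^esub>\<rparr>)"
    using A.M_cring by (intro cring.ring_iso_imp_img_cring)
  then have cB: "cring B" by (simp add: zero)
  interpret B: module K B by (rule mB)
  have "algebra K B"
  proof (rule algebraI[OF A.R_cring cB])
    fix a x y assume a: "a \<in> carrier K" and "x \<in> carrier B" "y \<in> carrier B"
    then obtain x' y' where xy: "x' \<in> carrier A" "y' \<in> carrier A" "x = \<phi> x'" "y = \<phi> y'"
      using img by (metis imageE)
    show "(a \<odot>\<^bsub>B\<^esub> x) \<otimes>\<^bsub>B\<^esub> y = a \<odot>\<^bsub>B\<^esub> (x \<otimes>\<^bsub>B\<^esub> y)"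
      using a xy by (simp flip: smult mult add: A.smult_assoc2)
  qed (auto simp: B.smult_l_distr B.smult_r_distr B.smult_assoc1)
  moreover have "submodule (H n) K B" for n
    unfolding H using A by (intro submodule_image[OF hom mA mB]) (simp add: graded_algebra_def)
  moreover have "\<exists>!c. (\<forall>n. c n \<in> H n) \<and> finite {n. c n \<noteq> \<zero>\<^bsub>B\<^esub>} \<and> y = finsum B c {n. c n \<noteq> \<zero>\<^bsub>B\<^esub>}"
    if y: "y \<in> carrier B" for y
  proof -
    from y obtain x where x: "x \<in> carrier A" "y = \<phi> x" using img by auto
    have GA: "G n \<subseteq> carrier A" for n
      using A submodule_subset[of "G n" K A] by (simp add: graded_algebra_def)
    have supp: "\<phi> z = \<zero>\<^bsub>B\<^esub> \<longleftrightarrow> z = \<zero>\<^bsub>A\<^esub>" if "z \<in> carrier A" for z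
      using inj that zero by (metis A.M.zero_closed inj_onD)
    \<comment> \<open>Since \<open>\<phi>\<close> is injective, a component vanishes exactly when
      its image does, and both sums run over the same support.\<close>
    have key: "\<phi> (finsum A c {n. c n \<noteq> \<zero>\<^bsub>A\<^esub>}) = finsum B (\<lambda>n. \<phi> (c n)) {n. \<phi> (c n) \<noteq> \<zero>\<^bsub>B\<^esub>}"
      if "\<forall>n. c n \<in> G n" for c
      using that GA supp module_hom_finsum[OF hom mA mB, of "{n. c n \<noteq> \<zero>\<^bsub>A\<^esub>}" c]
      by (smt (verit, best) Collect_cong subsetD)
    have uniq: "\<exists>!c. (\<forall>n. c n \<in> G n) \<and> finite {n. c n \<noteq> \<zero>\<^bsub>A\<^esub>} \<and> x = finsum A c {n. c n \<noteq> \<zero>\<^bsub>A\<^esub>}"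
      using A x by (simp add: graded_algebra_def)
    then obtain c where c: "\<forall>n. c n \<in> G n" "finite {n. c n \<noteq> \<zero>\<^bsub>A\<^esub>}" "x = finsum A c {n. c n \<noteq> \<zero>\<^bsub>A\<^esub>}"
      by blast
    show ?thesis
    proof (rule ex1I[of _ "\<lambda>n. \<phi> (c n)"])
      have "{n. \<phi> (c n) \<noteq> \<zero>\<^bsub>B\<^esub>} = {n. c n \<noteq> \<zero>\<^bsub>A\<^esub>}" using supp c(1) GA by (metis subsetD)
      then show "(\<forall>n. \<phi> (c n) \<in> H n) \<and> finite {n. \<phi> (c n) \<noteq> \<zero>\<^bsub>B\<^esub>} \<and>
          y = finsum B (\<lambda>n. \<phi> (c n)) {n. \<phi> (c n) \<noteq> \<zero>\<^bsub>B\<^esub>}"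
        using c key[OF c(1)] x by (auto simp: H)
      fix d assume d: "(\<forall>n. d n \<in> H n) \<and> finite {n. d n \<noteq> \<zero>\<^bsub>B\<^esub>} \<and> y = finsum B d {n. d n \<noteq> \<zero>\<^bsub>B\<^esub>}"
      \<comment> \<open>Uniqueness is pulled back: lift the components of another decomposition to
        \<open>A\<close> and compare there.\<close>
      then have "\<forall>n. \<exists>z. z \<in> G n \<and> d n = \<phi> z" by (auto simp: H)
      then obtain c' where c': "\<And>n. c' n \<in> G n" "\<And>n. d n = \<phi> (c' n)" by metis
      have s: "{n. c' n \<noteq> \<zero>\<^bsub>A\<^esub>} = {n. d n \<noteq> \<zero>\<^bsub>B\<^esub>}" using supp c' GA by (metis subsetD)
      have fc: "finsum A c' {n. c' n \<noteq> \<zero>\<^bsub>A\<^esub>} \<in> carrier A"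
        using c'(1) GA by (intro A.M.finsum_closed) auto
      have "\<phi> (finsum A c' {n. c' n \<noteq> \<zero>\<^bsub>A\<^esub>}) = \<phi> x"
        using key[of c'] c'(1) d x(2) by (simp flip: c'(2))
      then have "x = finsum A c' {n. c' n \<noteq> \<zero>\<^bsub>A\<^esub>}"
        using inj x(1) fc by (metis inj_onD)
      then have "c' = c" using uniq c c'(1) s d by (metis (mono_tags, lifting))
      then show "d = (\<lambda>n. \<phi> (c n))" using c'(2) by auto
    qed
  qed
  moreover have "\<one>\<^bsub>B\<^esub> \<in> H 0" using A one by (auto simp: graded_algebra_def H intro!: image_eqI[of _ \<phi> "\<one>\<^bsub>A\<^esub>"])
  moreover have "x \<otimes>\<^bsub>B\<^esub> y \<in> H (i + j)" if xy: "x \<in> H i" "y \<in> H j" for i j x y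
  proof -
    obtain x' y' where x': "x' \<in> G i" "y' \<in> G j" "x = \<phi> x'" "y = \<phi> y'" using xy by (auto simp: H)
    then have "x' \<in> carrier A" "y' \<in> carrier A" "x' \<otimes>\<^bsub>A\<^esub> y' \<in> G (i + j)"
      using A submodule_subset[of "G i" K A] submodule_subset[of "G j" K A]
      by (auto simp: graded_algebra_def)
    then show ?thesis using x' by (auto simp: H mult intro!: image_eqI[of _ _ "x' \<otimes>\<^bsub>A\<^esub> y'"])
  qed
  ultimately show ?thesis by (simp add: graded_algebra_def)
qed

section \<open>The algebra of natural families\<close>

context block_species
begin

text \<open>The last clause stands for the finiteness in both direct sums: it bounds the number of
  tensor factors and their degrees on one side, and the number of nonzero degrees on the other.
  Extensionality makes equality a matter of values on block families.\<close>

definition family :: "(nat set set \<Rightarrow> 'v) \<Rightarrow> bool" where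
  "family u \<longleftrightarrow> u \<in> (\<Pi>\<^sub>E A\<in>Collect block_family. carrier (V A)) \<and>
     (\<forall>A f. block_family A \<longrightarrow> inj_on f (\<Union>A) \<longrightarrow> act f A (u A) = u (im f A)) \<and>
     (\<exists>n. \<forall>A. block_family A \<longrightarrow> card (\<Union>A) > n \<longrightarrow> u A = \<zero>\<^bsub>V A\<^esub>)"

definition families :: "('k, nat set set \<Rightarrow> 'v) module" where
  "families =
     \<lparr>carrier = Collect family,
      monoid.mult = (\<lambda>u v. \<lambda>A\<in>Collect block_family.
        finsum (V A) (\<lambda>S. star S (A - S) (u S) (v (A - S))) (Pow A)),
      one = (\<lambda>A\<in>Collect block_family. if A = {} then e else \<zero>\<^bsub>V A\<^esub>),
      zero = (\<lambda>A\<in>Collect block_family. \<zero>\<^bsub>V A\<^esub>),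
      add = (\<lambda>u v. \<lambda>A\<in>Collect block_family. u A \<oplus>\<^bsub>V A\<^esub> v A),
      smult = (\<lambda>a u. \<lambda>A\<in>Collect block_family. a \<odot>\<^bsub>V A\<^esub> u A)\<rparr>"

definition family_degree :: "nat \<Rightarrow> (nat set set \<Rightarrow> 'v) set" where
  "family_degree n = {u. family u \<and> (\<forall>A. block_family A \<longrightarrow> card (\<Union>A) \<noteq> n \<longrightarrow> u A = \<zero>\<^bsub>V A\<^esub>)}"

lemma family_closed: "family u \<Longrightarrow> block_family A \<Longrightarrow> u A \<in> carrier (V A)"
  by (auto simp: family_def)

lemma family_act: "family u \<Longrightarrow> block_family A \<Longrightarrow> inj_on f (\<Union>A) \<Longrightarrow> act f A (u A) = u (im f A)"
  by (auto simp: family_def)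

lemma family_bound:
  assumes "family u"
  obtains n where "\<And>A. block_family A \<Longrightarrow> card (\<Union>A) > n \<Longrightarrow> u A = \<zero>\<^bsub>V A\<^esub>"
  using assms by (auto simp: family_def)

lemma familyI:
  assumes "u \<in> extensional (Collect block_family)"
    and "\<And>A. block_family A \<Longrightarrow> u A \<in> carrier (V A)"
    and "\<And>A f. block_family A \<Longrightarrow> inj_on f (\<Union>A) \<Longrightarrow> act f A (u A) = u (im f A)"
    and "\<And>A. block_family A \<Longrightarrow> card (\<Union>A) > n \<Longrightarrow> u A = \<zero>\<^bsub>V A\<^esub>"
  shows "family u"
  using assms unfolding family_def PiE_def by blast

lemma family_eqI:
  assumes "family u" "family v" "\<And>A. block_family A \<Longrightarrow> u A = v A"
  shows "u = v"
proof (rule PiE_ext[where k = "Collect block_family" and s = "\<lambda>A. carrier (V A)"])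
  show "u \<in> (\<Pi>\<^sub>E A\<in>Collect block_family. carrier (V A))" using assms(1) by (simp add: family_def)
  show "v \<in> (\<Pi>\<^sub>E A\<in>Collect block_family. carrier (V A))" using assms(2) by (simp add: family_def)
qed (use assms(3) in simp)

lemma V_group: "block_family A \<Longrightarrow> abelian_group (V A)"
  by (rule moduleD_abelian_group[OF V])

lemma V_monoid: "block_family A \<Longrightarrow> abelian_monoid (V A)"
  by (rule abelian_group.axioms(1)[OF V_group])

lemmas V_zero [simp] = abelian_monoid.zero_closed[OF V_monoid]
  and V_add_closed = abelian_monoid.a_closed[OF V_monoid]

lemma act_zero: "block_family A \<Longrightarrow> inj_on f (\<Union>A) \<Longrightarrow> act f A \<zero>\<^bsub>V A\<^esub> = \<zero>\<^bsub>V (im f A)\<^esub>"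
  by (intro module_hom_zero[OF act_hom] V block_family_im)

lemma split_facts:
  assumes "block_family A" "S \<subseteq> A"
  shows "block_family S" "block_family (A - S)" "sep S (A - S)" "S \<union> (A - S) = A"
  using assms block_family_sep[OF assms(1), of S "A - S"] by (auto intro: block_family_subset)

lemma split_hom1:
  assumes "block_family A" "S \<subseteq> A" "y \<in> carrier (V (A - S))"
  shows "(\<lambda>x. star S (A - S) x y) \<in> module_hom K (V S) (V A)"
  using star_hom1[OF split_facts(1-3)[OF assms(1,2)] assms(3)] split_facts(4)[OF assms(1,2)] by simp

lemma split_hom2:
  assumes "block_family A" "S \<subseteq> A" "x \<in> carrier (V S)"
  shows "(\<lambda>y. star S (A - S) x y) \<in> module_hom K (V (A - S)) (V A)"
  using star_hom2[OF split_facts(1-3)[OF assms(1,2)] assms(3)] split_facts(4)[OF assms(1,2)] by simp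

lemma split_closed:
  assumes "block_family A" "S \<subseteq> A" "x \<in> carrier (V S)" "y \<in> carrier (V (A - S))"
  shows "star S (A - S) x y \<in> carrier (V A)"
  by (rule module_hom_closed[OF split_hom1[OF assms(1,2,4)] assms(3)])

lemma split_zero1:
  assumes "block_family A" "S \<subseteq> A" "y \<in> carrier (V (A - S))"
  shows "star S (A - S) \<zero>\<^bsub>V S\<^esub> y = \<zero>\<^bsub>V A\<^esub>"
  by (rule module_hom_zero[OF split_hom1[OF assms] V[OF split_facts(1)[OF assms(1,2)]] V[OF assms(1)]])

lemma split_zero2:
  assumes "block_family A" "S \<subseteq> A" "x \<in> carrier (V S)"
  shows "star S (A - S) x \<zero>\<^bsub>V (A - S)\<^esub> = \<zero>\<^bsub>V A\<^esub>"
  by (rule module_hom_zero[OF split_hom2[OF assms] V[OF split_facts(2)[OF assms(1,2)]] V[OF assms(1)]])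

lemma families_simps:
  "carrier families = Collect family"
  "u \<oplus>\<^bsub>families\<^esub> v = (\<lambda>A\<in>Collect block_family. u A \<oplus>\<^bsub>V A\<^esub> v A)"
  "\<zero>\<^bsub>families\<^esub> = (\<lambda>A\<in>Collect block_family. \<zero>\<^bsub>V A\<^esub>)"
  "a \<odot>\<^bsub>families\<^esub> u = (\<lambda>A\<in>Collect block_family. a \<odot>\<^bsub>V A\<^esub> u A)"
  "\<one>\<^bsub>families\<^esub> = (\<lambda>A\<in>Collect block_family. if A = {} then e else \<zero>\<^bsub>V A\<^esub>)"
  by (simp_all add: families_def)

lemma families_mult:
  "block_family A \<Longrightarrow>
    (u \<otimes>\<^bsub>families\<^esub> v) A = finsum (V A) (\<lambda>S. star S (A - S) (u S) (v (A - S))) (Pow A)"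
  by (simp add: families_def)

lemma family_zero: "family \<zero>\<^bsub>families\<^esub>"
  by (rule familyI[of _ 0]) (auto simp: families_simps act_zero block_family_im)

lemma family_add:
  assumes u: "family u" and v: "family v"
  shows "family (u \<oplus>\<^bsub>families\<^esub> v)"
proof -
  obtain n where n: "\<And>A. block_family A \<Longrightarrow> card (\<Union>A) > n \<Longrightarrow> u A = \<zero>\<^bsub>V A\<^esub>"
    using family_bound[OF u] by metis
  obtain m where m: "\<And>A. block_family A \<Longrightarrow> card (\<Union>A) > m \<Longrightarrow> v A = \<zero>\<^bsub>V A\<^esub>"
    using family_bound[OF v] by metis
  show ?thesis
  proof (rule familyI[of _ "n + m"])
    fix A and f :: "nat \<Rightarrow> nat" assume A: "block_family A" and f: "inj_on f (\<Union>A)"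
    show "act f A ((u \<oplus>\<^bsub>families\<^esub> v) A) = (u \<oplus>\<^bsub>families\<^esub> v) (im f A)"
      using u v A f
      by (simp add: families_simps block_family_im module_hom_add[OF act_hom] family_closed family_act)
  next
    fix A assume A: "block_family A" and c: "card (\<Union>A) > n + m"
    show "(u \<oplus>\<^bsub>families\<^esub> v) A = \<zero>\<^bsub>V A\<^esub>"
      using A c n[of A] m[of A] by (simp add: families_simps abelian_monoid.l_zero[OF V_monoid])
  qed (auto simp: families_simps V_add_closed family_closed u v)
qed

lemma family_smult:
  assumes a: "a \<in> carrier K" and u: "family u"
  shows "family (a \<odot>\<^bsub>families\<^esub> u)"
proof -
  obtain n where n: "\<And>A. block_family A \<Longrightarrow> card (\<Union>A) > n \<Longrightarrow> u A = \<zero>\<^bsub>V A\<^esub>"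
    using family_bound[OF u] by metis
  show ?thesis
  proof (rule familyI[of _ n])
    fix A and f :: "nat \<Rightarrow> nat" assume A: "block_family A" and f: "inj_on f (\<Union>A)"
    show "act f A ((a \<odot>\<^bsub>families\<^esub> u) A) = (a \<odot>\<^bsub>families\<^esub> u) (im f A)"
      using u a A f
      by (simp add: families_simps block_family_im module_hom_smult[OF act_hom] family_closed family_act)
  qed (auto simp: families_simps family_closed u a n module.smult_closed[OF V] module.smult_r_null[OF V])
qed

lemma families_subset: "carrier families \<subseteq> (\<Pi>\<^sub>E A\<in>Collect block_family. carrier (V A))"
  by (simp add: families_simps family_def subset_iff)

lemma module_families: "module K families"
proof (rule pointwise_module[OF K _ families_subset])
  show "\<zero>\<^bsub>families\<^esub> \<in> carrier families" using family_zero by (simp add: families_simps(1))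
  show "u \<oplus>\<^bsub>families\<^esub> v \<in> carrier families" if "u \<in> carrier families" "v \<in> carrier families" for u v
    using that family_add by (simp add: families_simps(1))
  show "a \<odot>\<^bsub>families\<^esub> u \<in> carrier families" if "a \<in> carrier K" "u \<in> carrier families" for a u
    using that family_smult by (simp add: families_simps(1))
qed (simp_all add: V families_simps)

lemma families_eval: "block_family A \<Longrightarrow> (\<lambda>u. u A) \<in> module_hom K families (V A)"
  by (rule pointwise_eval[OF families_subset]) (simp_all add: families_simps)

lemma family_one: "family \<one>\<^bsub>families\<^esub>"
proof (rule familyI[of _ 0])
  fix A and f :: "nat \<Rightarrow> nat" assume "block_family A" "inj_on f (\<Union>A)"
  then show "act f A (\<one>\<^bsub>families\<^esub> A) = \<one>\<^bsub>families\<^esub> (im f A)"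
    by (auto simp: families_simps act_zero block_family_im act_ident[of "{}" f e] e_closed)
qed (auto simp: families_simps e_closed)

section \<open>The product of families\<close>

lemma mult_term_closed:
  assumes "family u" "family v" "block_family A" "S \<subseteq> A"
  shows "star S (A - S) (u S) (v (A - S)) \<in> carrier (V A)"
  by (rule split_closed[OF assms(3,4) family_closed[OF assms(1) split_facts(1)[OF assms(3,4)]]
        family_closed[OF assms(2) split_facts(2)[OF assms(3,4)]]])

lemma star_split_act:
  assumes u: "family u" and v: "family v" and A: "block_family A" and f: "inj_on f (\<Union>A)" and S: "S \<subseteq> A"
  shows "act f A (star S (A - S) (u S) (v (A - S))) =
    star (im f S) (im f A - im f S) (u (im f S)) (v (im f A - im f S))"
proof -
  have inj: "inj_on (image f) A"
    using f by (intro inj_onI) (metis Sup_upper inj_on_image_eq_iff)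
  have d: "im f (A - S) = im f A - im f S"
    using S inj by (simp add: inj_on_image_set_diff[OF inj])
  have fS: "inj_on f (\<Union>S)" "inj_on f (\<Union>(A - S))"
    using S by (auto intro!: inj_on_subset[OF f])
  have "act f A (star S (A - S) (u S) (v (A - S))) =
      star (im f S) (im f (A - S)) (act f S (u S)) (act f (A - S) (v (A - S)))"
    using star_act[of S "A - S" f "u S" "v (A - S)"] split_facts[OF A S] f u v
    by (simp add: family_closed Un_absorb1[OF Union_mono[OF S]])
  also have "\<dots> = star (im f S) (im f A - im f S) (u (im f S)) (v (im f A - im f S))"
    using split_facts[OF A S] fS u v by (simp add: family_act d)
  finally show ?thesis .
qed

lemma im_Pow: "inj_on f (\<Union>A) \<Longrightarrow> bij_betw (im f) (Pow A) (Pow (im f A))"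
proof -
  assume f: "inj_on f (\<Union>A)"
  have "inj_on (image f) A"
    using f by (intro inj_onI) (metis Sup_upper inj_on_image_eq_iff)
  then show ?thesis by (intro bij_betw_Pow) (simp add: bij_betw_def)
qed

text \<open>Restricting the sum to the \<open>S\<close> with \<open>card (\<Union>S) \<in> I\<close> covers both the product and its
  bihomogeneous parts.\<close>

lemma mult_natural:
  assumes u: "family u" and v: "family v" and A: "block_family A" and f: "inj_on f (\<Union>A)"
  shows "act f A (finsum (V A) (\<lambda>S. star S (A - S) (u S) (v (A - S))) {S \<in> Pow A. card (\<Union>S) \<in> I}) =
    finsum (V (im f A)) (\<lambda>S. star S (im f A - S) (u S) (v (im f A - S))) {S \<in> Pow (im f A). card (\<Union>S) \<in> I}"
proof -
  interpret VA: abelian_monoid "V A" by (rule V_monoid[OF A])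
  interpret VB: abelian_monoid "V (im f A)" by (rule V_monoid[OF block_family_im[OF A f]])
  let ?I = "{S \<in> Pow A. card (\<Union>S) \<in> I}"
  have card: "card (\<Union>(im f S)) = card (\<Union>S)" if "S \<subseteq> A" for S
    unfolding Union_im using that by (intro card_image inj_on_subset[OF f]) auto
  have img: "im f ` ?I = {S \<in> Pow (im f A). card (\<Union>S) \<in> I}"
    using im_Pow[OF f] card unfolding bij_betw_def by (auto simp: image_iff) (metis subset_imageE)
  have inj: "inj_on (im f) ?I"
    using im_Pow[OF f] unfolding bij_betw_def by (auto intro: inj_on_subset)
  have "act f A (finsum (V A) (\<lambda>S. star S (A - S) (u S) (v (A - S))) ?I) =
      finsum (V (im f A)) (\<lambda>S. act f A (star S (A - S) (u S) (v (A - S)))) ?I"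
    using A f u v
    by (intro module_hom_finsum[OF act_hom] V block_family_im mult_term_closed) auto
  also have "\<dots> = finsum (V (im f A)) (\<lambda>S. star (im f S) (im f A - im f S) (u (im f S)) (v (im f A - im f S))) ?I"
    using A f u v block_family_im[OF A f]
    by (intro VB.finsum_cong') (auto simp: star_split_act intro!: mult_term_closed)
  also have "\<dots> = finsum (V (im f A)) (\<lambda>S. star S (im f A - S) (u S) (v (im f A - S))) (im f ` ?I)"
  proof (rule VB.finsum_reindex[OF _ inj, symmetric])
    show "(\<lambda>S. star S (im f A - S) (u S) (v (im f A - S))) \<in> im f ` ?I \<rightarrow> carrier (V (im f A))"
      unfolding img using mult_term_closed[OF u v block_family_im[OF A f]] by auto
  qed
  finally show ?thesis unfolding img .
qed

lemma family_mult:
  assumes u: "family u" and v: "family v"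
  shows "family (u \<otimes>\<^bsub>families\<^esub> v)"
proof -
  obtain n where n: "\<And>A. block_family A \<Longrightarrow> card (\<Union>A) > n \<Longrightarrow> u A = \<zero>\<^bsub>V A\<^esub>"
    using family_bound[OF u] by metis
  obtain m where m: "\<And>A. block_family A \<Longrightarrow> card (\<Union>A) > m \<Longrightarrow> v A = \<zero>\<^bsub>V A\<^esub>"
    using family_bound[OF v] by metis
  show ?thesis
  \<comment> \<open>If \<open>A\<close> has more than \<open>n + m\<close> points, then for every
    splitting one part exceeds the bound of its factor.\<close>
  proof (rule familyI[of _ "n + m"])
    show "u \<otimes>\<^bsub>families\<^esub> v \<in> extensional (Collect block_family)" by (simp add: families_def)
    fix A assume A: "block_family A"
    interpret VA: abelian_monoid "V A" by (rule V_monoid[OF A])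
    show "(u \<otimes>\<^bsub>families\<^esub> v) A \<in> carrier (V A)"
      using mult_term_closed[OF u v A] by (auto simp: families_mult[OF A] intro!: VA.finsum_closed)
    show "act f A ((u \<otimes>\<^bsub>families\<^esub> v) A) = (u \<otimes>\<^bsub>families\<^esub> v) (im f A)" if f: "inj_on f (\<Union>A)" for f
      using mult_natural[OF u v A f, of UNIV]
      by (simp add: families_mult[OF A] families_mult[OF block_family_im[OF A f]] Pow_def)
    show "(u \<otimes>\<^bsub>families\<^esub> v) A = \<zero>\<^bsub>V A\<^esub>" if c: "card (\<Union>A) > n + m"
    proof -
      have "star S (A - S) (u S) (v (A - S)) = \<zero>\<^bsub>V A\<^esub>" if S: "S \<subseteq> A" for S
      proof -
        note sf = split_facts[OF A S]
        have "card (\<Union>A) \<le> card (\<Union>S) + card (\<Union>(A - S))"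
          using card_Un_le[of "\<Union>S" "\<Union>(A - S)"] sf(4) by (metis Union_Un_distrib)
        then consider "card (\<Union>S) > n" | "card (\<Union>(A - S)) > m" using c by linarith
        then show ?thesis
        proof cases
          case 1
          then show ?thesis using n[OF sf(1) 1] split_zero1[OF A S family_closed[OF v sf(2)]] by simp
        next
          case 2
          then show ?thesis using m[OF sf(2) 2] split_zero2[OF A S family_closed[OF u sf(1)]] by simp
        qed
      qed
      then have "finsum (V A) (\<lambda>S. star S (A - S) (u S) (v (A - S))) (Pow A) =
          finsum (V A) (\<lambda>S. \<zero>\<^bsub>V A\<^esub>) (Pow A)"
        by (intro VA.finsum_cong') auto
      then show ?thesis by (simp add: families_mult[OF A] VA.finsum_zero)
    qed
  qed
qed

text \<open>Reindexing by complements exchanges the arguments in each summand, and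
  \<open>star_comm\<close> exchanges them back.\<close>

lemma families_mult_comm:
  assumes u: "family u" and v: "family v"
  shows "u \<otimes>\<^bsub>families\<^esub> v = v \<otimes>\<^bsub>families\<^esub> u"
proof (rule family_eqI[OF family_mult[OF u v] family_mult[OF v u]])
  fix A assume A: "block_family A"
  interpret VA: abelian_monoid "V A" by (rule V_monoid[OF A])
  have img: "(\<lambda>S. A - S) ` Pow A = Pow A"
    by (auto simp: image_iff)
  have inj: "inj_on (\<lambda>S. A - S) (Pow A)" by (auto simp: inj_on_def)
  have "finsum (V A) (\<lambda>S. star S (A - S) (u S) (v (A - S))) ((\<lambda>S. A - S) ` Pow A) =
      finsum (V A) (\<lambda>S. star (A - S) (A - (A - S)) (u (A - S)) (v (A - (A - S)))) (Pow A)"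
    using mult_term_closed[OF u v A] by (intro VA.finsum_reindex[OF _ inj]) auto
  also have "\<dots> = finsum (V A) (\<lambda>S. star S (A - S) (v S) (u (A - S))) (Pow A)"
  proof (intro VA.finsum_cong' refl)
    fix S assume "S \<in> Pow A"
    then have S: "S \<subseteq> A" and AS: "A - (A - S) = S" by auto
    note sf = split_facts[OF A S]
    show "star (A - S) (A - (A - S)) (u (A - S)) (v (A - (A - S))) = star S (A - S) (v S) (u (A - S))"
      unfolding AS by (rule star_comm[OF sf(1-3) family_closed[OF v sf(1)] family_closed[OF u sf(2)], symmetric])
  qed (use mult_term_closed[OF v u A] in auto)
  finally show "(u \<otimes>\<^bsub>families\<^esub> v) A = (v \<otimes>\<^bsub>families\<^esub> u) A"
    unfolding img by (simp add: families_mult[OF A])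
qed

lemma families_one_mult:
  assumes u: "family u"
  shows "\<one>\<^bsub>families\<^esub> \<otimes>\<^bsub>families\<^esub> u = u"
proof (rule family_eqI[OF family_mult[OF family_one u] u])
  fix A assume A: "block_family A"
  interpret VA: abelian_monoid "V A" by (rule V_monoid[OF A])
  have "finsum (V A) (\<lambda>S. star S (A - S) (\<one>\<^bsub>families\<^esub> S) (u (A - S))) (Pow A) =
      finsum (V A) (\<lambda>S. if {} = S then u A else \<zero>\<^bsub>V A\<^esub>) (Pow A)"
  proof (intro VA.finsum_cong' refl)
    fix S assume "S \<in> Pow A"
    then have S: "S \<subseteq> A" by auto
    note sf = split_facts[OF A S]
    show "star S (A - S) (\<one>\<^bsub>families\<^esub> S) (u (A - S)) = (if {} = S then u A else \<zero>\<^bsub>V A\<^esub>)"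
      using sf(1,2) A u split_zero1[OF A S family_closed[OF u sf(2)]]
      by (auto simp: families_simps star_e family_closed)
  qed (use family_closed[OF u A] A in auto)
  also have "\<dots> = u A"
    using VA.finsum_singleton[of "{}" "Pow A" "\<lambda>_. u A"] family_closed[OF u A] block_family_finite[OF A] by simp
  finally show "(\<one>\<^bsub>families\<^esub> \<otimes>\<^bsub>families\<^esub> u) A = u A" by (simp add: families_mult[OF A])
qed

text \<open>Both sides are sums over the ordered decompositions of \<open>A\<close> into three
  parts. On the left they are indexed by \<open>S\<close> and a subset \<open>R\<close> of
  \<open>S\<close>, on the right by \<open>R\<close> and a subset \<open>Q\<close> of its
  complement.\<close>

lemma families_mult_assoc:
  assumes u: "family u" and v: "family v" and w: "family w"
  shows "(u \<otimes>\<^bsub>families\<^esub> v) \<otimes>\<^bsub>families\<^esub> w = u \<otimes>\<^bsub>families\<^esub> (v \<otimes>\<^bsub>families\<^esub> w)"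
proof (rule family_eqI[OF family_mult[OF family_mult[OF u v] w] family_mult[OF u family_mult[OF v w]]])
  fix A assume A: "block_family A"
  interpret VA: abelian_monoid "V A" by (rule V_monoid[OF A])
  have fin: "finite A" by (rule block_family_finite[OF A])
  define l where "l S R = star S (A - S) (star R (S - R) (u R) (v (S - R))) (w (A - S))" for S R
  define r where "r R Q = star R (A - R) (u R) (star Q (A - R - Q) (v Q) (w (A - R - Q)))" for R Q
  have lc: "l S R \<in> carrier (V A)" if "S \<subseteq> A" "R \<subseteq> S" for S R
    unfolding l_def using that A split_facts[OF A that(1)]
    by (intro split_closed mult_term_closed u v family_closed[OF w]) auto
  have rc: "r R Q \<in> carrier (V A)" if "R \<subseteq> A" "Q \<subseteq> A - R" for R Q
    unfolding r_def using that A split_facts[OF A that(1)]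
    by (intro split_closed mult_term_closed v w family_closed[OF u]) auto
  have "((u \<otimes>\<^bsub>families\<^esub> v) \<otimes>\<^bsub>families\<^esub> w) A = finsum (V A) (\<lambda>S. finsum (V A) (l S) (Pow S)) (Pow A)"
    unfolding families_mult[OF A]
  proof (intro VA.finsum_cong' refl)
    fix S assume "S \<in> Pow A"
    then have S: "S \<subseteq> A" by auto
    note sf = split_facts[OF A S]
    show "star S (A - S) ((u \<otimes>\<^bsub>families\<^esub> v) S) (w (A - S)) = finsum (V A) (l S) (Pow S)"
      unfolding families_mult[OF sf(1)] l_def[abs_def]
      using sf(1) by (intro module_hom_finsum[OF split_hom1[OF A S family_closed[OF w sf(2)]] V V]
          A mult_term_closed u v) auto
  qed (use lc in \<open>auto intro!: VA.finsum_closed\<close>)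
  also have "\<dots> = finsum (V A) (\<lambda>(S, R). l S R) (Sigma (Pow A) Pow)"
    using fin lc by (intro VA.finsum_Sigma) (auto intro: finite_subset)
  \<comment> \<open>The two indexings are matched by \<open>S = R \<union> Q\<close>; conversely
    \<open>Q = S - R\<close>.\<close>
  also have "Sigma (Pow A) Pow = (\<lambda>(R, Q). (R \<union> Q, R)) ` Sigma (Pow A) (\<lambda>R. Pow (A - R))" (is "_ = ?h ` ?J")
  proof
    show "Sigma (Pow A) Pow \<subseteq> ?h ` ?J"
    proof
      fix p assume p: "p \<in> Sigma (Pow A) Pow"
      then obtain S R where "p = (S, R)" "S \<subseteq> A" "R \<subseteq> S" by auto
      then show "p \<in> ?h ` ?J" by (intro image_eqI[of _ _ "(R, S - R)"]) auto
    qed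
  qed auto
  also have "finsum (V A) (\<lambda>(S, R). l S R) (?h ` ?J) = finsum (V A) (\<lambda>x. (\<lambda>(S, R). l S R) (?h x)) ?J"
  proof (rule VA.finsum_reindex)
    show "inj_on ?h ?J"
    proof (rule inj_onI)
      fix p q assume "p \<in> ?J" "q \<in> ?J" and eq: "?h p = ?h q"
      then obtain R Q R' Q' where pq: "p = (R, Q)" "q = (R', Q')" "Q \<subseteq> A - R" "Q' \<subseteq> A - R'" by auto
      then have "R = R'" "R \<union> Q = R \<union> Q'" using eq by auto
      moreover have "Q = (R \<union> Q) - R" "Q' = (R \<union> Q') - R" using pq \<open>R = R'\<close> by auto
      ultimately show "p = q" using pq by metis
    qed
  qed (auto intro!: lc)
  also have "\<dots> = finsum (V A) (\<lambda>(R, Q). r R Q) ?J"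
  proof (intro VA.finsum_cong' refl)
    fix p assume "p \<in> ?J"
    then obtain R Q where p: "p = (R, Q)" "R \<subseteq> A" "Q \<subseteq> A - R" by auto
    have e1: "R \<union> Q - R = Q" "Q \<union> (A - (R \<union> Q)) = A - R" "A - R - Q = A - (R \<union> Q)" using p by auto
    have bf: "block_family R" "block_family Q" "block_family (A - (R \<union> Q))"
      using p by (auto intro: block_family_subset[OF A])
    have sp: "sep R Q" "sep R (A - (R \<union> Q))" "sep Q (A - (R \<union> Q))"
      by (rule block_family_sep[OF A]; use p in auto)+
    show "(\<lambda>(S, R). l S R) (?h p) = (\<lambda>(R, Q). r R Q) p"
      using star_assoc[OF bf sp family_closed[OF u bf(1)] family_closed[OF v bf(2)] family_closed[OF w bf(3)]]
      by (simp add: p(1) l_def r_def e1)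
  qed (use rc in auto)
  also have "\<dots> = finsum (V A) (\<lambda>R. finsum (V A) (r R) (Pow (A - R))) (Pow A)"
    using fin rc by (intro VA.finsum_Sigma[symmetric]) auto
  also have "\<dots> = (u \<otimes>\<^bsub>families\<^esub> (v \<otimes>\<^bsub>families\<^esub> w)) A"
    unfolding families_mult[OF A]
  proof (intro VA.finsum_cong' refl)
    fix R assume "R \<in> Pow A"
    then have R: "R \<subseteq> A" by auto
    note sf = split_facts[OF A R]
    show "finsum (V A) (r R) (Pow (A - R)) = star R (A - R) (u R) ((v \<otimes>\<^bsub>families\<^esub> w) (A - R))"
      unfolding families_mult[OF sf(2)] r_def[abs_def]
      using sf(2) by (intro module_hom_finsum[OF split_hom2[OF A R family_closed[OF u sf(1)]] V V, symmetric]
          A mult_term_closed v w) auto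
  next
    show "(\<lambda>R. star R (A - R) (u R) ((v \<otimes>\<^bsub>families\<^esub> w) (A - R))) \<in> Pow A \<rightarrow> carrier (V A)"
      using mult_term_closed[OF u family_mult[OF v w] A] by auto
  qed
  finally show "((u \<otimes>\<^bsub>families\<^esub> v) \<otimes>\<^bsub>families\<^esub> w) A = (u \<otimes>\<^bsub>families\<^esub> (v \<otimes>\<^bsub>families\<^esub> w)) A" .
qed

lemma families_l_distr:
  assumes u: "family u" and v: "family v" and w: "family w"
  shows "(u \<oplus>\<^bsub>families\<^esub> v) \<otimes>\<^bsub>families\<^esub> w = u \<otimes>\<^bsub>families\<^esub> w \<oplus>\<^bsub>families\<^esub> v \<otimes>\<^bsub>families\<^esub> w"
proof (rule family_eqI)
  fix A assume A: "block_family A"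
  interpret VA: abelian_monoid "V A" by (rule V_monoid[OF A])
  have "((u \<oplus>\<^bsub>families\<^esub> v) \<otimes>\<^bsub>families\<^esub> w) A =
      finsum (V A) (\<lambda>S. star S (A - S) (u S) (w (A - S)) \<oplus>\<^bsub>V A\<^esub> star S (A - S) (v S) (w (A - S))) (Pow A)"
    unfolding families_mult[OF A]
  proof (intro VA.finsum_cong' refl)
    fix S assume "S \<in> Pow A"
    then have S: "S \<subseteq> A" by auto
    note sf = split_facts[OF A S]
    show "star S (A - S) ((u \<oplus>\<^bsub>families\<^esub> v) S) (w (A - S)) =
        star S (A - S) (u S) (w (A - S)) \<oplus>\<^bsub>V A\<^esub> star S (A - S) (v S) (w (A - S))"
      using sf module_hom_add[OF split_hom1[OF A S family_closed[OF w sf(2)]]] u v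
      by (simp add: families_simps family_closed)
  qed (use mult_term_closed[OF _ w A] u v in auto)
  also have "\<dots> = (u \<otimes>\<^bsub>families\<^esub> w) A \<oplus>\<^bsub>V A\<^esub> (v \<otimes>\<^bsub>families\<^esub> w) A"
    unfolding families_mult[OF A] using mult_term_closed[OF _ w A] u v by (intro VA.finsum_addf) auto
  finally show "((u \<oplus>\<^bsub>families\<^esub> v) \<otimes>\<^bsub>families\<^esub> w) A = (u \<otimes>\<^bsub>families\<^esub> w \<oplus>\<^bsub>families\<^esub> v \<otimes>\<^bsub>families\<^esub> w) A"
    using A by (simp add: families_simps)
qed (intro family_mult family_add u v w)+

lemma families_smult_assoc:
  assumes a: "a \<in> carrier K" and u: "family u" and v: "family v"
  shows "(a \<odot>\<^bsub>families\<^esub> u) \<otimes>\<^bsub>families\<^esub> v = a \<odot>\<^bsub>families\<^esub> (u \<otimes>\<^bsub>families\<^esub> v)"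
proof (rule family_eqI)
  fix A assume A: "block_family A"
  interpret VA: module K "V A" by (rule V[OF A])
  have "((a \<odot>\<^bsub>families\<^esub> u) \<otimes>\<^bsub>families\<^esub> v) A =
      finsum (V A) (\<lambda>S. a \<odot>\<^bsub>V A\<^esub> star S (A - S) (u S) (v (A - S))) (Pow A)"
    unfolding families_mult[OF A]
  proof (intro VA.M.finsum_cong' refl)
    fix S assume "S \<in> Pow A"
    then have S: "S \<subseteq> A" by auto
    note sf = split_facts[OF A S]
    show "star S (A - S) ((a \<odot>\<^bsub>families\<^esub> u) S) (v (A - S)) = a \<odot>\<^bsub>V A\<^esub> star S (A - S) (u S) (v (A - S))"
      using sf module_hom_smult[OF split_hom1[OF A S family_closed[OF v sf(2)]] a] u
      by (simp add: families_simps family_closed)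
  qed (use mult_term_closed[OF u v A] a in auto)
  also have "\<dots> = a \<odot>\<^bsub>V A\<^esub> (u \<otimes>\<^bsub>families\<^esub> v) A"
    unfolding families_mult[OF A] using mult_term_closed[OF u v A] a block_family_finite[OF A]
    by (intro VA.finsum_smult_ldistr[symmetric]) auto
  finally show "((a \<odot>\<^bsub>families\<^esub> u) \<otimes>\<^bsub>families\<^esub> v) A = (a \<odot>\<^bsub>families\<^esub> (u \<otimes>\<^bsub>families\<^esub> v)) A"
    using A by (simp add: families_simps)
qed (intro family_mult family_smult a u v)+

lemma algebra_families: "algebra K families"
proof -
  interpret F: module K families by (rule module_families)
  have "comm_monoid families"
  proof (rule comm_monoidI)
    show "u \<otimes>\<^bsub>families\<^esub> v = v \<otimes>\<^bsub>families\<^esub> u" if "u \<in> carrier families" "v \<in> carrier families" for u v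
      using that by (simp add: families_simps(1) families_mult_comm)
  qed (simp_all add: families_simps(1) family_mult family_one families_mult_assoc families_one_mult)
  then have "cring families"
    by (intro cringI F.M.abelian_group_axioms) (auto simp: families_simps(1) families_l_distr)
  then show ?thesis
    by (intro algebraI[OF K])
      (auto simp: F.smult_l_distr F.smult_r_distr F.smult_assoc1, auto simp: families_simps(1) families_smult_assoc)
qed

section \<open>The grading by the number of points\<close>

lemma submodule_family_degree: "submodule (family_degree n) K families"
proof (rule submoduleI'[OF module_families])
  show "family_degree n \<subseteq> carrier families" by (auto simp: family_degree_def families_simps)
  show "\<zero>\<^bsub>families\<^esub> \<in> family_degree n"
    using family_zero by (auto simp: family_degree_def families_simps)
  show "u \<oplus>\<^bsub>families\<^esub> v \<in> family_degree n" if "u \<in> family_degree n" "v \<in> family_degree n" for u v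
    using that family_add[of u v]
    by (auto simp: family_degree_def families_simps(2) abelian_monoid.l_zero[OF V_monoid])
  show "a \<odot>\<^bsub>families\<^esub> u \<in> family_degree n" if "a \<in> carrier K" "u \<in> family_degree n" for a u
    using that family_smult[of a u]
    by (auto simp: family_degree_def families_simps(4) module.smult_r_null[OF V])
qed

text \<open>At a given \<open>A\<close> all components vanish except the one whose degree is the
  number of points of \<open>A\<close>.\<close>

lemma family_degree_sum:
  assumes c: "\<And>n. c n \<in> family_degree n" and fin: "finite {n. c n \<noteq> \<zero>\<^bsub>families\<^esub>}" and A: "block_family A"
  shows "finsum families c {n. c n \<noteq> \<zero>\<^bsub>families\<^esub>} A = c (card (\<Union>A)) A"
proof -
  interpret VA: abelian_monoid "V A" by (rule V_monoid[OF A])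
  let ?F = "{n. c n \<noteq> \<zero>\<^bsub>families\<^esub>}" and ?n = "card (\<Union>A)"
  have cf: "family (c n)" for n using c by (auto simp: family_degree_def)
  have "finsum families c ?F A = finsum (V A) (\<lambda>n. c n A) ?F"
    using cf by (intro module_hom_finsum[OF families_eval[OF A] module_families V[OF A]])
      (simp add: families_simps)
  also have "\<dots> = finsum (V A) (\<lambda>n. if ?n = n then c ?n A else \<zero>\<^bsub>V A\<^esub>) ?F"
    using c A cf by (intro VA.finsum_cong') (auto simp: family_degree_def family_closed)
  also have "\<dots> = c ?n A"
  proof (cases "?n \<in> ?F")
    case True
    then show ?thesis
      using VA.finsum_singleton[of ?n ?F "\<lambda>_. c ?n A"] fin family_closed[OF cf A] by simp
  next
    case False
    then have "finsum (V A) (\<lambda>n. if ?n = n then c ?n A else \<zero>\<^bsub>V A\<^esub>) ?F = finsum (V A) (\<lambda>n. \<zero>\<^bsub>V A\<^esub>) ?F"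
      by (intro VA.finsum_cong') auto
    then show ?thesis using False A by (simp add: VA.finsum_zero families_simps)
  qed
  finally show ?thesis .
qed

text \<open>The part of degree \<open>n\<close> is the family cut down to block families with
  \<open>n\<close> points. Injections preserve this number, so naturality survives, and the bound of
  \<open>u\<close> leaves finitely many parts.\<close>

lemma family_decomposition:
  assumes u: "family u"
  shows "\<exists>!c. (\<forall>n. c n \<in> family_degree n) \<and> finite {n. c n \<noteq> \<zero>\<^bsub>families\<^esub>} \<and>
    u = finsum families c {n. c n \<noteq> \<zero>\<^bsub>families\<^esub>}"
proof -
  interpret F: module K families by (rule module_families)
  obtain m where m: "\<And>A. block_family A \<Longrightarrow> card (\<Union>A) > m \<Longrightarrow> u A = \<zero>\<^bsub>V A\<^esub>"
    using family_bound[OF u] by metis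
  define c where "c n = (\<lambda>A\<in>Collect block_family. if card (\<Union>A) = n then u A else \<zero>\<^bsub>V A\<^esub>)" for n
  have fam: "family (c n)" for n
  proof (rule familyI[of _ m])
    fix A and f :: "nat \<Rightarrow> nat" assume A: "block_family A" and f: "inj_on f (\<Union>A)"
    have "card (\<Union>(im f A)) = card (\<Union>A)" unfolding Union_im by (rule card_image[OF f])
    then show "act f A (c n A) = c n (im f A)"
      using A f u by (simp add: c_def block_family_im act_zero family_act)
  qed (auto simp: c_def m family_closed[OF u])
  have deg: "c n \<in> family_degree n" for n
    using fam by (auto simp: family_degree_def c_def)
  have fin: "finite {n. c n \<noteq> \<zero>\<^bsub>families\<^esub>}"
  proof (rule finite_subset)
    show "{n. c n \<noteq> \<zero>\<^bsub>families\<^esub>} \<subseteq> {..m}"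
    proof (rule subsetI, rule ccontr)
      fix n assume n: "n \<in> {n. c n \<noteq> \<zero>\<^bsub>families\<^esub>}" "n \<notin> {..m}"
      then have "c n = \<zero>\<^bsub>families\<^esub>"
        by (intro family_eqI[OF fam family_zero]) (auto simp: c_def families_simps m)
      then show False using n by simp
    qed
  qed simp
  show ?thesis
  proof (rule ex1I[of _ c])
    have "u = finsum families c {n. c n \<noteq> \<zero>\<^bsub>families\<^esub>}"
    proof (rule family_eqI[OF u])
      have "finsum families c {n. c n \<noteq> \<zero>\<^bsub>families\<^esub>} \<in> carrier families"
        using fam by (intro F.M.finsum_closed) (auto simp: families_simps)
      then show "family (finsum families c {n. c n \<noteq> \<zero>\<^bsub>families\<^esub>})" by (simp add: families_simps)
      show "u A = finsum families c {n. c n \<noteq> \<zero>\<^bsub>families\<^esub>} A" if "block_family A" for A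
      proof -
        have "c (card (\<Union>A)) A = u A" using that by (simp add: c_def)
        then show ?thesis using family_degree_sum[OF deg fin that] by simp
      qed
    qed
    then show "(\<forall>n. c n \<in> family_degree n) \<and> finite {n. c n \<noteq> \<zero>\<^bsub>families\<^esub>} \<and>
        u = finsum families c {n. c n \<noteq> \<zero>\<^bsub>families\<^esub>}" using deg fin by blast
    fix d assume d: "(\<forall>n. d n \<in> family_degree n) \<and> finite {n. d n \<noteq> \<zero>\<^bsub>families\<^esub>} \<and>
        u = finsum families d {n. d n \<noteq> \<zero>\<^bsub>families\<^esub>}"
    show "d = c"
    proof
      fix n
      have dn: "d n \<in> family_degree n" using d by blast
      show "d n = c n"
      proof (rule family_eqI)
        show "family (d n)" using dn by (simp add: family_degree_def)
        show "family (c n)" by (rule fam)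
        fix A assume A: "block_family A"
        have "u A = d (card (\<Union>A)) A"
          using family_degree_sum[of d A] d A by metis
        then show "d n A = c n A"
          using dn A by (cases "card (\<Union>A) = n") (auto simp: c_def family_degree_def)
      qed
    qed
  qed
qed

lemma family_degree_mult:
  assumes u: "u \<in> family_degree i" and v: "v \<in> family_degree j"
  shows "u \<otimes>\<^bsub>families\<^esub> v \<in> family_degree (i + j)"
proof -
  have fu: "family u" and fv: "family v" using u v by (auto simp: family_degree_def)
  have "(u \<otimes>\<^bsub>families\<^esub> v) A = \<zero>\<^bsub>V A\<^esub>" if A: "block_family A" and c: "card (\<Union>A) \<noteq> i + j" for A
  proof -
    interpret VA: abelian_monoid "V A" by (rule V_monoid[OF A])
    have "star S (A - S) (u S) (v (A - S)) = \<zero>\<^bsub>V A\<^esub>" if S: "S \<subseteq> A" for S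
    proof -
      note sf = split_facts[OF A S]
      have "card (\<Union>A) = card (\<Union>S) + card (\<Union>(A - S))"
        using card_Un_disjoint[of "\<Union>S" "\<Union>(A - S)"] sf
        by (metis Union_Un_distrib block_family_def)
      then consider "card (\<Union>S) \<noteq> i" | "card (\<Union>(A - S)) \<noteq> j" using c by linarith
      then show ?thesis
      proof cases
        case 1
        then have "u S = \<zero>\<^bsub>V S\<^esub>" using u sf by (auto simp: family_degree_def)
        then show ?thesis using split_zero1[OF A S family_closed[OF fv sf(2)]] by simp
      next
        case 2
        then have "v (A - S) = \<zero>\<^bsub>V (A - S)\<^esub>" using v sf by (auto simp: family_degree_def)
        then show ?thesis using split_zero2[OF A S family_closed[OF fu sf(1)]] by simp
      qed
    qed
    then have "finsum (V A) (\<lambda>S. star S (A - S) (u S) (v (A - S))) (Pow A) =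
        finsum (V A) (\<lambda>S. \<zero>\<^bsub>V A\<^esub>) (Pow A)"
      by (intro VA.finsum_cong') auto
    then show ?thesis by (simp add: families_mult[OF A] VA.finsum_zero)
  qed
  then show ?thesis using family_mult[OF fu fv] by (simp add: family_degree_def)
qed

lemma graded_algebra_families: "graded_algebra K families family_degree"
  unfolding graded_algebra_def
proof (intro conjI allI ballI)
  show "\<one>\<^bsub>families\<^esub> \<in> family_degree 0"
    using family_one by (auto simp: family_degree_def families_simps)
  show "\<exists>!c. (\<forall>n. c n \<in> family_degree n) \<and> finite {n. c n \<noteq> \<zero>\<^bsub>families\<^esub>} \<and>
      u = finsum families c {n. c n \<noteq> \<zero>\<^bsub>families\<^esub>}" if "u \<in> carrier families" for u
    using that by (intro family_decomposition) (simp add: families_simps(1))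
qed (simp_all add: algebra_families submodule_family_degree family_degree_mult)

end

section \<open>Shuffles\<close>

text \<open>An increasing function on an interval lists its image in sorted order, and the sorted
  list of a set is unique.\<close>

lemma strict_mono_on_image_unique:
  fixes f g :: "nat \<Rightarrow> nat"
  assumes "strict_mono_on {a..<b} f" "strict_mono_on {a..<b} g" "f ` {a..<b} = g ` {a..<b}"
    and "k \<in> {a..<b}"
  shows "f k = g k"
proof -
  have s: "sorted (map h [a..<b]) \<and> distinct (map h [a..<b])" if "strict_mono_on {a..<b} h" for h :: "nat \<Rightarrow> nat"
  proof
    show "sorted (map h [a..<b])"
      unfolding sorted_map using that
      by (intro sorted_wrt_mono_rel[OF _ sorted_wrt_upt]) (auto simp: strict_mono_on_def less_imp_le)
    show "distinct (map h [a..<b])"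
      using strict_mono_on_imp_inj_on[OF that] by (simp add: distinct_map)
  qed
  have "map f [a..<b] = map g [a..<b]"
    using s[OF assms(1)] s[OF assms(2)] assms(3) by (intro sorted_distinct_set_unique) auto
  then show ?thesis using assms(4) by simp
qed

text \<open>A shuffle enumerates the image of the first \<open>i\<close> positions and its
  complement increasingly, so this image determines it; any set of the right size occurs.\<close>

lemma shuffle_image_bij:
  "bij_betw (\<lambda>\<sigma>. \<sigma> ` {..<i}) (shuffle_perms i j) {I. I \<subseteq> {..<i + j} \<and> card I = i}"
proof (rule bij_betw_imageI)
  have at: "{..<i} = {0..<i}" by auto
  show "inj_on (\<lambda>\<sigma>. \<sigma> ` {..<i}) (shuffle_perms i j)"
  proof (rule inj_onI)
    fix \<sigma> \<tau> assume s: "\<sigma> \<in> shuffle_perms i j" and t: "\<tau> \<in> shuffle_perms i j" and eq: "\<sigma> ` {..<i} = \<tau> ` {..<i}"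
    have ps: "\<sigma> permutes {..<i + j}" and pt: "\<tau> permutes {..<i + j}" using s t by (auto simp: shuffle_perms_def)
    \<comment> \<open>The image of the last \<open>j\<close> positions is the complement, so it
      agrees for both shuffles as well.\<close>
    have c: "\<rho> ` {i..<i + j} = {..<i + j} - \<rho> ` {..<i}" if "\<rho> permutes {..<i + j}" for \<rho> :: "nat \<Rightarrow> nat"
    proof -
      have "{i..<i + j} = {..<i + j} - {..<i}" by auto
      then have "\<rho> ` {i..<i + j} = \<rho> ` {..<i + j} - \<rho> ` {..<i}"
        using image_set_diff[OF permutes_inj[OF that]] by metis
      then show ?thesis by (simp only: permutes_image[OF that])
    qed
    show "\<sigma> = \<tau>"
    proof
      fix k
      consider "k < i" | "i \<le> k" "k < i + j" | "k \<ge> i + j" by linarith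
      then show "\<sigma> k = \<tau> k"
      proof cases
        case 1
        then show ?thesis
          using strict_mono_on_image_unique[of 0 i \<sigma> \<tau> k] s t eq by (simp add: shuffle_perms_def at)
      next
        case 2
        then show ?thesis
          using strict_mono_on_image_unique[of i "i + j" \<sigma> \<tau> k] s t eq c[OF ps] c[OF pt]
          by (simp add: shuffle_perms_def)
      next
        case 3
        then show ?thesis using ps pt by (simp add: permutes_not_in)
      qed
    qed
  qed
  show "(\<lambda>\<sigma>. \<sigma> ` {..<i}) ` shuffle_perms i j = {I. I \<subseteq> {..<i + j} \<and> card I = i}"
  proof (intro equalityI subsetI)
    fix I assume "I \<in> (\<lambda>\<sigma>. \<sigma> ` {..<i}) ` shuffle_perms i j"
    then obtain \<sigma> where \<sigma>: "\<sigma> permutes {..<i + j}" "I = \<sigma> ` {..<i}" by (auto simp: shuffle_perms_def)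
    have "I \<subseteq> \<sigma> ` {..<i + j}" using \<sigma>(2) by auto
    then show "I \<in> {I. I \<subseteq> {..<i + j} \<and> card I = i}"
      using permutes_image[OF \<sigma>(1)] card_image[OF inj_on_subset[OF permutes_inj[OF \<sigma>(1)]], of "{..<i}"] \<sigma>(2)
      by simp
  next
    fix I assume I: "I \<in> {I. I \<subseteq> {..<i + j} \<and> card I = i}"
    let ?J = "{..<i + j} - I"
    have fin: "finite I" "finite ?J" using I finite_subset by auto
    have cI: "card I = i" and cJ: "card ?J = j" using I fin by (auto simp: card_Diff_subset)
    define xs where "xs = sorted_list_of_set I"
    define ys where "ys = sorted_list_of_set ?J"
    have xs: "length xs = i" "set xs = I" "sorted_wrt (<) xs"
      using fin cI by (auto simp: xs_def)
    have ys: "length ys = j" "set ys = ?J" "sorted_wrt (<) ys"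
      using fin cJ by (auto simp: ys_def)
    have d: "distinct (xs @ ys)"
      using xs(2) ys(2) strict_sorted_iff[of xs] strict_sorted_iff[of ys] xs(3) ys(3) by simp
    \<comment> \<open>List \<open>I\<close> in increasing order, then its complement; the identity
      elsewhere makes this a permutation of the naturals.\<close>
    define \<sigma> where "\<sigma> k = (if k < i + j then (xs @ ys) ! k else k)" for k
    have set: "set (xs @ ys) = {..<i + j}" using xs(2) ys(2) I by auto
    have len: "length (xs @ ys) = i + j" using xs ys by simp
    have "bij_betw ((!) (xs @ ys)) {..<i + j} {..<i + j}"
      by (rule bij_betw_nth[OF d]) (simp_all only: set len)
    then have "bij_betw \<sigma> {..<i + j} {..<i + j}"
      by (rule bij_betw_cong[THEN iffD1, rotated]) (simp add: \<sigma>_def)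
    then have perm: "\<sigma> permutes {..<i + j}"
      by (rule bij_imp_permutes) (simp add: \<sigma>_def)
    have 1: "strict_mono_on {..<i} \<sigma>"
      using xs by (auto simp: strict_mono_on_def \<sigma>_def nth_append sorted_wrt_iff_nth_less)
    have 2: "strict_mono_on {i..<i + j} \<sigma>"
      using xs ys by (auto simp: strict_mono_on_def \<sigma>_def nth_append sorted_wrt_iff_nth_less)
    have "\<sigma> ` {..<i} = (!) xs ` {..<i}"
      using xs by (intro image_cong) (auto simp: \<sigma>_def nth_append)
    also have "(!) xs ` {..<i} = set xs" unfolding xs(1)[symmetric] by (auto simp: set_conv_nth)
    also have "set xs = I" by (rule xs(2))
    finally show "I \<in> (\<lambda>\<sigma>. \<sigma> ` {..<i}) ` shuffle_perms i j"
      using perm 1 2 by (auto simp: shuffle_perms_def)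
  qed
qed

lemma finite_shuffle_perms: "finite (shuffle_perms i j)"
  unfolding shuffle_perms_def by (rule finite_subset[OF _ finite_permutations[of "{..<i + j}"]]) auto

section \<open>Symmetric invariant tensors as natural families\<close>

context block_species
begin

lemma TS_simps:
  "carrier (TS K D) = {x \<in> carrier (direct_sum UNIV T).
     \<forall>r \<sigma>. \<sigma> permutes {..<r} \<longrightarrow> tensor_permute K D r \<sigma> (x r) = x r}"
  "x \<otimes>\<^bsub>TS K D\<^esub> y = (\<lambda>n. finsum (T n) (\<lambda>i. finsum (T n)
     (\<lambda>\<sigma>. tensor_permute K D n \<sigma> (tensor_concat K D i (n - i) (x i) (y (n - i)))) (shuffle_perms i (n - i))) {..n})"
  "\<one>\<^bsub>TS K D\<^esub> = (\<lambda>r. if r = 0 then pure 0 [] else \<zero>\<^bsub>T r\<^esub>)"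
  "\<zero>\<^bsub>TS K D\<^esub> = (\<lambda>r. \<zero>\<^bsub>T r\<^esub>)"
  "x \<oplus>\<^bsub>TS K D\<^esub> y = (\<lambda>r. x r \<oplus>\<^bsub>T r\<^esub> y r)"
  "a \<odot>\<^bsub>TS K D\<^esub> x = (\<lambda>r. a \<odot>\<^bsub>T r\<^esub> x r)"
  by (simp_all add: TS_def Let_def direct_sum_simps restrict_def fun_eq_iff)

lemma TS_closed: "x \<in> carrier (TS K D) \<Longrightarrow> x r \<in> carrier (T r)"
  by (auto simp: TS_simps direct_sum_simps)

lemma TS_finite: "x \<in> carrier (TS K D) \<Longrightarrow> finite {r. x r \<noteq> \<zero>\<^bsub>T r\<^esub>}"
  by (auto simp: TS_simps direct_sum_simps)

lemma TS_invariant: "x \<in> carrier (TS K D) \<Longrightarrow> \<sigma> permutes {..<r} \<Longrightarrow> tensor_permute K D r \<sigma> (x r) = x r"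
  by (simp add: TS_simps)

text \<open>Two orders of the same blocks differ by a permutation, which can be moved from the
  blocks to the tensor and is absorbed there.\<close>

lemma nuhat_invariant:
  assumes x: "x \<in> carrier (TS K D)" and Bs: "block_list Bs" and Cs: "block_list Cs" and eq: "set Bs = set Cs"
  shows "nuhat Bs (x (length Bs)) = nuhat Cs (x (length Cs))"
proof -
  have m: "mset Cs = mset Bs"
    using Bs Cs eq by (metis block_list_def set_eq_iff_mset_eq_distinct)
  obtain \<sigma> where \<sigma>: "\<sigma> permutes {..<length Bs}" "permute_list \<sigma> Bs = Cs"
    using mset_eq_permutation[OF m] .
  have "nuhat Bs (x (length Bs)) = nuhat Bs (tensor_permute K D (length Bs) \<sigma> (x (length Bs)))"
    using TS_invariant[OF x \<sigma>(1)] by simp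
  also have "\<dots> = nuhat Cs (x (length Bs))"
    using nuhat_permute[OF Bs \<sigma>(1) TS_closed[OF x]] \<sigma>(2) by simp
  finally show ?thesis using m by (metis size_mset)
qed

text \<open>An arbitrary order of the blocks. For invariant tensors it has no influence, see
  \<open>Psi_eq\<close>.\<close>

definition blocks :: "nat set set \<Rightarrow> nat set list" where
  "blocks A = (SOME Bs. distinct Bs \<and> set Bs = A)"

lemma
  assumes "block_family A"
  shows set_blocks: "set (blocks A) = A" and block_list_blocks: "block_list (blocks A)"
    and length_blocks: "length (blocks A) = card A"
proof -
  have "\<exists>Bs. distinct Bs \<and> set Bs = A"
    using finite_distinct_list[OF block_family_finite[OF assms]] by blast
  then have *: "distinct (blocks A) \<and> set (blocks A) = A"
    unfolding blocks_def by (rule someI_ex)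
  then show "set (blocks A) = A" "block_list (blocks A)" "length (blocks A) = card A"
    using assms distinct_card[of "blocks A"] by (auto simp: block_list_def)
qed

definition Psi :: "(nat \<Rightarrow> ((nat \<Rightarrow> 'v) list \<Rightarrow> 'k) set) \<Rightarrow> nat set set \<Rightarrow> 'v" where
  "Psi x = (\<lambda>A\<in>Collect block_family. nuhat (blocks A) (x (card A)))"

lemma Psi_eq:
  assumes x: "x \<in> carrier (TS K D)" and Bs: "block_list Bs"
  shows "Psi x (set Bs) = nuhat Bs (x (length Bs))"
proof -
  have A: "block_family (set Bs)" using Bs by (simp add: block_list_def)
  have "nuhat (blocks (set Bs)) (x (length (blocks (set Bs)))) = nuhat Bs (x (length Bs))"
    using set_blocks[OF A] by (intro nuhat_invariant x block_list_blocks A Bs)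
  then show ?thesis using A by (simp add: Psi_def length_blocks)
qed

lemma card_Union_blocks: "block_list Bs \<Longrightarrow> card (\<Union>(set Bs)) = sum_list (map card Bs)"
proof (induction Bs)
  case (Cons B Bs)
  then have "finite (\<Union>(set Bs))" by (auto simp: block_list_Cons block_list_def[of Bs] block_family_def)
  then show ?case using Cons by (auto simp: block_list_Cons card_Un_disjoint)
qed simp

text \<open>The tensor has finitely many multihomogeneous parts, and each is visible only on lists
  with its own block sizes. Any bound on the total sizes that occur will do.\<close>

lemma nuhat_bounded:
  assumes t: "t \<in> carrier (T r)"
  shows "\<exists>n. \<forall>Bs. block_list Bs \<and> length Bs = r \<and> card (\<Union>(set Bs)) > n \<longrightarrow> nuhat Bs t = \<zero>\<^bsub>V (set Bs)\<^esub>"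
proof -
  from T_expand[OF t] obtain F where F: "F \<subseteq> {ds. length ds = r}" "finite F"
    "\<forall>E. finite E \<and> F \<subseteq> E \<and> E \<subseteq> {ds. length ds = r} \<longrightarrow>
      t = finsum (T r) (\<lambda>ds. theta (std ds) (nuhat (std ds) t)) E"
    by (elim exE conjE) (rule that; assumption)
  have te: "t = finsum (T r) (\<lambda>ds. theta (std ds) (nuhat (std ds) t)) F"
    using F by blast
  have c: "nuhat (std ds) t \<in> carrier (V (set (std ds)))" if "ds \<in> F" for ds
    using nuhat_closed[OF block_list_std, of t ds] that F(1) t by auto
  \<comment> \<open>The inserted \<open>0\<close> keeps \<open>Max\<close> meaningful when
    \<open>F\<close> is empty.\<close>
  define n where "n = Max (insert 0 ((\<lambda>ds. sum_list (map Suc ds)) ` F))"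
  have n: "sum_list (map Suc ds) \<le> n" if "ds \<in> F" for ds
    unfolding n_def using F(2) that by (intro Max_ge) auto
  show ?thesis
  proof (intro exI[of _ n] allI impI, elim conjE)
    fix Bs assume Bs: "block_list Bs" and len: "length Bs = r" and big: "card (\<Union>(set Bs)) > n"
    interpret VB: module K "V (set Bs)" by (rule V_blocks[OF Bs])
    have "nuhat Bs t = nuhat Bs (finsum (T r) (\<lambda>ds. theta (std ds) (nuhat (std ds) t)) F)"
      by (rule arg_cong[OF te])
    also have "\<dots> = finsum (V (set Bs)) (\<lambda>ds. nuhat Bs (theta (std ds) (nuhat (std ds) t))) F"
    proof (rule module_hom_finsum[OF _ module_T V_blocks[OF Bs]])
      show "nuhat Bs \<in> module_hom K (T r) (V (set Bs))" using nuhat_hom[OF Bs] len by simp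
      show "theta (std ds) (nuhat (std ds) t) \<in> carrier (T r)" if "ds \<in> F" for ds
        using theta_closed[OF block_list_std c[OF that]] that F(1) by auto
    qed
    also have "\<dots> = finsum (V (set Bs)) (\<lambda>ds. \<zero>\<^bsub>V (set Bs)\<^esub>) F"
    proof (intro VB.M.finsum_cong' refl)
      fix ds assume ds: "ds \<in> F"
      have "map card Bs \<noteq> map card (std ds)"
        using n[OF ds] big card_Union_blocks[OF Bs] by (metis std_card leD)
      then show "nuhat Bs (theta (std ds) (nuhat (std ds) t)) = \<zero>\<^bsub>V (set Bs)\<^esub>"
        using ds F(1) len c by (intro nuhat_theta_other Bs block_list_std) auto
    qed auto
    finally show "nuhat Bs t = \<zero>\<^bsub>V (set Bs)\<^esub>" by (simp add: VB.M.finsum_zero)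
  qed
qed

lemma nuhat_zero: "block_list Bs \<Longrightarrow> nuhat Bs \<zero>\<^bsub>T (length Bs)\<^esub> = \<zero>\<^bsub>V (set Bs)\<^esub>"
  by (intro module_hom_zero[OF nuhat_hom] module_T V_blocks)

text \<open>Each tensor power has its own bound from \<open>nuhat_bounded\<close>; only finitely
  many powers contribute, so the bounds have a common maximum.\<close>

lemma family_Psi:
  assumes x: "x \<in> carrier (TS K D)"
  shows "family (Psi x)"
proof -
  have "\<forall>r. \<exists>n. \<forall>Bs. block_list Bs \<and> length Bs = r \<and> card (\<Union>(set Bs)) > n \<longrightarrow> nuhat Bs (x r) = \<zero>\<^bsub>V (set Bs)\<^esub>"
    using nuhat_bounded[OF TS_closed[OF x]] by blast
  then obtain b where b: "\<And>r Bs. \<lbrakk>block_list Bs; length Bs = r; card (\<Union>(set Bs)) > b r\<rbrakk> \<Longrightarrow> nuhat Bs (x r) = \<zero>\<^bsub>V (set Bs)\<^esub>"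
    by metis
  let ?S = "{r. x r \<noteq> \<zero>\<^bsub>T r\<^esub>}"
  define n where "n = Max (insert 0 (b ` ?S))"
  have n: "b r \<le> n" if "r \<in> ?S" for r
    unfolding n_def using TS_finite[OF x] that by (intro Max_ge) auto
  show ?thesis
  proof (rule familyI[of _ n])
    show "Psi x \<in> extensional (Collect block_family)" by (simp add: Psi_def)
    fix A assume A: "block_family A"
    note bl = block_list_blocks[OF A] set_blocks[OF A] length_blocks[OF A]
    have PA: "Psi x A = nuhat (blocks A) (x (card A))" using A by (simp add: Psi_def)
    show "Psi x A \<in> carrier (V A)"
      using nuhat_closed[OF bl(1), of "x (card A)"] TS_closed[OF x] bl(2,3) PA by simp
    show "act f A (Psi x A) = Psi x (im f A)" if f: "inj_on f (\<Union>A)" for f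
    proof -
      have f': "inj_on f (\<Union>(set (blocks A)))" using f bl(2) by simp
      have "act f A (Psi x A) = nuhat (map (image f) (blocks A)) (x (card A))"
        using nuhat_act[OF bl(1) f', of "x (card A)"] TS_closed[OF x] bl(2,3) PA by simp
      also have "\<dots> = Psi x (set (map (image f) (blocks A)))"
        using Psi_eq[OF x block_list_map[OF bl(1) f']] bl(3) by simp
      finally show ?thesis using bl(2) by simp
    qed
    show "Psi x A = \<zero>\<^bsub>V A\<^esub>" if c: "card (\<Union>A) > n"
    proof (cases "card A \<in> ?S")
      case True
      then show ?thesis using n[OF True] c b[OF bl(1)] bl PA by simp
    next
      case False
      then show ?thesis using nuhat_zero[OF bl(1)] bl PA by simp
    qed
  qed
qed

section \<open>Bijectivity of the evaluation\<close>

lemma Psi_inject: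
  assumes x: "x \<in> carrier (TS K D)" and y: "y \<in> carrier (TS K D)" and eq: "Psi x = Psi y"
  shows "x = y"
proof
  fix r
  show "x r = y r"
  proof (rule nuhat_inject[OF TS_closed[OF x] TS_closed[OF y]])
    fix Bs assume "block_list Bs" "length Bs = r"
    then show "nuhat Bs (x r) = nuhat Bs (y r)"
      using Psi_eq[OF x, of Bs] Psi_eq[OF y, of Bs] eq by simp
  qed
qed

text \<open>Evaluations separate tensors, so a sequence of tensors that evaluates to a natural
  family is forced to be invariant and finitely supported. This settles closure under each operation
  of \<open>TS\<close> together with its compatibility with \<open>Psi\<close>.\<close>

lemma TS_memI:
  assumes x: "\<And>r. x r \<in> carrier (T r)" and u: "family u"
    and eq: "\<And>Bs. block_list Bs \<Longrightarrow> nuhat Bs (x (length Bs)) = u (set Bs)"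
  shows "x \<in> carrier (TS K D)" "Psi x = u"
proof -
  obtain n where n: "\<And>A. block_family A \<Longrightarrow> card (\<Union>A) > n \<Longrightarrow> u A = \<zero>\<^bsub>V A\<^esub>"
    using family_bound[OF u] by metis
  interpret T: module K "T r" for r by (rule module_T)
  have "x r = \<zero>\<^bsub>T r\<^esub>" if r: "r > n" for r
  proof (rule nuhat_inject[OF x T.M.zero_closed])
    fix Bs assume Bs: "block_list Bs" and len: "length Bs = r"
    \<comment> \<open>A list of \<open>r\<close> nonempty blocks has at least \<open>r\<close>
      points, so beyond the bound of \<open>u\<close> all evaluations of the \<open>r\<close>-th
      component vanish.\<close>
    have "length Bs \<le> sum_list (map card Bs)"
      using Bs
    proof (induction Bs)
      case (Cons B Bs)
      then have "card B > 0" by (simp add: block_list_Cons card_gt_0_iff)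
      then show ?case using Cons by (simp add: block_list_Cons)
    qed simp
    then have "card (\<Union>(set Bs)) > n" using card_Union_blocks[OF Bs] r len by simp
    then show "nuhat Bs (x r) = nuhat Bs \<zero>\<^bsub>T r\<^esub>"
      using eq[OF Bs] n[of "set Bs"] Bs nuhat_zero[OF Bs] len by (simp add: block_list_def)
  qed
  then have "{r. x r \<noteq> \<zero>\<^bsub>T r\<^esub>} \<subseteq> {..n}" by (metis (mono_tags, lifting) atMost_iff leI mem_Collect_eq subsetI)
  then have fin: "finite {r. x r \<noteq> \<zero>\<^bsub>T r\<^esub>}" by (rule finite_subset) simp
  have "tensor_permute K D r \<sigma> (x r) = x r" if \<sigma>: "\<sigma> permutes {..<r}" for r \<sigma>
  proof (rule nuhat_inject[OF module_hom_closed[OF permute_hom[OF \<sigma>] x] x])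
    fix Bs assume Bs: "block_list Bs" and len: "length Bs = r"
    have "nuhat Bs (tensor_permute K D r \<sigma> (x r)) = nuhat (permute_list \<sigma> Bs) (x r)"
      using nuhat_permute[OF Bs, of \<sigma> "x r"] \<sigma> len x by simp
    then show "nuhat Bs (tensor_permute K D r \<sigma> (x r)) = nuhat Bs (x r)"
      using eq[OF Bs] eq[OF block_list_permute[OF Bs]] \<sigma> len by simp
  qed
  then show 1: "x \<in> carrier (TS K D)"
    using x fin by (auto simp: TS_simps direct_sum_simps)
  show "Psi x = u"
  proof (rule family_eqI[OF family_Psi[OF 1] u])
    fix A assume A: "block_family A"
    show "Psi x A = u A"
      using Psi_eq[OF 1 block_list_blocks[OF A]] eq[OF block_list_blocks[OF A]] set_blocks[OF A] by simp
  qed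
qed

text \<open>A preimage is assembled from its multihomogeneous parts: the value of the family on each
  model list is turned into a tensor by \<open>theta\<close>. By naturality these values determine
  those on all block lists.\<close>

lemma Psi_surj:
  assumes u: "family u"
  shows "\<exists>x \<in> carrier (TS K D). Psi x = u"
proof -
  obtain n where n: "\<And>A. block_family A \<Longrightarrow> card (\<Union>A) > n \<Longrightarrow> u A = \<zero>\<^bsub>V A\<^esub>"
    using family_bound[OF u] by metis
  interpret T: module K "T r" for r by (rule module_T)
  \<comment> \<open>Finitely many degree sequences suffice: an entry above \<open>n\<close> gives a
    block with more than \<open>n\<close> points, where \<open>u\<close> vanishes.\<close>
  define F where "F r = {ds. length ds = r \<and> set ds \<subseteq> {..n}}" for r
  have finF: "finite (F r)" for r
    unfolding F_def using finite_lists_length_eq[of "{..n}" r] by (simp add: conj_commute)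
  have bf: "block_family (set (std ds))" for ds using block_list_std by (simp add: block_list_def)
  have tc: "theta (std ds) (u (set (std ds))) \<in> carrier (T (length ds))" for ds
    using theta_closed[OF block_list_std family_closed[OF u bf], of ds] by simp
  have tc': "theta (std ds) (u (set (std ds))) \<in> carrier (T r)" if "length ds = r" for ds r
    using tc[of ds] that by simp
  define x where "x r = finsum (T r) (\<lambda>ds. theta (std ds) (u (set (std ds)))) (F r)" for r
  have xc: "x r \<in> carrier (T r)" for r
    unfolding x_def using tc' by (intro T.M.finsum_closed) (auto simp: F_def)
  have "nuhat Bs (x (length Bs)) = u (set Bs)" if Bs: "block_list Bs" for Bs
  proof -
    interpret VB: module K "V (set Bs)" by (rule V_blocks[OF Bs])
    define ds where "ds = map (\<lambda>B. card B - 1) Bs"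
    have bfB: "block_family (set Bs)" using Bs by (simp add: block_list_def)
    have "card B > 0" if "B \<in> set Bs" for B
      using block_list_mem[OF Bs that] by (simp add: card_gt_0_iff)
    then have ds: "map Suc ds = map card Bs" by (simp add: ds_def)
    have lds: "length ds = length Bs" by (simp add: ds_def)
    obtain f where f: "inj_on f (\<Union>(set (std ds)))" "map (image f) (std ds) = Bs"
      using block_list_transport[OF block_list_std Bs, of ds] ds std_card[of ds] by auto
    \<comment> \<open>The only summand seen by \<open>Bs\<close> is the one with its block sizes.
      Its value on the model list is moved to \<open>Bs\<close> by the injection
      \<open>f\<close>.\<close>
    have self: "nuhat Bs (theta (std ds) (u (set (std ds)))) = u (set Bs)"
    proof -
      have "nuhat Bs (theta (std ds) (u (set (std ds)))) =
          act f (set (std ds)) (nuhat (std ds) (theta (std ds) (u (set (std ds)))))"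
        using nuhat_act[OF block_list_std f(1), of "theta (std ds) (u (set (std ds)))"] tc[of ds] f(2) by simp
      also have "\<dots> = u (im f (set (std ds)))"
        using nuhat_theta[OF block_list_std family_closed[OF u bf]] family_act[OF u bf f(1)] by simp
      finally show ?thesis using f(2) by (metis image_set)
    qed
    have other: "nuhat Bs (theta (std cs) (u (set (std cs)))) = \<zero>\<^bsub>V (set Bs)\<^esub>"
      if "length cs = length Bs" "cs \<noteq> ds" for cs
    proof (rule nuhat_theta_other[OF Bs block_list_std _ _ family_closed[OF u bf]])
      show "map card Bs \<noteq> map card (std cs)"
        unfolding std_card ds[symmetric] using that(2) by (metis inj_Suc inj_map_eq_map)
    qed (use that in simp)
    have "nuhat Bs (x (length Bs)) = finsum (V (set Bs)) (\<lambda>cs. nuhat Bs (theta (std cs) (u (set (std cs))))) (F (length Bs))"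
      unfolding x_def
      by (intro module_hom_finsum[OF nuhat_hom[OF Bs] module_T V_blocks[OF Bs]] tc') (simp add: F_def)
    also have "\<dots> = finsum (V (set Bs)) (\<lambda>cs. if ds = cs then u (set Bs) else \<zero>\<^bsub>V (set Bs)\<^esub>) (F (length Bs))"
      using self other family_closed[OF u bfB] by (intro VB.M.finsum_cong') (auto simp: F_def)
    also have "\<dots> = u (set Bs)"
    proof (cases "ds \<in> F (length Bs)")
      case True
      then show ?thesis
        using VB.M.finsum_singleton[OF True finF, of "\<lambda>_. u (set Bs)"] family_closed[OF u bfB] by simp
    next
      case False
      \<comment> \<open>The summand with the right sizes was left out of the sum, but then
        \<open>u\<close> is zero on \<open>Bs\<close> anyway.\<close>
      then have "\<exists>d \<in> set ds. d > n" using lds by (auto simp: F_def not_le subset_iff)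
      then obtain d where "d \<in> set ds" "d > n" by auto
      then have "sum_list (map Suc ds) > n"
        using member_le_sum_list[of "Suc d" "map Suc ds"] by auto
      then have "u (set Bs) = \<zero>\<^bsub>V (set Bs)\<^esub>"
        using n[OF bfB] card_Union_blocks[OF Bs] ds by simp
      then have "finsum (V (set Bs)) (\<lambda>cs. if ds = cs then u (set Bs) else \<zero>\<^bsub>V (set Bs)\<^esub>) (F (length Bs)) =
          finsum (V (set Bs)) (\<lambda>cs. \<zero>\<^bsub>V (set Bs)\<^esub>) (F (length Bs))"
        by (intro VB.M.finsum_cong') auto
      then show ?thesis using \<open>u (set Bs) = \<zero>\<^bsub>V (set Bs)\<^esub>\<close> by (simp add: VB.M.finsum_zero)
    qed
    finally show ?thesis .
  qed
  from TS_memI[OF xc u this] show ?thesis by blast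
qed

text \<open>The term of a shuffle evaluates to the summand of \<open>families\<close> for the set of
  blocks in the positions that receive the first \<open>i\<close> factors. Shuffles for all
  \<open>i\<close> together meet every subset exactly once.\<close>

lemma nuhat_mult:
  assumes x: "x \<in> carrier (TS K D)" and y: "y \<in> carrier (TS K D)" and Bs: "block_list Bs"
  shows "nuhat Bs ((x \<otimes>\<^bsub>TS K D\<^esub> y) (length Bs)) = (Psi x \<otimes>\<^bsub>families\<^esub> Psi y) (set Bs)"
proof -
  define n where "n = length Bs"
  define A where "A = set Bs"
  have A: "block_family A" using Bs by (simp add: A_def block_list_def)
  have dB: "distinct Bs" using Bs by (simp add: block_list_def)
  interpret Tn: module K "T n" by (rule module_T)
  interpret VA: module K "V A" by (rule V[OF A])
  have hom: "nuhat Bs \<in> module_hom K (T n) (V A)" using nuhat_hom[OF Bs] by (simp add: n_def A_def)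
  define g where "g S = star S (A - S) (Psi x S) (Psi y (A - S))" for S
  have gc: "g S \<in> carrier (V A)" if "S \<subseteq> A" for S
    unfolding g_def by (rule mult_term_closed[OF family_Psi[OF x] family_Psi[OF y] A that])
  \<comment> \<open>The set of blocks that receive the factors of \<open>x\<close> under the
    shuffle.\<close>
  define h where "h p = (\<lambda>k. Bs ! k) ` (snd p ` {..<fst p})" for p :: "nat \<times> (nat \<Rightarrow> nat)"
  have tm: "nuhat Bs (tensor_permute K D n \<sigma> (tensor_concat K D i (n - i) (x i) (y (n - i)))) = g (h (i, \<sigma>))"
    and tc: "tensor_permute K D n \<sigma> (tensor_concat K D i (n - i) (x i) (y (n - i))) \<in> carrier (T n)"
    and hA: "h (i, \<sigma>) \<subseteq> A"
    if i: "i \<le> n" and \<sigma>: "\<sigma> \<in> shuffle_perms i (n - i)" for i \<sigma>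
  proof -
    have p: "\<sigma> permutes {..<n}" using i \<sigma> by (simp add: shuffle_perms_def)
    have cc: "tensor_concat K D i (n - i) (x i) (y (n - i)) \<in> carrier (T n)"
      using concat_closed[OF TS_closed[OF x] TS_closed[OF y], of i "n - i"] i by simp
    then show "tensor_permute K D n \<sigma> (tensor_concat K D i (n - i) (x i) (y (n - i))) \<in> carrier (T n)"
      by (rule module_hom_closed[OF permute_hom[OF p]])
    \<comment> \<open>In this order the first \<open>i\<close> blocks are those of
      \<open>h (i, \<sigma>)\<close>, so that \<open>nuhat_concat\<close> applies to the split
      list.\<close>
    define Cs where "Cs = permute_list \<sigma> Bs"
    have Cs: "block_list Cs" and lC: "length Cs = n" and sC: "set Cs = A"
      using block_list_permute[OF Bs, of \<sigma>] p by (simp_all add: Cs_def n_def A_def)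
    have tl: "length (take i Cs) = i" "length (drop i Cs) = n - i" using i lC by simp_all
    have bl: "block_list (take i Cs @ drop i Cs)" using Cs by simp
    have bl2: "block_list (take i Cs)" "block_list (drop i Cs)" using bl by (simp_all only: block_list_append)
    have S: "set (take i Cs) = h (i, \<sigma>)"
    proof -
      have "set (take i Cs) = (\<lambda>k. Cs ! k) ` {..<i}"
        using nth_image[of i Cs] i lC by (simp add: lessThan_atLeast0)
      also have "\<dots> = h (i, \<sigma>)"
        using i p by (auto simp: h_def Cs_def permute_list_nth n_def image_image intro!: image_cong)
      finally show ?thesis .
    qed
    have "distinct (take i Cs @ drop i Cs)" using Cs by (simp add: block_list_def)
    then have "set (take i Cs) \<inter> set (drop i Cs) = {}" by (simp only: distinct_append)
    moreover have "set (take i Cs) \<union> set (drop i Cs) = A"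
      using sC by (metis append_take_drop_id set_append)
    ultimately have Sc: "set (drop i Cs) = A - h (i, \<sigma>)" using S by auto
    show "h (i, \<sigma>) \<subseteq> A" using \<open>set (take i Cs) \<union> set (drop i Cs) = A\<close> S by auto
    have "nuhat Bs (tensor_permute K D n \<sigma> (tensor_concat K D i (n - i) (x i) (y (n - i)))) =
        nuhat Cs (tensor_concat K D i (n - i) (x i) (y (n - i)))"
      using nuhat_permute[OF Bs, of \<sigma>] p cc by (simp add: n_def Cs_def)
    also have "\<dots> = star (set (take i Cs)) (set (drop i Cs)) (nuhat (take i Cs) (x i)) (nuhat (drop i Cs) (y (n - i)))"
      using nuhat_concat[OF bl, of "x i" "y (n - i)"] TS_closed[OF x] TS_closed[OF y] tl by simp
    also have "\<dots> = g (h (i, \<sigma>))"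
      using Psi_eq[OF x bl2(1)] Psi_eq[OF y bl2(2)] tl S Sc by (simp add: g_def)
    finally show "nuhat Bs (tensor_permute K D n \<sigma> (tensor_concat K D i (n - i) (x i) (y (n - i)))) = g (h (i, \<sigma>))" .
  qed
  have ghc: "g (h (i, \<sigma>)) \<in> carrier (V A)" if "i \<le> n" "\<sigma> \<in> shuffle_perms i (n - i)" for i \<sigma>
    by (rule gc[OF hA[OF that]])
  let ?J = "Sigma {..n} (\<lambda>i. shuffle_perms i (n - i))"
  have injB: "inj_on (\<lambda>k. Bs ! k) {..<n}" using dB by (simp add: inj_on_nth n_def)
  have imB: "(\<lambda>k. Bs ! k) ` {..<n} = A"
    by (auto simp: A_def n_def set_conv_nth)
  have sh: "bij_betw (\<lambda>\<sigma>. \<sigma> ` {..<i}) (shuffle_perms i (n - i)) {I. I \<subseteq> {..<n} \<and> card I = i}" if "i \<le> n" for i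
    using shuffle_image_bij[of i "n - i"] that by simp
  have shI: "\<sigma> ` {..<i} \<subseteq> {..<n} \<and> card (\<sigma> ` {..<i}) = i" if "i \<le> n" "\<sigma> \<in> shuffle_perms i (n - i)" for i \<sigma>
    using bij_betw_apply[OF sh[OF that(1)] that(2)] by simp
  have hinj: "inj_on h ?J"
  proof (rule inj_onI)
    fix p q assume pJ: "p \<in> ?J" and qJ: "q \<in> ?J" and eq: "h p = h q"
    obtain i \<sigma> j \<tau> where pq: "p = (i, \<sigma>)" "q = (j, \<tau>)" by (cases p, cases q)
    have I: "\<sigma> ` {..<i} \<subseteq> {..<n}" "card (\<sigma> ` {..<i}) = i" "\<tau> ` {..<j} \<subseteq> {..<n}" "card (\<tau> ` {..<j}) = j"
      using shI[of i \<sigma>] shI[of j \<tau>] pJ qJ by (simp_all add: pq)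
    have "\<sigma> ` {..<i} = \<tau> ` {..<j}"
      using eq inj_on_image_eq_iff[OF injB I(1) I(3)] by (simp add: h_def pq)
    \<comment> \<open>The number of positions recovers \<open>i\<close>, so the sets for different
      \<open>i\<close> cannot coincide.\<close>
    moreover from this have "i = j" using I by metis
    ultimately show "p = q"
      using inj_onD[OF bij_betw_imp_inj_on[OF sh[of i]], of \<sigma> \<tau>] pJ qJ by (simp add: pq)
  qed
  have himg: "h ` ?J = Pow A"
  proof
    show "h ` ?J \<subseteq> Pow A" using hA by auto
    show "Pow A \<subseteq> h ` ?J"
    proof
      fix S assume "S \<in> Pow A"
      then obtain I where I: "I \<subseteq> {..<n}" "S = (\<lambda>k. Bs ! k) ` I" using imB by (metis PowD subset_imageE)
      have c: "card I \<le> n" using card_mono[OF _ I(1)] by simp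
      have "I \<in> (\<lambda>\<sigma>. \<sigma> ` {..<card I}) ` shuffle_perms (card I) (n - card I)"
        unfolding bij_betw_imp_surj_on[OF sh[OF c]] using I(1) by simp
      then obtain \<sigma> where "\<sigma> \<in> shuffle_perms (card I) (n - card I)" "I = \<sigma> ` {..<card I}"
        by (rule imageE)
      then have "(card I, \<sigma>) \<in> ?J" "S = h (card I, \<sigma>)"
        using c I(2) by (simp_all add: h_def)
      then show "S \<in> h ` ?J" by (rule rev_image_eqI)
    qed
  qed
  have "nuhat Bs ((x \<otimes>\<^bsub>TS K D\<^esub> y) n) = finsum (V A) (\<lambda>i. nuhat Bs (finsum (T n)
      (\<lambda>\<sigma>. tensor_permute K D n \<sigma> (tensor_concat K D i (n - i) (x i) (y (n - i)))) (shuffle_perms i (n - i)))) {..n}"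
    unfolding TS_simps(2) using tc
    by (intro module_hom_finsum[OF hom] module_T V A) (auto intro!: Tn.M.finsum_closed)
  also have "\<dots> = finsum (V A) (\<lambda>i. finsum (V A) (\<lambda>\<sigma>. g (h (i, \<sigma>))) (shuffle_perms i (n - i))) {..n}"
  proof (intro VA.M.finsum_cong' refl)
    fix i assume i: "i \<in> {..n}"
    have "nuhat Bs (finsum (T n) (\<lambda>\<sigma>. tensor_permute K D n \<sigma> (tensor_concat K D i (n - i) (x i) (y (n - i)))) (shuffle_perms i (n - i)))
        = finsum (V A) (\<lambda>\<sigma>. nuhat Bs (tensor_permute K D n \<sigma> (tensor_concat K D i (n - i) (x i) (y (n - i))))) (shuffle_perms i (n - i))"
      using tc i by (intro module_hom_finsum[OF hom] module_T V A) auto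
    also have "\<dots> = finsum (V A) (\<lambda>\<sigma>. g (h (i, \<sigma>))) (shuffle_perms i (n - i))"
      using i by (intro VA.M.finsum_cong' refl) (auto intro!: ghc simp: tm)
    finally show "nuhat Bs (finsum (T n) (\<lambda>\<sigma>. tensor_permute K D n \<sigma> (tensor_concat K D i (n - i) (x i) (y (n - i)))) (shuffle_perms i (n - i)))
        = finsum (V A) (\<lambda>\<sigma>. g (h (i, \<sigma>))) (shuffle_perms i (n - i))" .
  qed (auto intro!: VA.M.finsum_closed ghc)
  also have "\<dots> = finsum (V A) (\<lambda>(i, \<sigma>). g (h (i, \<sigma>))) ?J"
    using ghc by (intro VA.M.finsum_Sigma) (auto simp: finite_shuffle_perms)
  also have "\<dots> = finsum (V A) (\<lambda>p. g (h p)) ?J"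
    by (simp add: case_prod_unfold)
  also have "\<dots> = finsum (V A) g (h ` ?J)"
    using gc unfolding himg by (intro VA.M.finsum_reindex[symmetric, OF _ hinj, unfolded himg]) auto
  also have "\<dots> = (Psi x \<otimes>\<^bsub>families\<^esub> Psi y) A"
    unfolding himg families_mult[OF A] g_def ..
  finally show ?thesis by (simp add: A_def n_def)
qed

section \<open>Compatibility with the algebra operations\<close>

lemma TS_mult:
  assumes x: "x \<in> carrier (TS K D)" and y: "y \<in> carrier (TS K D)"
  shows "x \<otimes>\<^bsub>TS K D\<^esub> y \<in> carrier (TS K D)" "Psi (x \<otimes>\<^bsub>TS K D\<^esub> y) = Psi x \<otimes>\<^bsub>families\<^esub> Psi y"
proof -
  have c: "(x \<otimes>\<^bsub>TS K D\<^esub> y) n \<in> carrier (T n)" for n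
  proof -
    interpret Tn: module K "T n" by (rule module_T)
    have "tensor_permute K D n \<sigma> (tensor_concat K D i (n - i) (x i) (y (n - i))) \<in> carrier (T n)"
      if "i \<le> n" "\<sigma> \<in> shuffle_perms i (n - i)" for i \<sigma>
      using that concat_closed[OF TS_closed[OF x] TS_closed[OF y], of i "n - i"]
      by (intro module_hom_closed[OF permute_hom]) (auto simp: shuffle_perms_def)
    then show ?thesis unfolding TS_simps(2) by (auto intro!: Tn.M.finsum_closed)
  qed
  show "x \<otimes>\<^bsub>TS K D\<^esub> y \<in> carrier (TS K D)" "Psi (x \<otimes>\<^bsub>TS K D\<^esub> y) = Psi x \<otimes>\<^bsub>families\<^esub> Psi y"
    using TS_memI[OF c family_mult[OF family_Psi[OF x] family_Psi[OF y]] nuhat_mult[OF x y]] by auto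
qed

lemma TS_one: "\<one>\<^bsub>TS K D\<^esub> \<in> carrier (TS K D)" "Psi \<one>\<^bsub>TS K D\<^esub> = \<one>\<^bsub>families\<^esub>"
proof -
  interpret T: module K "T r" for r by (rule module_T)
  have c: "\<one>\<^bsub>TS K D\<^esub> r \<in> carrier (T r)" for r
    using pure_closed[of 0 "[]"] by (simp add: TS_simps)
  have n: "nuhat Bs (\<one>\<^bsub>TS K D\<^esub> (length Bs)) = \<one>\<^bsub>families\<^esub> (set Bs)" if Bs: "block_list Bs" for Bs
  proof (cases Bs)
    case Nil
    then show ?thesis using nuhat_pure[of "[]" "[]"] by (simp add: TS_simps families_simps idx_iff tensor_index_def)
  next
    case (Cons B Cs)
    then show ?thesis using nuhat_zero[OF Bs] Bs by (simp add: TS_simps families_simps block_list_def)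
  qed
  show "\<one>\<^bsub>TS K D\<^esub> \<in> carrier (TS K D)" "Psi \<one>\<^bsub>TS K D\<^esub> = \<one>\<^bsub>families\<^esub>"
    using TS_memI[OF c family_one n] by auto
qed

lemma TS_zero: "\<zero>\<^bsub>TS K D\<^esub> \<in> carrier (TS K D)" "Psi \<zero>\<^bsub>TS K D\<^esub> = \<zero>\<^bsub>families\<^esub>"
proof -
  interpret T: module K "T r" for r by (rule module_T)
  have n: "nuhat Bs (\<zero>\<^bsub>TS K D\<^esub> (length Bs)) = \<zero>\<^bsub>families\<^esub> (set Bs)" if Bs: "block_list Bs" for Bs
    using nuhat_zero[OF Bs] Bs by (simp add: TS_simps families_simps block_list_def)
  show "\<zero>\<^bsub>TS K D\<^esub> \<in> carrier (TS K D)" "Psi \<zero>\<^bsub>TS K D\<^esub> = \<zero>\<^bsub>families\<^esub>"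
    using TS_memI[OF _ family_zero n] by (auto simp: TS_simps(4))
qed

lemma TS_add:
  assumes x: "x \<in> carrier (TS K D)" and y: "y \<in> carrier (TS K D)"
  shows "x \<oplus>\<^bsub>TS K D\<^esub> y \<in> carrier (TS K D)" "Psi (x \<oplus>\<^bsub>TS K D\<^esub> y) = Psi x \<oplus>\<^bsub>families\<^esub> Psi y"
proof -
  interpret T: module K "T r" for r by (rule module_T)
  have n: "nuhat Bs ((x \<oplus>\<^bsub>TS K D\<^esub> y) (length Bs)) = (Psi x \<oplus>\<^bsub>families\<^esub> Psi y) (set Bs)" if Bs: "block_list Bs" for Bs
    using module_hom_add[OF nuhat_hom[OF Bs] TS_closed[OF x] TS_closed[OF y]] Bs
      Psi_eq[OF x Bs] Psi_eq[OF y Bs] by (simp add: TS_simps families_simps block_list_def)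
  have c: "(x \<oplus>\<^bsub>TS K D\<^esub> y) r \<in> carrier (T r)" for r
    using TS_closed[OF x] TS_closed[OF y] by (simp add: TS_simps(5))
  show "x \<oplus>\<^bsub>TS K D\<^esub> y \<in> carrier (TS K D)" "Psi (x \<oplus>\<^bsub>TS K D\<^esub> y) = Psi x \<oplus>\<^bsub>families\<^esub> Psi y"
    using TS_memI[OF c family_add[OF family_Psi[OF x] family_Psi[OF y]] n] by auto
qed

lemma TS_smult:
  assumes a: "a \<in> carrier K" and x: "x \<in> carrier (TS K D)"
  shows "a \<odot>\<^bsub>TS K D\<^esub> x \<in> carrier (TS K D)" "Psi (a \<odot>\<^bsub>TS K D\<^esub> x) = a \<odot>\<^bsub>families\<^esub> Psi x"
proof -
  interpret T: module K "T r" for r by (rule module_T)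
  have n: "nuhat Bs ((a \<odot>\<^bsub>TS K D\<^esub> x) (length Bs)) = (a \<odot>\<^bsub>families\<^esub> Psi x) (set Bs)" if Bs: "block_list Bs" for Bs
    using module_hom_smult[OF nuhat_hom[OF Bs] a TS_closed[OF x]] Bs
      Psi_eq[OF x Bs] by (simp add: TS_simps families_simps block_list_def)
  have c: "(a \<odot>\<^bsub>TS K D\<^esub> x) r \<in> carrier (T r)" for r
    using TS_closed[OF x] a by (simp add: TS_simps(6))
  show "a \<odot>\<^bsub>TS K D\<^esub> x \<in> carrier (TS K D)" "Psi (a \<odot>\<^bsub>TS K D\<^esub> x) = a \<odot>\<^bsub>families\<^esub> Psi x"
    using TS_memI[OF c family_smult[OF a family_Psi[OF x]] n] by auto
qed

section \<open>The graded isomorphism from \<open>TS\<close>\<close>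

lemma Psi_bij: "bij_betw Psi (carrier (TS K D)) (carrier families)"
proof (rule bij_betw_imageI)
  show "inj_on Psi (carrier (TS K D))" by (rule inj_onI) (rule Psi_inject)
  show "Psi ` carrier (TS K D) = carrier families"
    using family_Psi Psi_surj by (auto simp: families_simps)
qed

text \<open>The degree of a homogeneous pure tensor is the number of points of the block lists that
  it fits. So a tensor of degree \<open>n\<close> evaluates to zero elsewhere; conversely, the parts
  of a preimage with another total degree are zero because the family is.\<close>

lemma Psi_degree: "Psi ` TS_degree K M n = family_degree n"
proof -
  let ?G = "\<lambda>r. {pure r zs | zs ds. length zs = r \<and> length ds = r \<and>
    (\<forall>j<r. zs ! j \<in> homogeneous M (ds ! j)) \<and> (\<Sum>j<r. ds ! j + 1) = n}"
  have deg: "TS_degree K M n = {x \<in> carrier (TS K D). \<forall>r. x r \<in> submodule_span K (T r) (?G r)}"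
    by (simp add: TS_degree_def Let_def)
  have sub: "submodule (submodule_span K (T r) (?G r)) K (T r)" for r
    using pure_closed by (intro submodule_spanI module_T) auto
  have sl: "(\<Sum>j<length ds. ds ! j + 1) = sum_list (map Suc ds)" for ds
    by (simp add: sum_list_sum_nth atLeast0LessThan Suc_eq_plus1)
  have cstd: "card (std ds ! i) - 1 = ds ! i" if "i < length ds" for ds i
    using arg_cong[OF std_card[of ds], of "\<lambda>l. l ! i"] that by simp
  have hl: "homlist (std ds) zs \<longleftrightarrow> length zs = length ds \<and> (\<forall>j<length ds. zs ! j \<in> homogeneous M (ds ! j))" for ds zs
    using cstd[of _ ds] by (auto simp: list_all2_conv_all_nth)
  show ?thesis
  proof
    show "Psi ` TS_degree K M n \<subseteq> family_degree n"
    proof (rule image_subsetI)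
      fix x assume x: "x \<in> TS_degree K M n"
      then have xc: "x \<in> carrier (TS K D)" by (simp add: deg)
      have "Psi x A = \<zero>\<^bsub>V A\<^esub>" if A: "block_family A" and c: "card (\<Union>A) \<noteq> n" for A
      proof -
        define Bs where "Bs = blocks A"
        have Bs: "block_list Bs" "set Bs = A" using A by (simp_all add: Bs_def block_list_blocks set_blocks)
        let ?r = "length Bs"
        \<comment> \<open>The kernel of the evaluation is a submodule, so it is enough that the pure
          tensors spanning degree \<open>n\<close> lie in it.\<close>
        have "submodule_span K (T ?r) (?G ?r) \<subseteq> {t \<in> carrier (T ?r). nuhat Bs t = \<zero>\<^bsub>V (set Bs)\<^esub>}"
        proof (rule span_least[OF submodule_equalizer[OF nuhat_hom[OF Bs(1)] module_hom_const_zero[OF V_blocks[OF Bs(1)]] module_T V_blocks[OF Bs(1)]]])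
          show "?G ?r \<subseteq> {t \<in> carrier (T ?r). nuhat Bs t = \<zero>\<^bsub>V (set Bs)\<^esub>}"
          proof
            fix t assume "t \<in> ?G ?r"
            then obtain zs ds where t0: "t = pure ?r zs" "length zs = ?r" "length ds = ?r"
              "\<forall>j<?r. zs ! j \<in> homogeneous M (ds ! j)" "(\<Sum>j<?r. ds ! j + 1) = n"
              by blast
            have t: "t = pure ?r zs" "length ds = ?r" "homlist (std ds) zs" "sum_list (map Suc ds) = n"
              using t0 sl[of ds] by (simp_all add: hl)
            have "map card Bs \<noteq> map card (std ds)"
              using t(4) c card_Union_blocks[OF Bs(1)] Bs(2) by (metis std_card)
            then have "nu (zip Bs zs) = \<zero>\<^bsub>V (set Bs)\<^esub>"
              using t by (intro nu_homlist_degree[OF Bs(1) t(3) _ block_list_mem[OF block_list_std]]) auto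
            moreover have "zs \<in> idx ?r" using homlist_idx[OF t(3)] t(2) by simp
            ultimately show "t \<in> {t \<in> carrier (T ?r). nuhat Bs t = \<zero>\<^bsub>V (set Bs)\<^esub>}"
              using nuhat_pure[OF Bs(1)] pure_closed t(1) by simp
          qed
        qed
        then have "nuhat Bs (x ?r) = \<zero>\<^bsub>V (set Bs)\<^esub>" using x by (auto simp: deg)
        then show ?thesis using Psi_eq[OF xc Bs(1)] Bs(2) by simp
      qed
      then show "Psi x \<in> family_degree n" using family_Psi[OF xc] by (simp add: family_degree_def)
    qed
    show "family_degree n \<subseteq> Psi ` TS_degree K M n"
    proof
      fix u assume u: "u \<in> family_degree n"
      then have fu: "family u" by (simp add: family_degree_def)
      obtain x where x: "x \<in> carrier (TS K D)" "Psi x = u" using Psi_surj[OF fu] by blast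
      have "x r \<in> submodule_span K (T r) (?G r)" for r
      proof -
        from T_expand[OF TS_closed[OF x(1)], of r] obtain F where F: "F \<subseteq> {ds. length ds = r}" "finite F"
          "\<forall>E. finite E \<and> F \<subseteq> E \<and> E \<subseteq> {ds. length ds = r} \<longrightarrow>
            x r = finsum (T r) (\<lambda>ds. theta (std ds) (nuhat (std ds) (x r))) E"
          by (elim exE conjE) (rule that; assumption)
        have "x r = finsum (T r) (\<lambda>ds. theta (std ds) (nuhat (std ds) (x r))) F"
          using F by blast
        moreover have "finsum (T r) (\<lambda>ds. theta (std ds) (nuhat (std ds) (x r))) F \<in> submodule_span K (T r) (?G r)"
        proof (rule submodule_finsum[OF sub module_T])
          fix ds assume "ds \<in> F"
          then have len: "length ds = r" using F(1) by auto
          have nx: "nuhat (std ds) (x r) = u (set (std ds))"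
            using Psi_eq[OF x(1) block_list_std, of ds] x(2) len by simp
          have bf: "block_family (set (std ds))" using block_list_std by (simp add: block_list_def)
          show "theta (std ds) (nuhat (std ds) (x r)) \<in> submodule_span K (T r) (?G r)"
          \<comment> \<open>Parts of total degree \<open>n\<close> are combinations of the required
            pure tensors by \<open>theta_span\<close>; all other parts vanish.\<close>
          proof (cases "sum_list (map Suc ds) = n")
            case True
            have "theta (std ds) (u (set (std ds))) \<in> submodule_span K (T r) (?G r)"
            proof (rule theta_span[OF block_list_std family_closed[OF fu bf]])
              show "submodule (submodule_span K (T r) (?G r)) K (T (length (std ds)))"
                using sub len by simp
              fix zs assume "homlist (std ds) zs"
              then have "length zs = r \<and> length ds = r \<and> (\<forall>j<r. zs ! j \<in> homogeneous M (ds ! j)) \<and>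
                  (\<Sum>j<r. ds ! j + 1) = n"
                using True sl[of ds] len by (simp add: hl)
              then have "pure r zs \<in> ?G r" by blast
              then have "pure r zs \<in> submodule_span K (T r) (?G r)"
                by (rule subsetD[OF span_superset])
              then show "pure (length (std ds)) zs \<in> submodule_span K (T r) (?G r)"
                by (simp only: std_length len)
            qed
            then show ?thesis by (simp add: nx)
          next
            case False
            then have "card (\<Union>(set (std ds))) \<noteq> n"
              using card_Union_blocks[OF block_list_std, of ds] std_card[of ds] by simp
            then have "u (set (std ds)) = \<zero>\<^bsub>V (set (std ds))\<^esub>" using u bf by (simp add: family_degree_def)
            then have "theta (std ds) (nuhat (std ds) (x r)) = \<zero>\<^bsub>T r\<^esub>"
              using module_hom_zero[OF theta_hom[OF block_list_std] V_blocks[OF block_list_std] module_T, of ds] len nx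
              by simp
            then show ?thesis using submodule_zero[OF sub] by simp
          qed
        qed
        ultimately show ?thesis by simp
      qed
      then have "x \<in> TS_degree K M n" using x(1) by (simp add: deg)
      then show "u \<in> Psi ` TS_degree K M n" using x(2) by blast
    qed
  qed
qed

text \<open>The axioms are transported backwards along \<open>Psi\<close>, which avoids verifying
  the shuffle product directly.\<close>

lemma graded_algebra_TS: "graded_algebra K (TS K D) (TS_degree K M)"
proof (rule graded_algebra_image[OF graded_algebra_families, where \<phi> = "inv_into (carrier (TS K D)) Psi"])
  let ?i = "inv_into (carrier (TS K D)) Psi"
  show "bij_betw ?i (carrier families) (carrier (TS K D))"
    by (rule bij_betw_inv_into[OF Psi_bij])
  have inj: "inj_on Psi (carrier (TS K D))" using Psi_bij by (simp add: bij_betw_def)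
  have ex: "\<exists>x \<in> carrier (TS K D). u = Psi x" if "u \<in> carrier families" for u
    using that Psi_surj by (auto simp: families_simps)
  have i: "?i (Psi x) = x" if "x \<in> carrier (TS K D)" for x
    using inj that by simp
  show "?i \<one>\<^bsub>families\<^esub> = \<one>\<^bsub>TS K D\<^esub>" "?i \<zero>\<^bsub>families\<^esub> = \<zero>\<^bsub>TS K D\<^esub>"
    using i[OF TS_one(1)] i[OF TS_zero(1)] by (simp_all add: TS_one(2) TS_zero(2))
  fix u v assume u: "u \<in> carrier families" and v: "v \<in> carrier families"
  obtain x where x: "x \<in> carrier (TS K D)" "u = Psi x"
    by (rule bexE[OF ex[OF u]])
  obtain y where y: "y \<in> carrier (TS K D)" "v = Psi y"
    by (rule bexE[OF ex[OF v]])
  show "?i (u \<oplus>\<^bsub>families\<^esub> v) = ?i u \<oplus>\<^bsub>TS K D\<^esub> ?i v"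
    unfolding x(2) y(2) TS_add(2)[OF x(1) y(1), symmetric] i[OF x(1)] i[OF y(1)]
    by (rule i[OF TS_add(1)[OF x(1) y(1)]])
  show "?i (u \<otimes>\<^bsub>families\<^esub> v) = ?i u \<otimes>\<^bsub>TS K D\<^esub> ?i v"
    unfolding x(2) y(2) TS_mult(2)[OF x(1) y(1), symmetric] i[OF x(1)] i[OF y(1)]
    by (rule i[OF TS_mult(1)[OF x(1) y(1)]])
next
  let ?i = "inv_into (carrier (TS K D)) Psi"
  fix a u assume a: "a \<in> carrier K" and "u \<in> carrier families"
  then have "u \<in> Psi ` carrier (TS K D)"
    unfolding bij_betw_imp_surj_on[OF Psi_bij] by simp
  then obtain x where x: "x \<in> carrier (TS K D)" "u = Psi x"
    by (rule imageE)
  have i: "?i (Psi x) = x" if "x \<in> carrier (TS K D)" for x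
    using Psi_bij that by (simp add: bij_betw_def)
  show "?i (a \<odot>\<^bsub>families\<^esub> u) = a \<odot>\<^bsub>TS K D\<^esub> ?i u"
    unfolding x(2) TS_smult(2)[OF a x(1), symmetric] i[OF x(1)]
    by (rule i[OF TS_smult(1)[OF a x(1)]])
next
  let ?i = "inv_into (carrier (TS K D)) Psi"
  show "TS_degree K M n = ?i ` family_degree n" for n
  proof -
    have "TS_degree K M n \<subseteq> carrier (TS K D)" by (auto simp: TS_degree_def Let_def)
    then show ?thesis
      unfolding Psi_degree[of n, symmetric]
      using inv_into_image_cancel[of Psi "carrier (TS K D)" "TS_degree K M n"] Psi_bij
      by (simp add: bij_betw_def)
  qed
qed

lemma Psi_iso: "Psi \<in> graded_algebra_iso K (TS K D) (TS_degree K M) families family_degree"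
proof -
  have c: "Psi x \<in> carrier families" if "x \<in> carrier (TS K D)" for x
    using family_Psi[OF that] by (simp add: families_simps)
  have "Psi \<in> ring_iso (TS K D) families"
    using Psi_bij c by (simp add: ring_iso_def ring_hom_def TS_add TS_mult TS_one)
  moreover have "Psi \<in> module_hom K (TS K D) families"
    using c by (intro module_homI) (simp_all add: TS_add TS_smult)
  ultimately show ?thesis
    using Psi_degree graded_algebra_TS graded_algebra_families by (simp add: graded_algebra_iso_def)
qed

end

section \<open>Partitions as block families\<close>

definition ptn_of :: "nat set set \<Rightarrow> ptn" where
  "ptn_of A = (\<Union>A, \<Union>B\<in>A. B \<times> B)"

abbreviation inl :: "nat \<Rightarrow> nat" where "inl x \<equiv> sum_encode (Inl x)"
abbreviation inr :: "nat \<Rightarrow> nat" where "inr x \<equiv> sum_encode (Inr x)"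

definition sumb :: "nat set set \<Rightarrow> nat set set \<Rightarrow> nat set set" where
  "sumb A B = im inl A \<union> im inr B"

definition fine :: "nat set set \<Rightarrow> nat set set \<Rightarrow> bool" where
  "fine C A \<longleftrightarrow> \<Union>C = \<Union>A \<and> (\<forall>X\<in>C. \<exists>Y\<in>A. X \<subseteq> Y)"

text \<open>A condition on blocks that implies membership in \<open>ptn_mor\<close>; images of
  blocks are easier to follow through compositions than related pairs.\<close>

definition mor :: "(nat \<Rightarrow> nat) \<Rightarrow> nat set set \<Rightarrow> nat set set \<Rightarrow> bool" where
  "mor f A B \<longleftrightarrow> bij_betw f (\<Union>A) (\<Union>B) \<and> (\<forall>X\<in>A. \<exists>Y\<in>B. f ` X \<subseteq> Y)"

lemma lr_inj [simp]: "inl x = inl y \<longleftrightarrow> x = y" "inr x = inr y \<longleftrightarrow> x = y" "inl x \<noteq> inr y" "inr y \<noteq> inl x"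
  by (simp_all add: sum_encode_eq)

lemma lr_cases: obtains x where "n = inl x" | y where "n = inr y"
proof (cases "sum_decode n")
  case (Inl x)
  then show ?thesis using that(1)[of x] by (metis sum_decode_inverse)
next
  case (Inr y)
  then show ?thesis using that(2)[of y] by (metis sum_decode_inverse)
qed

lemma lr_fun_eqI: "(\<And>x. f (inl x) = g (inl x)) \<Longrightarrow> (\<And>y. f (inr y) = g (inr y)) \<Longrightarrow> f = g"
  by (rule ext) (metis lr_cases)

lemma sum_maps [simp]:
  "sum_fold (inl x) = x" "sum_fold (inr y) = y"
  "sum_swap (inl x) = inr x" "sum_swap (inr y) = inl y"
  "mor_sum f g (inl x) = inl (f x)" "mor_sum f g (inr y) = inr (g y)"
  "sum_assoc (inl (inl x)) = inl x" "sum_assoc (inl (inr y)) = inr (inl y)" "sum_assoc (inr z) = inr (inr z)"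
  "append_mor i (inl x) = x" "append_mor i (inr y) = i + y"
  by (simp_all add: sum_fold_def sum_swap_def mor_sum_def sum_assoc_def append_mor_def)

lemma mor_sum_id: "mor_sum id id = id"
  by (rule lr_fun_eqI) simp_all

lemma block_family_nonempty: "block_family A \<Longrightarrow> B \<in> A \<Longrightarrow> \<exists>x. x \<in> B"
  unfolding block_family_def by (metis ex_in_conv)

lemma lr_image_eq [simp]: "inl ` X = inl ` Y \<longleftrightarrow> X = Y" "inr ` X = inr ` Y \<longleftrightarrow> X = Y"
  "inl ` X = inr ` Y \<longleftrightarrow> X = {} \<and> Y = {}" "inr ` Y = inl ` X \<longleftrightarrow> X = {} \<and> Y = {}"
proof -
  show "inl ` X = inl ` Y \<longleftrightarrow> X = Y" "inr ` X = inr ` Y \<longleftrightarrow> X = Y"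
    by (rule inj_image_eq_iff; simp add: inj_def)+
  have "inl ` X \<inter> inr ` Y = {}" by auto
  then show "inl ` X = inr ` Y \<longleftrightarrow> X = {} \<and> Y = {}" "inr ` Y = inl ` X \<longleftrightarrow> X = {} \<and> Y = {}"
    by (metis Int_absorb image_empty image_is_empty)+
qed

lemma block_family_eq:
  assumes "block_family A" "B \<in> A" "C \<in> A" "x \<in> B" "x \<in> C"
  shows "B = C"
proof (rule ccontr)
  assume "B \<noteq> C"
  then have "B \<inter> C = {}" using assms(1-3) by (simp add: block_family_def disjoint_def)
  then show False using assms(4,5) by blast
qed

lemma is_ptn_of:
  assumes "block_family A"
  shows "is_ptn (ptn_of A)"
proof -
  have "equiv (\<Union>A) (\<Union>B\<in>A. B \<times> B)"
  proof (rule equivI)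
    show "trans (\<Union>B\<in>A. B \<times> B)"
    proof (rule transI)
      fix x y z assume "(x, y) \<in> (\<Union>B\<in>A. B \<times> B)" "(y, z) \<in> (\<Union>B\<in>A. B \<times> B)"
      then obtain B C where "B \<in> A" "C \<in> A" "x \<in> B" "y \<in> B" "y \<in> C" "z \<in> C" by auto
      moreover from this have "B = C" using block_family_eq[OF assms] by blast
      ultimately show "(x, z) \<in> (\<Union>B\<in>A. B \<times> B)" by auto
    qed
  qed (auto simp: refl_on_def sym_def)
  then show ?thesis using assms by (simp add: is_ptn_def ptn_of_def block_family_def)
qed

lemma quotient_ptn_of:
  assumes A: "block_family A"
  shows "fst (ptn_of A) // snd (ptn_of A) = A"
proof -
  let ?r = "\<Union>B\<in>A. B \<times> B"
  have img: "?r `` {x} = B" if "B \<in> A" "x \<in> B" for B x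
  proof -
    have "y \<in> B" if "y \<in> ?r `` {x}" for y
    proof -
      from that obtain C where C: "C \<in> A" "x \<in> C" "y \<in> C" by auto
      then have "C = B" using block_family_eq[OF A C(1) \<open>B \<in> A\<close> C(2) \<open>x \<in> B\<close>] by simp
      then show ?thesis using C(3) by simp
    qed
    then show ?thesis using that by blast
  qed
  show ?thesis
  proof
    show "fst (ptn_of A) // snd (ptn_of A) \<subseteq> A"
      using img by (auto simp: ptn_of_def quotient_def)
    show "A \<subseteq> fst (ptn_of A) // snd (ptn_of A)"
    proof
      fix B assume B: "B \<in> A"
      then obtain x where x: "x \<in> B" using block_family_nonempty[OF A] by blast
      then have "B = ?r `` {x}" "x \<in> \<Union>A" using img[OF B x] B by auto
      then show "B \<in> fst (ptn_of A) // snd (ptn_of A)"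
        by (auto simp: ptn_of_def intro: quotientI)
    qed
  qed
qed

lemma ptn_of_inj: "block_family A \<Longrightarrow> block_family B \<Longrightarrow> ptn_of A = ptn_of B \<longleftrightarrow> A = B"
  using quotient_ptn_of by metis

lemma ptn_of_surj:
  assumes "is_ptn \<Lambda>"
  obtains A where "block_family A" "\<Lambda> = ptn_of A"
proof -
  let ?A = "fst \<Lambda> // snd \<Lambda>"
  have fin: "finite (fst \<Lambda>)" and eq: "equiv (fst \<Lambda>) (snd \<Lambda>)" using assms by (auto simp: is_ptn_def)
  have U: "\<Union>?A = fst \<Lambda>" by (rule Union_quotient[OF eq])
  have "disjoint ?A"
    using quotient_disj[OF eq] by (auto simp: disjoint_def)
  moreover have "{} \<notin> ?A" using in_quotient_imp_non_empty[OF eq] by auto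
  ultimately have bf: "block_family ?A" using U fin by (simp add: block_family_def)
  have "(\<Union>B\<in>?A. B \<times> B) = snd \<Lambda>"
  proof (intro equalityI subsetI)
    fix p assume "p \<in> (\<Union>B\<in>?A. B \<times> B)"
    then obtain B x y where "p = (x, y)" "B \<in> ?A" "x \<in> B" "y \<in> B" by auto
    then show "p \<in> snd \<Lambda>" using quotient_eq_iff[OF eq] by blast
  next
    fix p assume p: "p \<in> snd \<Lambda>"
    obtain x y where xy: "p = (x, y)" by (cases p)
    have x: "x \<in> fst \<Lambda>" using eq p xy by (auto simp: equiv_def)
    then have "snd \<Lambda> `` {x} \<in> ?A" "x \<in> snd \<Lambda> `` {x}" "y \<in> snd \<Lambda> `` {x}"
      using equiv_class_self[OF eq x] p xy by (auto intro: quotientI)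
    then show "p \<in> (\<Union>B\<in>?A. B \<times> B)" using xy by blast
  qed
  then have "\<Lambda> = ptn_of ?A" using U by (simp add: ptn_of_def)
  then show ?thesis using bf that by blast
qed

lemma ptn_mor_of: "mor f A B \<Longrightarrow> f \<in> ptn_mor (ptn_of A) (ptn_of B)"
proof -
  assume f: "mor f A B"
  have "(f x, f y) \<in> (\<Union>Y\<in>B. Y \<times> Y)" if "X \<in> A" "x \<in> X" "y \<in> X" for X x y
  proof -
    obtain Y where "Y \<in> B" "f ` X \<subseteq> Y" using f \<open>X \<in> A\<close> by (auto simp: mor_def)
    then show ?thesis using that by auto
  qed
  then show ?thesis using f by (auto simp: mor_def ptn_mor_def ptn_of_def)
qed

lemma ptn_image_of: "ptn_image f (ptn_of A) = ptn_of (im f A)"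
  by (auto simp: ptn_image_def ptn_of_def image_iff)

lemma ptn_sum_of: "ptn_sum (ptn_of A) (ptn_of B) = ptn_of (sumb A B)"
  by (auto simp: ptn_sum_def ptn_of_def sumb_def image_iff)

text \<open>The reason why only the images of blocks matter for transfers: if \<open>f\<close> and
  \<open>g\<close> send a block to the same set, then \<open>f x\<close> and \<open>g x\<close> lie
  in a common block.\<close>

lemma two_iso_of:
  "(\<forall>B\<in>A. f ` B = g ` B) \<Longrightarrow> two_iso (ptn_of A) (ptn_of (im f A)) f g"
proof -
  assume eq: "\<forall>B\<in>A. f ` B = g ` B"
  have "(f x, g x) \<in> (\<Union>Y\<in>im f A. Y \<times> Y)" if "X \<in> A" "x \<in> X" for x X
  proof -
    have "g x \<in> f ` X" using eq that by blast
    then show ?thesis using that by blast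
  qed
  then show ?thesis by (auto simp: two_iso_def ptn_of_def)
qed

lemma Union_sumb: "\<Union>(sumb A B) = inl ` \<Union>A \<union> inr ` \<Union>B"
  by (auto simp: sumb_def)

lemma block_family_sumb:
  assumes "block_family A" "block_family B"
  shows "block_family (sumb A B)"
  unfolding sumb_def using assms
  by (intro block_family_Un block_family_im) (auto simp: inj_on_def)

lemma refinements_of:
  assumes A: "block_family A"
  shows "refinements (ptn_of A) = ptn_of ` {C. block_family C \<and> fine C A}"
proof (intro equalityI subsetI)
  fix \<Gamma> assume \<Gamma>: "\<Gamma> \<in> refinements (ptn_of A)"
  then obtain C where C: "block_family C" "\<Gamma> = ptn_of C"
    using ptn_of_surj[of \<Gamma>] by (auto simp only: refinements_def mem_Collect_eq)
  have U: "\<Union>C = \<Union>A" and m: "\<And>x y. (x, y) \<in> snd (ptn_of C) \<Longrightarrow> (x, y) \<in> snd (ptn_of A)"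
    using \<Gamma> C by (auto simp: refinements_def ptn_le_def ptn_mor_def ptn_of_def)
  have "\<exists>Y\<in>A. X \<subseteq> Y" if X: "X \<in> C" for X
  proof -
    obtain x where x: "x \<in> X" using block_family_nonempty[OF C(1) X] by blast
    then obtain Y where Y: "Y \<in> A" "x \<in> Y" using U X by blast
    have "y \<in> Y" if y: "y \<in> X" for y
    proof -
      have "(x, y) \<in> snd (ptn_of A)" using x y X by (intro m) (auto simp: ptn_of_def)
      then obtain Z where "Z \<in> A" "x \<in> Z" "y \<in> Z" by (auto simp: ptn_of_def)
      then show ?thesis using block_family_eq[OF A \<open>Z \<in> A\<close> Y(1) \<open>x \<in> Z\<close> Y(2)] by simp
    qed
    then show ?thesis using Y by blast
  qed
  then show "\<Gamma> \<in> ptn_of ` {C. block_family C \<and> fine C A}" using C U by (auto simp: fine_def)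
next
  fix \<Gamma> assume "\<Gamma> \<in> ptn_of ` {C. block_family C \<and> fine C A}"
  then obtain C where C: "block_family C" "fine C A" "\<Gamma> = ptn_of C" by auto
  have "(x, y) \<in> snd (ptn_of A)" if "(x, y) \<in> snd (ptn_of C)" for x y
  proof -
    from that obtain X where X: "X \<in> C" "x \<in> X" "y \<in> X" by (auto simp: ptn_of_def)
    then obtain Y where "Y \<in> A" "X \<subseteq> Y" using C(2) by (auto simp: fine_def)
    then show ?thesis using X by (auto simp: ptn_of_def)
  qed
  then show "\<Gamma> \<in> refinements (ptn_of A)"
    using C is_ptn_of[OF C(1)] by (auto simp: refinements_def ptn_le_def ptn_mor_def fine_def) (auto simp: ptn_of_def)
qed

lemma underline_0: "underline 0 = ptn_of {}"
  by (simp add: underline_def ptn_of_def)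

lemma underline_Suc: "m > 0 \<Longrightarrow> underline m = ptn_of {{1..m}}"
  by (simp add: underline_def ptn_of_def)

section \<open>Morphisms between block families\<close>

lemma mor_im: "inj_on f (\<Union>A) \<Longrightarrow> mor f A (im f A)"
  by (auto simp: mor_def bij_betw_def Union_im)

lemma mor_id: "fine C A \<Longrightarrow> mor id C A"
  by (auto simp: mor_def fine_def)

lemma fine_refl: "fine A A"
  by (auto simp: fine_def)

lemma mor_comp: "mor f A B \<Longrightarrow> mor g B C \<Longrightarrow> mor (g \<circ> f) A C"
proof -
  assume f: "mor f A B" and g: "mor g B C"
  have "\<exists>Z\<in>C. (g \<circ> f) ` X \<subseteq> Z" if "X \<in> A" for X
  proof -
    obtain Y where Y: "Y \<in> B" "f ` X \<subseteq> Y" using f \<open>X \<in> A\<close> by (auto simp: mor_def)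
    obtain Z where "Z \<in> C" "g ` Y \<subseteq> Z" using g Y(1) by (auto simp: mor_def)
    then show ?thesis using Y(2) by (intro bexI[of _ Z]) auto
  qed
  then show ?thesis using f g bij_betw_trans[of f "\<Union>A" "\<Union>B" g "\<Union>C"] by (simp add: mor_def)
qed

lemma mor_mor_sum:
  assumes f: "mor f A A'" and g: "mor g B B'"
  shows "mor (mor_sum f g) (sumb A B) (sumb A' B')"
proof -
  have ll: "mor_sum f g ` inl ` X = inl ` f ` X" "mor_sum f g ` inr ` X = inr ` g ` X" for X
    by (simp_all add: image_image)
  have "bij_betw (mor_sum f g) (\<Union>(sumb A B)) (\<Union>(sumb A' B'))"
    using f g unfolding Union_sumb mor_def bij_betw_def
    by (auto simp: inj_on_def image_Un ll)
  moreover have "\<exists>Y\<in>sumb A' B'. mor_sum f g ` X \<subseteq> Y" if "X \<in> sumb A B" for X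
  proof -
    from that consider Z where "Z \<in> A" "X = inl ` Z" | Z where "Z \<in> B" "X = inr ` Z"
      by (auto simp: sumb_def)
    then show ?thesis
    proof cases
      case 1
      then obtain Y where "Y \<in> A'" "f ` Z \<subseteq> Y" using f by (auto simp: mor_def)
      then show ?thesis using 1 ll(1)[of Z] by (intro bexI[of _ "inl ` Y"]) (auto simp: sumb_def)
    next
      case 2
      then obtain Y where "Y \<in> B'" "g ` Z \<subseteq> Y" using g by (auto simp: mor_def)
      then show ?thesis using 2 ll(2)[of Z] by (intro bexI[of _ "inr ` Y"]) (auto simp: sumb_def)
    qed
  qed
  ultimately show ?thesis by (simp add: mor_def)
qed

lemma mor_swap: "mor sum_swap (sumb A B) (sumb B A)"
proof -
  have "im sum_swap (sumb A B) = sumb B A"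
    by (auto simp: sumb_def image_Un image_image)
  moreover have "inj_on sum_swap (\<Union>(sumb A B))"
    by (auto simp: Union_sumb inj_on_def)
  ultimately show ?thesis using mor_im[of sum_swap "sumb A B"] by simp
qed

lemma mor_assoc: "mor sum_assoc (sumb (sumb A B) C) (sumb A (sumb B C))"
proof -
  have "im sum_assoc (sumb (sumb A B) C) = sumb A (sumb B C)"
    by (auto simp: sumb_def image_Un image_image)
  moreover have "inj_on sum_assoc (\<Union>(sumb (sumb A B) C))"
    by (auto simp: Union_sumb inj_on_def)
  ultimately show ?thesis using mor_im[of sum_assoc "sumb (sumb A B) C"] by simp
qed

lemma im_fold: "im sum_fold (sumb A B) = A \<union> B"
  by (auto simp: sumb_def image_Un image_image)

lemma inj_fold: "sep A B \<Longrightarrow> inj_on sum_fold (\<Union>(sumb A B))"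
  by (auto simp: Union_sumb inj_on_def disjoint_iff)

lemma mor_fold: "sep A B \<Longrightarrow> mor sum_fold (sumb A B) (A \<union> B)"
  using mor_im[OF inj_fold, of A B] by (simp add: im_fold)

section \<open>Refinements of a disjoint union\<close>

lemma fine_im:
  assumes "fine C A"
  shows "fine (im f C) (im f A)"
proof -
  have "\<exists>Y\<in>im f A. X \<subseteq> Y" if "X \<in> im f C" for X
  proof -
    from that obtain Z where Z: "Z \<in> C" "X = f ` Z" by auto
    then obtain Y where "Y \<in> A" "Z \<subseteq> Y" using assms by (auto simp: fine_def)
    then show ?thesis using Z by (intro bexI[of _ "f ` Y"]) auto
  qed
  then show ?thesis using assms by (simp only: fine_def Union_im) simp
qed

lemma im_eq_iff:
  assumes "inj_on f (\<Union>A)" "\<Union>C = \<Union>A" "im f C = im f A"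
  shows "C = A"
proof -
  have "inj_on (image f) (Pow (\<Union>A))"
    using assms(1) by (intro inj_onI) (metis PowD inj_on_image_eq_iff)
  then show ?thesis
    using inj_on_image_eq_iff[of "image f" "Pow (\<Union>A)" C A] assms(2,3) by blast
qed

lemma fine_Un: "fine C A \<Longrightarrow> fine E B \<Longrightarrow> fine (C \<union> E) (A \<union> B)"
  by (simp add: fine_def Union_Un_distrib ball_Un bex_Un)

lemma fine_sumb: "fine C A \<Longrightarrow> fine E B \<Longrightarrow> fine (sumb C E) (sumb A B)"
  unfolding sumb_def by (intro fine_Un fine_im)

text \<open>The empty set is the only common image under \<open>inl\<close> and \<open>inr\<close>.
  Once it is excluded, the two halves can be read off from the sum.\<close>

lemma sumb_inj:
  assumes "sumb A B = sumb C E" "{} \<notin> A" "{} \<notin> B" "{} \<notin> C" "{} \<notin> E"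
  shows "A = C" "B = E"
proof -
  have 1: "A = {X. X \<noteq> {} \<and> inl ` X \<in> sumb A B}" if "{} \<notin> A" for A B :: "nat set set"
    using that by (auto simp: sumb_def image_iff)
  have 2: "B = {X. X \<noteq> {} \<and> inr ` X \<in> sumb A B}" if "{} \<notin> B" for A B :: "nat set set"
    using that by (auto simp: sumb_def image_iff)
  show "A = C" using 1[of A B] 1[of C E] assms by simp
  show "B = E" using 2[of B A] 2[of E C] assms by simp
qed

text \<open>Here \<open>f\<close> is one of the two injections into a disjoint union. A block of
  \<open>C\<close> lies in a block of \<open>A\<close>, so it is either contained in the range of
  \<open>f\<close> or disjoint from it, and the blocks inside form a refinement of the
  summand.\<close>

lemma fine_part:
  assumes C: "block_family C" and A: "fine C A" and f: "inj f"
    and img: "\<And>Z. Z \<in> A \<Longrightarrow> (\<exists>Y\<in>A1. Z = f ` Y) \<or> Z \<inter> range f = {}" and A1: "im f A1 \<subseteq> A"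
  shows "block_family {X. f ` X \<in> C} \<and> fine {X. f ` X \<in> C} A1 \<and>
    im f {X. f ` X \<in> C} = {Z \<in> C. Z \<inter> range f \<noteq> {}}"
proof -
  let ?C1 = "{X. f ` X \<in> C}"
  have X: "\<exists>Y\<in>A1. Z = f ` {x \<in> Y. f x \<in> Z}" if Z: "Z \<in> C" "Z \<inter> range f \<noteq> {}" for Z
  proof -
    obtain W where W: "W \<in> A" "Z \<subseteq> W" using A Z(1) by (auto simp: fine_def)
    then have "W \<inter> range f \<noteq> {}" using Z(2) by auto
    then obtain Y where "Y \<in> A1" "W = f ` Y" using img[OF W(1)] by auto
    then show ?thesis using W by (intro bexI[of _ Y]) auto
  qed
  have ne: "X \<noteq> {}" if "X \<in> ?C1" for X using that C by (auto simp: block_family_def)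
  have "f ` \<Union>?C1 \<subseteq> \<Union>C" by auto
  then have "finite (\<Union>?C1)"
    using C f by (metis block_family_def finite_imageD finite_subset inj_on_subset subset_UNIV)
  moreover have "disjoint ?C1"
    unfolding disjoint_def
  proof (intro ballI impI)
    fix X Y assume "X \<in> ?C1" "Y \<in> ?C1" "X \<noteq> Y"
    then have "f ` X \<in> C" "f ` Y \<in> C" "f ` X \<noteq> f ` Y" using f by (auto simp: inj_image_eq_iff)
    then have "f ` X \<inter> f ` Y = {}" using C by (auto simp: block_family_def disjoint_def)
    then show "X \<inter> Y = {}" by auto
  qed
  moreover have "{} \<notin> ?C1" using C by (simp add: block_family_def)
  ultimately have bf: "block_family ?C1" by (simp add: block_family_def)
  have im: "im f ?C1 = {Z \<in> C. Z \<inter> range f \<noteq> {}}"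
  proof (intro equalityI subsetI)
    fix Z assume "Z \<in> im f ?C1"
    then obtain X where X: "Z = f ` X" "f ` X \<in> C" by auto
    then have "X \<noteq> {}" using ne by auto
    then show "Z \<in> {Z \<in> C. Z \<inter> range f \<noteq> {}}" using X by auto
  next
    fix Z assume Z: "Z \<in> {Z \<in> C. Z \<inter> range f \<noteq> {}}"
    then obtain Y where "Z = f ` {x \<in> Y. f x \<in> Z}" using X[of Z] by auto
    then show "Z \<in> im f ?C1" using Z by auto
  qed
  have sub: "\<exists>Y\<in>A1. X \<subseteq> Y" if "X \<in> ?C1" for X
  proof -
    have "f ` X \<inter> range f \<noteq> {}" "f ` X \<in> C" using ne[OF that] that by auto
    from X[OF this(2,1)] obtain Y where Y: "Y \<in> A1" "f ` X = f ` {x \<in> Y. f x \<in> f ` X}"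
      by (rule bexE)
    then have "X = {x \<in> Y. f x \<in> f ` X}" using f by (metis inj_image_eq_iff)
    then show ?thesis using Y(1) by blast
  qed
  have "\<Union>?C1 = \<Union>A1"
  proof (intro equalityI subsetI)
    fix x assume "x \<in> \<Union>?C1"
    then show "x \<in> \<Union>A1" using sub by blast
  next
    fix x assume "x \<in> \<Union>A1"
    then obtain Y where Y: "Y \<in> A1" "x \<in> Y" by auto
    then have "f x \<in> \<Union>A" using A1 by auto
    then have "f x \<in> \<Union>C" using A by (simp add: fine_def)
    then obtain Z where Z: "Z \<in> C" "f x \<in> Z" by blast
    then have "Z \<inter> range f \<noteq> {}" by auto
    then obtain X where X: "f ` X \<in> C" "Z = f ` X" using im Z(1) by blast
    then have "x \<in> X" using Z(2) f by (auto simp: inj_image_mem_iff)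
    then show "x \<in> \<Union>?C1" using X by auto
  qed
  then show ?thesis using bf im sub by (simp add: fine_def)
qed

text \<open>This lets a transfer into a disjoint union be written with transfers into its two
  summands, which is what makes the ideals compatible with the universal property of
  products.\<close>

lemma fine_sumb_split:
  assumes C: "block_family C" and f: "fine C (sumb A B)"
  obtains C1 C2 where "block_family C1" "block_family C2" "fine C1 A" "fine C2 B" "C = sumb C1 C2"
proof -
  let ?C1 = "{X. inl ` X \<in> C}" and ?C2 = "{X. inr ` X \<in> C}"
  have 1: "block_family ?C1 \<and> fine ?C1 A \<and> im inl ?C1 = {Z \<in> C. Z \<inter> range inl \<noteq> {}}"
    by (rule fine_part[OF C f]) (auto simp: inj_def sumb_def)
  have 2: "block_family ?C2 \<and> fine ?C2 B \<and> im inr ?C2 = {Z \<in> C. Z \<inter> range inr \<noteq> {}}"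
    by (rule fine_part[OF C f]) (auto simp: inj_def sumb_def)
  have "Z \<inter> range inl \<noteq> {} \<or> Z \<inter> range inr \<noteq> {}" if Z: "Z \<in> C" for Z
  proof -
    obtain z where z: "z \<in> Z" using block_family_nonempty[OF C Z] by blast
    have "z \<in> range inl \<or> z \<in> range inr" by (rule lr_cases[of z]) simp_all
    then show ?thesis using z by blast
  qed
  then have "C = {Z \<in> C. Z \<inter> range inl \<noteq> {}} \<union> {Z \<in> C. Z \<inter> range inr \<noteq> {}}" by blast
  then have split: "C = sumb ?C1 ?C2" unfolding sumb_def using 1 2 by simp
  show ?thesis
    by (rule that[OF _ _ _ _ split])
      (rule conjunct1[OF 1] conjunct1[OF 2] conjunct1[OF conjunct2[OF 1]] conjunct1[OF conjunct2[OF 2]])+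
qed

section \<open>The species of indecomposables\<close>

locale cring_symmetric_monoidal_pf = symmetric_monoidal_pf K R
  for K :: "('k, 'z) ring_scheme" and R :: "('k, 'b) monoidal_pf" +
  assumes K: "cring K"
begin

abbreviation W :: "nat set set \<Rightarrow> ('k, 'b) module" where
  "W A \<equiv> pf_val R (ptn_of A)"

abbreviation tr :: "nat set set \<Rightarrow> nat set set \<Rightarrow> (nat \<Rightarrow> nat) \<Rightarrow> 'b \<Rightarrow> 'b" where
  "tr A B \<equiv> pf_tr R (ptn_of A) (ptn_of B)"

abbreviation pr :: "nat set set \<Rightarrow> nat set set \<Rightarrow> 'b \<Rightarrow> 'b \<Rightarrow> 'b" where
  "pr A B \<equiv> pf_prod R (ptn_of A) (ptn_of B)"

section \<open>Values, transfers and external products in terms of blocks\<close>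

lemma W: "block_family A \<Longrightarrow> module K (W A)"
  by (rule val_module[OF is_ptn_of])

lemma tr_mod_hom:
  "\<lbrakk>block_family A; block_family B; mor f A B\<rbrakk> \<Longrightarrow> tr A B f \<in> module_hom K (W A) (W B)"
  by (rule tr_linear[OF is_ptn_of is_ptn_of ptn_mor_of])

lemmas tr_closed = module_hom_closed[OF tr_mod_hom]

lemma tr_trans:
  "\<lbrakk>block_family A; block_family B; block_family C; mor f A B; mor g B C; x \<in> carrier (W A)\<rbrakk>
    \<Longrightarrow> tr B C g (tr A B f x) = tr A C (g \<circ> f) x"
  by (rule tr_comp[symmetric, OF is_ptn_of is_ptn_of is_ptn_of ptn_mor_of ptn_mor_of])

lemma pr_hom1:
  "\<lbrakk>block_family A; block_family B; y \<in> carrier (W B)\<rbrakk> \<Longrightarrow> (\<lambda>x. pr A B x y) \<in> module_hom K (W A) (W (sumb A B))"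
  using prod_linear1[OF is_ptn_of is_ptn_of, of A B y] by (simp add: ptn_sum_of)

lemma pr_hom2:
  "\<lbrakk>block_family A; block_family B; x \<in> carrier (W A)\<rbrakk> \<Longrightarrow> (\<lambda>y. pr A B x y) \<in> module_hom K (W B) (W (sumb A B))"
  using prod_linear2[OF is_ptn_of is_ptn_of, of A B x] by (simp add: ptn_sum_of)

lemma pr_closed:
  "\<lbrakk>block_family A; block_family B; x \<in> carrier (W A); y \<in> carrier (W B)\<rbrakk> \<Longrightarrow> pr A B x y \<in> carrier (W (sumb A B))"
  by (rule module_hom_closed[OF pr_hom1])

lemma pr_tr:
  "\<lbrakk>block_family A; block_family A'; block_family B; block_family B'; mor f A A'; mor g B B';
    x \<in> carrier (W A); y \<in> carrier (W B)\<rbrakk>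
    \<Longrightarrow> tr (sumb A B) (sumb A' B') (mor_sum f g) (pr A B x y) = pr A' B' (tr A A' f x) (tr B B' g y)"
  using prod_tr[OF is_ptn_of is_ptn_of is_ptn_of is_ptn_of ptn_mor_of ptn_mor_of, of A A' B B' f g x y]
  by (simp add: ptn_sum_of)

text \<open>The two uses of bijectivity of the external product: products span the value on a
  disjoint union, and bilinear maps factor through it. Both are transferred from the tensor
  product.\<close>

lemma pr_span:
  assumes A: "block_family A" and B: "block_family B"
  shows "\<And>H. \<lbrakk>submodule H K (W (sumb A B));
      \<And>x y. \<lbrakk>x \<in> carrier (W A); y \<in> carrier (W B)\<rbrakk> \<Longrightarrow> pr A B x y \<in> H\<rbrakk>
      \<Longrightarrow> carrier (W (sumb A B)) \<subseteq> H"
    and "\<And>(P :: ('k, 'c) module) b. \<lbrakk>module K P;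
      \<And>y. y \<in> carrier (W B) \<Longrightarrow> (\<lambda>x. b x y) \<in> module_hom K (W A) P;
      \<And>x. x \<in> carrier (W A) \<Longrightarrow> (\<lambda>y. b x y) \<in> module_hom K (W B) P\<rbrakk>
      \<Longrightarrow> \<exists>h \<in> module_hom K (W (sumb A B)) P. \<forall>x \<in> carrier (W A). \<forall>y \<in> carrier (W B). h (pr A B x y) = b x y"
proof -
  let ?Ms = "[W A, W B]" and ?S = "W (sumb A B)"
  interpret TS: tensor_setup K ?Ms
    by (rule tensor_setup.intro) (use K W A B in auto)
  have S: "module K ?S" by (rule W[OF block_family_sumb[OF A B]])
  have idx: "xs \<in> tensor_index ?Ms \<longleftrightarrow> (\<exists>x \<in> carrier (W A). \<exists>y \<in> carrier (W B). xs = [x, y])" for xs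
    by (auto simp: tensor_index_def list_all2_Cons2)
  \<comment> \<open>A map that is linear in each of two arguments, read as a multilinear map on
    lists of length two.\<close>
  have ml: "multilinear K ?Ms P (\<lambda>xs. b (xs ! 0) (xs ! 1))"
    if 1: "\<And>y. y \<in> carrier (W B) \<Longrightarrow> (\<lambda>x. b x y) \<in> module_hom K (W A) P"
      and 2: "\<And>x. x \<in> carrier (W A) \<Longrightarrow> (\<lambda>y. b x y) \<in> module_hom K (W B) P" for P :: "('k, 'd) module" and b
    unfolding multilinear_def
  proof (intro conjI ballI allI impI)
    fix xs assume "xs \<in> tensor_index ?Ms"
    then obtain x y where xs: "x \<in> carrier (W A)" "y \<in> carrier (W B)" "xs = [x, y]" using idx by blast
    show "b (xs ! 0) (xs ! 1) \<in> carrier P" using module_hom_closed[OF 1[OF xs(2)] xs(1)] by (simp add: xs One_nat_def)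
    fix i assume "i < length ?Ms"
    then consider "i = 0" | "i = 1" by (auto simp: One_nat_def less_Suc_eq)
    then show "(\<lambda>z. b (xs[i := z] ! 0) (xs[i := z] ! 1)) \<in> module_hom K (?Ms ! i) P"
      using 1[OF xs(2)] 2[OF xs(1)] by cases (simp_all add: xs One_nat_def)
  qed
  let ?L = "tensor_lift K ?Ms ?S (\<lambda>xs. pr A B (xs ! 0) (xs ! 1))"
  have mlp: "multilinear K ?Ms ?S (\<lambda>xs. pr A B (xs ! 0) (xs ! 1))"
    by (rule ml[OF pr_hom1[OF A B] pr_hom2[OF A B]])
  have Lh: "?L \<in> module_hom K (tensor K ?Ms) ?S" by (rule TS.tensor_lift_hom[OF S mlp])
  have Lb: "bij_betw ?L (carrier (tensor K ?Ms)) (carrier ?S)"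
    using prod_bij[OF is_ptn_of[OF A] is_ptn_of[OF B]] by (simp add: ptn_sum_of)
  have Lp: "?L (pure_tensor K ?Ms [x, y]) = pr A B x y" if "x \<in> carrier (W A)" "y \<in> carrier (W B)" for x y
    using TS.tensor_lift_pure[OF S mlp, of "[x, y]"] that idx by (simp add: One_nat_def)
  show "carrier ?S \<subseteq> H" if H: "submodule H K ?S"
    and pr: "\<And>x y. \<lbrakk>x \<in> carrier (W A); y \<in> carrier (W B)\<rbrakk> \<Longrightarrow> pr A B x y \<in> H" for H
  proof
    fix z assume "z \<in> carrier ?S"
    then have "z \<in> ?L ` carrier (tensor K ?Ms)" using Lb by (simp add: bij_betw_def)
    then obtain t where t: "t \<in> carrier (tensor K ?Ms)" "z = ?L t" by (rule imageE)
    have "carrier (tensor K ?Ms) \<subseteq> {t \<in> carrier (tensor K ?Ms). ?L t \<in> H}"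
    proof (rule TS.tensor_span[OF submodule_vimage[OF Lh TS.module_tensor S H]])
      fix xs assume "xs \<in> tensor_index ?Ms"
      then obtain x y where xs: "x \<in> carrier (W A)" "y \<in> carrier (W B)" "xs = [x, y]" using idx by blast
      show "pure_tensor K ?Ms xs \<in> {t \<in> carrier (tensor K ?Ms). ?L t \<in> H}"
        using Lp[OF xs(1,2)] pr[OF xs(1,2)] TS.pure_tensor_closed[of xs] xs(3) by simp
    qed
    then show "z \<in> H" using t by auto
  qed
  fix P :: "('k, 'c) module" and b
  assume P: "module K P"
    and b: "\<And>y. y \<in> carrier (W B) \<Longrightarrow> (\<lambda>x. b x y) \<in> module_hom K (W A) P"
      "\<And>x. x \<in> carrier (W A) \<Longrightarrow> (\<lambda>y. b x y) \<in> module_hom K (W B) P"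
  let ?B = "tensor_lift K ?Ms P (\<lambda>xs. b (xs ! 0) (xs ! 1))"
  have mlb: "multilinear K ?Ms P (\<lambda>xs. b (xs ! 0) (xs ! 1))" by (rule ml[OF b])
  have Bh: "?B \<in> module_hom K (tensor K ?Ms) P" by (rule TS.tensor_lift_hom[OF P mlb])
  let ?i = "inv_into (carrier (tensor K ?Ms)) ?L"
  interpret TM: module K "tensor K ?Ms" by (rule TS.module_tensor)
  have iL: "?i (?L t) = t" if "t \<in> carrier (tensor K ?Ms)" for t
    using Lb that by (simp add: bij_betw_def)
  have ex: "\<exists>t \<in> carrier (tensor K ?Ms). z = ?L t" if "z \<in> carrier ?S" for z
    using Lb that by (auto simp: bij_betw_def)
  \<comment> \<open>The inverse of a linear bijection is linear; composing it with the lift of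
    \<open>b\<close> gives the map sought.\<close>
  have ih: "?i \<in> module_hom K ?S (tensor K ?Ms)"
  proof (rule module_homI)
    fix z w assume z: "z \<in> carrier ?S" and w: "w \<in> carrier ?S"
    obtain t where t: "t \<in> carrier (tensor K ?Ms)" "z = ?L t" by (rule bexE[OF ex[OF z]])
    obtain s where s: "s \<in> carrier (tensor K ?Ms)" "w = ?L s" by (rule bexE[OF ex[OF w]])
    show "?i (z \<oplus>\<^bsub>?S\<^esub> w) = ?i z \<oplus>\<^bsub>tensor K ?Ms\<^esub> ?i w"
      unfolding t(2) s(2) module_hom_add[OF Lh t(1) s(1), symmetric] iL[OF t(1)] iL[OF s(1)]
      by (rule iL) (simp add: t(1) s(1))
  next
    fix z assume z: "z \<in> carrier ?S"
    obtain t where t: "t \<in> carrier (tensor K ?Ms)" "z = ?L t" by (rule bexE[OF ex[OF z]])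
    show "?i z \<in> carrier (tensor K ?Ms)" unfolding t(2) iL[OF t(1)] by (rule t(1))
    show "?i (a \<odot>\<^bsub>?S\<^esub> z) = a \<odot>\<^bsub>tensor K ?Ms\<^esub> ?i z" if a: "a \<in> carrier K" for a
      unfolding t(2) module_hom_smult[OF Lh a t(1), symmetric] iL[OF t(1)]
      by (rule iL) (simp add: t(1) a)
  qed
  have "?B (?i (pr A B x y)) = b x y" if xy: "x \<in> carrier (W A)" "y \<in> carrier (W B)" for x y
  proof -
    have "?i (pr A B x y) = pure_tensor K ?Ms [x, y]"
      unfolding Lp[OF xy, symmetric] by (rule iL[OF TS.pure_tensor_closed])
    then show ?thesis
      using TS.tensor_lift_pure[OF P mlb, of "[x, y]"] xy idx by (simp add: One_nat_def)
  qed
  then show "\<exists>h \<in> module_hom K ?S P. \<forall>x \<in> carrier (W A). \<forall>y \<in> carrier (W B). h (pr A B x y) = b x y"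
    using module_hom_compose[OF ih Bh] by (intro bexI[where x = "\<lambda>z. ?B (?i z)"]) auto
qed

section \<open>The ideals of transfers from proper refinements\<close>

abbreviation I :: "nat set set \<Rightarrow> 'b set" where
  "I A \<equiv> tr_ideal K R (ptn_of A)"

lemma I_eq:
  assumes "block_family A"
  shows "I A = submodule_span K (W A) (\<Union>C\<in>{C. block_family C \<and> fine C A \<and> C \<noteq> A}. tr C A id ` carrier (W C))"
proof -
  have "refinements (ptn_of A) - {ptn_of A} = ptn_of ` {C. block_family C \<and> fine C A \<and> C \<noteq> A}"
    unfolding refinements_of[OF assms]
  proof (intro equalityI subsetI)
    fix \<Gamma> assume "\<Gamma> \<in> ptn_of ` {C. block_family C \<and> fine C A} - {ptn_of A}"
    then show "\<Gamma> \<in> ptn_of ` {C. block_family C \<and> fine C A \<and> C \<noteq> A}" by blast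
  next
    fix \<Gamma> assume "\<Gamma> \<in> ptn_of ` {C. block_family C \<and> fine C A \<and> C \<noteq> A}"
    then obtain C where C: "block_family C" "fine C A" "C \<noteq> A" "\<Gamma> = ptn_of C" by blast
    then have "\<Gamma> \<noteq> ptn_of A" using ptn_of_inj[OF C(1) assms] by simp
    then show "\<Gamma> \<in> ptn_of ` {C. block_family C \<and> fine C A} - {ptn_of A}" using C by blast
  qed
  then show ?thesis by (simp add: tr_ideal_def)
qed

lemma submodule_I: "block_family A \<Longrightarrow> submodule (I A) K (W A)"
  unfolding I_eq by (intro submodule_spanI W) (auto intro!: tr_closed mor_id)

lemma I_gen:
  assumes "block_family A" "block_family C" "fine C A" "C \<noteq> A" "z \<in> carrier (W C)"
  shows "tr C A id z \<in> I A"
  unfolding I_eq[OF assms(1)] using assms by (intro subsetD[OF span_superset]) blast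

lemma I_least:
  assumes A: "block_family A" and H: "submodule H K (W A)"
    and gen: "\<And>C z. \<lbrakk>block_family C; fine C A; C \<noteq> A; z \<in> carrier (W C)\<rbrakk> \<Longrightarrow> tr C A id z \<in> H"
  shows "I A \<subseteq> H"
  unfolding I_eq[OF A] by (rule span_least[OF H]) (use gen in auto)

text \<open>A transfer from \<open>C\<close> followed by a bijection \<open>f\<close> equals the
  transfer from the image of \<open>C\<close> after transport along \<open>f\<close>. As
  \<open>f\<close> is injective, the image of a proper refinement is still proper.\<close>

lemma tr_I:
  assumes A: "block_family A" and f: "inj_on f (\<Union>A)" and x: "x \<in> I A"
  shows "tr A (im f A) f x \<in> I (im f A)"
proof -
  have fA: "block_family (im f A)" by (rule block_family_im[OF A f])
  have h: "tr A (im f A) f \<in> module_hom K (W A) (W (im f A))" by (rule tr_mod_hom[OF A fA mor_im[OF f]])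
  have "I A \<subseteq> {x \<in> carrier (W A). tr A (im f A) f x \<in> I (im f A)}"
  proof (rule I_least[OF A submodule_vimage[OF h W[OF A] W[OF fA] submodule_I[OF fA]]])
    fix C z assume C: "block_family C" "fine C A" "C \<noteq> A" and z: "z \<in> carrier (W C)"
    have U: "\<Union>C = \<Union>A" using C(2) by (simp add: fine_def)
    have fC: "inj_on f (\<Union>C)" using f U by simp
    have bC: "block_family (im f C)" by (rule block_family_im[OF C(1) fC])
    have "tr A (im f A) f (tr C A id z) = tr C (im f A) f z"
      using tr_trans[OF C(1) A fA mor_id[OF C(2)] mor_im[OF f] z] by simp
    also have "\<dots> = tr (im f C) (im f A) id (tr C (im f C) f z)"
      using tr_trans[OF C(1) bC fA mor_im[OF fC] mor_id[OF fine_im[OF C(2)]] z] by simp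
    also have "\<dots> \<in> I (im f A)"
      using C(3) im_eq_iff[OF f U]
      by (intro I_gen fA bC fine_im C(2) tr_closed mor_im fC z C(1)) auto
    finally show "tr C A id z \<in> {x \<in> carrier (W A). tr A (im f A) f x \<in> I (im f A)}"
      using tr_closed[OF C(1) A mor_id[OF C(2)] z] by simp
  qed
  then show ?thesis using x by auto
qed

lemma sumb_ne:
  assumes "block_family A" "block_family B" "block_family C" "block_family E" "C \<noteq> A \<or> E \<noteq> B"
  shows "sumb C E \<noteq> sumb A B"
  using sumb_inj[of C E A B] assms by (auto simp: block_family_def)

text \<open>The product of a transfer with \<open>y\<close> is a transfer from the disjoint union in
  which only the first summand is refined, and this refinement is proper.\<close>

lemma pr_I1:
  assumes A: "block_family A" and B: "block_family B" and x: "x \<in> I A" and y: "y \<in> carrier (W B)"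
  shows "pr A B x y \<in> I (sumb A B)"
proof -
  have AB: "block_family (sumb A B)" by (rule block_family_sumb[OF A B])
  have "I A \<subseteq> {x \<in> carrier (W A). pr A B x y \<in> I (sumb A B)}"
  proof (rule I_least[OF A submodule_vimage[OF pr_hom1[OF A B y] W[OF A] W[OF AB] submodule_I[OF AB]]])
    fix C z assume C: "block_family C" "fine C A" "C \<noteq> A" and z: "z \<in> carrier (W C)"
    have "pr A B (tr C A id z) y = tr (sumb C B) (sumb A B) id (pr C B z y)"
      using pr_tr[OF C(1) A B B mor_id[OF C(2)] mor_id[OF fine_refl] z y] tr_id[OF is_ptn_of[OF B] y]
      by (simp add: mor_sum_id)
    also have "\<dots> \<in> I (sumb A B)"
      using sumb_ne[OF A B C(1) B] C(3)
      by (intro I_gen AB block_family_sumb C(1) B fine_sumb C(2) fine_refl pr_closed z y) auto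
    finally show "tr C A id z \<in> {x \<in> carrier (W A). pr A B x y \<in> I (sumb A B)}"
      using tr_closed[OF C(1) A mor_id[OF C(2)] z] by simp
  qed
  then show ?thesis using x by auto
qed

lemma pr_I2:
  assumes A: "block_family A" and B: "block_family B" and x: "x \<in> carrier (W A)" and y: "y \<in> I B"
  shows "pr A B x y \<in> I (sumb A B)"
proof -
  have AB: "block_family (sumb A B)" by (rule block_family_sumb[OF A B])
  have "I B \<subseteq> {y \<in> carrier (W B). pr A B x y \<in> I (sumb A B)}"
  proof (rule I_least[OF B submodule_vimage[OF pr_hom2[OF A B x] W[OF B] W[OF AB] submodule_I[OF AB]]])
    fix C z assume C: "block_family C" "fine C B" "C \<noteq> B" and z: "z \<in> carrier (W C)"
    have "pr A B x (tr C B id z) = tr (sumb A C) (sumb A B) id (pr A C x z)"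
      using pr_tr[OF A A C(1) B mor_id[OF fine_refl] mor_id[OF C(2)] x z] tr_id[OF is_ptn_of[OF A] x]
      by (simp add: mor_sum_id)
    also have "\<dots> \<in> I (sumb A B)"
      using sumb_ne[OF A B A C(1)] C(3)
      by (intro I_gen AB block_family_sumb A C(1) fine_sumb C(2) fine_refl pr_closed x z) auto
    finally show "tr C B id z \<in> {y \<in> carrier (W B). pr A B x y \<in> I (sumb A B)}"
      using tr_closed[OF C(1) B mor_id[OF C(2)] z] by simp
  qed
  then show ?thesis using y by auto
qed

section \<open>The quotients and their operations\<close>

definition V :: "nat set set \<Rightarrow> ('k, 'b set) module" where
  "V A = Rbar K R (ptn_of A)"

definition q :: "nat set set \<Rightarrow> 'b \<Rightarrow> 'b set" where
  "q A x = I A +>\<^bsub>W A\<^esub> x"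

lemma V_eq: "V A = quotient_module (W A) (I A)"
  by (simp add: V_def Rbar_def)

lemma module_V: "block_family A \<Longrightarrow> module K (V A)"
  unfolding V_eq by (intro module_quotient W submodule_I)

lemma q_hom: "block_family A \<Longrightarrow> q A \<in> module_hom K (W A) (V A)"
  unfolding V_eq q_def[abs_def] by (intro coset_hom W submodule_I)

lemmas q_closed = module_hom_closed[OF q_hom]

lemma q_surj: "X \<in> carrier (V A) \<Longrightarrow> \<exists>x \<in> carrier (W A). X = q A x"
  by (auto simp: V_eq q_def quotient_module_simps)

lemma q_eq_iff:
  "\<lbrakk>block_family A; x \<in> carrier (W A); y \<in> carrier (W A)\<rbrakk> \<Longrightarrow> q A x = q A y \<longleftrightarrow> x \<ominus>\<^bsub>W A\<^esub> y \<in> I A"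
  unfolding q_def by (rule coset_eq_iff[OF W submodule_I])

lemma q_I:
  assumes "block_family A" "x \<in> I A"
  shows "q A x = \<zero>\<^bsub>V A\<^esub>"
proof -
  interpret WA: module K "W A" by (rule W[OF assms(1)])
  have x: "x \<in> carrier (W A)" using submodule_subset[OF submodule_I[OF assms(1)]] assms(2) by auto
  have "q A x = q A \<zero>\<^bsub>W A\<^esub>"
    using submodule_a_minus[OF submodule_I W assms(2) submodule_zero[OF submodule_I]] assms(1) x
    by (subst q_eq_iff) simp_all
  then show ?thesis
    using module_hom_zero[OF q_hom W module_V] assms(1) by simp
qed

lemma q_lift:
  assumes A: "block_family A" and P: "module K P" and h: "h \<in> module_hom K (W A) P"
    and I0: "\<And>x. x \<in> I A \<Longrightarrow> h x = \<zero>\<^bsub>P\<^esub>"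
  shows "\<exists>g \<in> module_hom K (V A) P. \<forall>x \<in> carrier (W A). g (q A x) = h x"
  unfolding V_eq q_def by (rule quotient_hom_ex[OF W[OF A] submodule_I[OF A] P h I0])

text \<open>As \<open>q A\<close> is onto and linear, linearity of a map on the quotient can be
  tested on representatives.\<close>

lemma hom_on_V:
  assumes A: "block_family A" and h: "h \<in> module_hom K (W A) P" and g: "\<And>x. x \<in> carrier (W A) \<Longrightarrow> g (q A x) = h x"
  shows "g \<in> module_hom K (V A) P"
proof (rule module_homI)
  interpret WA: module K "W A" by (rule W[OF A])
  fix X assume "X \<in> carrier (V A)"
  then obtain x where x: "x \<in> carrier (W A)" "X = q A x" using q_surj by blast
  show "g X \<in> carrier P" using x g module_hom_closed[OF h] by simp
  show "g (a \<odot>\<^bsub>V A\<^esub> X) = a \<odot>\<^bsub>P\<^esub> g X" if "a \<in> carrier K" for a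
    using x g that module_hom_smult[OF h] by (simp flip: module_hom_smult[OF q_hom[OF A]])
  fix Y assume "Y \<in> carrier (V A)"
  then obtain y where y: "y \<in> carrier (W A)" "Y = q A y" using q_surj by blast
  show "g (X \<oplus>\<^bsub>V A\<^esub> Y) = g X \<oplus>\<^bsub>P\<^esub> g Y"
    using x y g module_hom_add[OF h] by (simp flip: module_hom_add[OF q_hom[OF A]])
qed

definition act :: "(nat \<Rightarrow> nat) \<Rightarrow> nat set set \<Rightarrow> 'b set \<Rightarrow> 'b set" where
  "act f A = Rbar_tr K R (ptn_of A) (ptn_of (im f A)) f"

text \<open>By \<open>tr_I\<close> the images of a coset under the transfer stay in one coset, so
  the set-valued definition of \<open>Rbar_tr\<close> computes the induced map.\<close>

lemma act_q:
  assumes A: "block_family A" and f: "inj_on f (\<Union>A)" and x: "x \<in> carrier (W A)"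
  shows "act f A (q A x) = q (im f A) (tr A (im f A) f x)"
  unfolding act_def Rbar_tr_def q_def
proof (rule set_add_representatives)
  have fA: "block_family (im f A)" by (rule block_family_im[OF A f])
  show "module K (W (im f A))" "submodule (I (im f A)) K (W (im f A))"
    using fA by (auto intro: W submodule_I)
  have h: "tr A (im f A) f \<in> module_hom K (W A) (W (im f A))" by (rule tr_mod_hom[OF A fA mor_im[OF f]])
  show "tr A (im f A) f x \<in> carrier (W (im f A))" by (rule module_hom_closed[OF h x])
  show "tr A (im f A) f ` (I A +>\<^bsub>W A\<^esub> x) \<noteq> {}" using coset_self[OF W[OF A] submodule_I[OF A] x] by auto
  show "tr A (im f A) f ` (I A +>\<^bsub>W A\<^esub> x) \<subseteq> I (im f A) +>\<^bsub>W (im f A)\<^esub> tr A (im f A) f x"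
  proof (rule image_subsetI)
    fix y assume "y \<in> I A +>\<^bsub>W A\<^esub> x"
    then obtain i where i: "i \<in> I A" "y = i \<oplus>\<^bsub>W A\<^esub> x" by (auto simp: a_r_coset_def')
    have "i \<in> carrier (W A)" using submodule_subset[OF submodule_I[OF A]] i(1) by auto
    then show "tr A (im f A) f y \<in> I (im f A) +>\<^bsub>W (im f A)\<^esub> tr A (im f A) f x"
      using tr_I[OF A f i(1)] by (auto simp: i(2) module_hom_add[OF h _ x] a_r_coset_def')
  qed
qed

text \<open>Changing either factor within its coset changes the product by an element of the ideal
  of the disjoint union.\<close>

lemma Rbar_prod_q:
  assumes A: "block_family A" and B: "block_family B" and x: "x \<in> carrier (W A)" and y: "y \<in> carrier (W B)"
  shows "Rbar_prod K R (ptn_of A) (ptn_of B) (q A x) (q B y) = q (sumb A B) (pr A B x y)"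
  unfolding Rbar_prod_def q_def ptn_sum_of
proof (rule set_add_representatives)
  have AB: "block_family (sumb A B)" by (rule block_family_sumb[OF A B])
  show "module K (W (sumb A B))" "submodule (I (sumb A B)) K (W (sumb A B))"
    using AB by (auto intro: W submodule_I)
  show "pr A B x y \<in> carrier (W (sumb A B))" by (rule pr_closed[OF A B x y])
  show "{pr A B x' y' | x' y'. x' \<in> I A +>\<^bsub>W A\<^esub> x \<and> y' \<in> I B +>\<^bsub>W B\<^esub> y} \<noteq> {}"
    using coset_self[OF W[OF A] submodule_I[OF A] x] coset_self[OF W[OF B] submodule_I[OF B] y] by blast
  show "{pr A B x' y' | x' y'. x' \<in> I A +>\<^bsub>W A\<^esub> x \<and> y' \<in> I B +>\<^bsub>W B\<^esub> y} \<subseteq> I (sumb A B) +>\<^bsub>W (sumb A B)\<^esub> pr A B x y"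
  proof
    fix z assume "z \<in> {pr A B x' y' | x' y'. x' \<in> I A +>\<^bsub>W A\<^esub> x \<and> y' \<in> I B +>\<^bsub>W B\<^esub> y}"
    then obtain x' y' where xy: "x' \<in> I A +>\<^bsub>W A\<^esub> x" "y' \<in> I B +>\<^bsub>W B\<^esub> y" "z = pr A B x' y'" by blast
    obtain i where i: "i \<in> I A" "x' = i \<oplus>\<^bsub>W A\<^esub> x" using xy(1) by (auto simp: a_r_coset_def')
    obtain j where j: "j \<in> I B" "y' = j \<oplus>\<^bsub>W B\<^esub> y" using xy(2) by (auto simp: a_r_coset_def')
    have ic: "i \<in> carrier (W A)" using submodule_subset[OF submodule_I[OF A]] i(1) by auto
    have jc: "j \<in> carrier (W B)" using submodule_subset[OF submodule_I[OF B]] j(1) by auto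
    interpret WB: module K "W B" by (rule W[OF B])
    interpret WS: module K "W (sumb A B)" by (rule W[OF AB])
    have y'c: "y' \<in> carrier (W B)" using j jc y by simp
    \<comment> \<open>Expand in the left factor first, keeping \<open>y'\<close> whole, and then in
      the right one; the first two of the three terms lie in the ideal.\<close>
    have "z = pr A B i y' \<oplus>\<^bsub>W (sumb A B)\<^esub> (pr A B x j \<oplus>\<^bsub>W (sumb A B)\<^esub> pr A B x y)"
      unfolding xy(3) i(2) module_hom_add[OF pr_hom1[OF A B y'c] ic x]
      by (subst (2) j(2)) (simp add: module_hom_add[OF pr_hom2[OF A B x] jc y])
    also have "\<dots> = (pr A B i y' \<oplus>\<^bsub>W (sumb A B)\<^esub> pr A B x j) \<oplus>\<^bsub>W (sumb A B)\<^esub> pr A B x y"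
      using pr_closed[OF A B] ic jc x y y'c by (simp add: WS.M.a_assoc)
    finally show "z \<in> I (sumb A B) +>\<^bsub>W (sumb A B)\<^esub> pr A B x y"
      using submodule_add[OF submodule_I[OF AB] pr_I1[OF A B i(1) y'c] pr_I2[OF A B x j(1)]]
      by (auto simp: a_r_coset_def')
  qed
qed

definition star :: "nat set set \<Rightarrow> nat set set \<Rightarrow> 'b set \<Rightarrow> 'b set \<Rightarrow> 'b set" where
  "star A B X Y = act sum_fold (sumb A B) (Rbar_prod K R (ptn_of A) (ptn_of B) X Y)"

lemma star_q:
  assumes A: "block_family A" and B: "block_family B" and sep: "sep A B"
    and x: "x \<in> carrier (W A)" and y: "y \<in> carrier (W B)"
  shows "star A B (q A x) (q B y) = q (A \<union> B) (tr (sumb A B) (A \<union> B) sum_fold (pr A B x y))"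
  using act_q[OF block_family_sumb[OF A B] inj_fold[OF sep] pr_closed[OF A B x y]]
  by (simp add: star_def Rbar_prod_q[OF A B x y] im_fold)

lemma star_rep_hom1:
  "\<lbrakk>block_family A; block_family B; sep A B; y \<in> carrier (W B)\<rbrakk> \<Longrightarrow>
    (\<lambda>x. q (A \<union> B) (tr (sumb A B) (A \<union> B) sum_fold (pr A B x y))) \<in> module_hom K (W A) (V (A \<union> B))"
  by (intro module_hom_compose[OF module_hom_compose[OF pr_hom1 tr_mod_hom] q_hom]
      block_family_sumb block_family_Un mor_fold)

lemma star_rep_hom2:
  "\<lbrakk>block_family A; block_family B; sep A B; x \<in> carrier (W A)\<rbrakk> \<Longrightarrow>
    (\<lambda>y. q (A \<union> B) (tr (sumb A B) (A \<union> B) sum_fold (pr A B x y))) \<in> module_hom K (W B) (V (A \<union> B))"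
  by (intro module_hom_compose[OF module_hom_compose[OF pr_hom2 tr_mod_hom] q_hom]
      block_family_sumb block_family_Un mor_fold)

definition e :: "'b set" where
  "e = q {} (pf_unit R \<one>\<^bsub>K\<^esub>)"

lemma unit_hom: "pf_unit R \<in> module_hom K (self_module K) (W {})"
  using unit_linear by (simp add: underline_0)

lemma unit_bij': "bij_betw (pf_unit R) (carrier K) (carrier (W {}))"
  using unit_bij by (simp add: underline_0)

text \<open>The empty family has no proper refinement, so nothing is divided out and
  \<open>V {}\<close> keeps the unit isomorphism with \<open>K\<close>.\<close>

lemma I_empty: "I {} = {\<zero>\<^bsub>W {}\<^esub>}"
proof -
  interpret W0: module K "W {}" by (rule W) simp
  have "fine C {} \<Longrightarrow> block_family C \<Longrightarrow> C = {}" for C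
    by (auto simp: fine_def block_family_def)
  then have g: "(\<Union>C\<in>{C. block_family C \<and> fine C {} \<and> C \<noteq> {}}. tr C {} id ` carrier (W C)) = {}" by blast
  have s: "submodule {\<zero>\<^bsub>W {}\<^esub>} K (W {})"
    by (rule submoduleI'[OF W]) auto
  have "I {} \<subseteq> {\<zero>\<^bsub>W {}\<^esub>}" unfolding I_eq[OF block_family_empty] g by (rule span_least[OF s]) simp
  then show ?thesis using submodule_zero[OF submodule_I[OF block_family_empty]] by auto
qed

text \<open>The values of \<open>f\<close> outside \<open>\<Union>A\<close> are unconstrained, so
  \<open>f\<close> need not be \<open>id\<close>; it is merely 2-isomorphic to it.\<close>

lemma tr_ident:
  assumes A: "block_family A" and f: "mor f A A" and id: "\<And>x. x \<in> \<Union>A \<Longrightarrow> f x = x" and z: "z \<in> carrier (W A)"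
  shows "tr A A f z = z"
proof -
  have "\<forall>B\<in>A. id ` B = f ` B"
  proof
    fix B assume "B \<in> A"
    then have "f ` B = (\<lambda>x. x) ` B" using id by (intro image_cong) auto
    then show "id ` B = f ` B" by simp
  qed
  from two_iso_of[OF this] have "two_iso (ptn_of A) (ptn_of A) id f" by simp
  then have "tr A A id z = tr A A f z"
    by (intro tr_two_iso is_ptn_of A ptn_mor_of mor_id fine_refl f z)
  then show ?thesis using tr_id[OF is_ptn_of[OF A] z] by simp
qed

text \<open>When \<open>A\<close> and \<open>B\<close> have disjoint underlying sets, folding is
  injective; this inverse reads a point of the union as a tagged point of the disjoint
  union.\<close>

definition unfold :: "nat set set \<Rightarrow> nat set set \<Rightarrow> nat \<Rightarrow> nat" where
  "unfold A B = inv_into (\<Union>(sumb A B)) sum_fold"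

lemma
  assumes sep: "sep A B"
  shows im_unfold: "im (unfold A B) (A \<union> B) = sumb A B"
    and inj_unfold: "inj_on (unfold A B) (\<Union>(A \<union> B))"
    and mor_unfold: "mor (unfold A B) (A \<union> B) (sumb A B)"
proof -
  have "unfold A B ` sum_fold ` X = X" if "X \<in> sumb A B" for X
    unfolding unfold_def using that by (intro inv_into_image_cancel inj_fold sep) auto
  then have "im (unfold A B) (im sum_fold (sumb A B)) = sumb A B"
    unfolding image_image[of "image (unfold A B)"] by simp
  then show 1: "im (unfold A B) (A \<union> B) = sumb A B" by (simp only: im_fold)
  have "\<Union>(A \<union> B) = sum_fold ` \<Union>(sumb A B)"
    unfolding Union_im[symmetric] im_fold ..
  then show 2: "inj_on (unfold A B) (\<Union>(A \<union> B))"
    unfolding unfold_def by (intro inj_on_inv_into) simp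
  show "mor (unfold A B) (A \<union> B) (sumb A B)" using mor_im[OF 2] unfolding 1 .
qed

lemma fold_unfold:
  assumes A: "block_family A" and B: "block_family B" and sep: "sep A B" and z: "z \<in> carrier (W (A \<union> B))"
  shows "tr (sumb A B) (A \<union> B) sum_fold (tr (A \<union> B) (sumb A B) (unfold A B) z) = z"
proof -
  have AB: "block_family (A \<union> B)" by (rule block_family_Un[OF A B sep])
  have U: "\<Union>(A \<union> B) = sum_fold ` \<Union>(sumb A B)"
    unfolding Union_im[symmetric] im_fold ..
  have "tr (A \<union> B) (A \<union> B) (sum_fold \<circ> unfold A B) z = z"
    using U by (intro tr_ident[OF AB mor_comp[OF mor_unfold[OF sep] mor_fold[OF sep]] _ z])
      (simp add: unfold_def f_inv_into_f)
  then show ?thesis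
    using tr_trans[OF AB block_family_sumb[OF A B] AB mor_unfold[OF sep] mor_fold[OF sep] z] by simp
qed

lemma unfold_fold:
  assumes A: "block_family A" and B: "block_family B" and sep: "sep A B" and z: "z \<in> carrier (W (sumb A B))"
  shows "tr (A \<union> B) (sumb A B) (unfold A B) (tr (sumb A B) (A \<union> B) sum_fold z) = z"
proof -
  have AB: "block_family (A \<union> B)" by (rule block_family_Un[OF A B sep])
  have S: "block_family (sumb A B)" by (rule block_family_sumb[OF A B])
  have "tr (sumb A B) (sumb A B) (unfold A B \<circ> sum_fold) z = z"
    by (intro tr_ident[OF S mor_comp[OF mor_fold[OF sep] mor_unfold[OF sep]] _ z])
      (simp only: unfold_def comp_apply inv_into_f_f[OF inj_fold[OF sep]])
  then show ?thesis
    using tr_trans[OF S AB S mor_fold[OF sep] mor_unfold[OF sep] z] by simp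
qed

text \<open>The bilinear map gives a linear map \<open>h\<close> on the value at the disjoint union,
  and the point is that \<open>h\<close> kills the ideal. A proper refinement of
  \<open>sumb A B\<close> splits into refinements of \<open>A\<close> and \<open>B\<close> of which
  at least one is proper, so \<open>b\<close> meets a factor that is zero in the quotient. The
  target has an arbitrary type; the species axiom is the instance for tensor powers.\<close>

lemma star_univ_aux:
  fixes P :: "('k, 'c) module"
  assumes A: "block_family A" and B: "block_family B" and sep: "sep A B" and P: "module K P"
    and b1: "\<And>Y. Y \<in> carrier (V B) \<Longrightarrow> (\<lambda>X. b X Y) \<in> module_hom K (V A) P"
    and b2: "\<And>X. X \<in> carrier (V A) \<Longrightarrow> (\<lambda>Y. b X Y) \<in> module_hom K (V B) P"
  shows "\<exists>h \<in> module_hom K (V (A \<union> B)) P. \<forall>X \<in> carrier (V A). \<forall>Y \<in> carrier (V B). h (star A B X Y) = b X Y"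
proof -
  have AB: "block_family (A \<union> B)" by (rule block_family_Un[OF A B sep])
  have S: "block_family (sumb A B)" by (rule block_family_sumb[OF A B])
  have "\<exists>h \<in> module_hom K (W (sumb A B)) P. \<forall>x \<in> carrier (W A). \<forall>y \<in> carrier (W B). h (pr A B x y) = b (q A x) (q B y)"
    by (rule pr_span(2)[OF A B P])
      (rule module_hom_compose[OF q_hom b1] module_hom_compose[OF q_hom b2]; intro A B q_closed; assumption)+
  then obtain h where h: "h \<in> module_hom K (W (sumb A B)) P"
    "\<And>x y. \<lbrakk>x \<in> carrier (W A); y \<in> carrier (W B)\<rbrakk> \<Longrightarrow> h (pr A B x y) = b (q A x) (q B y)" by blast
  have hI: "h x = \<zero>\<^bsub>P\<^esub>" if "x \<in> I (sumb A B)" for x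
  proof -
    have "I (sumb A B) \<subseteq> {x \<in> carrier (W (sumb A B)). h x = \<zero>\<^bsub>P\<^esub>}"
    proof (rule I_least[OF S submodule_equalizer[OF h(1) module_hom_const_zero[OF P] W[OF S] P]])
      fix C z assume C: "block_family C" "fine C (sumb A B)" "C \<noteq> sumb A B" and z: "z \<in> carrier (W C)"
      obtain C1 C2 where C12: "block_family C1" "block_family C2" "fine C1 A" "fine C2 B" "C = sumb C1 C2"
        by (rule fine_sumb_split[OF C(1,2)])
      have t: "tr C (sumb A B) id \<in> module_hom K (W C) (W (sumb A B))" by (rule tr_mod_hom[OF C(1) S mor_id[OF C(2)]])
      \<comment> \<open>External products span the value at the split refinement, so the vanishing
        of \<open>h\<close> needs checking only on them.\<close>
      have "carrier (W (sumb C1 C2)) \<subseteq> {z \<in> carrier (W (sumb C1 C2)). h (tr C (sumb A B) id z) = \<zero>\<^bsub>P\<^esub>}"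
      proof (rule pr_span(1)[OF C12(1,2)])
        show "submodule {z \<in> carrier (W (sumb C1 C2)). h (tr C (sumb A B) id z) = \<zero>\<^bsub>P\<^esub>} K (W (sumb C1 C2))"
          unfolding C12(5)[symmetric]
          by (rule submodule_equalizer[OF module_hom_compose[OF t h(1)] module_hom_const_zero[OF P] W[OF C(1)] P])
        fix x y assume x: "x \<in> carrier (W C1)" and y: "y \<in> carrier (W C2)"
        have x': "tr C1 A id x \<in> carrier (W A)" by (rule tr_closed[OF C12(1) A mor_id[OF C12(3)] x])
        have y': "tr C2 B id y \<in> carrier (W B)" by (rule tr_closed[OF C12(2) B mor_id[OF C12(4)] y])
        have "h (tr C (sumb A B) id (pr C1 C2 x y)) = b (q A (tr C1 A id x)) (q B (tr C2 B id y))"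
          using pr_tr[OF C12(1) A C12(2) B mor_id[OF C12(3)] mor_id[OF C12(4)] x y] h(2)[OF x' y']
          by (simp add: mor_sum_id C12(5))
        also have "\<dots> = \<zero>\<^bsub>P\<^esub>"
        proof (cases "C1 = A")
          case False
          then have "q A (tr C1 A id x) = \<zero>\<^bsub>V A\<^esub>"
            by (intro q_I A I_gen C12(1,3) x)
          then show ?thesis
            using module_hom_zero[OF b1[OF q_closed[OF B y']] module_V[OF A] P] by simp
        next
          case True
          then have "C2 \<noteq> B" using C(3) C12(5) by blast
          then have "q B (tr C2 B id y) = \<zero>\<^bsub>V B\<^esub>"
            by (intro q_I B I_gen C12(2,4) y)
          then show ?thesis
            using module_hom_zero[OF b2[OF q_closed[OF A x']] module_V[OF B] P] by simp
        qed
        finally show "pr C1 C2 x y \<in> {z \<in> carrier (W (sumb C1 C2)). h (tr C (sumb A B) id z) = \<zero>\<^bsub>P\<^esub>}"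
          using pr_closed[OF C12(1,2) x y] by simp
      qed
      then have "h (tr C (sumb A B) id z) = \<zero>\<^bsub>P\<^esub>" using z unfolding C12(5) by blast
      then show "tr C (sumb A B) id z \<in> {x \<in> carrier (W (sumb A B)). h x = \<zero>\<^bsub>P\<^esub>}"
        using module_hom_closed[OF t z] by simp
    qed
    then show ?thesis using that by blast
  qed
  \<comment> \<open>\<open>h\<close> is defined at the disjoint union, whereas the universal
    property concerns the actual union; \<open>unfold\<close> leads from the latter to the
    former.\<close>
  let ?k = "tr (A \<union> B) (sumb A B) (unfold A B)"
  have k: "?k \<in> module_hom K (W (A \<union> B)) (W (sumb A B))" by (rule tr_mod_hom[OF AB S mor_unfold[OF sep]])
  have "\<exists>g \<in> module_hom K (V (A \<union> B)) P. \<forall>x \<in> carrier (W (A \<union> B)). g (q (A \<union> B) x) = h (?k x)"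
  proof (rule q_lift[OF AB P module_hom_compose[OF k h(1)]])
    show "h (?k x) = \<zero>\<^bsub>P\<^esub>" if "x \<in> I (A \<union> B)" for x
      using tr_I[OF AB inj_unfold[OF sep] that] unfolding im_unfold[OF sep] by (rule hI)
  qed
  then obtain g where g: "g \<in> module_hom K (V (A \<union> B)) P"
    "\<And>x. x \<in> carrier (W (A \<union> B)) \<Longrightarrow> g (q (A \<union> B) x) = h (?k x)" by blast
  have "g (star A B X Y) = b X Y" if X: "X \<in> carrier (V A)" and Y: "Y \<in> carrier (V B)" for X Y
  proof -
    obtain x where x: "x \<in> carrier (W A)" "X = q A x" using q_surj[OF X] by blast
    obtain y where y: "y \<in> carrier (W B)" "Y = q B y" using q_surj[OF Y] by blast
    have p: "pr A B x y \<in> carrier (W (sumb A B))" by (rule pr_closed[OF A B x(1) y(1)])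
    show ?thesis
      using g(2)[OF tr_closed[OF S AB mor_fold[OF sep] p]] unfold_fold[OF A B sep p] h(2)[OF x(1) y(1)]
      by (simp add: x(2) y(2) star_q[OF A B sep x(1) y(1)])
  qed
  then show ?thesis using g(1) by blast
qed

text \<open>Both sides are transfers of one triple external product along one map, the map that
  forgets all tags. This is why internal products are strictly associative.\<close>

lemma star_assoc_aux:
  assumes A: "block_family A" and B: "block_family B" and C: "block_family C"
    and sep: "sep A B" "sep A C" "sep B C"
    and x: "x \<in> carrier (W A)" and y: "y \<in> carrier (W B)" and z: "z \<in> carrier (W C)"
  shows "star (A \<union> B) C (star A B (q A x) (q B y)) (q C z) = star A (B \<union> C) (q A x) (star B C (q B y) (q C z))"
proof -
  let ?U = "A \<union> B \<union> C" and ?T = "sumb (sumb A B) C"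
  have AB: "block_family (A \<union> B)" and BC: "block_family (B \<union> C)"
    using A B C sep by (auto intro: block_family_Un)
  have s1: "sep (A \<union> B) C" and s2: "sep A (B \<union> C)" using sep by auto
  have U: "block_family ?U" by (rule block_family_Un[OF AB C s1])
  have U': "A \<union> (B \<union> C) = ?U" by blast
  note S = block_family_sumb[OF A B] and S' = block_family_sumb[OF B C]
  have T: "block_family ?T" by (rule block_family_sumb[OF S C])
  have T': "block_family (sumb A (sumb B C))" by (rule block_family_sumb[OF A S'])
  define w where "w = pr (sumb A B) C (pr A B x y) z"
  have w: "w \<in> carrier (W ?T)" unfolding w_def by (intro pr_closed S C A B x y z)
  define u where "u = tr (sumb A B) (A \<union> B) sum_fold (pr A B x y)"
  define v where "v = tr (sumb B C) (B \<union> C) sum_fold (pr B C y z)"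
  have u: "u \<in> carrier (W (A \<union> B))" unfolding u_def
    by (rule tr_closed[OF S AB mor_fold[OF sep(1)] pr_closed[OF A B x y]])
  have v: "v \<in> carrier (W (B \<union> C))" unfolding v_def
    by (rule tr_closed[OF S' BC mor_fold[OF sep(3)] pr_closed[OF B C y z]])
  have m1: "mor (mor_sum sum_fold id) ?T (sumb (A \<union> B) C)"
    by (rule mor_mor_sum[OF mor_fold[OF sep(1)] mor_id[OF fine_refl]])
  have m2: "mor (mor_sum id sum_fold) (sumb A (sumb B C)) (sumb A (B \<union> C))"
    by (rule mor_mor_sum[OF mor_id[OF fine_refl] mor_fold[OF sep(3)]])
  have f2: "mor sum_fold (sumb A (B \<union> C)) ?U" using mor_fold[OF s2] unfolding U' .
  have "pr (A \<union> B) C u z = tr ?T (sumb (A \<union> B) C) (mor_sum sum_fold id) w"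
    using pr_tr[OF S AB C C mor_fold[OF sep(1)] mor_id[OF fine_refl] pr_closed[OF A B x y] z]
      tr_id[OF is_ptn_of[OF C] z] by (simp add: u_def w_def)
  then have L: "tr (sumb (A \<union> B) C) ?U sum_fold (pr (A \<union> B) C u z) = tr ?T ?U (sum_fold \<circ> mor_sum sum_fold id) w"
    using tr_trans[OF T block_family_sumb[OF AB C] U m1 mor_fold[OF s1] w] by simp
  have "pr A (sumb B C) x (pr B C y z) = tr ?T (sumb A (sumb B C)) sum_assoc w"
    using prod_assoc[OF is_ptn_of[OF A] is_ptn_of[OF B] is_ptn_of[OF C] x y z]
    by (simp add: ptn_sum_of w_def)
  then have "pr A (B \<union> C) x v = tr (sumb A (sumb B C)) (sumb A (B \<union> C)) (mor_sum id sum_fold) (tr ?T (sumb A (sumb B C)) sum_assoc w)"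
    using pr_tr[OF A A S' BC mor_id[OF fine_refl] mor_fold[OF sep(3)] x pr_closed[OF B C y z]]
      tr_id[OF is_ptn_of[OF A] x] by (simp add: v_def)
  also have "\<dots> = tr ?T (sumb A (B \<union> C)) (mor_sum id sum_fold \<circ> sum_assoc) w"
    by (rule tr_trans[OF T T' block_family_sumb[OF A BC] mor_assoc m2 w])
  finally have "tr (sumb A (B \<union> C)) ?U sum_fold (pr A (B \<union> C) x v) = tr ?T ?U (sum_fold \<circ> (mor_sum id sum_fold \<circ> sum_assoc)) w"
    using tr_trans[OF T block_family_sumb[OF A BC] U mor_comp[OF mor_assoc m2] f2 w] by simp
  \<comment> \<open>Folding twice removes both layers of tags, in whichever way the three summands
    are bracketed.\<close>
  moreover have "sum_fold \<circ> (mor_sum id sum_fold \<circ> sum_assoc) = sum_fold \<circ> mor_sum sum_fold id"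
  proof (rule lr_fun_eqI)
    show "(sum_fold \<circ> (mor_sum id sum_fold \<circ> sum_assoc)) (inl n) = (sum_fold \<circ> mor_sum sum_fold id) (inl n)" for n
      by (rule lr_cases[of n]) simp_all
  qed simp
  ultimately have R: "tr (sumb A (B \<union> C)) ?U sum_fold (pr A (B \<union> C) x v) = tr (sumb (A \<union> B) C) ?U sum_fold (pr (A \<union> B) C u z)"
    using L by simp
  have "star (A \<union> B) C (star A B (q A x) (q B y)) (q C z) = q ?U (tr (sumb (A \<union> B) C) ?U sum_fold (pr (A \<union> B) C u z))"
    unfolding star_q[OF A B sep(1) x y] u_def[symmetric] by (rule star_q[OF AB C s1 u z])
  also have "\<dots> = star A (B \<union> C) (q A x) (star B C (q B y) (q C z))"
    unfolding star_q[OF B C sep(3) y z] v_def[symmetric] star_q[OF A BC s2 x v] U' R ..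
  finally show ?thesis .
qed

text \<open>The identities are lifted to representatives, where they become equations between
  transfers; the generation and universal properties come from \<open>pr_span\<close> and
  \<open>star_univ_aux\<close>.\<close>

sublocale species: block_species K V act star e
proof (rule block_species.intro)
  show "cring K" by (rule K)
  fix A assume A: "block_family A"
  show "module K (V A)" by (rule module_V[OF A])
  show "act id A X = X" if "X \<in> carrier (V A)" for X
  proof -
    obtain x where x: "x \<in> carrier (W A)" "X = q A x" using q_surj[OF \<open>X \<in> carrier (V A)\<close>] by blast
    then show ?thesis using act_q[OF A _ x(1), of id] tr_id[OF is_ptn_of[OF A] x(1)] by simp
  qed
  show "star {} A e X = X" if "X \<in> carrier (V A)" for X
  proof -
    obtain x where x: "x \<in> carrier (W A)" "X = q A x" using q_surj[OF \<open>X \<in> carrier (V A)\<close>] by blast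
    have u: "pf_unit R \<one>\<^bsub>K\<^esub> \<in> carrier (W {})"
      using module_hom_closed[OF unit_hom, of "\<one>\<^bsub>K\<^esub>"] cring.cring_simprules(6)[OF K] by simp
    show ?thesis
      using star_q[OF _ A _ u x(1)] prod_unit_left[OF is_ptn_of[OF A] x(1)]
      by (simp add: x(2) e_def underline_0 ptn_sum_of)
  qed
  fix f :: "nat \<Rightarrow> nat" assume f: "inj_on f (\<Union>A)"
  have fA: "block_family (im f A)" by (rule block_family_im[OF A f])
  show "act f A \<in> module_hom K (V A) (V (im f A))"
    by (rule hom_on_V[OF A module_hom_compose[OF tr_mod_hom[OF A fA mor_im[OF f]] q_hom[OF fA]] act_q[OF A f]])
  show "act f A X = act g A X" if g: "inj_on g (\<Union>A)" and fg: "\<forall>B \<in> A. f ` B = g ` B" and X: "X \<in> carrier (V A)" for g X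
  proof -
    obtain x where x: "x \<in> carrier (W A)" "X = q A x" using q_surj[OF X] by blast
    have im: "im g A = im f A" using fg by auto
    \<comment> \<open>Invariance under 2-isomorphism of the transfers is what makes the action
      depend on images of blocks only.\<close>
    have "tr A (im f A) f x = tr A (im f A) g x"
      using mor_im[OF g] unfolding im
      by (intro tr_two_iso is_ptn_of A fA ptn_mor_of mor_im f two_iso_of fg x(1))
    then show ?thesis using act_q[OF A f x(1)] act_q[OF A g x(1)] by (simp add: im x(2))
  qed
  show "act g (im f A) (act f A X) = act (g \<circ> f) A X" if g: "inj_on g (f ` \<Union>A)" and X: "X \<in> carrier (V A)" for g X
  proof -
    obtain x where x: "x \<in> carrier (W A)" "X = q A x" using q_surj[OF X] by blast
    have g': "inj_on g (\<Union>(im f A))" unfolding Union_im by (rule g)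
    have gf: "inj_on (g \<circ> f) (\<Union>A)" using f g by (rule comp_inj_on)
    have im: "im g (im f A) = im (g \<circ> f) A" by (simp add: image_image)
    have gfA: "block_family (im (g \<circ> f) A)" by (rule block_family_im[OF A gf])
    show ?thesis
      using act_q[OF A f x(1)] act_q[OF fA g' tr_closed[OF A fA mor_im[OF f] x(1)]] act_q[OF A gf x(1)]
        tr_trans[OF A fA gfA mor_im[OF f] _ x(1), of g] mor_im[OF g']
      unfolding im x(2) by simp
  qed
next
  interpret W0: module K "W {}" by (rule W) simp
  interpret K: cring K by (rule K)
  have u: "pf_unit R \<one>\<^bsub>K\<^esub> \<in> carrier (W {})" using module_hom_closed[OF unit_hom, of "\<one>\<^bsub>K\<^esub>"] by simp
  show "e \<in> carrier (V {})" unfolding e_def by (rule q_closed[OF block_family_empty u])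
  show "\<exists>a \<in> carrier K. X = a \<odot>\<^bsub>V {}\<^esub> e" if "X \<in> carrier (V {})" for X
  proof -
    obtain x where x: "x \<in> carrier (W {})" "X = q {} x" using q_surj[OF \<open>X \<in> carrier (V {})\<close>] by blast
    obtain a where a: "a \<in> carrier K" "x = pf_unit R a" using unit_bij' x(1) by (auto simp: bij_betw_def)
    have "x = a \<odot>\<^bsub>W {}\<^esub> pf_unit R \<one>\<^bsub>K\<^esub>"
      using module_hom_smult[OF unit_hom a(1), of "\<one>\<^bsub>K\<^esub>"] a by simp
    then show ?thesis
      using a(1) x(2) module_hom_smult[OF q_hom[OF block_family_empty] a(1) u] by (auto simp: e_def)
  qed
  show "\<exists>\<epsilon> \<in> module_hom K (V {}) (self_module K). \<epsilon> e = \<one>\<^bsub>K\<^esub>"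
  proof -
    \<comment> \<open>The inverse of the unit isomorphism is the coordinate with respect to
      \<open>e\<close>.\<close>
    let ?i = "inv_into (carrier K) (pf_unit R)"
    have iu: "?i (pf_unit R a) = a" if "a \<in> carrier K" for a
      using unit_bij' that by (simp add: bij_betw_def)
    have ex: "\<exists>a \<in> carrier K. x = pf_unit R a" if "x \<in> carrier (W {})" for x
      using unit_bij' that by (auto simp: bij_betw_def)
    have "?i \<in> module_hom K (W {}) (self_module K)"
    proof (rule module_homI)
      fix x y assume x: "x \<in> carrier (W {})" and y: "y \<in> carrier (W {})"
      obtain a where a: "a \<in> carrier K" "x = pf_unit R a" by (rule bexE[OF ex[OF x]])
      obtain b where b: "b \<in> carrier K" "y = pf_unit R b" by (rule bexE[OF ex[OF y]])
      show "?i (x \<oplus>\<^bsub>W {}\<^esub> y) = ?i x \<oplus>\<^bsub>self_module K\<^esub> ?i y"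
        using module_hom_add[OF unit_hom, of a b] a b iu[of "a \<oplus>\<^bsub>K\<^esub> b"] iu by simp
    next
      fix x assume x: "x \<in> carrier (W {})"
      obtain a where a: "a \<in> carrier K" "x = pf_unit R a" by (rule bexE[OF ex[OF x]])
      show "?i x \<in> carrier (self_module K)" using a iu by simp
      show "?i (c \<odot>\<^bsub>W {}\<^esub> x) = c \<odot>\<^bsub>self_module K\<^esub> ?i x" if c: "c \<in> carrier K" for c
        using module_hom_smult[OF unit_hom c, of a] a c iu[of "c \<otimes>\<^bsub>K\<^esub> a"] iu by simp
    qed
    then obtain g where g: "g \<in> module_hom K (V {}) (self_module K)" "\<forall>x \<in> carrier (W {}). g (q {} x) = ?i x"
      using q_lift[OF block_family_empty module_self[OF K], of ?i] I_empty
        module_hom_zero[of ?i K "W {}" "self_module K", OF _ W module_self[OF K]] by auto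
    then show ?thesis using u iu[of "\<one>\<^bsub>K\<^esub>"] by (intro bexI[OF _ g(1)]) (simp add: e_def)
  qed
next
  fix A B assume A: "block_family A" and B: "block_family B" and sep: "sep A B"
  have AB: "block_family (A \<union> B)" by (rule block_family_Un[OF A B sep])
  have S: "block_family (sumb A B)" by (rule block_family_sumb[OF A B])
  note fold = tr_mod_hom[OF S AB mor_fold[OF sep]]
  show "(\<lambda>X. star A B X Y) \<in> module_hom K (V A) (V (A \<union> B))" if Y: "Y \<in> carrier (V B)" for Y
  proof -
    obtain y where y: "y \<in> carrier (W B)" "Y = q B y" using q_surj[OF Y] by blast
    show ?thesis
      by (rule hom_on_V[OF A star_rep_hom1[OF A B sep y(1)]]) (simp add: y star_q[OF A B sep])
  qed
  show "(\<lambda>Y. star A B X Y) \<in> module_hom K (V B) (V (A \<union> B))" if X: "X \<in> carrier (V A)" for X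
  proof -
    obtain x where x: "x \<in> carrier (W A)" "X = q A x" using q_surj[OF X] by blast
    show ?thesis
      by (rule hom_on_V[OF B star_rep_hom2[OF A B sep x(1)]]) (simp add: x star_q[OF A B sep])
  qed
  show "star A B X Y = star B A Y X" if X: "X \<in> carrier (V A)" and Y: "Y \<in> carrier (V B)" for X Y
  proof -
    obtain x where x: "x \<in> carrier (W A)" "X = q A x" using q_surj[OF X] by blast
    obtain y where y: "y \<in> carrier (W B)" "Y = q B y" using q_surj[OF Y] by blast
    have sep': "sep B A" using sep by blast
    have S': "block_family (sumb B A)" by (rule block_family_sumb[OF B A])
    have BA: "B \<union> A = A \<union> B" by blast
    have sw: "tr (sumb A B) (sumb B A) sum_swap (pr A B x y) = pr B A y x"
      using prod_sym[OF is_ptn_of[OF A] is_ptn_of[OF B] x(1) y(1)] by (simp add: ptn_sum_of)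
    \<comment> \<open>Exchanging tags is invisible after folding, so symmetry becomes strict
      commutativity.\<close>
    have "sum_fold \<circ> sum_swap = sum_fold" by (rule lr_fun_eqI) simp_all
    then have "tr (sumb B A) (A \<union> B) sum_fold (pr B A y x) = tr (sumb A B) (A \<union> B) sum_fold (pr A B x y)"
      using tr_trans[OF S S' AB mor_swap _ pr_closed[OF A B x(1) y(1)], of sum_fold] mor_fold[OF sep']
      unfolding sw BA by simp
    then show ?thesis
      using star_q[OF A B sep x(1) y(1)] star_q[OF B A sep' y(1) x(1)] by (simp add: x y BA)
  qed
  show "act f (A \<union> B) (star A B X Y) = star (im f A) (im f B) (act f A X) (act f B Y)"
    if f: "inj_on f (\<Union>(A \<union> B))" and X: "X \<in> carrier (V A)" and Y: "Y \<in> carrier (V B)" for f X Y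
  proof -
    obtain x where x: "x \<in> carrier (W A)" "X = q A x" using q_surj[OF X] by blast
    obtain y where y: "y \<in> carrier (W B)" "Y = q B y" using q_surj[OF Y] by blast
    have fA: "inj_on f (\<Union>A)" and fB: "inj_on f (\<Union>B)" using f by (auto simp: inj_on_Un)
    have bA: "block_family (im f A)" and bB: "block_family (im f B)"
      using block_family_im A B fA fB by blast+
    have sep': "sep (im f A) (im f B)" by (rule sep_im[OF f sep])
    have im: "im f (A \<union> B) = im f A \<union> im f B" by blast
    have bAB: "block_family (im f A \<union> im f B)" by (rule block_family_Un[OF bA bB sep'])
    have mf: "mor f (A \<union> B) (im f A \<union> im f B)" using mor_im[OF f] unfolding im .
    have "f \<circ> sum_fold = sum_fold \<circ> mor_sum f f" by (rule lr_fun_eqI) simp_all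
    then have "tr (A \<union> B) (im f A \<union> im f B) f (tr (sumb A B) (A \<union> B) sum_fold (pr A B x y)) =
        tr (sumb A B) (im f A \<union> im f B) (sum_fold \<circ> mor_sum f f) (pr A B x y)"
      using tr_trans[OF S AB bAB mor_fold[OF sep] mf pr_closed[OF A B x(1) y(1)]] by simp
    also have "\<dots> = tr (sumb (im f A) (im f B)) (im f A \<union> im f B) sum_fold
        (tr (sumb A B) (sumb (im f A) (im f B)) (mor_sum f f) (pr A B x y))"
      by (rule tr_trans[OF S block_family_sumb[OF bA bB] bAB mor_mor_sum[OF mor_im[OF fA] mor_im[OF fB]]
            mor_fold[OF sep'] pr_closed[OF A B x(1) y(1)], symmetric])
    also have "tr (sumb A B) (sumb (im f A) (im f B)) (mor_sum f f) (pr A B x y) =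
        pr (im f A) (im f B) (tr A (im f A) f x) (tr B (im f B) f y)"
      by (rule pr_tr[OF A bA B bB mor_im[OF fA] mor_im[OF fB] x(1) y(1)])
    finally have eq: "tr (A \<union> B) (im f A \<union> im f B) f (tr (sumb A B) (A \<union> B) sum_fold (pr A B x y)) =
        tr (sumb (im f A) (im f B)) (im f A \<union> im f B) sum_fold (pr (im f A) (im f B) (tr A (im f A) f x) (tr B (im f B) f y))" .
    have tA: "tr A (im f A) f x \<in> carrier (W (im f A))" by (rule tr_closed[OF A bA mor_im[OF fA] x(1)])
    have tB: "tr B (im f B) f y \<in> carrier (W (im f B))" by (rule tr_closed[OF B bB mor_im[OF fB] y(1)])
    have "act f (A \<union> B) (star A B X Y) = q (im f A \<union> im f B)
        (tr (A \<union> B) (im f A \<union> im f B) f (tr (sumb A B) (A \<union> B) sum_fold (pr A B x y)))"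
      using act_q[OF AB f module_hom_closed[OF fold pr_closed[OF A B x(1) y(1)]]]
      unfolding x(2) y(2) star_q[OF A B sep x(1) y(1)] im .
    also have "\<dots> = star (im f A) (im f B) (act f A X) (act f B Y)"
      unfolding x(2) y(2) act_q[OF A fA x(1)] act_q[OF B fB y(1)] star_q[OF bA bB sep' tA tB] eq ..
    finally show ?thesis .
  qed
  show "carrier (V (A \<union> B)) \<subseteq> H" if H: "submodule H K (V (A \<union> B))"
    and st: "\<And>X Y. \<lbrakk>X \<in> carrier (V A); Y \<in> carrier (V B)\<rbrakk> \<Longrightarrow> star A B X Y \<in> H" for H
  proof
    fix Z assume "Z \<in> carrier (V (A \<union> B))"
    then obtain z where z: "z \<in> carrier (W (A \<union> B))" "Z = q (A \<union> B) z" using q_surj by blast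
    have qf: "(\<lambda>w. q (A \<union> B) (tr (sumb A B) (A \<union> B) sum_fold w)) \<in> module_hom K (W (sumb A B)) (V (A \<union> B))"
      by (rule module_hom_compose[OF fold q_hom[OF AB]])
    \<comment> \<open>The preimage of \<open>H\<close> under folding and projection contains all
      external products, hence everything; folding is onto because \<open>unfold\<close> provides
      preimages.\<close>
    have "carrier (W (sumb A B)) \<subseteq> {w \<in> carrier (W (sumb A B)). q (A \<union> B) (tr (sumb A B) (A \<union> B) sum_fold w) \<in> H}"
    proof (rule pr_span(1)[OF A B submodule_vimage[OF qf W[OF S] module_V[OF AB] H]])
      fix x y assume x: "x \<in> carrier (W A)" and y: "y \<in> carrier (W B)"
      have "star A B (q A x) (q B y) \<in> H" by (rule st[OF q_closed[OF A x] q_closed[OF B y]])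
      then show "pr A B x y \<in> {w \<in> carrier (W (sumb A B)). q (A \<union> B) (tr (sumb A B) (A \<union> B) sum_fold w) \<in> H}"
        using pr_closed[OF A B x y] star_q[OF A B sep x y] by simp
    qed
    moreover obtain w where w: "w \<in> carrier (W (sumb A B))" "tr (sumb A B) (A \<union> B) sum_fold w = z"
    proof -
      show ?thesis
        by (rule that[OF tr_closed[OF AB S mor_unfold[OF sep] z(1)] fold_unfold[OF A B sep z(1)]])
    qed
    ultimately show "Z \<in> H" using z(2) by auto
  qed
  show "\<exists>h \<in> module_hom K (V (A \<union> B)) P. \<forall>X \<in> carrier (V A). \<forall>Y \<in> carrier (V B). h (star A B X Y) = b X Y"
    if P: "module K P"
      and b1: "\<And>Y. Y \<in> carrier (V B) \<Longrightarrow> (\<lambda>X. b X Y) \<in> module_hom K (V A) P"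
      and b2: "\<And>X. X \<in> carrier (V A) \<Longrightarrow> (\<lambda>Y. b X Y) \<in> module_hom K (V B) P"
    for P :: "('k, ((nat \<Rightarrow> 'b set) list \<Rightarrow> 'k) set) module" and b
    using star_univ_aux[OF A B sep P b1 b2] .
next
  fix A B C assume A: "block_family A" and B: "block_family B" and C: "block_family C"
    and sep: "sep A B" "sep A C" "sep B C"
  fix X Y Z assume X: "X \<in> carrier (V A)" and Y: "Y \<in> carrier (V B)" and Z: "Z \<in> carrier (V C)"
  obtain x where x: "x \<in> carrier (W A)" "X = q A x" using q_surj[OF X] by blast
  obtain y where y: "y \<in> carrier (W B)" "Y = q B y" using q_surj[OF Y] by blast
  obtain z where z: "z \<in> carrier (W C)" "Z = q C z" using q_surj[OF Z] by blast
  show "star (A \<union> B) C (star A B X Y) Z = star A (B \<union> C) X (star B C Y Z)"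
    using star_assoc_aux[OF A B C sep x(1) y(1) z(1)] by (simp add: x y z)
qed

end

section \<open>The algebra of PD\<close>

text \<open>The blocks of \<open>underline n\<close>. The case \<open>n = 0\<close> is separate
  because a block must not be empty.\<close>

definition U :: "nat \<Rightarrow> nat set set" where
  "U n = (if n = 0 then {} else {{1..n}})"

lemma Union_U [simp]: "\<Union>(U n) = {1..n}"
  by (simp add: U_def)

lemma block_family_U [simp]: "block_family (U n)"
  by (simp add: U_def)

lemma underline_eq: "underline n = ptn_of (U n)"
  using underline_0 underline_Suc[of n] by (simp add: U_def)

text \<open>\<open>U n\<close> is the coarsest partition of its set, so a refinement is just any
  partition of \<open>{1..n}\<close>. For \<open>n = 0\<close> there is no block to contain in
  another.\<close>

lemma fine_U:
  assumes "block_family C"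
  shows "fine C (U n) \<longleftrightarrow> \<Union>C = {1..n}"
proof
  assume C: "\<Union>C = {1..n}"
  have "\<exists>Y\<in>U n. X \<subseteq> Y" if X: "X \<in> C" for X
  proof -
    obtain x where "x \<in> X" using block_family_nonempty[OF assms X] by blast
    then have "x \<in> {1..n}" using C X by blast
    then have "n \<noteq> 0" by auto
    moreover have "X \<subseteq> {1..n}" using C X by blast
    ultimately show ?thesis by (simp add: U_def)
  qed
  then show "fine C (U n)" using C by (simp add: fine_def)
qed (simp add: fine_def)

lemma refinements_underline:
  "refinements (underline n) = ptn_of ` {C. block_family C \<and> \<Union>C = {1..n}}"
  unfolding underline_eq refinements_of[OF block_family_U] using fine_U by blast

lemma finite_refinements_underline: "finite (refinements (underline n))"
proof -
  have "{C. block_family C \<and> \<Union>C = {1..n}} \<subseteq> Pow (Pow {1..n})" by blast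
  then have "finite {C. block_family C \<and> \<Union>C = {1..n}}" by (rule finite_subset) simp
  then show ?thesis unfolding refinements_underline by simp
qed

lemma block_perms_of:
  "block_family A \<Longrightarrow> block_perms (ptn_of A) = {\<sigma>. \<sigma> permutes \<Union>A \<and> (\<forall>B\<in>A. \<sigma> ` B = B)}"
  unfolding block_perms_def quotient_ptn_of by (simp add: ptn_of_def)

lemma block_perms_underline: "block_perms (underline n) = {\<sigma>. \<sigma> permutes {1..n}}"
  unfolding underline_eq block_perms_of[OF block_family_U] using permutes_image[of _ "{1..n}"]
  by (auto simp: U_def)

lemma im_perm_inv:
  assumes "\<sigma> permutes S"
  shows "im \<sigma> (im (inv_into UNIV \<sigma>) C) = C" "im (inv_into UNIV \<sigma>) (im \<sigma> C) = C"
  by (simp_all add: image_image permutes_inverses[OF assms])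

lemma block_perms_id: "id \<in> block_perms \<Lambda>"
  by (simp add: block_perms_def permutes_id)

lemma block_perms_comp:
  assumes "\<sigma> \<in> block_perms \<Lambda>" "\<tau> \<in> block_perms \<Lambda>"
  shows "\<sigma> \<circ> \<tau> \<in> block_perms \<Lambda>"
proof -
  have "(\<sigma> \<circ> \<tau>) ` B = B" if "B \<in> fst \<Lambda> // snd \<Lambda>" for B
    unfolding image_comp[symmetric] using assms that by (simp add: block_perms_def)
  then show ?thesis using assms by (simp add: block_perms_def permutes_compose)
qed

lemma block_perms_inv:
  assumes "\<sigma> \<in> block_perms \<Lambda>"
  shows "inv_into UNIV \<sigma> \<in> block_perms \<Lambda>"
proof -
  have p: "\<sigma> permutes fst \<Lambda>" and b: "\<And>B. B \<in> fst \<Lambda> // snd \<Lambda> \<Longrightarrow> \<sigma> ` B = B"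
    using assms by (auto simp: block_perms_def)
  have "inv_into UNIV \<sigma> ` B = B" if "B \<in> fst \<Lambda> // snd \<Lambda>" for B
  proof -
    have "inv_into UNIV \<sigma> ` \<sigma> ` B = B" by (simp add: image_image permutes_inverses[OF p])
    then show ?thesis using b[OF that] by simp
  qed
  then show ?thesis using permutes_inv[OF p] by (simp add: block_perms_def)
qed

section \<open>Double cosets and extensions of bijections\<close>

lemma double_coset_eq:
  assumes \<rho>: "\<rho> = \<gamma> \<circ> \<sigma> \<circ> \<delta>" and \<gamma>: "\<gamma> \<in> block_perms \<Gamma>" and \<delta>: "\<delta> \<in> block_perms \<Lambda>"
  shows "{\<gamma> \<circ> \<rho> \<circ> \<delta> | \<gamma> \<delta>. \<gamma> \<in> block_perms \<Gamma> \<and> \<delta> \<in> block_perms \<Lambda>} =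
    {\<gamma> \<circ> \<sigma> \<circ> \<delta> | \<gamma> \<delta>. \<gamma> \<in> block_perms \<Gamma> \<and> \<delta> \<in> block_perms \<Lambda>}"
proof (intro equalityI subsetI)
  fix \<tau> assume "\<tau> \<in> {\<gamma> \<circ> \<rho> \<circ> \<delta> | \<gamma> \<delta>. \<gamma> \<in> block_perms \<Gamma> \<and> \<delta> \<in> block_perms \<Lambda>}"
  then obtain g d where gd: "\<tau> = g \<circ> \<rho> \<circ> d" "g \<in> block_perms \<Gamma>" "d \<in> block_perms \<Lambda>" by blast
  have "\<tau> = (g \<circ> \<gamma>) \<circ> \<sigma> \<circ> (\<delta> \<circ> d)" by (simp add: gd(1) \<rho> comp_assoc)
  then show "\<tau> \<in> {\<gamma> \<circ> \<sigma> \<circ> \<delta> | \<gamma> \<delta>. \<gamma> \<in> block_perms \<Gamma> \<and> \<delta> \<in> block_perms \<Lambda>}"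
    using block_perms_comp[OF gd(2) \<gamma>] block_perms_comp[OF \<delta> gd(3)] by blast
next
  fix \<tau> assume "\<tau> \<in> {\<gamma> \<circ> \<sigma> \<circ> \<delta> | \<gamma> \<delta>. \<gamma> \<in> block_perms \<Gamma> \<and> \<delta> \<in> block_perms \<Lambda>}"
  then obtain g d where gd: "\<tau> = g \<circ> \<sigma> \<circ> d" "g \<in> block_perms \<Gamma>" "d \<in> block_perms \<Lambda>" by blast
  have i: "inv_into UNIV \<gamma> \<circ> \<gamma> = id" "\<delta> \<circ> inv_into UNIV \<delta> = id"
    using \<gamma> \<delta> by (auto simp: block_perms_def intro: permutes_inv_o)
  have "inv_into UNIV \<gamma> \<circ> \<rho> \<circ> inv_into UNIV \<delta> = (inv_into UNIV \<gamma> \<circ> \<gamma>) \<circ> \<sigma> \<circ> (\<delta> \<circ> inv_into UNIV \<delta>)"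
    by (simp add: \<rho> comp_assoc)
  then have "\<sigma> = inv_into UNIV \<gamma> \<circ> \<rho> \<circ> inv_into UNIV \<delta>" unfolding i by simp
  then have "\<tau> = (g \<circ> inv_into UNIV \<gamma>) \<circ> \<rho> \<circ> (inv_into UNIV \<delta> \<circ> d)" by (simp add: gd(1) comp_assoc)
  then show "\<tau> \<in> {\<gamma> \<circ> \<rho> \<circ> \<delta> | \<gamma> \<delta>. \<gamma> \<in> block_perms \<Gamma> \<and> \<delta> \<in> block_perms \<Lambda>}"
    using block_perms_comp[OF gd(2) block_perms_inv[OF \<gamma>]] block_perms_comp[OF block_perms_inv[OF \<delta>] gd(3)] by blast
qed

text \<open>The representative is chosen by \<open>SOME\<close>; it is known only up to a factor on
  each side, and these two facts are all that is used about it.\<close>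

lemma double_coset_rep:
  assumes "D \<in> double_cosets \<Gamma> \<Omega> \<Lambda>"
  shows "D = {\<gamma> \<circ> rep D \<circ> \<delta> | \<gamma> \<delta>. \<gamma> \<in> block_perms \<Gamma> \<and> \<delta> \<in> block_perms \<Lambda>}"
    and "\<exists>\<gamma> \<in> block_perms \<Gamma>. \<exists>\<sigma> \<in> block_perms \<Omega>. \<exists>\<delta> \<in> block_perms \<Lambda>. rep D = \<gamma> \<circ> \<sigma> \<circ> \<delta>"
proof -
  obtain \<sigma> where \<sigma>: "\<sigma> \<in> block_perms \<Omega>" "D = {\<gamma> \<circ> \<sigma> \<circ> \<delta> | \<gamma> \<delta>. \<gamma> \<in> block_perms \<Gamma> \<and> \<delta> \<in> block_perms \<Lambda>}"
    using assms by (auto simp: double_cosets_def)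
  have "id \<circ> \<sigma> \<circ> id \<in> D" unfolding \<sigma>(2) using block_perms_id by blast
  then have "rep D \<in> D" unfolding rep_def by (rule someI[where P = "\<lambda>\<sigma>. \<sigma> \<in> D"])
  then obtain \<gamma> \<delta> where r: "rep D = \<gamma> \<circ> \<sigma> \<circ> \<delta>" "\<gamma> \<in> block_perms \<Gamma>" "\<delta> \<in> block_perms \<Lambda>"
    unfolding \<sigma>(2) by blast
  show "D = {\<gamma> \<circ> rep D \<circ> \<delta> | \<gamma> \<delta>. \<gamma> \<in> block_perms \<Gamma> \<and> \<delta> \<in> block_perms \<Lambda>}"
    using double_coset_eq[OF r] \<sigma>(2) by simp
  show "\<exists>\<gamma> \<in> block_perms \<Gamma>. \<exists>\<sigma> \<in> block_perms \<Omega>. \<exists>\<delta> \<in> block_perms \<Lambda>. rep D = \<gamma> \<circ> \<sigma> \<circ> \<delta>"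
    using r \<sigma>(1) by blast
qed

text \<open>Used to realize every set of blocks with \<open>i\<close> points in total by a double
  coset: a bijection onto the set and one between the complements are glued.\<close>

lemma permutation_extending:
  assumes S: "S \<subseteq> {1..n}" "card S = i"
  shows "\<exists>\<sigma>. \<sigma> permutes {1..n} \<and> \<sigma> ` {1..i} = S"
proof -
  have fS: "finite S" by (rule finite_subset[OF S(1)]) simp
  have i: "i \<le> n" using card_mono[OF _ S(1)] S(2) by simp
  obtain f where f: "bij_betw f {1..i} S"
    using finite_same_card_bij[of "{1..i}" S] fS S(2) by auto
  have "card ({1..n} - {1..i}) = card ({1..n} - S)"
    using i S fS by (simp add: card_Diff_subset)
  then obtain g where g: "bij_betw g ({1..n} - {1..i}) ({1..n} - S)"
    using finite_same_card_bij[of "{1..n} - {1..i}" "{1..n} - S"] by auto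
  define \<sigma> where "\<sigma> k = (if k \<in> {1..i} then f k else if k \<in> {1..n} then g k else k)" for k
  have s1: "bij_betw \<sigma> {1..i} S"
    using f by (rule bij_betw_cong[THEN iffD1, rotated]) (simp add: \<sigma>_def)
  moreover have "bij_betw \<sigma> ({1..n} - {1..i}) ({1..n} - S)"
    using g by (rule bij_betw_cong[THEN iffD1, rotated]) (simp add: \<sigma>_def)
  ultimately have "bij_betw \<sigma> ({1..i} \<union> ({1..n} - {1..i})) (S \<union> ({1..n} - S))"
    by (rule bij_betw_combine) auto
  moreover have "{1..i} \<union> ({1..n} - {1..i}) = {1..n}" "S \<union> ({1..n} - S) = {1..n}"
    using i S by auto
  ultimately have "bij_betw \<sigma> {1..n} {1..n}" by simp
  then have "\<sigma> permutes {1..n}"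
    by (rule bij_imp_permutes) (use i in \<open>auto simp: \<sigma>_def\<close>)
  then show ?thesis using s1 by (auto simp: bij_betw_def)
qed

lemma
  assumes h: "inj_on h (\<Union>(sumb A B))"
  shows inj_sumb_left: "inj_on (h \<circ> inl) (\<Union>A)"
    and inj_sumb_right: "inj_on (h \<circ> inr) (\<Union>B)"
    and sep_sumb_parts: "sep (im (h \<circ> inl) A) (im (h \<circ> inr) B)"
proof -
  have L: "inl ` \<Union>A \<subseteq> \<Union>(sumb A B)" and R: "inr ` \<Union>B \<subseteq> \<Union>(sumb A B)" unfolding Union_sumb by simp_all
  show "inj_on (h \<circ> inl) (\<Union>A)"
    by (rule comp_inj_on[OF _ inj_on_subset[OF h L]]) (simp add: inj_on_def)
  show "inj_on (h \<circ> inr) (\<Union>B)"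
    by (rule comp_inj_on[OF _ inj_on_subset[OF h R]]) (simp add: inj_on_def)
  have "inl ` \<Union>A \<inter> inr ` \<Union>B = {}" by auto
  then have "h ` inl ` \<Union>A \<inter> h ` inr ` \<Union>B = {}"
    using inj_on_image_Int[OF h L R] by simp
  then show "sep (im (h \<circ> inl) A) (im (h \<circ> inr) B)"
    unfolding Union_im image_comp .
qed

context cring_symmetric_monoidal_pf
begin

text \<open>Finite support is automatic since \<open>{1..n}\<close> has finitely many partitions.
  Replacing a partition by its image turns the invariance condition, stated with the inverse of
  \<open>\<sigma>\<close>, into naturality.\<close>

lemma PD_carrier:
  "x \<in> carrier (PD_val K R (underline n)) \<longleftrightarrow>
    x \<in> (\<Pi>\<^sub>E \<Gamma>\<in>refinements (underline n). carrier (Rbar K R \<Gamma>)) \<and>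
    (\<forall>C \<sigma>. block_family C \<longrightarrow> \<Union>C = {1..n} \<longrightarrow> \<sigma> permutes {1..n} \<longrightarrow>
      act \<sigma> C (x (ptn_of C)) = x (ptn_of (im \<sigma> C)))"
  (is "_ \<longleftrightarrow> ?P \<and> ?Q")
proof -
  have fin: "finite {\<Gamma> \<in> refinements (underline n). x \<Gamma> \<noteq> \<zero>\<^bsub>Rbar K R \<Gamma>\<^esub>}"
    using finite_refinements_underline by simp
  have "(\<forall>\<sigma> \<in> block_perms (underline n). \<forall>\<Gamma> \<in> refinements (underline n).
      Rbar_tr K R (ptn_image (inv_into UNIV \<sigma>) \<Gamma>) \<Gamma> \<sigma> (x (ptn_image (inv_into UNIV \<sigma>) \<Gamma>)) = x \<Gamma>) \<longleftrightarrow> ?Q"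
    (is "?L \<longleftrightarrow> _")
  proof
    assume L: ?L
    show ?Q
    proof (intro allI impI)
      fix C \<sigma> assume C: "block_family C" "\<Union>C = {1..n}" and \<sigma>: "\<sigma> permutes {1..n}"
      have "ptn_of (im \<sigma> C) \<in> refinements (underline n)"
        unfolding refinements_underline
        using block_family_im[OF C(1) inj_on_subset[OF permutes_inj[OF \<sigma>]]] C(2) permutes_image[OF \<sigma>]
        by (intro imageI) (simp only: mem_Collect_eq Union_im, simp)
      then show "act \<sigma> C (x (ptn_of C)) = x (ptn_of (im \<sigma> C))"
        using L[rule_format, of \<sigma> "ptn_of (im \<sigma> C)"] \<sigma>
        by (simp only: block_perms_underline mem_Collect_eq ptn_image_of im_perm_inv[OF \<sigma>] act_def)
    qed
  next
    assume Q: ?Q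
    show ?L
    proof (intro ballI)
      fix \<sigma> \<Gamma> assume "\<sigma> \<in> block_perms (underline n)" and "\<Gamma> \<in> refinements (underline n)"
      then obtain C where \<sigma>: "\<sigma> permutes {1..n}" and C: "block_family C" "\<Union>C = {1..n}" "\<Gamma> = ptn_of C"
        by (auto simp: block_perms_underline refinements_underline)
      let ?i = "inv_into UNIV \<sigma>"
      have i: "?i permutes {1..n}" by (rule permutes_inv[OF \<sigma>])
      have "block_family (im ?i C)" "\<Union>(im ?i C) = {1..n}"
        using block_family_im[OF C(1) inj_on_subset[OF permutes_inj[OF i]]] C(2) permutes_image[OF i]
        by (simp, simp only: Union_im)
      then show "Rbar_tr K R (ptn_image ?i \<Gamma>) \<Gamma> \<sigma> (x (ptn_image ?i \<Gamma>)) = x \<Gamma>"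
        using Q[rule_format, of "im ?i C" \<sigma>] \<sigma>
        by (simp only: C(3) ptn_image_of im_perm_inv[OF \<sigma>] act_def)
    qed
  qed
  then show ?thesis using fin by (simp add: PD_val_def Let_def direct_sum_simps)
qed

section \<open>The values of \<open>PD\<close> on the sets \<open>{1..n}\<close>\<close>

lemma PD_ops:
  "x \<oplus>\<^bsub>PD_val K R \<Lambda>\<^esub> y = (\<lambda>\<Gamma>\<in>refinements \<Lambda>. x \<Gamma> \<oplus>\<^bsub>Rbar K R \<Gamma>\<^esub> y \<Gamma>)"
  "\<zero>\<^bsub>PD_val K R \<Lambda>\<^esub> = (\<lambda>\<Gamma>\<in>refinements \<Lambda>. \<zero>\<^bsub>Rbar K R \<Gamma>\<^esub>)"
  "a \<odot>\<^bsub>PD_val K R \<Lambda>\<^esub> x = (\<lambda>\<Gamma>\<in>refinements \<Lambda>. a \<odot>\<^bsub>Rbar K R \<Gamma>\<^esub> x \<Gamma>)"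
  by (simp_all add: PD_val_def Let_def direct_sum_simps)

lemma refinement_mem: "block_family C \<Longrightarrow> \<Union>C = {1..n} \<Longrightarrow> ptn_of C \<in> refinements (underline n)"
  unfolding refinements_underline by blast

lemma Rbar_V: "Rbar K R (ptn_of C) = V C"
  by (simp add: V_def)

lemma perm_block_family:
  assumes "block_family C" "\<Union>C = {1..n}" "\<sigma> permutes {1..n}"
  shows "block_family (im \<sigma> C)" "\<Union>(im \<sigma> C) = {1..n}" "inj_on \<sigma> (\<Union>C)"
proof -
  show i: "inj_on \<sigma> (\<Union>C)" by (rule inj_on_subset[OF permutes_inj[OF assms(3)]]) simp
  show "block_family (im \<sigma> C)" by (rule block_family_im[OF assms(1) i])
  show "\<Union>(im \<sigma> C) = {1..n}" unfolding Union_im assms(2) by (rule permutes_image[OF assms(3)])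
qed

lemma perm_refinement:
  "\<lbrakk>block_family C; \<Union>C = {1..n}; \<sigma> permutes {1..n}\<rbrakk> \<Longrightarrow> ptn_of (im \<sigma> C) \<in> refinements (underline n)"
  by (rule refinement_mem[OF perm_block_family(1,2)])

lemma PD_carrierI:
  assumes ext: "x \<in> extensional (refinements (underline n))"
    and cl: "\<And>C. \<lbrakk>block_family C; \<Union>C = {1..n}\<rbrakk> \<Longrightarrow> x (ptn_of C) \<in> carrier (V C)"
    and nat: "\<And>C \<sigma>. \<lbrakk>block_family C; \<Union>C = {1..n}; \<sigma> permutes {1..n}\<rbrakk>
      \<Longrightarrow> act \<sigma> C (x (ptn_of C)) = x (ptn_of (im \<sigma> C))"
  shows "x \<in> carrier (PD_val K R (underline n))"
  unfolding PD_carrier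
proof (intro conjI allI impI nat)
  show "x \<in> (\<Pi>\<^sub>E \<Gamma>\<in>refinements (underline n). carrier (Rbar K R \<Gamma>))"
    using ext cl by (auto simp: PiE_def refinements_underline Rbar_V)
qed

lemma
  assumes "x \<in> carrier (PD_val K R (underline n))"
  shows PD_closed: "\<lbrakk>block_family C; \<Union>C = {1..n}\<rbrakk> \<Longrightarrow> x (ptn_of C) \<in> carrier (V C)"
    and PD_act: "\<lbrakk>block_family C; \<Union>C = {1..n}; \<sigma> permutes {1..n}\<rbrakk>
      \<Longrightarrow> act \<sigma> C (x (ptn_of C)) = x (ptn_of (im \<sigma> C))"
    and PD_extensional: "x \<in> extensional (refinements (underline n))"
proof -
  have P: "x \<in> (\<Pi>\<^sub>E \<Gamma>\<in>refinements (underline n). carrier (Rbar K R \<Gamma>))"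
    and Q: "\<And>C \<sigma>. \<lbrakk>block_family C; \<Union>C = {1..n}; \<sigma> permutes {1..n}\<rbrakk>
      \<Longrightarrow> act \<sigma> C (x (ptn_of C)) = x (ptn_of (im \<sigma> C))"
    using assms unfolding PD_carrier by blast+
  show "\<lbrakk>block_family C; \<Union>C = {1..n}\<rbrakk> \<Longrightarrow> x (ptn_of C) \<in> carrier (V C)"
    using PiE_mem[OF P refinement_mem] by (simp add: Rbar_V)
  show "\<lbrakk>block_family C; \<Union>C = {1..n}; \<sigma> permutes {1..n}\<rbrakk>
      \<Longrightarrow> act \<sigma> C (x (ptn_of C)) = x (ptn_of (im \<sigma> C))" by (rule Q)
  show "x \<in> extensional (refinements (underline n))" using P by (simp add: PiE_def)
qed

lemma PD_eqI:
  assumes "x \<in> extensional (refinements (underline n))" "y \<in> extensional (refinements (underline n))"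
    and "\<And>C. \<lbrakk>block_family C; \<Union>C = {1..n}\<rbrakk> \<Longrightarrow> x (ptn_of C) = y (ptn_of C)"
  shows "x = y"
  using assms(1,2) by (rule extensionalityI) (use assms(3) in \<open>auto simp: refinements_underline\<close>)

lemma module_PD: "module K (PD_val K R (underline n))"
proof (rule pointwise_module[OF K, of "refinements (underline n)" "Rbar K R"])
  show "module K (Rbar K R \<Gamma>)" if "\<Gamma> \<in> refinements (underline n)" for \<Gamma>
    using that species.V by (auto simp: refinements_underline Rbar_V)
  show "carrier (PD_val K R (underline n)) \<subseteq> (\<Pi>\<^sub>E \<Gamma>\<in>refinements (underline n). carrier (Rbar K R \<Gamma>))"
    by (rule subsetI) (rule PD_carrier[THEN iffD1, THEN conjunct1])
  show "\<zero>\<^bsub>PD_val K R (underline n)\<^esub> \<in> carrier (PD_val K R (underline n))"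
    by (rule PD_carrierI) (simp_all add: PD_ops refinement_mem perm_refinement perm_block_family(1) permutes_inj_on Rbar_V species.act_zero)
  show "x \<oplus>\<^bsub>PD_val K R (underline n)\<^esub> y \<in> carrier (PD_val K R (underline n))"
    if x: "x \<in> carrier (PD_val K R (underline n))" and y: "y \<in> carrier (PD_val K R (underline n))" for x y
    by (rule PD_carrierI)
      (simp_all add: PD_ops refinement_mem perm_refinement perm_block_family(1) permutes_inj_on Rbar_V species.V_add_closed
        module_hom_add[OF species.act_hom] PD_closed[OF x] PD_closed[OF y] PD_act[OF x] PD_act[OF y])
  show "a \<odot>\<^bsub>PD_val K R (underline n)\<^esub> x \<in> carrier (PD_val K R (underline n))"
    if a: "a \<in> carrier K" and x: "x \<in> carrier (PD_val K R (underline n))" for a x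
    by (rule PD_carrierI)
      (simp_all add: a PD_ops refinement_mem perm_refinement perm_block_family(1) permutes_inj_on Rbar_V module.smult_closed[OF species.V]
        module_hom_smult[OF species.act_hom] PD_closed[OF x] PD_act[OF x])
qed (simp_all add: PD_ops)

lemma PD_eval:
  assumes "block_family C" "\<Union>C = {1..n}"
  shows "(\<lambda>x. x (ptn_of C)) \<in> module_hom K (PD_val K R (underline n)) (V C)"
  using assms PD_closed by (intro module_homI) (simp_all add: PD_ops refinement_mem Rbar_V)

section \<open>Restricting families to initial segments\<close>

abbreviation SA :: "('k, nat \<Rightarrow> ptn \<Rightarrow> 'b set) module" where
  "SA \<equiv> Sigma_algebra K (PD K R)"

lemma SA_simps:
  "carrier SA = {x. (\<forall>n. x n \<in> carrier (PD_val K R (underline n))) \<and>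
     finite {n. x n \<noteq> \<zero>\<^bsub>PD_val K R (underline n)\<^esub>}}"
  "x \<otimes>\<^bsub>SA\<^esub> y = (\<lambda>n. finsum (PD_val K R (underline n))
     (\<lambda>i. PD_tr K R (ptn_sum (underline i) (underline (n - i))) (underline n) (append_mor i)
       (PD_prod K R (underline i) (underline (n - i)) (x i) (y (n - i)))) {..n})"
  "\<one>\<^bsub>SA\<^esub> = (\<lambda>n. if n = 0 then PD_unit K R \<one>\<^bsub>K\<^esub> else \<zero>\<^bsub>PD_val K R (underline n)\<^esub>)"
  "\<zero>\<^bsub>SA\<^esub> = (\<lambda>n. \<zero>\<^bsub>PD_val K R (underline n)\<^esub>)"
  "x \<oplus>\<^bsub>SA\<^esub> y = (\<lambda>n. x n \<oplus>\<^bsub>PD_val K R (underline n)\<^esub> y n)"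
  "a \<odot>\<^bsub>SA\<^esub> x = (\<lambda>n. a \<odot>\<^bsub>PD_val K R (underline n)\<^esub> x n)"
  by (auto simp: Sigma_algebra_def Let_def PD_def direct_sum_simps restrict_def)

text \<open>The quotient \<open>fst \<Gamma> // snd \<Gamma>\<close> recovers the blocks from a
  partition.\<close>

definition rho :: "(nat set set \<Rightarrow> 'b set) \<Rightarrow> nat \<Rightarrow> ptn \<Rightarrow> 'b set" where
  "rho u n = (\<lambda>\<Gamma>\<in>refinements (underline n). u (fst \<Gamma> // snd \<Gamma>))"

lemma rho_of: "block_family C \<Longrightarrow> \<Union>C = {1..n} \<Longrightarrow> rho u n (ptn_of C) = u C"
  by (simp add: rho_def refinement_mem quotient_ptn_of)

lemma rho_extensional: "rho u n \<in> extensional (refinements (underline n))"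
  by (simp add: rho_def)

lemma rho_PD: "species.family u \<Longrightarrow> rho u n \<in> carrier (PD_val K R (underline n))"
proof -
  assume u: "species.family u"
  show ?thesis
  proof (rule PD_carrierI[OF rho_extensional])
    fix C assume C: "block_family C" "\<Union>C = {1..n}"
    show "rho u n (ptn_of C) \<in> carrier (V C)"
      using rho_of[OF C, of u] species.family_closed[OF u C(1)] by simp
    fix \<sigma> assume \<sigma>: "\<sigma> permutes {1..n}"
    show "act \<sigma> C (rho u n (ptn_of C)) = rho u n (ptn_of (im \<sigma> C))"
      unfolding rho_of[OF C] rho_of[OF perm_block_family(1,2)[OF C \<sigma>]]
      by (rule species.family_act[OF u C(1) perm_block_family(3)[OF C \<sigma>]])
  qed
qed

lemma rho_closed:
  assumes u: "species.family u"
  shows "rho u \<in> carrier SA"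
proof -
  obtain m where m: "\<And>A. block_family A \<Longrightarrow> card (\<Union>A) > m \<Longrightarrow> u A = \<zero>\<^bsub>V A\<^esub>"
    using species.family_bound[OF u] by metis
  have "rho u n = \<zero>\<^bsub>PD_val K R (underline n)\<^esub>" if n: "n > m" for n
  proof (rule PD_eqI[OF rho_extensional])
    fix C assume C: "block_family C" "\<Union>C = {1..n}"
    then show "rho u n (ptn_of C) = \<zero>\<^bsub>PD_val K R (underline n)\<^esub> (ptn_of C)"
      using m[of C] n by (simp add: rho_of PD_ops refinement_mem Rbar_V)
  qed (simp add: PD_ops)
  then have "{n. rho u n \<noteq> \<zero>\<^bsub>PD_val K R (underline n)\<^esub>} \<subseteq> {..m}"
    by (metis (mono_tags, lifting) atMost_iff leI mem_Collect_eq subsetI)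
  then have "finite {n. rho u n \<noteq> \<zero>\<^bsub>PD_val K R (underline n)\<^esub>}" by (rule finite_subset) simp
  then show ?thesis using rho_PD[OF u] by (simp add: SA_simps)
qed

text \<open>Numbering the points carries any block family to a partition of an initial segment, so a
  natural family is determined by its values on these.\<close>

lemma initial_model:
  assumes A: "block_family A"
  obtains g C where "block_family C" "\<Union>C = {1..card (\<Union>A)}" "inj_on g {1..card (\<Union>A)}" "im g C = A"
proof -
  have fin: "finite (\<Union>A)" using A by (simp add: block_family_def)
  obtain g where g: "bij_betw g {1..card (\<Union>A)} (\<Union>A)"
    using finite_same_card_bij[of "{1..card (\<Union>A)}" "\<Union>A"] fin by auto
  let ?k = "inv_into {1..card (\<Union>A)} g"
  have k: "bij_betw ?k (\<Union>A) {1..card (\<Union>A)}" by (rule bij_betw_inv_into[OF g])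
  have "g ` ?k ` X = X" if "X \<in> A" for X
    using that g by (intro image_inv_into_cancel[where A = "{1..card (\<Union>A)}" and A' = "\<Union>A"]) (auto simp: bij_betw_def)
  then have "im g (im ?k A) = A" unfolding image_image[of "image g"] by simp
  moreover have "block_family (im ?k A)" using k by (intro block_family_im[OF A]) (simp add: bij_betw_def)
  moreover have "\<Union>(im ?k A) = {1..card (\<Union>A)}" using k unfolding Union_im by (simp add: bij_betw_def)
  ultimately show ?thesis using that[of "im ?k A" g] g by (simp add: bij_betw_def)
qed

lemma rho_inject:
  assumes u: "species.family u" and v: "species.family v" and eq: "rho u = rho v"
  shows "u = v"
proof (rule species.family_eqI[OF u v])
  fix A assume A: "block_family A"
  obtain g C where C: "block_family C" "\<Union>C = {1..card (\<Union>A)}" "inj_on g {1..card (\<Union>A)}" "im g C = A"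
    by (rule initial_model[OF A])
  have g: "inj_on g (\<Union>C)" using C by simp
  have "u C = v C"
    using rho_of[OF C(1,2), of u] rho_of[OF C(1,2), of v] eq by simp
  then show "u A = v A"
    using species.family_act[OF u C(1) g] species.family_act[OF v C(1) g] C(4) by simp
qed

text \<open>Unlike a permutation, \<open>h\<close> is arbitrary outside the initial segment.\<close>

lemma PD_act':
  assumes x: "x \<in> carrier (PD_val K R (underline n))" and C: "block_family C" "\<Union>C = {1..n}"
    and h: "bij_betw h {1..n} {1..n}"
  shows "act h C (x (ptn_of C)) = x (ptn_of (im h C))"
proof -
  define \<sigma> where "\<sigma> k = (if k \<in> {1..n} then h k else k)" for k
  have \<sigma>: "\<sigma> permutes {1..n}"
  proof (rule bij_imp_permutes)
    show "bij_betw \<sigma> {1..n} {1..n}"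
      using h by (rule bij_betw_cong[THEN iffD1, rotated]) (simp add: \<sigma>_def)
  qed (auto simp: \<sigma>_def)
  have e: "h ` B = \<sigma> ` B" if "B \<in> C" for B
    using that C(2) by (intro image_cong) (auto simp: \<sigma>_def)
  have hC: "inj_on h (\<Union>C)" using h C(2) by (simp add: bij_betw_def)
  have "act h C (x (ptn_of C)) = act \<sigma> C (x (ptn_of C))"
    using e by (intro species.act_cong[OF C(1) hC perm_block_family(3)[OF C \<sigma>] _ PD_closed[OF x C]]) simp
  also have "\<dots> = x (ptn_of (im \<sigma> C))" by (rule PD_act[OF x C \<sigma>])
  also have "im \<sigma> C = im h C" using e by simp
  finally show ?thesis .
qed

text \<open>The family is extended from initial segments to all block families by transport along a
  numbering. Invariance of \<open>x\<close> makes the result independent of the numbering, and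
  naturality follows from this independence.\<close>

lemma rho_surj:
  assumes x: "x \<in> carrier SA"
  shows "\<exists>u. species.family u \<and> rho u = x"
proof -
  have xn: "x n \<in> carrier (PD_val K R (underline n))" for n using x by (simp add: SA_simps)
  have "\<exists>g C. block_family C \<and> \<Union>C = {1..card (\<Union>A)} \<and> inj_on g {1..card (\<Union>A)} \<and> im g C = A"
    if "block_family A" for A
    using initial_model[OF that] by metis
  then obtain g C where C: "\<And>A. block_family A \<Longrightarrow> block_family (C A)"
    "\<And>A. block_family A \<Longrightarrow> \<Union>(C A) = {1..card (\<Union>A)}"
    "\<And>A. block_family A \<Longrightarrow> inj_on (g A) {1..card (\<Union>A)}" "\<And>A. block_family A \<Longrightarrow> im (g A) (C A) = A"
    by metis
  define u where "u = (\<lambda>A\<in>Collect block_family. act (g A) (C A) (x (card (\<Union>A)) (ptn_of (C A))))"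
  have gC: "inj_on (g A) (\<Union>(C A))" if "block_family A" for A using C(2,3)[OF that] by simp
  have img: "g A ` {1..card (\<Union>A)} = \<Union>A" if "block_family A" for A
    using arg_cong[OF C(4)[OF that], of Union] unfolding Union_im C(2)[OF that] .
  have xc: "x (card (\<Union>A)) (ptn_of (C A)) \<in> carrier (V (C A))" if "block_family A" for A
    by (rule PD_closed[OF xn C(1,2)[OF that]])
  \<comment> \<open>Independence of the numbering: \<open>g A\<close> may be replaced by any
    numbering \<open>h\<close> of \<open>A\<close>, with its own model \<open>E\<close>.\<close>
  have model: "u A = act h E (x (card (\<Union>A)) (ptn_of E))"
    if A: "block_family A" and E: "block_family E" "\<Union>E = {1..card (\<Union>A)}" and h: "inj_on h {1..card (\<Union>A)}" and hE: "im h E = A" for A h E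
  proof -
    let ?n = "card (\<Union>A)"
    \<comment> \<open>The change of numbering; it permutes the initial segment and carries the model
      \<open>E\<close> to \<open>C A\<close>.\<close>
    define s where "s = inv_into {1..?n} (g A) \<circ> h"
    have hb: "bij_betw h {1..?n} (\<Union>A)"
      using h arg_cong[OF hE, of Union] unfolding Union_im E(2) by (simp add: bij_betw_def)
    have gb: "bij_betw (g A) {1..?n} (\<Union>A)" using C(3)[OF A] img[OF A] by (simp add: bij_betw_def)
    have s: "bij_betw s {1..?n} {1..?n}"
      unfolding s_def by (rule bij_betw_trans[OF hb bij_betw_inv_into[OF gb]])
    have gs: "g A (s k) = h k" if "k \<in> {1..?n}" for k
    proof -
      have "h k \<in> g A ` {1..?n}" using bij_betw_apply[OF hb that] img[OF A] by simp
      then show ?thesis unfolding s_def comp_apply by (rule f_inv_into_f)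
    qed
    have gsX: "g A ` s ` X = h ` X" if "X \<in> E" for X
    proof -
      have "X \<subseteq> {1..?n}" using that E(2) by blast
      then show ?thesis unfolding image_image by (intro image_cong refl gs) blast
    qed
    have "im (g A) (im s E) = A"
      unfolding image_image[of "image (g A)"] using gsX hE by simp
    then have "im s E = C A"
    proof -
      have sU: "\<Union>(im s E) = \<Union>(C A)" unfolding Union_im E(2) C(2)[OF A] using s by (simp add: bij_betw_def)
      show ?thesis
        using \<open>im (g A) (im s E) = A\<close> C(4)[OF A] by (intro im_eq_iff[OF gC[OF A] sU]) simp
    qed
    then have "x ?n (ptn_of (C A)) = act s E (x ?n (ptn_of E))"
      using PD_act'[OF xn E s] by simp
    then have "u A = act (g A) (im s E) (act s E (x ?n (ptn_of E)))"
      using A \<open>im s E = C A\<close> by (simp add: u_def)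
    also have "\<dots> = act (g A \<circ> s) E (x ?n (ptn_of E))"
      using s C(3)[OF A] E(2)
      by (intro species.act_comp[OF E(1) _ _ PD_closed[OF xn E]]) (simp_all add: bij_betw_def)
    also have "\<dots> = act h E (x ?n (ptn_of E))"
    proof (rule species.act_cong[OF E(1) _ _ _ PD_closed[OF xn E]])
      show "inj_on (g A \<circ> s) (\<Union>E)"
        using s C(3)[OF A] E(2) by (intro comp_inj_on) (simp_all add: bij_betw_def)
      show "inj_on h (\<Union>E)" using h E(2) by simp
      show "\<forall>B\<in>E. (g A \<circ> s) ` B = h ` B" unfolding image_comp[symmetric] using gsX by blast
    qed
    finally show ?thesis .
  qed
  obtain m where m: "\<And>n. n > m \<Longrightarrow> x n = \<zero>\<^bsub>PD_val K R (underline n)\<^esub>"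
  proof -
    have "finite {n. x n \<noteq> \<zero>\<^bsub>PD_val K R (underline n)\<^esub>}" using x by (simp add: SA_simps)
    then obtain m where "\<forall>n \<in> {n. x n \<noteq> \<zero>\<^bsub>PD_val K R (underline n)\<^esub>}. n \<le> m"
      using finite_nat_set_iff_bounded_le by blast
    then show ?thesis using that[of m] by (metis (mono_tags, lifting) leD mem_Collect_eq)
  qed
  have fam: "species.family u"
  proof (rule species.familyI[of _ m])
    show "u \<in> extensional (Collect block_family)" by (simp add: u_def)
    fix A assume A: "block_family A"
    show "u A \<in> carrier (V A)"
      using species.act_closed[OF C(1)[OF A] gC[OF A] xc[OF A]] C(4)[OF A] A by (simp add: u_def)
    show "u A = \<zero>\<^bsub>V A\<^esub>" if c: "card (\<Union>A) > m"
      using species.act_zero[OF C(1)[OF A] gC[OF A]] C(4)[OF A] A m[OF c] refinement_mem[OF C(1,2)[OF A]]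
      by (simp add: u_def PD_ops Rbar_V)
    show "act f A (u A) = u (im f A)" if f: "inj_on f (\<Union>A)" for f
    proof -
      have c: "card (\<Union>(im f A)) = card (\<Union>A)" unfolding Union_im by (rule card_image[OF f])
      have fg: "inj_on f (g A ` {1..card (\<Union>A)})" using f img[OF A] by simp
      have "act f A (u A) = act f (im (g A) (C A)) (act (g A) (C A) (x (card (\<Union>A)) (ptn_of (C A))))"
        using A C(4)[OF A] by (simp add: u_def)
      also have "\<dots> = act (f \<circ> g A) (C A) (x (card (\<Union>A)) (ptn_of (C A)))"
        using fg C(2)[OF A] by (intro species.act_comp[OF C(1)[OF A] gC[OF A] _ xc[OF A]]) simp
      also have "\<dots> = u (im f A)"
      proof -
        have "im (f \<circ> g A) (C A) = im f (im (g A) (C A))" by (simp add: image_image)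
        then have "im (f \<circ> g A) (C A) = im f A" using C(4)[OF A] by simp
        then show ?thesis
          using model[OF block_family_im[OF A f] C(1)[OF A] _ _, of "f \<circ> g A"] C(2)[OF A]
            comp_inj_on[OF C(3)[OF A] fg] by (simp add: c)
      qed
      finally show ?thesis .
    qed
  qed
  have "rho u = x"
  proof
    fix n
    show "rho u n = x n"
    proof (rule PD_eqI[OF rho_extensional PD_extensional[OF xn]])
      fix E assume E: "block_family E" "\<Union>E = {1..n}"
      have "u E = act id E (x n (ptn_of E))"
        using model[OF E(1) E(1), of id] E(2) by simp
      then show "rho u n (ptn_of E) = x n (ptn_of E)"
        using rho_of[OF E] species.act_id[OF E(1) PD_closed[OF xn E]] by simp
    qed
  qed
  then show ?thesis using fam by blast
qed

text \<open>An injection on the disjoint union is the fold after the sum of its two halves. This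
  brings the terms of the transfer formula into the shape of internal products.\<close>

lemma act_Rbar_prod:
  assumes A: "block_family A" and B: "block_family B" and h: "inj_on h (\<Union>(sumb A B))"
    and X: "X \<in> carrier (V A)" and Y: "Y \<in> carrier (V B)"
  shows "act h (sumb A B) (Rbar_prod K R (ptn_of A) (ptn_of B) X Y) =
    star (im (h \<circ> inl) A) (im (h \<circ> inr) B) (act (h \<circ> inl) A X) (act (h \<circ> inr) B Y)"
proof -
  obtain x where x: "x \<in> carrier (W A)" "X = q A x" using q_surj[OF X] by blast
  obtain y where y: "y \<in> carrier (W B)" "Y = q B y" using q_surj[OF Y] by blast
  let ?f = "h \<circ> inl" and ?g = "h \<circ> inr"
  note f = inj_sumb_left[OF h] and g = inj_sumb_right[OF h] and sep = sep_sumb_parts[OF h]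
  have bf: "block_family (im ?f A)" and bg: "block_family (im ?g B)"
    using block_family_im[OF A f] block_family_im[OF B g] by auto
  have imh: "im h (sumb A B) = im ?f A \<union> im ?g B"
    by (simp add: sumb_def image_Un image_image)
  have S: "block_family (sumb A B)" by (rule block_family_sumb[OF A B])
  have U: "block_family (im ?f A \<union> im ?g B)" by (rule block_family_Un[OF bf bg sep])
  have tf: "tr A (im ?f A) ?f x \<in> carrier (W (im ?f A))" by (rule tr_closed[OF A bf mor_im[OF f] x(1)])
  have tg: "tr B (im ?g B) ?g y \<in> carrier (W (im ?g B))" by (rule tr_closed[OF B bg mor_im[OF g] y(1)])
  have p: "pr A B x y \<in> carrier (W (sumb A B))" by (rule pr_closed[OF A B x(1) y(1)])
  have hh: "sum_fold \<circ> mor_sum ?f ?g = h" by (rule lr_fun_eqI) simp_all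
  have "tr (sumb (im ?f A) (im ?g B)) (im ?f A \<union> im ?g B) sum_fold (pr (im ?f A) (im ?g B) (tr A (im ?f A) ?f x) (tr B (im ?g B) ?g y)) =
      tr (sumb A B) (im ?f A \<union> im ?g B) h (pr A B x y)"
    using pr_tr[OF A bf B bg mor_im[OF f] mor_im[OF g] x(1) y(1)]
      tr_trans[OF S block_family_sumb[OF bf bg] U mor_mor_sum[OF mor_im[OF f] mor_im[OF g]] mor_fold[OF sep] p]
    unfolding hh by simp
  then show ?thesis
    using act_q[OF S h p] unfolding imh x(2) y(2) Rbar_prod_q[OF A B x(1) y(1)]
      act_q[OF A f x(1)] act_q[OF B g y(1)] star_q[OF bf bg sep tf tg] by simp
qed

text \<open>The splitting of a refinement of the disjoint union is unique, so the definite
  description in \<open>PD_prod\<close> denotes this product.\<close>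

lemma PD_prod_of:
  assumes C1: "block_family C1" "\<Union>C1 = {1..i}" and C2: "block_family C2" "\<Union>C2 = {1..j}"
  shows "PD_prod K R (underline i) (underline j) x y (ptn_of (sumb C1 C2)) =
    Rbar_prod K R (ptn_of C1) (ptn_of C2) (x (ptn_of C1)) (y (ptn_of C2))"
proof -
  have bf: "block_family (sumb C1 C2)" by (rule block_family_sumb[OF C1(1) C2(1)])
  have "fine (sumb C1 C2) (sumb (U i) (U j))"
    using C1 C2 fine_U by (intro fine_sumb) auto
  then have mem: "ptn_of (sumb C1 C2) \<in> refinements (ptn_sum (underline i) (underline j))"
    unfolding underline_eq ptn_sum_of refinements_of[OF block_family_sumb[OF block_family_U block_family_U]]
    using bf by blast
  have uniq: "\<Gamma> = ptn_of C1 \<and> \<Theta> = ptn_of C2"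
    if \<Gamma>: "\<Gamma> \<in> refinements (underline i)" and \<Theta>: "\<Theta> \<in> refinements (underline j)"
      and eq: "ptn_of (sumb C1 C2) = ptn_sum \<Gamma> \<Theta>" for \<Gamma> \<Theta>
  proof -
    obtain E1 where E1: "block_family E1" "\<Gamma> = ptn_of E1" using \<Gamma> unfolding refinements_underline by blast
    obtain E2 where E2: "block_family E2" "\<Theta> = ptn_of E2" using \<Theta> unfolding refinements_underline by blast
    have "sumb C1 C2 = sumb E1 E2"
      using eq ptn_of_inj[OF bf block_family_sumb[OF E1(1) E2(1)]] unfolding E1(2) E2(2) ptn_sum_of by simp
    then have "C1 = E1" "C2 = E2"
      using sumb_inj[of C1 C2 E1 E2] C1(1) C2(1) E1(1) E2(1) by (simp_all add: block_family_def)
    then show ?thesis using E1 E2 by simp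
  qed
  have "(THE v. \<exists>\<Gamma> \<in> refinements (underline i). \<exists>\<Theta> \<in> refinements (underline j).
      ptn_of (sumb C1 C2) = ptn_sum \<Gamma> \<Theta> \<and> v = Rbar_prod K R \<Gamma> \<Theta> (x \<Gamma>) (y \<Theta>)) =
    Rbar_prod K R (ptn_of C1) (ptn_of C2) (x (ptn_of C1)) (y (ptn_of C2))"
  proof (rule the_equality)
    show "\<exists>\<Gamma> \<in> refinements (underline i). \<exists>\<Theta> \<in> refinements (underline j).
        ptn_of (sumb C1 C2) = ptn_sum \<Gamma> \<Theta> \<and>
        Rbar_prod K R (ptn_of C1) (ptn_of C2) (x (ptn_of C1)) (y (ptn_of C2)) = Rbar_prod K R \<Gamma> \<Theta> (x \<Gamma>) (y \<Theta>)"
      using refinement_mem[OF C1] refinement_mem[OF C2] ptn_sum_of[of C1 C2] by metis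
  qed (use uniq in blast)
  then show ?thesis using mem by (simp add: PD_prod_def)
qed

text \<open>Let \<open>Q\<close> consist of the nonempty sets among \<open>{1..i}\<close> and
  \<open>{i+1..n}\<close>. Its block group is the stabilizer of \<open>{1..i}\<close>, so a coset of
  it is the \<open>i\<close>-element set to which \<open>{1..i}\<close> is sent. The order condition
  says that this set is a union of blocks of \<open>C\<close>, and such a union is fixed by the
  block group of \<open>C\<close>. The admissible double cosets are therefore the sets of blocks
  with \<open>i\<close> points in total.\<close>

lemma PD_tr_of:
  assumes u: "species.family u" and v: "species.family v" and i: "i \<le> n"
    and C: "block_family C" "\<Union>C = {1..n}"
  shows "PD_tr K R (ptn_sum (underline i) (underline (n - i))) (underline n) (append_mor i)
      (PD_prod K R (underline i) (underline (n - i)) (rho u i) (rho v (n - i))) (ptn_of C) =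
    finsum (V C) (\<lambda>S. star S (C - S) (u S) (v (C - S))) {S \<in> Pow C. card (\<Union>S) \<in> {i}}"
proof -
  define j where "j = n - i"
  define E where "E = sumb (U i) (U j)"
  \<comment> \<open>For \<open>i = 0\<close> or \<open>i = n\<close> one of the two blocks is
    missing, which is why membership in \<open>Q\<close> is treated case by case.\<close>
  define Q where "Q = im (append_mor i) E"
  let ?z = "PD_prod K R (underline i) (underline j) (rho u i) (rho v j)"
  have E: "block_family E" unfolding E_def by (rule block_family_sumb) simp_all
  have UE: "\<Union>E = inl ` {1..i} \<union> inr ` {1..j}" by (simp add: E_def Union_sumb)
  have inj_app: "inj_on (append_mor i) (\<Union>E)"
    unfolding UE by (auto simp: inj_on_def)
  have app: "append_mor i ` inl ` {1..i} = {1..i}" "append_mor i ` inr ` {1..j} = {i+1..n}"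
  proof -
    have "append_mor i ` inr ` {1..j} = (\<lambda>k. i + k) ` {1..j}" by (simp add: image_image)
    also have "\<dots> = {i+1..n}" using i by (simp add: j_def add.commute image_add_atLeastAtMost)
    finally show "append_mor i ` inr ` {1..j} = {i+1..n}" .
  qed (simp add: image_image)
  have app_inr: "append_mor i ` X = {i+1..n}" if "X = inr ` {1..j}" for X using app(2) that by simp
  have UQ: "\<Union>Q = {1..n}"
    unfolding Q_def Union_im UE image_Un app using i by auto
  have Q: "block_family Q" unfolding Q_def by (rule block_family_im[OF E inj_app])
  have Qmem: "B = {1..i} \<or> B = {i+1..n}" if "B \<in> Q" for B
    using that app unfolding Q_def E_def sumb_def U_def by (auto split: if_splits)
  have Qin: "{1..i} \<in> Q" if "i > 0"
  proof -
    have "append_mor i ` inl ` {1..i} \<in> Q" using that by (simp add: Q_def E_def sumb_def U_def)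
    then show ?thesis unfolding app(1) .
  qed
  have Qin': "{i+1..n} \<in> Q" if "j > 0"
  proof -
    have "append_mor i ` inr ` {1..j} \<in> Q" using that by (simp add: Q_def E_def sumb_def U_def)
    then show ?thesis unfolding app(2) .
  qed
  have bpQ: "\<delta> \<in> block_perms (ptn_of Q) \<longleftrightarrow> \<delta> permutes {1..n} \<and> \<delta> ` {1..i} = {1..i}" for \<delta>
  proof
    assume "\<delta> \<in> block_perms (ptn_of Q)"
    then have d: "\<delta> permutes {1..n}" "\<And>B. B \<in> Q \<Longrightarrow> \<delta> ` B = B" by (auto simp: block_perms_of[OF Q] UQ)
    have "\<delta> ` {1..i} = {1..i}" using d(2)[OF Qin] by (cases "i = 0") auto
    then show "\<delta> permutes {1..n} \<and> \<delta> ` {1..i} = {1..i}" using d by simp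
  next
    assume d: "\<delta> permutes {1..n} \<and> \<delta> ` {1..i} = {1..i}"
    have "{i+1..n} = {1..n} - {1..i}" by auto
    then have "\<delta> ` {i+1..n} = \<delta> ` {1..n} - \<delta> ` {1..i}"
      using image_set_diff[OF permutes_inj] d by metis
    then have d': "\<delta> ` {i+1..n} = {i+1..n}"
      using d permutes_image[of \<delta> "{1..n}"] \<open>{i+1..n} = _\<close> by simp
    have "\<delta> ` B = B" if "B \<in> Q" for B
      using Qmem[OF that]
    proof
      assume "B = {1..i}"
      then show ?thesis using d by simp
    next
      assume "B = {i+1..n}"
      then show ?thesis using d' by (simp only:)
    qed
    then show "\<delta> \<in> block_perms (ptn_of Q)" using d by (simp add: block_perms_of[OF Q] UQ)
  qed
  \<comment> \<open>The order condition means that no block of \<open>C\<close> crosses the boundary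
    of the image of \<open>{1..i}\<close>.\<close>
  have fineQ: "fine C (im \<rho> Q) \<longleftrightarrow> (\<forall>X\<in>C. X \<subseteq> \<rho> ` {1..i} \<or> X \<inter> \<rho> ` {1..i} = {})"
    if \<rho>: "\<rho> permutes {1..n}" for \<rho>
  proof -
    have "{i+1..n} = {1..n} - {1..i}" by auto
    then have comp: "\<rho> ` {i+1..n} = {1..n} - \<rho> ` {1..i}"
      using image_set_diff[OF permutes_inj[OF \<rho>], of "{1..n}" "{1..i}"] permutes_image[OF \<rho>] by simp
    have UU: "\<Union>(im \<rho> Q) = \<Union>C" unfolding Union_im UQ C(2) by (rule permutes_image[OF \<rho>])
    have "(\<exists>Y\<in>im \<rho> Q. X \<subseteq> Y) \<longleftrightarrow> X \<subseteq> \<rho> ` {1..i} \<or> X \<inter> \<rho> ` {1..i} = {}" if X: "X \<in> C" for X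
    proof
      assume "\<exists>Y\<in>im \<rho> Q. X \<subseteq> Y"
      then obtain B where "B \<in> Q" "X \<subseteq> \<rho> ` B" by blast
      then show "X \<subseteq> \<rho> ` {1..i} \<or> X \<inter> \<rho> ` {1..i} = {}" using Qmem comp by blast
    next
      assume or: "X \<subseteq> \<rho> ` {1..i} \<or> X \<inter> \<rho> ` {1..i} = {}"
      obtain a where a: "a \<in> X" using block_family_nonempty[OF C(1) X] by blast
      have Xn: "X \<subseteq> {1..n}" using X C(2) by blast
      show "\<exists>Y\<in>im \<rho> Q. X \<subseteq> Y"
      proof (cases "X \<subseteq> \<rho> ` {1..i}")
        case True
        then have "i > 0" using a by (cases i) auto
        then show ?thesis using True Qin by blast
      next
        case False
        then have sub: "X \<subseteq> \<rho> ` {i+1..n}" using or Xn unfolding comp by blast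
        then have "{i+1..n} \<noteq> {}" using a by blast
        then have "j > 0" using i by (simp add: j_def)
        then show ?thesis using sub Qin' by blast
      qed
    qed
    then show ?thesis using UU by (simp add: fine_def)
  qed
  let ?\<Psi> = "ptn_sum (underline i) (underline j)"
  have \<Psi>: "?\<Psi> = ptn_of E" unfolding underline_eq ptn_sum_of E_def ..
  have \<Psi>Q: "ptn_image (append_mor i) ?\<Psi> = ptn_of Q" unfolding \<Psi> ptn_image_of Q_def ..
  define J where "J = {D \<in> double_cosets (ptn_of C) (underline n) (ptn_of Q). ptn_le (ptn_of C) (ptn_image (rep D \<circ> append_mor i) ?\<Psi>)}"
  \<comment> \<open>The set of blocks attached to a double coset; for \<open>D \<in> J\<close> its
    union is the image of \<open>{1..i}\<close>.\<close>
  define T where "T D = {X \<in> C. X \<subseteq> rep D ` {1..i}}" for D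
  define g where "g S = star S (C - S) (u S) (v (C - S))" for S
  have rep_perm: "rep D permutes {1..n}" if D: "D \<in> double_cosets (ptn_of C) (underline n) (ptn_of Q)" for D
  proof -
    obtain \<gamma> \<sigma> \<delta> where "\<gamma> \<in> block_perms (ptn_of C)" "\<sigma> \<in> block_perms (underline n)" "\<delta> \<in> block_perms (ptn_of Q)"
      "rep D = \<gamma> \<circ> \<sigma> \<circ> \<delta>" using double_coset_rep(2)[OF D] by blast
    then show ?thesis
      using C(2) UQ by (auto simp: block_perms_underline block_perms_of[OF C(1)] block_perms_of[OF Q] intro!: permutes_compose)
  qed
  have le: "ptn_le (ptn_of C) (ptn_image (\<rho> \<circ> append_mor i) ?\<Psi>) \<longleftrightarrow> fine C (im \<rho> Q)"
    if \<rho>: "\<rho> permutes {1..n}" for \<rho>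
  proof -
    have bQ: "block_family (im \<rho> Q)" by (rule perm_block_family(1)[OF Q UQ \<rho>])
    have e: "ptn_image (\<rho> \<circ> append_mor i) ?\<Psi> = ptn_of (im \<rho> Q)"
      unfolding \<Psi> ptn_image_of Q_def by (simp add: image_image)
    have "ptn_le (ptn_of C) (ptn_of (im \<rho> Q)) \<longleftrightarrow> ptn_of C \<in> refinements (ptn_of (im \<rho> Q))"
      using is_ptn_of[OF C(1)] by (simp add: refinements_def)
    also have "\<dots> \<longleftrightarrow> fine C (im \<rho> Q)"
      unfolding refinements_of[OF bQ] using ptn_of_inj[OF C(1)] C(1) by auto
    finally show ?thesis unfolding e .
  qed
  have J: "D \<in> J \<longleftrightarrow> D \<in> double_cosets (ptn_of C) (underline n) (ptn_of Q) \<and>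
      (\<forall>X\<in>C. X \<subseteq> rep D ` {1..i} \<or> X \<inter> rep D ` {1..i} = {})" for D
    unfolding J_def using le[OF rep_perm] fineQ[OF rep_perm] by blast
  have T: "T D \<subseteq> C" "\<Union>(T D) = rep D ` {1..i}" "rep D permutes {1..n}" if D: "D \<in> J" for D
  proof -
    show "T D \<subseteq> C" by (auto simp: T_def)
    show p: "rep D permutes {1..n}" using D unfolding J_def by (intro rep_perm) blast
    have "rep D ` {1..i} \<subseteq> \<Union>C" using C(2) permutes_image[OF p] i by auto
    moreover have or: "\<forall>X\<in>C. X \<subseteq> rep D ` {1..i} \<or> X \<inter> rep D ` {1..i} = {}"
      using D unfolding J by (rule conjunct2)
    ultimately have "\<exists>X\<in>C. a \<in> X \<and> X \<subseteq> rep D ` {1..i}" if a: "a \<in> rep D ` {1..i}" for a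
    proof -
      have "a \<in> \<Union>C" using \<open>rep D ` {1..i} \<subseteq> \<Union>C\<close> a by blast
      then obtain X where X: "X \<in> C" "a \<in> X" by blast
      then have "X \<subseteq> rep D ` {1..i}" using or a by blast
      then show ?thesis using X by blast
    qed
    then show "\<Union>(T D) = rep D ` {1..i}" unfolding T_def by blast
  qed
  have term_eq: "(let h = rep D \<circ> append_mor i; \<Gamma>' = ptn_image (inv_into (fst ?\<Psi>) h) (ptn_of C)
      in Rbar_tr K R \<Gamma>' (ptn_of C) h (?z \<Gamma>')) = g (T D)" if D: "D \<in> J" for D
  proof -
    define \<rho> where "\<rho> = rep D"
    define h where "h = \<rho> \<circ> append_mor i"
    have p: "\<rho> permutes {1..n}" and TC: "T D \<subseteq> C" and UT: "\<Union>(T D) = \<rho> ` {1..i}" using T[OF D] by (simp_all add: \<rho>_def)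
    note sf = species.split_facts[OF C(1) TC]
    have UT': "\<Union>(C - T D) = \<rho> ` {i+1..n}"
    proof -
      have "{i+1..n} = {1..n} - {1..i}" by auto
      then have "\<rho> ` {i+1..n} = {1..n} - \<rho> ` {1..i}"
        using image_set_diff[OF permutes_inj[OF p], of "{1..n}" "{1..i}"] permutes_image[OF p] by simp
      moreover have "\<Union>(C - T D) = \<Union>C - \<Union>(T D)" using sf(3) by blast
      ultimately show ?thesis using UT C(2) by simp
    qed
    let ?k = "inv_into UNIV \<rho>"
    have kk: "?k (\<rho> a) = a" "\<rho> (?k a) = a" for a using permutes_inverses[OF p] by auto
    \<comment> \<open>\<open>C1\<close> and \<open>C2\<close> are the two halves of the partition
      \<open>C\<close> pulled back along \<open>h\<close>; the subtraction of \<open>i\<close> in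
      the second undoes the shift in \<open>append_mor\<close>.\<close>
    define C1 where "C1 = im ?k (T D)"
    define C2 where "C2 = im (\<lambda>a. ?k a - i) (C - T D)"
    have kinj: "inj ?k" by (rule permutes_inj[OF permutes_inv[OF p]])
    have C1: "block_family C1" unfolding C1_def
      by (rule block_family_im[OF sf(1) inj_on_subset[OF kinj]]) simp
    have UC1: "\<Union>C1 = {1..i}" unfolding C1_def Union_im UT image_image kk by simp
    have k2: "?k a \<in> {i+1..n}" if "a \<in> \<Union>(C - T D)" for a
      using that kk unfolding UT' by auto
    have inj2: "inj_on (\<lambda>a. ?k a - i) (\<Union>(C - T D))"
    proof (rule inj_onI)
      fix a b assume a: "a \<in> \<Union>(C - T D)" and b: "b \<in> \<Union>(C - T D)" and eq: "?k a - i = ?k b - i"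
      then have "?k a = ?k b" using k2[OF a] k2[OF b] by auto
      then show "a = b" using kinj by (simp add: inj_eq)
    qed
    have C2: "block_family C2" unfolding C2_def by (rule block_family_im[OF sf(2) inj2])
    have UC2: "\<Union>C2 = {1..j}"
    proof -
      have "\<Union>C2 = (\<lambda>a. a - i) ` {i+1..n}" unfolding C2_def Union_im UT' image_image kk ..
      also have "\<dots> = {1..j}"
      proof (intro equalityI subsetI)
        fix a assume "a \<in> {1..j}"
        then show "a \<in> (\<lambda>a. a - i) ` {i+1..n}" using i by (intro image_eqI[of _ _ "i + a"]) (auto simp: j_def)
      qed (auto simp: j_def)
      finally show ?thesis .
    qed
    have h1: "(h \<circ> inl) ` ?k ` X = X" for X unfolding image_image by (simp add: h_def kk)
    have h2: "(h \<circ> inr) ` (\<lambda>a. ?k a - i) ` X = X" if "X \<in> C - T D" for X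
    proof -
      have "(h \<circ> inr) (?k a - i) = a" if "a \<in> X" for a
      proof -
        have "?k a \<in> {i+1..n}" using k2 \<open>a \<in> X\<close> \<open>X \<in> C - T D\<close> by blast
        then show ?thesis by (simp add: h_def kk)
      qed
      then show ?thesis unfolding image_image by simp
    qed
    have im1: "im (h \<circ> inl) C1 = T D" unfolding C1_def image_image[of "image (h \<circ> inl)"] h1 by simp
    have im2: "im (h \<circ> inr) C2 = C - T D"
      unfolding C2_def image_image[of "image (h \<circ> inr)"] using h2 by simp
    have US: "\<Union>(sumb C1 C2) = \<Union>E" unfolding Union_sumb UC1 UC2 UE ..
    have hinj: "inj_on h (\<Union>(sumb C1 C2))"
      unfolding US h_def by (rule comp_inj_on[OF inj_app inj_on_subset[OF permutes_inj[OF p]]]) simp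
    have imh: "im h (sumb C1 C2) = C"
    proof -
      have "im h (sumb C1 C2) = im (h \<circ> inl) C1 \<union> im (h \<circ> inr) C2"
        by (simp add: sumb_def image_Un image_image)
      then show ?thesis using im1 im2 sf(4) by simp
    qed
    have inv: "im (inv_into (\<Union>E) h) C = sumb C1 C2"
    proof -
      have "inv_into (\<Union>E) h ` h ` X = X" if "X \<in> sumb C1 C2" for X
        using that hinj US by (intro inv_into_image_cancel) auto
      then have "im (inv_into (\<Union>E) h) (im h (sumb C1 C2)) = sumb C1 C2"
        unfolding image_image[of "image (inv_into (\<Union>E) h)"] by simp
      then show ?thesis unfolding imh .
    qed
    have fst\<Psi>: "fst ?\<Psi> = \<Union>E" unfolding \<Psi> by (simp add: ptn_of_def)
    have "(let h = rep D \<circ> append_mor i; \<Gamma>' = ptn_image (inv_into (fst ?\<Psi>) h) (ptn_of C)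
        in Rbar_tr K R \<Gamma>' (ptn_of C) h (?z \<Gamma>')) = Rbar_tr K R (ptn_of (sumb C1 C2)) (ptn_of C) h (?z (ptn_of (sumb C1 C2)))"
      by (simp only: Let_def \<rho>_def[symmetric] h_def[symmetric] fst\<Psi> ptn_image_of inv)
    also have "\<dots> = act h (sumb C1 C2) (Rbar_prod K R (ptn_of C1) (ptn_of C2) (u C1) (v C2))"
      unfolding PD_prod_of[OF C1 UC1 C2 UC2] rho_of[OF C1 UC1] rho_of[OF C2 UC2] act_def imh ..
    also have "\<dots> = star (T D) (C - T D) (act (h \<circ> inl) C1 (u C1)) (act (h \<circ> inr) C2 (v C2))"
      using act_Rbar_prod[OF C1 C2 hinj species.family_closed[OF u C1] species.family_closed[OF v C2]]
      unfolding im1 im2 .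
    also have "\<dots> = g (T D)"
    proof -
      note i1 = inj_sumb_left[OF hinj] and i2 = inj_sumb_right[OF hinj]
      show ?thesis
        unfolding g_def species.family_act[OF u C1 i1] species.family_act[OF v C2 i2] im1 im2 ..
    qed
    finally show ?thesis .
  qed
  have Tinj: "inj_on T J"
  proof (rule inj_onI)
    fix D D' assume D: "D \<in> J" and D': "D' \<in> J" and eq: "T D = T D'"
    let ?\<rho> = "rep D" and ?\<rho>' = "rep D'"
    have p: "?\<rho> permutes {1..n}" "?\<rho>' permutes {1..n}" using T(3) D D' by auto
    have im: "?\<rho> ` {1..i} = ?\<rho>' ` {1..i}" using T(2)[OF D] T(2)[OF D'] eq by simp
    \<comment> \<open>Two representatives with the same image of \<open>{1..i}\<close> differ on the
      right by an element of the stabilizer of \<open>{1..i}\<close>, hence define the same double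
      coset.\<close>
    define \<delta> where "\<delta> = inv_into UNIV ?\<rho> \<circ> ?\<rho>'"
    have "\<delta> ` {1..i} = inv_into UNIV ?\<rho> ` ?\<rho>' ` {1..i}" by (simp add: \<delta>_def image_comp)
    also have "\<dots> = {1..i}" unfolding im[symmetric] image_image permutes_inverses[OF p(1)] by simp
    finally have "\<delta> \<in> block_perms (ptn_of Q)"
      unfolding bpQ \<delta>_def using permutes_compose[OF p(2) permutes_inv[OF p(1)]] by simp
    moreover have "?\<rho>' = id \<circ> ?\<rho> \<circ> \<delta>"
      by (simp add: \<delta>_def fun_eq_iff permutes_inverses[OF p(1)])
    ultimately have e: "{\<gamma> \<circ> ?\<rho>' \<circ> \<delta> | \<gamma> \<delta>. \<gamma> \<in> block_perms (ptn_of C) \<and> \<delta> \<in> block_perms (ptn_of Q)} =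
        {\<gamma> \<circ> ?\<rho> \<circ> \<delta> | \<gamma> \<delta>. \<gamma> \<in> block_perms (ptn_of C) \<and> \<delta> \<in> block_perms (ptn_of Q)}"
      by (intro double_coset_eq[OF _ block_perms_id])
    have "D \<in> double_cosets (ptn_of C) (underline n) (ptn_of Q)"
        "D' \<in> double_cosets (ptn_of C) (underline n) (ptn_of Q)"
      using D D' by (auto simp: J_def)
    note d = double_coset_rep(1)[OF this(1)] double_coset_rep(1)[OF this(2)]
    show "D = D'" by (rule trans[OF d(1) trans[OF e[symmetric] d(2)[symmetric]]])
  qed
  have Timg: "T ` J = {S \<in> Pow C. card (\<Union>S) \<in> {i}}"
  proof (intro equalityI subsetI)
    fix S assume "S \<in> T ` J"
    then obtain D where D: "D \<in> J" "S = T D" by auto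
    have "card (\<Union>(T D)) = i"
      unfolding T(2)[OF D(1)] using card_image[OF inj_on_subset[OF permutes_inj[OF T(3)[OF D(1)]]], of "{1..i}"] by simp
    then show "S \<in> {S \<in> Pow C. card (\<Union>S) \<in> {i}}" using T(1)[OF D(1)] D(2) by simp
  next
    fix S assume S: "S \<in> {S \<in> Pow C. card (\<Union>S) \<in> {i}}"
    then have SC: "S \<subseteq> C" and cS: "card (\<Union>S) = i" by auto
    have "\<Union>S \<subseteq> {1..n}" using SC C(2) by blast
    then obtain \<sigma> where \<sigma>: "\<sigma> permutes {1..n}" "\<sigma> ` {1..i} = \<Union>S"
      using permutation_extending[OF _ cS] by blast
    define D where "D = {\<gamma> \<circ> \<sigma> \<circ> \<delta> | \<gamma> \<delta>. \<gamma> \<in> block_perms (ptn_of C) \<and> \<delta> \<in> block_perms (ptn_of Q)}"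
    have Dd: "D \<in> double_cosets (ptn_of C) (underline n) (ptn_of Q)"
      unfolding double_cosets_def D_def block_perms_underline using \<sigma>(1) by blast
    have "id \<circ> \<sigma> \<circ> id \<in> D" unfolding D_def using block_perms_id by blast
    then have "rep D \<in> D" unfolding rep_def by (rule someI[where P = "\<lambda>\<sigma>. \<sigma> \<in> D"])
    then obtain \<gamma> \<delta> where r: "rep D = \<gamma> \<circ> \<sigma> \<circ> \<delta>" "\<gamma> \<in> block_perms (ptn_of C)" "\<delta> \<in> block_perms (ptn_of Q)"
      unfolding D_def by blast
    \<comment> \<open>The factors that separate \<open>rep D\<close> from \<open>\<sigma>\<close> do
      no harm: \<open>\<delta>\<close> preserves \<open>{1..i}\<close> and \<open>\<gamma>\<close>
      preserves every block of \<open>C\<close>.\<close>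
    have "rep D ` {1..i} = \<gamma> ` \<sigma> ` \<delta> ` {1..i}" unfolding r(1) by (simp add: image_comp comp_assoc)
    also have "\<dots> = \<gamma> ` \<Union>S" using r(3) bpQ \<sigma>(2) by simp
    also have "\<dots> = \<Union>S"
    proof -
      have "\<gamma> ` X = X" if "X \<in> S" for X using r(2) that SC by (auto simp: block_perms_of[OF C(1)])
      then show ?thesis by (simp add: image_Union)
    qed
    finally have im: "rep D ` {1..i} = \<Union>S" .
    have dis: "X \<inter> \<Union>S = {}" if "X \<in> C" "X \<notin> S" for X
      using block_family_sep[OF C(1), of "{X}" S] that SC by auto
    have "D \<in> J" unfolding J im using Dd dis by blast
    moreover have "T D = S"
      unfolding T_def im
    proof (intro equalityI subsetI)
      fix X assume X: "X \<in> {X \<in> C. X \<subseteq> \<Union>S}"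
      then obtain a where "a \<in> X" using block_family_nonempty[OF C(1)] by blast
      then show "X \<in> S" using dis X by blast
    qed (use SC in blast)
    ultimately show "S \<in> T ` J" by blast
  qed
  have gc: "g S \<in> carrier (V C)" if "S \<subseteq> C" for S
    unfolding g_def by (rule species.mult_term_closed[OF u v C(1) that])
  interpret VC: module K "V C" by (rule species.V[OF C(1)])
  have "PD_tr K R ?\<Psi> (underline n) (append_mor i) ?z (ptn_of C) =
      finsum (V C) (\<lambda>D. let h = rep D \<circ> append_mor i; \<Gamma>' = ptn_image (inv_into (fst ?\<Psi>) h) (ptn_of C)
        in Rbar_tr K R \<Gamma>' (ptn_of C) h (?z \<Gamma>')) J"
    using refinement_mem[OF C] by (simp add: PD_tr_def Rbar_V J_def \<Psi>Q)
  also have "\<dots> = finsum (V C) (\<lambda>D. g (T D)) J"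
    using term_eq gc T(1) by (intro VC.M.finsum_cong' refl) auto
  also have "\<dots> = finsum (V C) g (T ` J)"
    using gc T(1) by (intro VC.M.finsum_reindex[symmetric] Tinj) auto
  finally show ?thesis unfolding Timg g_def j_def .
qed

text \<open>The product in degree \<open>n\<close> is a sum over \<open>i\<close> of transfers, each
  of which collects the subsets with \<open>i\<close> points. Summing over \<open>i\<close> exhausts
  the subsets of \<open>C\<close>.\<close>

lemma rho_mult:
  assumes u: "species.family u" and v: "species.family v"
  shows "rho (u \<otimes>\<^bsub>species.families\<^esub> v) = rho u \<otimes>\<^bsub>SA\<^esub> rho v"
proof
  fix n
  define t where "t i = PD_tr K R (ptn_sum (underline i) (underline (n - i))) (underline n) (append_mor i)
      (PD_prod K R (underline i) (underline (n - i)) (rho u i) (rho v (n - i)))" for i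
  have tC: "t i (ptn_of C) = finsum (V C) (\<lambda>S. star S (C - S) (u S) (v (C - S))) {S \<in> Pow C. card (\<Union>S) \<in> {i}}"
    if "i \<le> n" "block_family C" "\<Union>C = {1..n}" for i C
    unfolding t_def by (rule PD_tr_of[OF u v that])
  have tc: "t i \<in> carrier (PD_val K R (underline n))" if i: "i \<le> n" for i
  proof (rule PD_carrierI)
    show "t i \<in> extensional (refinements (underline n))" by (simp add: t_def PD_tr_def)
    fix C assume C: "block_family C" "\<Union>C = {1..n}"
    interpret VC: module K "V C" by (rule species.V[OF C(1)])
    show "t i (ptn_of C) \<in> carrier (V C)"
      unfolding tC[OF i C] using species.mult_term_closed[OF u v C(1)] by (intro VC.M.finsum_closed) auto
    fix \<sigma> assume \<sigma>: "\<sigma> permutes {1..n}"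
    show "act \<sigma> C (t i (ptn_of C)) = t i (ptn_of (im \<sigma> C))"
      unfolding tC[OF i C] tC[OF i perm_block_family(1,2)[OF C \<sigma>]]
      by (rule species.mult_natural[OF u v C(1) perm_block_family(3)[OF C \<sigma>]])
  qed
  interpret P: module K "PD_val K R (underline n)" by (rule module_PD)
  have sum: "finsum (PD_val K R (underline n)) t {..n} \<in> carrier (PD_val K R (underline n))"
    using tc by (intro P.M.finsum_closed) auto
  have "rho (u \<otimes>\<^bsub>species.families\<^esub> v) n = finsum (PD_val K R (underline n)) t {..n}"
  proof (rule PD_eqI[OF rho_extensional PD_extensional[OF sum]])
    fix C assume C: "block_family C" "\<Union>C = {1..n}"
    interpret VC: module K "V C" by (rule species.V[OF C(1)])
    define g where "g S = star S (C - S) (u S) (v (C - S))" for S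
    have gc: "g S \<in> carrier (V C)" if "S \<subseteq> C" for S
      unfolding g_def by (rule species.mult_term_closed[OF u v C(1) that])
    have finC: "finite C" by (rule block_family_finite[OF C(1)])
    have "finsum (PD_val K R (underline n)) t {..n} (ptn_of C) = finsum (V C) (\<lambda>i. t i (ptn_of C)) {..n}"
      using tc by (intro module_hom_finsum[OF PD_eval[OF C] module_PD species.V[OF C(1)]]) simp
    also have "\<dots> = finsum (V C) (\<lambda>i. finsum (V C) g {S \<in> Pow C. card (\<Union>S) \<in> {i}}) {..n}"
    proof (intro VC.M.finsum_cong' refl)
      show "t i (ptn_of C) = finsum (V C) g {S \<in> Pow C. card (\<Union>S) \<in> {i}}" if "i \<in> {..n}" for i
        unfolding g_def using that by (intro tC[OF _ C]) simp
    qed (use gc in \<open>auto intro!: VC.M.finsum_closed\<close>)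
    also have "\<dots> = finsum (V C) (\<lambda>(i, S). g S) (Sigma {..n} (\<lambda>i. {S \<in> Pow C. card (\<Union>S) \<in> {i}}))"
      using gc finC by (intro VC.M.finsum_Sigma) auto
    also have "\<dots> = finsum (V C) (\<lambda>p. g (snd p)) (Sigma {..n} (\<lambda>i. {S \<in> Pow C. card (\<Union>S) \<in> {i}}))"
      by (simp add: case_prod_unfold)
    also have "\<dots> = finsum (V C) g (snd ` Sigma {..n} (\<lambda>i. {S \<in> Pow C. card (\<Union>S) \<in> {i}}))"
      using gc by (intro VC.M.finsum_reindex[symmetric]) (auto simp: inj_on_def)
    \<comment> \<open>Every subset of \<open>C\<close> occurs for precisely one \<open>i\<close>,
      the number of its points, and this is at most \<open>n\<close>.\<close>
    also have "snd ` Sigma {..n} (\<lambda>i. {S \<in> Pow C. card (\<Union>S) \<in> {i}}) = Pow C"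
    proof (intro equalityI subsetI)
      fix S assume S: "S \<in> Pow C"
      then have "\<Union>S \<subseteq> {1..n}" using C(2) by blast
      then have "card (\<Union>S) \<le> n" using card_mono[of "{1..n}" "\<Union>S"] by simp
      then show "S \<in> snd ` Sigma {..n} (\<lambda>i. {S \<in> Pow C. card (\<Union>S) \<in> {i}})"
        using S by (intro image_eqI[of _ snd "(card (\<Union>S), S)"]) auto
    qed auto
    also have "finsum (V C) g (Pow C) = (u \<otimes>\<^bsub>species.families\<^esub> v) C"
      unfolding species.families_mult[OF C(1)] g_def ..
    finally show "rho (u \<otimes>\<^bsub>species.families\<^esub> v) n (ptn_of C) = finsum (PD_val K R (underline n)) t {..n} (ptn_of C)"
      using rho_of[OF C] by simp
  qed
  then show "rho (u \<otimes>\<^bsub>species.families\<^esub> v) n = (rho u \<otimes>\<^bsub>SA\<^esub> rho v) n"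
    by (simp add: SA_simps(2) t_def[abs_def])
qed

section \<open>The graded isomorphism onto the algebra of \<open>PD\<close>\<close>

lemma rho_one: "rho \<one>\<^bsub>species.families\<^esub> = \<one>\<^bsub>SA\<^esub>"
proof
  fix n
  show "rho \<one>\<^bsub>species.families\<^esub> n = \<one>\<^bsub>SA\<^esub> n"
  proof (rule PD_eqI[OF rho_extensional])
    show "\<one>\<^bsub>SA\<^esub> n \<in> extensional (refinements (underline n))"
      by (simp add: SA_simps PD_unit_def PD_ops)
    fix C assume C: "block_family C" "\<Union>C = {1..n}"
    have "n = 0 \<longleftrightarrow> C = {}"
    proof
      assume "n = 0"
      then have "\<Union>C = {}" using C(2) by simp
      then show "C = {}" using block_family_nonempty[OF C(1)] by blast
    qed (use C(2) in simp)
    note n0 = this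
    have L: "rho \<one>\<^bsub>species.families\<^esub> n (ptn_of C) = (if C = {} then e else \<zero>\<^bsub>V C\<^esub>)"
      using C by (simp add: rho_of species.families_simps)
    show "rho \<one>\<^bsub>species.families\<^esub> n (ptn_of C) = \<one>\<^bsub>SA\<^esub> n (ptn_of C)"
    proof (cases "n = 0")
      case True
      then have "C = {}" using n0 by simp
      then show ?thesis
        using L True refinement_mem[OF C] by (simp add: SA_simps PD_unit_def e_def q_def)
    next
      case False
      then have "C \<noteq> {}" using n0 by simp
      then show ?thesis
        using L False refinement_mem[OF C] by (simp add: SA_simps PD_ops Rbar_V)
    qed
  qed
qed

lemma rho_linear:
  shows "rho \<zero>\<^bsub>species.families\<^esub> = \<zero>\<^bsub>SA\<^esub>"
    and "rho (u \<oplus>\<^bsub>species.families\<^esub> v) = rho u \<oplus>\<^bsub>SA\<^esub> rho v"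
    and "rho (a \<odot>\<^bsub>species.families\<^esub> u) = a \<odot>\<^bsub>SA\<^esub> rho u"
  by (rule ext, rule PD_eqI[OF rho_extensional];
      simp add: SA_simps PD_ops rho_of refinement_mem Rbar_V species.families_simps)+

lemma rho_bij: "bij_betw rho (carrier species.families) (carrier SA)"
proof (rule bij_betw_imageI)
  show "inj_on rho (carrier species.families)"
    by (rule inj_onI) (simp add: species.families_simps rho_inject)
  show "rho ` carrier species.families = carrier SA"
  proof (intro equalityI subsetI)
    fix x assume "x \<in> carrier SA"
    then obtain u where "species.family u" "rho u = x" using rho_surj by blast
    then show "x \<in> rho ` carrier species.families" by (auto simp: species.families_simps)
  next
    fix x assume "x \<in> rho ` carrier species.families"
    then obtain u where "species.family u" "x = rho u" unfolding species.families_simps(1) by blast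
    then show "x \<in> carrier SA" using rho_closed by simp
  qed
qed

lemma Sigma_degree_eq:
  "Sigma_degree (PD K R) n = {x \<in> carrier SA. \<forall>i. i \<noteq> n \<longrightarrow> x i = \<zero>\<^bsub>PD_val K R (underline i)\<^esub>}"
  by (simp add: Sigma_degree_def homogeneous_def PD_def Sigma_algebra_def Let_def)

text \<open>The number of points of a partition of \<open>{1..i}\<close> is \<open>i\<close>, and by
  naturality vanishing on initial segments spreads to all block families with as many
  points.\<close>

lemma rho_degree: "rho ` species.family_degree n = Sigma_degree (PD K R) n"
proof (intro equalityI subsetI)
  fix x assume "x \<in> rho ` species.family_degree n"
  then obtain u where u: "u \<in> species.family_degree n" "x = rho u" by blast
  then have fu: "species.family u" by (simp add: species.family_degree_def)
  have "rho u i = \<zero>\<^bsub>PD_val K R (underline i)\<^esub>" if "i \<noteq> n" for i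
  proof (rule PD_eqI[OF rho_extensional])
    fix C assume C: "block_family C" "\<Union>C = {1..i}"
    then show "rho u i (ptn_of C) = \<zero>\<^bsub>PD_val K R (underline i)\<^esub> (ptn_of C)"
      using u(1) \<open>i \<noteq> n\<close> by (simp add: rho_of PD_ops refinement_mem Rbar_V species.family_degree_def)
  qed (simp add: PD_ops)
  then show "x \<in> Sigma_degree (PD K R) n"
    using rho_closed[OF fu] u(2) by (simp add: Sigma_degree_eq)
next
  fix x assume x: "x \<in> Sigma_degree (PD K R) n"
  then obtain u where u: "species.family u" "rho u = x" using rho_surj by (auto simp: Sigma_degree_eq)
  have "u A = \<zero>\<^bsub>V A\<^esub>" if A: "block_family A" and c: "card (\<Union>A) \<noteq> n" for A
  proof -
    obtain g C where C: "block_family C" "\<Union>C = {1..card (\<Union>A)}" "inj_on g {1..card (\<Union>A)}" "im g C = A"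
      by (rule initial_model[OF A])
    have g: "inj_on g (\<Union>C)" using C by simp
    have "u C = x (card (\<Union>A)) (ptn_of C)" using rho_of[OF C(1,2), of u] u(2) by simp
    also have "\<dots> = \<zero>\<^bsub>V C\<^esub>"
      using x c refinement_mem[OF C(1,2)] by (simp add: Sigma_degree_eq PD_ops Rbar_V)
    finally show ?thesis
      using species.family_act[OF u(1) C(1) g] species.act_zero[OF C(1) g] C(4) by simp
  qed
  then show "x \<in> rho ` species.family_degree n" using u by (auto simp: species.family_degree_def)
qed

lemma graded_algebra_SA: "graded_algebra K SA (Sigma_degree (PD K R))"
  by (rule graded_algebra_image[OF species.graded_algebra_families rho_bij])
    (simp_all add: rho_linear rho_one rho_degree species.families_simps(1) rho_mult)

lemma rho_iso:
  "rho \<in> graded_algebra_iso K species.families species.family_degree SA (Sigma_degree (PD K R))"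
proof -
  have c: "rho u \<in> carrier SA" if "u \<in> carrier species.families" for u
    using rho_closed that by (simp add: species.families_simps(1))
  have "rho \<in> ring_iso species.families SA"
    using rho_bij c by (simp add: ring_iso_def ring_hom_def rho_linear rho_one species.families_simps(1) rho_mult)
  moreover have "rho \<in> module_hom K species.families SA"
    using c by (intro module_homI) (simp_all add: rho_linear)
  ultimately show ?thesis
    using rho_degree graded_algebra_SA species.graded_algebra_families by (simp add: graded_algebra_iso_def)
qed

lemma species_M: "species.M i = Rbar K R (underline (i + 1))"
  by (simp add: species.M_def underline_eq U_def V_def)

end

lemma graded_algebra_iso_trans:
  assumes f: "f \<in> graded_algebra_iso K A G B H" and g: "g \<in> graded_algebra_iso K B H C I"
  shows "g \<circ> f \<in> graded_algebra_iso K A G C I"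
proof -
  have "g \<circ> f \<in> ring_iso A C"
    using f g by (intro ring_iso_set_trans[of f A B g C]) (simp_all add: graded_algebra_iso_def)
  moreover have "g \<circ> f \<in> module_hom K A C"
    using f g module_hom_compose[of f K A B g C] by (simp add: graded_algebra_iso_def comp_def)
  moreover have "(g \<circ> f) ` G n = I n" for n
    unfolding image_comp[symmetric] using f g by (simp add: graded_algebra_iso_def)
  ultimately show ?thesis
    using f g unfolding graded_algebra_iso_def by simp
qed

theorem proposition11p1:
  fixes K :: "('k, 'z) ring_scheme"
    and R :: "('k, 'b) monoidal_pf"
    and M :: "nat \<Rightarrow> ('k, 'b set) module"
  assumes "cring K"
    and "symmetric_monoidal_pf K R"
    and "\<And>i. M i = Rbar K R (underline (i + 1))"
  shows "\<exists>\<phi>. \<phi> \<in> graded_algebra_iso K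
    (TS K (direct_sum UNIV M)) (TS_degree K M)
    (Sigma_algebra K (PD K R)) (Sigma_degree (PD K R))"
proof -
  interpret cring_symmetric_monoidal_pf K R
    using assms(1,2) by (simp add: cring_symmetric_monoidal_pf_def cring_symmetric_monoidal_pf_axioms_def)
  \<comment> \<open>The given graded module is the one built into the species, so the two
    isomorphisms through the algebra of families compose.\<close>
  have "M = species.M"
    using assms(3) species_M by (intro ext) simp
  then show ?thesis
    using graded_algebra_iso_trans[OF species.Psi_iso rho_iso] by blast
qed

end
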